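(* Fix $T>0$. There is a constant $\hat C>0$, independent of $a,\delta,q,\varepsilon$, such that the following holds. Let $a\in[0,1)$ and $\delta\in(2a,2)$, put $$p_\varepsilon:=1-\hat C\varepsilon^{-a}\sqrt{r\varepsilon^\delta\ln\Big(\frac{T}{r\varepsilon^\delta}\Big)}$$ (so $p_\varepsilon\to1$ as $\varepsilon\to0$), and define the events $$H^\varepsilon:=\Big\{\sup_{t\in[0,T]}\alpha^\varepsilon_t\ge\varepsilon^{a/2}\Big\},\qquad S^\varepsilon:=\Big\{\sup_{t\in[0,T]}\|\mathcal Y^\varepsilon_t\|\ge8\varepsilon^a\Big\}.$$ Fix $q>0$ and assume that the $\widehat{\mathfrak z}^\varepsilon$ system possesses the property $\mathscr P(T,q)$. Then there exists $\varepsilon_q>0$ such that for all $0<\varepsilon<\varepsilon_q$ $$\mathbb P[H^\varepsilon]<q+2(1-p_\varepsilon),\qquad \mathbb P[S^\varepsilon]<q+2(1-p_\varepsilon).$$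
   Context: Equation. Let $r>0$ and let $\mathcal C=C([-r,0];\mathbb R)$ with the sup norm $\|\cdot\|$; $\|\cdot\|_2$ is the Euclidean norm on $\mathbb R^2$. For $\varepsilon>0$ and a continuous function $f$ on $[-\varepsilon^2r,T]$ let $\Pi^\varepsilon_tf\in\mathcal C$ be $(\Pi^\varepsilon_tf)(\theta)=f(t+\varepsilon^2\theta)$. Let $L_0:\mathcal C\to\mathbb R$ be bounded linear, and assume that the characteristic equation $\lambda-L_0(e^{\lambda\,\cdot})=0$ has exactly two roots (counted with multiplicity) on the imaginary axis, $\pm i\omega_c$ with $\omega_c>0$, and that all other roots have negative real parts. Let $G(\eta)=\int_{-r}^0\eta(\theta)d\nu_1(\theta)+\int_{-r}^0\eta^3(\theta)d\nu_3(\theta)$, where $\nu_1,\nu_3:[-r,0]\to\mathbb R$ are functions of bounded variation, continuous from the left on $(-r,0)$, with $\nu_i(0)=0$. Let $\sigma\in\mathbb R$, $W$ a one-dimensional Wiener process, $\xi\in\mathcal C$ deterministic. $X^\varepsilon$ is the solution of $dX^\varepsilon(t)=\varepsilon^{-2}L_0(\Pi^\varepsilon_tX^\varepsilon)dt+G(\Pi^\varepsilon_tX^\varepsilon)dt+\sigma dW(t)$ for $t\in[0,T]$, $X^\varepsilon(t)=\xi(\varepsilon^{-2}t)$ for $t\in[-\varepsilon^2r,0]$. Splitting. Let $\hat{\mathcal C}$ be the space of bounded measurable functions $[-r,0]\to\mathbb R$ with sup norm; $L_0$ is extended to $\hat{\mathcal C}$ via its Riesz representation as integration against a finite signed measure.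 For $\phi\in\hat{\mathcal C}$, $\hat T(t)\phi\in\hat{\mathcal C}$ is $\theta\mapsto x(t+\theta)$, where $x=\phi$ on $[-r,0]$ and $x(t)=\phi(0)+\int_0^tL_0(x(s+\cdot))ds$ for $t\ge0$. Put $\Phi_1(\theta)=\cos(\omega_c\theta)$, $\Phi_2(\theta)=\sin(\omega_c\theta)$, $\Phi=[\Phi_1,\Phi_2]$, $\Phi v=v_1\Phi_1+v_2\Phi_2$ for $v\in\mathbb R^2$, $P=\mathrm{span}\{\Phi_1,\Phi_2\}$, $B=\begin{pmatrix}0&\omega_c\\-\omega_c&0\end{pmatrix}$. Then $\hat{\mathcal C}=P\oplus\hat Q$, where $\hat Q$ is the $\hat T$-invariant set of $\phi$ with $\hat T(t)\phi\to0$ as $t\to\infty$; $\hat\pi$ is the projection onto $P$ along $\hat Q$ and $\pi$ its restriction to $\mathcal C$. With $\mathbf 1_{\{0\}}$ the indicator function of $\{0\}$ on $[-r,0]$, $\tilde\Psi\in\mathbb R^2$ is defined by $\hat\pi\mathbf 1_{\{0\}}=\Phi\tilde\Psi$. Processes. Write $\Pi^\varepsilon_tX^\varepsilon=\Phi z^\varepsilon_t+y^\varepsilon_t$ with $\Phi z^\varepsilon_t=\pi\Pi^\varepsilon_tX^\varepsilon$, $y^\varepsilon_t=(1-\pi)\Pi^\varepsilon_tX^\varepsilon$; $\mathfrak Y^\varepsilon_t=\hat T(t/\varepsilon^2)y^\varepsilon_0$, $\mathcal Y^\varepsilon_t=y^\varepsilon_t-\mathfrak Y^\varepsilon_t$;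 $\mathfrak z^\varepsilon_t=e^{-tB/\varepsilon^2}z^\varepsilon_t$. The process $\widehat{\mathfrak z}^\varepsilon$ in $\mathbb R^2$ solves $d\widehat{\mathfrak z}^\varepsilon_t=e^{-tB/\varepsilon^2}\tilde\Psi\,G(\Phi e^{tB/\varepsilon^2}\widehat{\mathfrak z}^\varepsilon_t+\mathfrak Y^\varepsilon_t)dt+e^{-tB/\varepsilon^2}\tilde\Psi\sigma dW_t$, $\widehat{\mathfrak z}^\varepsilon_0=z^\varepsilon_0$. Put $\alpha^\varepsilon_t=\frac12\|\mathfrak z^\varepsilon_t-\widehat{\mathfrak z}^\varepsilon_t\|_2^2$. Property $\mathscr P(T,q)$: given $T>0,q>0$, the $\widehat{\mathfrak z}^\varepsilon$ system possesses $\mathscr P(T,q)$ if there exist $C_{\mathfrak e},\varepsilon_*>0$ such that for all $0<\varepsilon<\varepsilon_*$, $\mathbb P\big[\sup_{t\in[0,T]}\|\Phi e^{tB/\varepsilon^2}\widehat{\mathfrak z}^\varepsilon_t\|<0.99\,C_{\mathfrak e}\big]\ge1-q$. The constant $\hat C$ may depend on $T$ and the data ($r,L_0,\sigma$). *)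

theory Defs
  imports "HOL-Probability.Probability" "HOL-Complex_Analysis.Complex_Analysis"
begin

section \<open>Function spaces on \<open>[-r,0]\<close>\<close>

text \<open>
  Elements of \<open>C([-r,0])\<close> and of the space of bounded measurable functions on \<open>[-r,0]\<close> are
  represented by functions \<open>real \<Rightarrow> real\<close> of which only the values on \<open>{-r..0}\<close> matter.
\<close>

definition delay_C :: "real \<Rightarrow> (real \<Rightarrow> real) set" where
  "delay_C r = {\<eta>. continuous_on {-r..0} \<eta>}"

definition delay_Chat :: "real \<Rightarrow> (real \<Rightarrow> real) set" where
  "delay_Chat r =
     {\<phi> \<in> borel_measurable (restrict_space borel {-r..0}). bounded (\<phi> ` {-r..0})}"

definition supnorm :: "real \<Rightarrow> (real \<Rightarrow> real) \<Rightarrow> real" where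
  "supnorm r \<phi> = (SUP \<theta>\<in>{-r..0}. \<bar>\<phi> \<theta>\<bar>)"

text \<open>
  Linearity together with the bound forces the value of \<open>L\<close> at a continuous function to depend
  only on the restriction of that function to \<open>{-r..0}\<close>.
\<close>

definition bounded_linear_functional :: "real \<Rightarrow> ((real \<Rightarrow> real) \<Rightarrow> real) \<Rightarrow> bool" where
  "bounded_linear_functional r L \<longleftrightarrow>
     (\<forall>\<eta>\<in>delay_C r. \<forall>\<zeta>\<in>delay_C r. L (\<lambda>\<theta>. \<eta> \<theta> + \<zeta> \<theta>) = L \<eta> + L \<zeta>) \<and>
     (\<forall>c. \<forall>\<eta>\<in>delay_C r. L (\<lambda>\<theta>. c * \<eta> \<theta>) = c * L \<eta>) \<and>
     (\<exists>K. \<forall>\<eta>\<in>delay_C r. \<bar>L \<eta>\<bar> \<le> K * supnorm r \<eta>)"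

text \<open>
  A finite signed Borel measure on \<open>[-r,0]\<close> is given as a difference of two finite measures.
  The Riesz theorem provides such a pair for every bounded linear functional on \<open>C([-r,0])\<close>;
  the integral of a bounded measurable function does not depend on the pair chosen.
\<close>

definition riesz_represents ::
  "real \<Rightarrow> ((real \<Rightarrow> real) \<Rightarrow> real) \<Rightarrow> real measure \<Rightarrow> real measure \<Rightarrow> bool" where
  "riesz_represents r L \<mu>1 \<mu>2 \<longleftrightarrow>
     finite_measure \<mu>1 \<and> sets \<mu>1 = sets (restrict_space borel {-r..0}) \<and>
     finite_measure \<mu>2 \<and> sets \<mu>2 = sets (restrict_space borel {-r..0}) \<and>
     (\<forall>\<eta>\<in>delay_C r. L \<eta> = integral\<^sup>L \<mu>1 \<eta> - integral\<^sup>L \<mu>2 \<eta>)"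

definition riesz_measures ::
  "real \<Rightarrow> ((real \<Rightarrow> real) \<Rightarrow> real) \<Rightarrow> real measure \<times> real measure" where
  "riesz_measures r L = (SOME \<mu>. riesz_represents r L (fst \<mu>) (snd \<mu>))"

definition L_ext :: "real \<Rightarrow> ((real \<Rightarrow> real) \<Rightarrow> real) \<Rightarrow> (real \<Rightarrow> real) \<Rightarrow> real" where
  "L_ext r L \<phi> =
     integral\<^sup>L (fst (riesz_measures r L)) \<phi> - integral\<^sup>L (snd (riesz_measures r L)) \<phi>"


section \<open>Characteristic equation\<close>

text \<open>\<open>L\<close> acts on the complex-valued function \<open>\<theta> \<mapsto> exp (\<zeta>\<theta>)\<close> by complex linearity.\<close>

definition char_fun :: "((real \<Rightarrow> real) \<Rightarrow> real) \<Rightarrow> complex \<Rightarrow> complex" where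
  "char_fun L \<zeta> =
     \<zeta> - Complex (L (\<lambda>\<theta>. Re (exp (\<zeta> * of_real \<theta>)))) (L (\<lambda>\<theta>. Im (exp (\<zeta> * of_real \<theta>))))"

text \<open>Exactly two imaginary roots counted with multiplicity means that both are simple.\<close>

definition critical_spectrum :: "((real \<Rightarrow> real) \<Rightarrow> real) \<Rightarrow> real \<Rightarrow> bool" where
  "critical_spectrum L \<omega>c \<longleftrightarrow>
     0 < \<omega>c \<and>
     {\<zeta>. char_fun L \<zeta> = 0 \<and> Re \<zeta> = 0} = {\<i> * of_real \<omega>c, - \<i> * of_real \<omega>c} \<and>
     zorder (char_fun L) (\<i> * of_real \<omega>c) = 1 \<and>
     zorder (char_fun L) (- \<i> * of_real \<omega>c) = 1 \<and>
     (\<forall>\<zeta>. char_fun L \<zeta> = 0 \<and> Re \<zeta> \<noteq> 0 \<longrightarrow> Re \<zeta> < 0)"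


section \<open>Linear semigroup and splitting\<close>

definition lin_solution ::
  "real \<Rightarrow> ((real \<Rightarrow> real) \<Rightarrow> real) \<Rightarrow> (real \<Rightarrow> real) \<Rightarrow> (real \<Rightarrow> real) \<Rightarrow> bool" where
  "lin_solution r L \<phi> x \<longleftrightarrow>
     (\<forall>\<theta>\<in>{-r..0}. x \<theta> = \<phi> \<theta>) \<and>
     (\<forall>t\<ge>0. set_integrable lborel {0..t} (\<lambda>s. L_ext r L (\<lambda>\<theta>. x (s + \<theta>))) \<and>
             x t = \<phi> 0 + (LINT s:{0..t}|lborel. L_ext r L (\<lambda>\<theta>. x (s + \<theta>))))"

text \<open>
  The solution is unique on \<open>{-r..}\<close> for \<open>\<phi> \<in> delay_Chat r\<close>, so the values of \<open>That r L t \<phi>\<close>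
  on \<open>{-r..0}\<close> do not depend on the choice.
\<close>

definition That ::
  "real \<Rightarrow> ((real \<Rightarrow> real) \<Rightarrow> real) \<Rightarrow> real \<Rightarrow> (real \<Rightarrow> real) \<Rightarrow> real \<Rightarrow> real" where
  "That r L t \<phi> = (\<lambda>\<theta>. (SOME x. lin_solution r L \<phi> x) (t + \<theta>))"

definition Phi :: "real \<Rightarrow> real^2 \<Rightarrow> real \<Rightarrow> real" where
  "Phi \<omega>c v = (\<lambda>\<theta>. v $ 1 * cos (\<omega>c * \<theta>) + v $ 2 * sin (\<omega>c * \<theta>))"

definition P_space :: "real \<Rightarrow> (real \<Rightarrow> real) set" where
  "P_space \<omega>c = range (Phi \<omega>c)"

definition Qhat :: "real \<Rightarrow> ((real \<Rightarrow> real) \<Rightarrow> real) \<Rightarrow> (real \<Rightarrow> real) set" where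
  "Qhat r L = {\<phi> \<in> delay_Chat r. ((\<lambda>t. supnorm r (That r L t \<phi>)) \<longlongrightarrow> 0) at_top}"

definition pihat ::
  "real \<Rightarrow> ((real \<Rightarrow> real) \<Rightarrow> real) \<Rightarrow> real \<Rightarrow> (real \<Rightarrow> real) \<Rightarrow> real \<Rightarrow> real" where
  "pihat r L \<omega>c \<phi> = (THE p. p \<in> P_space \<omega>c \<and> (\<lambda>\<theta>. \<phi> \<theta> - p \<theta>) \<in> Qhat r L)"

definition P_coords :: "real \<Rightarrow> (real \<Rightarrow> real) \<Rightarrow> real^2" where
  "P_coords \<omega>c p = (THE v. p = Phi \<omega>c v)"

definition Psi_tilde :: "real \<Rightarrow> ((real \<Rightarrow> real) \<Rightarrow> real) \<Rightarrow> real \<Rightarrow> real^2" where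
  "Psi_tilde r L \<omega>c = P_coords \<omega>c (pihat r L \<omega>c (indicat_real {0}))"

definition B_mat :: "real \<Rightarrow> real^2^2" where
  "B_mat \<omega>c = vector [vector [0, \<omega>c], vector [- \<omega>c, 0]]"

definition mat_exp :: "real^2^2 \<Rightarrow> real^2^2" where
  "mat_exp A = (\<Sum>n. (1 / fact n) *\<^sub>R (((**) A ^^ n) (mat 1)))"


section \<open>The nonlinearity\<close>

definition bounded_variation_on :: "(real \<Rightarrow> real) \<Rightarrow> real \<Rightarrow> real \<Rightarrow> bool" where
  "bounded_variation_on \<nu> a b \<longleftrightarrow>
     (\<exists>K. \<forall>d. d division_of {a..b} \<longrightarrow> (\<Sum>J\<in>d. \<bar>\<nu> (Sup J) - \<nu> (Inf J)\<bar>) \<le> K)"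

definition admissible_integrator :: "real \<Rightarrow> (real \<Rightarrow> real) \<Rightarrow> bool" where
  "admissible_integrator r \<nu> \<longleftrightarrow>
     bounded_variation_on \<nu> (-r) 0 \<and>
     (\<forall>s\<in>{-r<..<0}. continuous (at_left s) \<nu>) \<and> \<nu> 0 = 0"

text \<open>
  Riemann--Stieltjes integral. \<open>G\<close> below is only ever applied to continuous functions, for which
  it exists and coincides with the Lebesgue--Stieltjes integral over the closed interval: jumps of
  the integrator at both end points are counted.
\<close>

definition has_RS_integral ::
  "(real \<Rightarrow> real) \<Rightarrow> (real \<Rightarrow> real) \<Rightarrow> real \<Rightarrow> real \<Rightarrow> real \<Rightarrow> bool" where
  "has_RS_integral f \<nu> a b I \<longleftrightarrow>
     (\<forall>e>0. \<exists>d>0. \<forall>p. p tagged_division_of {a..b} \<and> (\<lambda>x. ball x d) fine p \<longrightarrow>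
        \<bar>(\<Sum>(x, J)\<in>p. f x * (\<nu> (Sup J) - \<nu> (Inf J))) - I\<bar> < e)"

definition RS_integral :: "(real \<Rightarrow> real) \<Rightarrow> (real \<Rightarrow> real) \<Rightarrow> real \<Rightarrow> real \<Rightarrow> real" where
  "RS_integral f \<nu> a b = (THE I. has_RS_integral f \<nu> a b I)"

definition G_nl ::
  "real \<Rightarrow> (real \<Rightarrow> real) \<Rightarrow> (real \<Rightarrow> real) \<Rightarrow> (real \<Rightarrow> real) \<Rightarrow> real" where
  "G_nl r \<nu>1 \<nu>3 \<eta> = RS_integral \<eta> \<nu>1 (-r) 0 + RS_integral (\<lambda>\<theta>. \<eta> \<theta> ^ 3) \<nu>3 (-r) 0"


section \<open>Wiener process and Wiener integral\<close>

definition wiener_process :: "'a measure \<Rightarrow> (real \<Rightarrow> 'a \<Rightarrow> real) \<Rightarrow> bool" where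
  "wiener_process M W \<longleftrightarrow>
     prob_space M \<and>
     (\<forall>t\<ge>0. W t \<in> borel_measurable M) \<and>
     (\<forall>w\<in>space M. continuous_on {0..} (\<lambda>t. W t w)) \<and>
     (AE w in M. W 0 w = 0) \<and>
     (\<forall>s t. 0 \<le> s \<and> s < t \<longrightarrow>
        distributed M lborel (\<lambda>w. W t w - W s w) (normal_density 0 (sqrt (t - s)))) \<and>
     (\<forall>n (s :: nat \<Rightarrow> real). 0 \<le> s 0 \<and> (\<forall>i<n. s i \<le> s (Suc i)) \<longrightarrow>
        prob_space.indep_vars M (\<lambda>_. borel) (\<lambda>i w. W (s (Suc i)) w - W (s i) w) {..<n})"

text \<open>
  \<open>Y\<close> is a version of \<open>\<integral>\<^sub>0\<^sup>t f dW\<close> for a continuous deterministic integrand \<open>f\<close>: the limit in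
  mean square of the left-point sums as the mesh of the partition of \<open>[0,t]\<close> tends to \<open>0\<close>.
\<close>

definition has_wiener_integral ::
  "'a measure \<Rightarrow> (real \<Rightarrow> 'a \<Rightarrow> real) \<Rightarrow> (real \<Rightarrow> real^2) \<Rightarrow> real \<Rightarrow> ('a \<Rightarrow> real^2) \<Rightarrow> bool" where
  "has_wiener_integral M W f t Y \<longleftrightarrow>
     Y \<in> borel_measurable M \<and>
     (\<forall>e>0. \<exists>d>0. \<forall>n (s :: nat \<Rightarrow> real).
        s 0 = 0 \<and> s n = t \<and> (\<forall>i<n. s i \<le> s (Suc i) \<and> s (Suc i) - s i < d) \<longrightarrow>
        (\<integral>\<^sup>+ w. ennreal ((norm (Y w -
            (\<Sum>i<n. (W (s (Suc i)) w - W (s i) w) *\<^sub>R f (s i))))\<^sup>2) \<partial>M) < ennreal e)"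


section \<open>The delay equation and the derived processes\<close>

definition segment :: "real \<Rightarrow> (real \<Rightarrow> real) \<Rightarrow> real \<Rightarrow> real \<Rightarrow> real" where
  "segment \<epsilon> f t = (\<lambda>\<theta>. f (t + \<epsilon>\<^sup>2 * \<theta>))"

definition sdde_solution ::
  "'a measure \<Rightarrow> (real \<Rightarrow> 'a \<Rightarrow> real) \<Rightarrow> real \<Rightarrow> real \<Rightarrow> real \<Rightarrow> ((real \<Rightarrow> real) \<Rightarrow> real) \<Rightarrow>
   (real \<Rightarrow> real) \<Rightarrow> (real \<Rightarrow> real) \<Rightarrow> (real \<Rightarrow> real) \<Rightarrow> real \<Rightarrow> (real \<Rightarrow> 'a \<Rightarrow> real) \<Rightarrow> bool" where
  "sdde_solution M W r T \<sigma> L \<nu>1 \<nu>3 \<xi> \<epsilon> X \<longleftrightarrow>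
     (\<forall>t\<in>{- (\<epsilon>\<^sup>2 * r)..T}. X t \<in> borel_measurable M) \<and>
     (\<forall>w\<in>space M. continuous_on {- (\<epsilon>\<^sup>2 * r)..T} (\<lambda>t. X t w)) \<and>
     (\<forall>w\<in>space M. \<forall>t\<in>{- (\<epsilon>\<^sup>2 * r)..0}. X t w = \<xi> (t / \<epsilon>\<^sup>2)) \<and>
     (AE w in M. \<forall>t\<in>{0..T}.
        X t w = X 0 w
          + (LINT s:{0..t}|lborel. (1 / \<epsilon>\<^sup>2) * L (segment \<epsilon> (\<lambda>u. X u w) s)
                                   + G_nl r \<nu>1 \<nu>3 (segment \<epsilon> (\<lambda>u. X u w) s))
          + \<sigma> * W t w)"

text \<open>The following are functions of a single path \<open>x\<close> of the solution.\<close>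

definition z_path ::
  "real \<Rightarrow> ((real \<Rightarrow> real) \<Rightarrow> real) \<Rightarrow> real \<Rightarrow> real \<Rightarrow> (real \<Rightarrow> real) \<Rightarrow> real \<Rightarrow> real^2" where
  "z_path r L \<omega>c \<epsilon> x t = P_coords \<omega>c (pihat r L \<omega>c (segment \<epsilon> x t))"

definition y_path ::
  "real \<Rightarrow> ((real \<Rightarrow> real) \<Rightarrow> real) \<Rightarrow> real \<Rightarrow> real \<Rightarrow> (real \<Rightarrow> real) \<Rightarrow> real \<Rightarrow> real \<Rightarrow> real" where
  "y_path r L \<omega>c \<epsilon> x t = (\<lambda>\<theta>. segment \<epsilon> x t \<theta> - pihat r L \<omega>c (segment \<epsilon> x t) \<theta>)"

definition Yfrak ::
  "real \<Rightarrow> ((real \<Rightarrow> real) \<Rightarrow> real) \<Rightarrow> real \<Rightarrow> real \<Rightarrow> (real \<Rightarrow> real) \<Rightarrow> real \<Rightarrow> real \<Rightarrow> real" where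
  "Yfrak r L \<omega>c \<epsilon> x t = That r L (t / \<epsilon>\<^sup>2) (y_path r L \<omega>c \<epsilon> x 0)"

definition Ycal ::
  "real \<Rightarrow> ((real \<Rightarrow> real) \<Rightarrow> real) \<Rightarrow> real \<Rightarrow> real \<Rightarrow> (real \<Rightarrow> real) \<Rightarrow> real \<Rightarrow> real \<Rightarrow> real" where
  "Ycal r L \<omega>c \<epsilon> x t = (\<lambda>\<theta>. y_path r L \<omega>c \<epsilon> x t \<theta> - Yfrak r L \<omega>c \<epsilon> x t \<theta>)"

definition zfrak ::
  "real \<Rightarrow> ((real \<Rightarrow> real) \<Rightarrow> real) \<Rightarrow> real \<Rightarrow> real \<Rightarrow> (real \<Rightarrow> real) \<Rightarrow> real \<Rightarrow> real^2" where
  "zfrak r L \<omega>c \<epsilon> x t = mat_exp ((- (t / \<epsilon>\<^sup>2)) *\<^sub>R B_mat \<omega>c) *v z_path r L \<omega>c \<epsilon> x t"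

definition zhat_solution ::
  "'a measure \<Rightarrow> (real \<Rightarrow> 'a \<Rightarrow> real) \<Rightarrow> real \<Rightarrow> real \<Rightarrow> real \<Rightarrow> ((real \<Rightarrow> real) \<Rightarrow> real) \<Rightarrow> real \<Rightarrow>
   (real \<Rightarrow> real) \<Rightarrow> (real \<Rightarrow> real) \<Rightarrow> real \<Rightarrow> (real \<Rightarrow> 'a \<Rightarrow> real) \<Rightarrow> (real \<Rightarrow> 'a \<Rightarrow> real^2) \<Rightarrow> bool" where
  "zhat_solution M W r T \<sigma> L \<omega>c \<nu>1 \<nu>3 \<epsilon> X Z \<longleftrightarrow>
     (\<forall>t\<in>{0..T}. Z t \<in> borel_measurable M) \<and>
     (\<forall>w\<in>space M. continuous_on {0..T} (\<lambda>t. Z t w)) \<and>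
     (AE w in M. Z 0 w = z_path r L \<omega>c \<epsilon> (\<lambda>u. X u w) 0) \<and>
     (\<forall>t\<in>{0..T}. has_wiener_integral M W
        (\<lambda>s. \<sigma> *\<^sub>R (mat_exp ((- (s / \<epsilon>\<^sup>2)) *\<^sub>R B_mat \<omega>c) *v Psi_tilde r L \<omega>c)) t
        (\<lambda>w. Z t w - z_path r L \<omega>c \<epsilon> (\<lambda>u. X u w) 0
           - (LINT s:{0..t}|lborel.
                G_nl r \<nu>1 \<nu>3 (\<lambda>\<theta>. Phi \<omega>c (mat_exp ((s / \<epsilon>\<^sup>2) *\<^sub>R B_mat \<omega>c) *v Z s w) \<theta>
                                 + Yfrak r L \<omega>c \<epsilon> (\<lambda>u. X u w) s \<theta>)
                *\<^sub>R (mat_exp ((- (s / \<epsilon>\<^sup>2)) *\<^sub>R B_mat \<omega>c) *v Psi_tilde r L \<omega>c))))"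

text \<open>\<open>Z \<epsilon> t w\<close> and \<open>X \<epsilon> t w\<close> are families of processes indexed by \<open>\<epsilon>\<close>.\<close>

definition property_P ::
  "'a measure \<Rightarrow> real \<Rightarrow> real \<Rightarrow> (real \<Rightarrow> real \<Rightarrow> 'a \<Rightarrow> real^2) \<Rightarrow> real \<Rightarrow> real \<Rightarrow> bool" where
  "property_P M r \<omega>c Z T q \<longleftrightarrow>
     (\<exists>C>0. \<exists>\<epsilon>'>0. \<forall>\<epsilon>. 0 < \<epsilon> \<and> \<epsilon> < \<epsilon>' \<longrightarrow>
        measure M {w \<in> space M.
          (SUP t\<in>{0..T}. supnorm r (Phi \<omega>c (mat_exp ((t / \<epsilon>\<^sup>2) *\<^sub>R B_mat \<omega>c) *v Z \<epsilon> t w)))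
            < 0.99 * C} \<ge> 1 - q)"

definition alpha_proc ::
  "real \<Rightarrow> ((real \<Rightarrow> real) \<Rightarrow> real) \<Rightarrow> real \<Rightarrow> (real \<Rightarrow> real \<Rightarrow> 'a \<Rightarrow> real) \<Rightarrow>
   (real \<Rightarrow> real \<Rightarrow> 'a \<Rightarrow> real^2) \<Rightarrow> real \<Rightarrow> real \<Rightarrow> 'a \<Rightarrow> real" where
  "alpha_proc r L \<omega>c X Z \<epsilon> t w =
     (1 / 2) * (norm (zfrak r L \<omega>c \<epsilon> (\<lambda>u. X \<epsilon> u w) t - Z \<epsilon> t w))\<^sup>2"

definition p_eps :: "real \<Rightarrow> real \<Rightarrow> real \<Rightarrow> real \<Rightarrow> real \<Rightarrow> real \<Rightarrow> real" where
  "p_eps C r T a \<delta> \<epsilon> =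
     1 - C * \<epsilon> powr (- a) * sqrt (r * \<epsilon> powr \<delta> * ln (T / (r * \<epsilon> powr \<delta>)))"

definition H_event ::
  "'a measure \<Rightarrow> real \<Rightarrow> real \<Rightarrow> ((real \<Rightarrow> real) \<Rightarrow> real) \<Rightarrow> real \<Rightarrow>
   (real \<Rightarrow> real \<Rightarrow> 'a \<Rightarrow> real) \<Rightarrow> (real \<Rightarrow> real \<Rightarrow> 'a \<Rightarrow> real^2) \<Rightarrow> real \<Rightarrow> real \<Rightarrow> 'a set" where
  "H_event M r T L \<omega>c X Z a \<epsilon> =
     {w \<in> space M. (SUP t\<in>{0..T}. alpha_proc r L \<omega>c X Z \<epsilon> t w) \<ge> \<epsilon> powr (a / 2)}"

definition S_event ::
  "'a measure \<Rightarrow> real \<Rightarrow> real \<Rightarrow> ((real \<Rightarrow> real) \<Rightarrow> real) \<Rightarrow> real \<Rightarrow>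
   (real \<Rightarrow> real \<Rightarrow> 'a \<Rightarrow> real) \<Rightarrow> real \<Rightarrow> real \<Rightarrow> 'a set" where
  "S_event M r T L \<omega>c X a \<epsilon> =
     {w \<in> space M.
        (SUP t\<in>{0..T}. supnorm r (Ycal r L \<omega>c \<epsilon> (\<lambda>u. X \<epsilon> u w) t)) \<ge> 8 * \<epsilon> powr a}"

end

theory Submission
  imports Defs "HOL-Real_Asymp.Real_Asymp"
begin

text \<open>
  In the fast time \<open>\<tau> = t / \<epsilon>\<^sup>2\<close> the equation is a perturbation \<open>U' = L U + F'\<close> of the linear delay
  equation by the rough path \<open>F = \<integral> G dt + \<sigma> W\<close>. Variation of constants expresses \<open>U\<close> by the
  fundamental solution \<open>x\<close>, which is an inverse Laplace transform of the reciprocal of the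
  characteristic function; shifting the contour to the left of the imaginary axis collects the
  residues at \<open>\<plusminus>i\<omega>\<close>, so that \<open>x\<close> is \<open>\<Phi> \<Psi>\<close> up to an exponentially small error and \<open>\<Psi>\<close> is the
  vector \<open>\<Psi>\<close>-tilde of the splitting. Consequently the stable component \<open>\<Y>\<close> only sees the oscillation of
  \<open>F\<close> over bounded fast times: if \<open>\<bar>F v - F u\<bar> \<le> \<beta> (3 + (v - u))\<close>, then \<open>\<Y> = O(\<beta>)\<close>. For the Wiener
  process a union bound over a grid of mesh \<open>\<epsilon>\<^sup>2\<close> and high Gaussian moments give \<open>\<beta> = O(\<epsilon>\<^sup>b)\<close> for any
  \<open>b < 1\<close> outside an event of probability \<open>O(\<epsilon>)\<close>, and \<open>b = (1 + a) / 2\<close> beats \<open>\<epsilon>\<^sup>a\<close>. The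
  noise enters the two equations for \<open>z\<close> additively and in the same way, so it cancels in the
  difference, and a Gronwall argument on paths that stay in the ball where \<open>G\<close> is Lipschitz bounds
  the difference by \<open>O(\<beta>)\<close>; the bound on \<open>z\<close>-hat from the property \<open>\<P>(T,q)\<close> keeps the path in that ball.
  Since \<open>1 - p\<close> decays more slowly than \<open>\<epsilon>\<close>, the constant of the theorem can be taken to be \<open>1\<close>.
\<close>

section \<open>Riesz representation\<close>

text \<open>The noise path is only continuous, so nothing is ever integrated against it:
  \<open>voc\<close> and \<open>zeta\<close> are written after partial integration, with known
  kernels multiplying the forcing itself, and all estimates hold path by path. The drift is cubic,
  hence Lipschitz only on balls; Gronwall needs the path to stay in a ball, and that ball bound
  needs the outcome of Gronwall, a circle which a first-exit time breaks. The projection is defined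
  through decay under the linear flow, so it is computed by following that flow to infinity.
  Measurability of the two events is not established: each is contained in one measurable bad set of
  measure at most q + K \<epsilon>. Here K depends on a, and the admissible range of \<epsilon> on
  q, on the integrators and on the initial segment; the constant of the theorem sees none of this,
  because 1 - p is at least of the order of \<epsilon> to the power \<delta>/2 - a, an exponent
  below 1 since \<delta> < 2. Thus 2(1 - p) exceeds K \<epsilon> below a threshold that is chosen
  last.\<close>

lemma supnorm_le:
  assumes "0 \<le> r" "\<And>\<theta>. -r \<le> \<theta> \<Longrightarrow> \<theta> \<le> 0 \<Longrightarrow> \<bar>\<phi> \<theta>\<bar> \<le> B"
  shows "supnorm r \<phi> \<le> B"
  unfolding supnorm_def using assms by (intro cSUP_least) auto

lemma supnorm_upper:
  assumes "bounded (\<phi> ` {-r..0})" "-r \<le> \<theta>" "\<theta> \<le> 0"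
  shows "\<bar>\<phi> \<theta>\<bar> \<le> supnorm r \<phi>"
proof -
  obtain B where "\<forall>x\<in>{-r..0}. \<bar>\<phi> x\<bar> \<le> B"
    using assms(1) unfolding bounded_iff by auto
  then have "bdd_above ((\<lambda>\<theta>. \<bar>\<phi> \<theta>\<bar>) ` {-r..0})" by (auto intro!: bdd_aboveI2)
  then show ?thesis unfolding supnorm_def using assms by (intro cSUP_upper) auto
qed

lemma bounded_image_delay_C: "\<phi> \<in> delay_C r \<Longrightarrow> bounded (\<phi> ` {-r..0})"
  unfolding delay_C_def by (auto intro!: compact_imp_bounded compact_continuous_image)

lemma supnorm_nonneg:
  assumes "0 \<le> r" "bounded (\<phi> ` {-r..0})" shows "0 \<le> supnorm r \<phi>"
  using supnorm_upper[OF assms(2), of 0] assms(1) by simp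

lemma delay_C_diff: "f \<in> delay_C r \<Longrightarrow> g \<in> delay_C r \<Longrightarrow> (\<lambda>\<theta>. f \<theta> - g \<theta>) \<in> delay_C r"
  unfolding delay_C_def by (auto intro!: continuous_intros)

lemma blf_bound:
  assumes "bounded_linear_functional r L" "0 < r"
  shows "\<exists>K\<ge>0. \<forall>\<eta>\<in>delay_C r. \<bar>L \<eta>\<bar> \<le> K * supnorm r \<eta>"
proof -
  obtain K where K: "\<forall>\<eta>\<in>delay_C r. \<bar>L \<eta>\<bar> \<le> K * supnorm r \<eta>"
    using assms unfolding bounded_linear_functional_def by blast
  show ?thesis
  proof (intro exI[of _ "max K 0"] conjI ballI)
    fix \<eta> assume e: "\<eta> \<in> delay_C r"
    have "\<bar>L \<eta>\<bar> \<le> K * supnorm r \<eta>" using K e by blast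
    also have "\<dots> \<le> max K 0 * supnorm r \<eta>"
      using supnorm_nonneg[OF _ bounded_image_delay_C[OF e]] assms(2) by (intro mult_right_mono) auto
    finally show "\<bar>L \<eta>\<bar> \<le> max K 0 * supnorm r \<eta>" .
  qed simp
qed

lemma blf_add:
  assumes "bounded_linear_functional r L" "f \<in> delay_C r" "g \<in> delay_C r"
  shows "L (\<lambda>\<theta>. f \<theta> + g \<theta>) = L f + L g"
  using assms unfolding bounded_linear_functional_def by simp

lemma blf_scale:
  assumes "bounded_linear_functional r L" "f \<in> delay_C r"
  shows "L (\<lambda>\<theta>. c * f \<theta>) = c * L f"
  using assms unfolding bounded_linear_functional_def by simp

lemma blf_diff:
  assumes "bounded_linear_functional r L" "f \<in> delay_C r" "g \<in> delay_C r"
  shows "L (\<lambda>\<theta>. f \<theta> - g \<theta>) = L f - L g"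
proof -
  have 1: "(\<lambda>\<theta>. (-1) * g \<theta>) \<in> delay_C r"
    using assms(3) unfolding delay_C_def by (auto intro!: continuous_intros)
  show ?thesis using blf_add[OF assms(1,2) 1] blf_scale[OF assms(1,3), of "-1"] by simp
qed

lemma blf_sum:
  assumes L: "bounded_linear_functional r L" and "finite I" "\<And>i. i \<in> I \<Longrightarrow> f i \<in> delay_C r"
  shows "L (\<lambda>\<theta>. \<Sum>i\<in>I. c i * f i \<theta>) = (\<Sum>i\<in>I. c i * L (f i))"
  using assms(2,3)
proof (induction I)
  case empty
  have "(\<lambda>\<theta>. 0) \<in> delay_C r" by (simp add: delay_C_def)
  from blf_scale[OF L this, of 0] show ?case by simp
next
  case (insert i I)
  have a: "(\<lambda>\<theta>. c i * f i \<theta>) \<in> delay_C r" "(\<lambda>\<theta>. \<Sum>i\<in>I. c i * f i \<theta>) \<in> delay_C r"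
    using insert.prems unfolding delay_C_def by (auto intro!: continuous_intros)
  show ?case
    using blf_add[OF L a] blf_scale[OF L insert.prems(1)[of i]] insert by simp
qed

section \<open>Weak limits of discrete measures and the representing measures\<close>

lemma integral_distr_point_measure:
  fixes x :: "nat \<Rightarrow> real" and f :: "real \<Rightarrow> real"
  assumes "\<And>k. 0 \<le> w k" "f \<in> borel_measurable borel"
  shows "integral\<^sup>L (distr (point_measure {..n} (\<lambda>k. ennreal (w k))) borel x) f = (\<Sum>k\<le>n. w k * f (x k))"
  using assms by (subst integral_distr) (auto simp: measurable_point_measure_eq1 lebesgue_integral_point_measure_finite)

text \<open>Divided by \<open>A\<close>, the sums are integrals against probability laws that all
  live in one bounded interval, so the family is tight and has a weak limit along a subsequence. The
  parameter \<open>s\<close> allows a further extraction from a subsequence already chosen, which is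
  how the second limit is taken below.\<close>

lemma discrete_weak_limit:
  fixes x :: "nat \<Rightarrow> nat \<Rightarrow> real" and w :: "nat \<Rightarrow> nat \<Rightarrow> real"
  assumes w: "\<And>n k. 0 \<le> w n k" and A: "\<And>n. (\<Sum>k\<le>n. w n k) = A" "0 < A"
    and x: "\<forall>n. \<forall>k\<le>n. a < x n k \<and> x n k \<le> b" and ab: "a < b" and s: "strict_mono (s :: nat \<Rightarrow> nat)"
  shows "\<exists>(\<rho> :: nat \<Rightarrow> nat) M. strict_mono \<rho> \<and> real_distribution M \<and>
    (\<forall>f B. (\<forall>y. isCont f y) \<longrightarrow> (\<forall>y. \<bar>f y\<bar> \<le> B) \<longrightarrow>
      (\<lambda>n. \<Sum>k\<le>s (\<rho> n). w (s (\<rho> n)) k * f (x (s (\<rho> n)) k)) \<longlonglongrightarrow> A * integral\<^sup>L M (f :: real \<Rightarrow> real))"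
proof -
  let ?P = "\<lambda>n. point_measure {..n} (\<lambda>k. ennreal (w n k / A))"
  define \<mu> where "\<mu> n = distr (?P n) borel (x n)" for n
  have wA: "0 \<le> w n k / A" for n k using w A by simp
  have P: "prob_space (?P n)" for n
  proof
    have "emeasure (?P n) (space (?P n)) = ennreal (\<Sum>k\<le>n. w n k / A)"
      using wA by (simp add: space_point_measure emeasure_point_measure_finite sum_ennreal)
    also have "(\<Sum>k\<le>n. w n k / A) = 1" using A by (simp flip: sum_divide_distrib)
    finally show "emeasure (?P n) (space (?P n)) = 1" by simp
  qed
  have rd: "real_distribution (\<mu> n)" for n
    unfolding \<mu>_def by (intro prob_space.real_distribution_distr P) (simp add: measurable_point_measure_eq1)
  have int: "integral\<^sup>L (\<mu> n) f = (\<Sum>k\<le>n. w n k / A * f (x n k))" if "f \<in> borel_measurable borel" for n f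
    unfolding \<mu>_def by (rule integral_distr_point_measure) (use wA that in auto)
  have m1: "measure (\<mu> n) {a<..b} = 1" for n
  proof -
    have "measure (\<mu> n) {a<..b} = integral\<^sup>L (\<mu> n) (indicator {a<..b})"
      unfolding \<mu>_def by simp
    also have "\<dots> = (\<Sum>k\<le>n. w n k / A * indicator {a<..b} (x n k))" by (rule int) auto
    also have "\<dots> = (\<Sum>k\<le>n. w n k / A)" using x by (intro sum.cong) auto
    also have "\<dots> = 1" using A by (simp flip: sum_divide_distrib)
    finally show ?thesis .
  qed
  have "tight \<mu>" unfolding tight_def
  proof (intro conjI allI impI)
    fix e :: real assume "0 < e"
    then show "\<exists>a b. a < b \<and> (\<forall>n. 1 - e < measure (\<mu> n) {a<..b})"
      using ab m1 by (intro exI[of _ a] exI[of _ b]) simp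
  qed (rule rd)
  from tight_imp_convergent_subsubsequence[OF this s] obtain \<rho> M
    where \<rho>: "strict_mono \<rho>" "real_distribution M" "weak_conv_m (\<mu> \<circ> s \<circ> \<rho>) M" by blast
  show ?thesis
  proof (intro exI[of _ \<rho>] exI[of _ M] conjI allI impI \<rho>(1,2))
    fix f :: "real \<Rightarrow> real" and B assume f: "\<forall>y. isCont f y" "\<forall>y. \<bar>f y\<bar> \<le> B"
    have fm: "f \<in> borel_measurable borel"
      using f by (intro borel_measurable_continuous_onI) (simp add: continuous_at_imp_continuous_on)
    have "(\<lambda>n. integral\<^sup>L ((\<mu> \<circ> s \<circ> \<rho>) n) f) \<longlonglongrightarrow> integral\<^sup>L M f"
      by (rule weak_conv_imp_integral_bdd_continuous_conv[where B=B])
         (use \<rho> rd f in \<open>auto simp: comp_def\<close>)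
    then have "(\<lambda>n. A * integral\<^sup>L ((\<mu> \<circ> s \<circ> \<rho>) n) f) \<longlonglongrightarrow> A * integral\<^sup>L M f"
      by (intro tendsto_intros)
    moreover have "A * integral\<^sup>L ((\<mu> \<circ> s \<circ> \<rho>) n) f = (\<Sum>k\<le>s (\<rho> n). w (s (\<rho> n)) k * f (x (s (\<rho> n)) k))" for n
      using int[OF fm, of "s (\<rho> n)"] A by (simp add: sum_distrib_left)
    ultimately show "(\<lambda>n. \<Sum>k\<le>s (\<rho> n). w (s (\<rho> n)) k * f (x (s (\<rho> n)) k)) \<longlonglongrightarrow> A * integral\<^sup>L M f" by simp
  qed
qed

text \<open>Bernstein polynomials replace \<eta> by its values at the nodes, so
  \<open>L \<eta>\<close> is the limit of integrals of \<eta> against discrete signed measures with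
  weights \<open>L (b n k)\<close>. Their total variation is at most \<open>K\<close>, so positive
  and negative parts have weakly convergent subsequences, and the two limits represent
  \<open>L\<close>. This existence is what gives the choice in \<open>riesz_measures\<close> its
  meaning.\<close>

lemma riesz_representation:
  assumes r: "0 < r" and L: "bounded_linear_functional r L"
  shows "\<exists>\<mu>1 \<mu>2. riesz_represents r L \<mu>1 \<mu>2"
proof -
  obtain K where K: "0 \<le> K" "\<And>\<eta>. \<eta> \<in> delay_C r \<Longrightarrow> \<bar>L \<eta>\<bar> \<le> K * supnorm r \<eta>"
    using blf_bound[OF L r] by blast
  define b where "b n k = (\<lambda>\<theta>. Bernstein n k (1 + \<theta> / r))" for n k
  \<comment> \<open>The nodes k/n carried from [0,1] to [-r,0]; for n = 0, division by zero yields
    the single node -r, which still lies in the interval.\<close>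
  define x where "x n k = r * (real k / real n - 1)" for n k :: nat
  have bC: "b n k \<in> delay_C r" for n k
    unfolding b_def delay_C_def Bernstein_def using r by (auto intro!: continuous_intros)
  have b0: "0 \<le> b n k \<theta>" if "-r \<le> \<theta>" "\<theta> \<le> 0" for n k \<theta>
    unfolding b_def using that r by (intro Bernstein_nonneg) (auto simp: field_simps)
  have b1: "(\<Sum>k\<le>n. b n k \<theta>) = 1" for n \<theta> unfolding b_def by simp
  \<comment> \<open>This is the bound on the total variation: the basis functions are nonnegative
    and sum to 1, so the combination has sup norm at most 1. Coefficients that select the positive
    weights bound the positive part.\<close>
  have comb: "\<bar>\<Sum>k\<le>n. c k * L (b n k)\<bar> \<le> K" if c: "\<And>k. \<bar>c k\<bar> \<le> 1" for c n
  proof -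
    have "(\<lambda>\<theta>. \<Sum>k\<le>n. c k * b n k \<theta>) \<in> delay_C r"
      using bC unfolding delay_C_def by (auto intro!: continuous_intros)
    then have "\<bar>L (\<lambda>\<theta>. \<Sum>k\<le>n. c k * b n k \<theta>)\<bar> \<le> K * supnorm r (\<lambda>\<theta>. \<Sum>k\<le>n. c k * b n k \<theta>)"
      by (rule K)
    also have "\<dots> \<le> K * 1"
    proof (intro mult_left_mono supnorm_le K)
      fix \<theta> assume t: "-r \<le> \<theta>" "\<theta> \<le> 0"
      have "\<bar>\<Sum>k\<le>n. c k * b n k \<theta>\<bar> \<le> (\<Sum>k\<le>n. b n k \<theta>)"
        by (intro order_trans[OF sum_abs] sum_mono)
           (use c b0[OF t] in \<open>auto simp: abs_mult mult_left_le_one_le\<close>)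
      then show "\<bar>\<Sum>k\<le>n. c k * b n k \<theta>\<bar> \<le> 1" by (simp add: b1)
    qed (use r in auto)
    finally show ?thesis using blf_sum[OF L, of "{..n}" "b n" c] bC by simp
  qed
  \<comment> \<open>Surplus mass, placed at the node of index 0 in both families: it cancels in
    \<open>wp - wm\<close> and makes both total masses independent of n. The extra 1 in
    \<open>K + 1\<close> keeps these masses positive, so that they can be normalised.\<close>
  define res where "res n = K + 1 - (\<Sum>k\<le>n. max 0 (L (b n k)))" for n
  define wp where "wp n k = max 0 (L (b n k)) + (if k = 0 then res n else 0)" for n k :: nat
  define wm where "wm n k = max 0 (- L (b n k)) + (if k = 0 then res n else 0)" for n k :: nat
  have res0: "0 \<le> res n" for n
  proof -
    have "(\<Sum>k\<le>n. max 0 (L (b n k))) = (\<Sum>k\<le>n. (if L (b n k) > 0 then 1 else 0) * L (b n k))"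
      by (intro sum.cong) auto
    also have "\<bar>\<dots>\<bar> \<le> K" by (rule comb) simp
    then have "(\<Sum>k\<le>n. (if L (b n k) > 0 then 1 else 0) * L (b n k)) \<le> K" by linarith
    finally show ?thesis by (simp add: res_def)
  qed
  have wpm: "wp n k - wm n k = L (b n k)" for n k by (simp add: wp_def wm_def)
  have L1: "(\<Sum>k\<le>n. L (b n k)) = L (\<lambda>_. 1)" for n
    using blf_sum[OF L, of "{..n}" "b n" "\<lambda>_. 1"] bC by (simp add: b1)
  have sp: "(\<Sum>k\<le>n. wp n k) = K + 1" for n
    unfolding wp_def by (simp add: sum.distrib sum.delta res_def)
  have sm: "(\<Sum>k\<le>n. wm n k) = K + 1 - L (\<lambda>_. 1)" for n
  proof -
    have "(\<Sum>k\<le>n. wm n k) = (\<Sum>k\<le>n. wp n k - L (b n k))" by (intro sum.cong) (auto simp flip: wpm)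
    then show ?thesis by (simp add: sum_subtractf sp L1)
  qed
  have A2: "0 < K + 1 - L (\<lambda>_. 1)" using comb[of "\<lambda>_. 1" 0] L1[of 0] by simp
  have nn: "0 \<le> wp n k" "0 \<le> wm n k" for n k using res0 by (auto simp: wp_def wm_def)
  have xr: "-r \<le> x n k" "x n k \<le> 0" if "k \<le> n" for n k
  proof -
    have "0 \<le> real k / real n" "real k / real n \<le> 1" using that by (auto simp: divide_le_eq)
    then show "-r \<le> x n k" "x n k \<le> 0"
      unfolding x_def right_diff_distrib
      using r mult_left_le[of "real k / real n" r] mult_nonneg_nonneg[of r "real k / real n"]
      by linarith+
  qed
  \<comment> \<open>The left end is lowered to -r-1 because tightness uses intervals open on the
    left and -r is itself a node.\<close>
  have xr': "\<forall>n. \<forall>k\<le>n. -r-1 < x n k \<and> x n k \<le> 0"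
    using xr by force
  have r1: "-r-1 < 0" and K1: "0 < K + 1" using r K by auto
  have si: "strict_mono (\<lambda>n::nat. n)" by (simp add: strict_mono_def)
  obtain \<rho>1 M1 where 1: "strict_mono (\<rho>1 :: nat \<Rightarrow> nat)" "real_distribution M1"
    "\<forall>f B. (\<forall>y. isCont f y) \<longrightarrow> (\<forall>y. \<bar>f y\<bar> \<le> B) \<longrightarrow>
      (\<lambda>n. \<Sum>k\<le>\<rho>1 n. wp (\<rho>1 n) k * f (x (\<rho>1 n) k)) \<longlonglongrightarrow> (K + 1) * integral\<^sup>L M1 (f :: real \<Rightarrow> real)"
    using discrete_weak_limit[where x=x, OF nn(1) sp K1 xr' r1 si] by (elim exE conjE) (rule that)
  obtain \<rho>2 M2 where 2: "strict_mono (\<rho>2 :: nat \<Rightarrow> nat)" "real_distribution M2"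
    "\<forall>f B. (\<forall>y. isCont f y) \<longrightarrow> (\<forall>y. \<bar>f y\<bar> \<le> B) \<longrightarrow>
      (\<lambda>n. \<Sum>k\<le>\<rho>1 (\<rho>2 n). wm (\<rho>1 (\<rho>2 n)) k * f (x (\<rho>1 (\<rho>2 n)) k)) \<longlonglongrightarrow> (K + 1 - L (\<lambda>_. 1)) * integral\<^sup>L M2 (f :: real \<Rightarrow> real)"
    using discrete_weak_limit[where x=x, OF nn(2) sm A2 xr' r1 1(1)] by (elim exE conjE) (rule that)
  interpret M1: real_distribution M1 by fact
  interpret M2: real_distribution M2 by fact
  \<comment> \<open>Clamping the line to [-r,0] turns \<eta> into a bounded continuous test function
    on the line, and pushing the limit laws forward along it places them on the interval without a
    discussion of their supports.\<close>
  define cl :: "real \<Rightarrow> real" where "cl y = max (-r) (min 0 y)" for y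
  have clc: "continuous_on UNIV cl" unfolding cl_def by (intro continuous_intros)
  have clr: "cl y \<in> {-r..0}" for y using r by (auto simp: cl_def)
  have cl_id: "cl y = y" if "-r \<le> y" "y \<le> 0" for y using that by (auto simp: cl_def)
  have clm: "cl \<in> measurable borel (restrict_space borel {-r..0})"
    by (intro measurable_restrict_space2) (use clr clc in \<open>auto intro!: borel_measurable_continuous_onI\<close>)
  define \<mu> where "\<mu> A M = distr (density M (\<lambda>_. ennreal A)) (restrict_space borel {-r..0}) cl" for A and M :: "real measure"
  have fm: "finite_measure (\<mu> A M) \<and> sets (\<mu> A M) = sets (restrict_space borel {-r..0})"
    and im: "\<eta> \<in> delay_C r \<Longrightarrow> integral\<^sup>L (\<mu> A M) \<eta> = A * integral\<^sup>L M (\<lambda>y. \<eta> (cl y))"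
    if "real_distribution M" "0 \<le> A" for A M \<eta>
  proof -
    interpret real_distribution M by fact
    have clm2: "cl \<in> measurable (density M (\<lambda>_. ennreal A)) (restrict_space borel {-r..0})"
      and clm3: "cl \<in> measurable M (restrict_space borel {-r..0})"
      using clm measurable_cong_sets[OF events_eq_borel refl, of "restrict_space borel {-r..0}"] by auto
    have "finite_measure (density M (\<lambda>_. ennreal A))"
      by (intro finite_measureI) (simp add: emeasure_density ennreal_mult_eq_top_iff emeasure_eq_measure)
    then show "finite_measure (\<mu> A M) \<and> sets (\<mu> A M) = sets (restrict_space borel {-r..0})"
      unfolding \<mu>_def using clm2 by (auto intro!: finite_measure.finite_measure_distr)
    assume "\<eta> \<in> delay_C r"
    then have e: "\<eta> \<in> borel_measurable (restrict_space borel {-r..0})"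
      unfolding delay_C_def by (auto intro: borel_measurable_continuous_on_restrict)
    have "(\<lambda>y. \<eta> (cl y)) \<in> borel_measurable M" using measurable_compose[OF clm3 e] .
    then show "integral\<^sup>L (\<mu> A M) \<eta> = A * integral\<^sup>L M (\<lambda>y. \<eta> (cl y))"
      unfolding \<mu>_def using \<open>0 \<le> A\<close> by (subst integral_distr[OF clm2 e]) (simp add: integral_density)
  qed
  have "riesz_represents r L (\<mu> (K+1) M1) (\<mu> (K + 1 - L (\<lambda>_. 1)) M2)"
    unfolding riesz_represents_def
  proof (intro conjI ballI)
    fix \<eta> assume e: "\<eta> \<in> delay_C r"
    have bd: "\<forall>y. \<bar>\<eta> (cl y)\<bar> \<le> supnorm r \<eta>"
      using supnorm_upper[OF bounded_image_delay_C[OF e]] clr by auto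
    have co: "\<forall>y. isCont (\<lambda>y. \<eta> (cl y)) y"
    proof -
      have "continuous_on UNIV (\<lambda>y. \<eta> (cl y))"
        using e clr by (intro continuous_on_compose2[OF _ clc]) (auto simp: delay_C_def)
      then show ?thesis by (simp add: continuous_on_eq_continuous_at)
    qed
    have l1: "(\<lambda>n. \<Sum>k\<le>\<rho>1 (\<rho>2 n). wp (\<rho>1 (\<rho>2 n)) k * \<eta> (x (\<rho>1 (\<rho>2 n)) k)) \<longlonglongrightarrow> (K + 1) * integral\<^sup>L M1 (\<lambda>y. \<eta> (cl y))"
      using LIMSEQ_subseq_LIMSEQ[OF 1(3)[rule_format, OF co[rule_format] bd[rule_format]] 2(1)] xr by (simp add: o_def cl_id)
    have l2: "(\<lambda>n. \<Sum>k\<le>\<rho>1 (\<rho>2 n). wm (\<rho>1 (\<rho>2 n)) k * \<eta> (x (\<rho>1 (\<rho>2 n)) k)) \<longlonglongrightarrow> (K + 1 - L (\<lambda>_. 1)) * integral\<^sup>L M2 (\<lambda>y. \<eta> (cl y))"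
      using 2(3)[rule_format, OF co[rule_format] bd[rule_format]] xr by (simp add: cl_id)
    define S where "S n = (\<Sum>k\<le>n. \<eta> (x n k) * L (b n k))" for n
    have "(\<lambda>n. S (\<rho>1 (\<rho>2 n))) \<longlonglongrightarrow> (K + 1) * integral\<^sup>L M1 (\<lambda>y. \<eta> (cl y)) - (K + 1 - L (\<lambda>_. 1)) * integral\<^sup>L M2 (\<lambda>y. \<eta> (cl y))"
      using tendsto_diff[OF l1 l2] unfolding S_def by (simp flip: wpm sum_subtractf add: algebra_simps)
    moreover have "S \<longlonglongrightarrow> L \<eta>"
    proof (rule LIMSEQ_I)
      fix e :: real assume "0 < e"
      then have e': "0 < e / (K + 1)" using K by simp
      have "continuous_on {0..1} (\<lambda>y. \<eta> (r * (y - 1)))"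
        using e r unfolding delay_C_def
        by (auto intro!: continuous_on_compose2[of "{-r..0}" \<eta>] continuous_intros simp: algebra_simps mult_left_le)
      from Bernstein_Weierstrass[OF this e'] obtain N where N:
        "\<And>n y. N \<le> n \<Longrightarrow> y \<in> {0..1} \<Longrightarrow> \<bar>\<eta> (r * (y - 1)) - (\<Sum>k\<le>n. \<eta> (x n k) * Bernstein n k y)\<bar> < e / (K + 1)"
        unfolding x_def by blast
      show "\<exists>N. \<forall>n\<ge>N. norm (S n - L \<eta>) < e"
      proof (intro exI[of _ N] allI impI)
        fix n assume n: "N \<le> n"
        let ?g = "\<lambda>\<theta>. \<Sum>k\<le>n. \<eta> (x n k) * b n k \<theta>"
        have g: "?g \<in> delay_C r" using bC unfolding delay_C_def by (auto intro!: continuous_intros)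
        have "S n - L \<eta> = L (\<lambda>\<theta>. ?g \<theta> - \<eta> \<theta>)"
          unfolding S_def using blf_sum[OF L, of "{..n}" "b n" "\<lambda>k. \<eta> (x n k)"] bC
          by (subst blf_diff[OF L g e]) simp
        then have "\<bar>S n - L \<eta>\<bar> \<le> K * supnorm r (\<lambda>\<theta>. ?g \<theta> - \<eta> \<theta>)"
          using K(2)[OF delay_C_diff[OF g e]] r by simp
        also have "\<dots> \<le> K * (e / (K + 1))"
        proof (intro mult_left_mono supnorm_le K)
          fix \<theta> assume "-r \<le> \<theta>" "\<theta> \<le> 0"
          then show "\<bar>?g \<theta> - \<eta> \<theta>\<bar> \<le> e / (K + 1)"
            using N[OF n, of "1 + \<theta> / r"] r by (auto simp: field_simps b_def abs_minus_commute)
        qed (use r in auto)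
        also have "\<dots> < e" using K \<open>0 < e\<close> by (simp add: field_simps)
        finally show "norm (S n - L \<eta>) < e" by simp
      qed
    qed
    then have "(\<lambda>n. S (\<rho>1 (\<rho>2 n))) \<longlonglongrightarrow> L \<eta>"
      using LIMSEQ_subseq_LIMSEQ[OF LIMSEQ_subseq_LIMSEQ[OF _ 1(1)] 2(1)] by (simp add: o_def)
    ultimately show "L \<eta> = integral\<^sup>L (\<mu> (K+1) M1) \<eta> - integral\<^sup>L (\<mu> (K + 1 - L (\<lambda>_. 1)) M2) \<eta>"
      using LIMSEQ_unique im[OF 1(2) _ e] im[OF 2(2) _ e] K A2 by force
  qed (use fm[OF 1(2)] fm[OF 2(2)] K A2 in auto)
  then show ?thesis by blast
qed

section \<open>Integrals over compact intervals\<close>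

lemma set_integrable_bounded:
  fixes f :: "real \<Rightarrow> 'b::{banach,second_countable_topology}"
  assumes "set_borel_measurable lborel {a..b} f" "\<And>s. a \<le> s \<Longrightarrow> s \<le> b \<Longrightarrow> norm (f s) \<le> B"
  shows "set_integrable lborel {a..b} f"
  unfolding set_integrable_def
proof (rule Bochner_Integration.integrable_bound)
  show "integrable lborel (\<lambda>s. indicator {a..b} s *\<^sub>R B)"
    using integrable_real_indicator[of "{a..b}" lborel] by (cases "a \<le> b") (simp_all add: mult.commute)
  show "(\<lambda>s. indicator {a..b} s *\<^sub>R f s) \<in> borel_measurable lborel"
    using assms(1) by (simp add: set_borel_measurable_def)
  show "AE s in lborel. norm (indicator {a..b} s *\<^sub>R f s) \<le> norm (indicator {a..b} s *\<^sub>R B)"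
    using order_trans[OF assms(2) abs_ge_self] by (intro AE_I2) (auto simp: indicator_def)
qed

lemma set_integrable_bounded_borel:
  fixes f :: "real \<Rightarrow> 'b::{banach,second_countable_topology}"
  assumes [measurable]: "f \<in> borel_measurable borel" and "\<And>s. a \<le> s \<Longrightarrow> s \<le> b \<Longrightarrow> norm (f s) \<le> B"
  shows "set_integrable lborel {a..b} f"
  using assms(2) by (intro set_integrable_bounded) (auto simp: set_borel_measurable_def)

text \<open>If \<open>f\<close> fails to be integrable its integral is 0 by convention, and the
  bound still holds because the hypothesis forces \<open>g\<close> to be nonnegative on the
  interval.\<close>

lemma set_integral_norm_le:
  fixes f :: "real \<Rightarrow> 'b::{banach,second_countable_topology}"
  assumes "set_integrable lborel {a..b} g" "\<And>s. a \<le> s \<Longrightarrow> s \<le> b \<Longrightarrow> norm (f s) \<le> g s"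
  shows "norm (LINT s:{a..b}|lborel. f s) \<le> (LINT s:{a..b}|lborel. (g s :: real))"
proof -
  have g0: "0 \<le> indicator {a..b} s *\<^sub>R g s" for s
    using order_trans[OF norm_ge_zero assms(2)] by (auto simp: indicator_def)
  show ?thesis
  proof (cases "set_integrable lborel {a..b} f")
    case True
    show ?thesis unfolding set_lebesgue_integral_def
      by (rule Bochner_Integration.integral_norm_bound_integral)
         (use True assms in \<open>auto simp: set_integrable_def indicator_def\<close>)
  next
    case False
    then have "(LINT s:{a..b}|lborel. f s) = 0"
      by (simp add: set_lebesgue_integral_def set_integrable_def not_integrable_integral_eq)
    then show ?thesis using g0 by (simp add: set_lebesgue_integral_def)
  qed
qed

lemma set_integral_const_Icc:
  "a \<le> b \<Longrightarrow> (LINT s:{a..b}|lborel. (c::real)) = (b - a) * c"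
  by (simp add: set_lebesgue_integral_def)

lemma set_integral_norm_le_const:
  fixes f :: "real \<Rightarrow> 'b::{banach,second_countable_topology}"
  assumes "a \<le> b" "\<And>s. a \<le> s \<Longrightarrow> s \<le> b \<Longrightarrow> norm (f s) \<le> B"
  shows "norm (LINT s:{a..b}|lborel. f s) \<le> (b - a) * B"
  using set_integral_norm_le[of a b "\<lambda>_. B" f] assms
  by (simp add: set_integral_const_Icc set_integrable_def)

lemma set_integral_Icc_point[simp]:
  fixes f :: "real \<Rightarrow> 'b::{banach,second_countable_topology}"
  shows "(LINT s:{a..a}|lborel. f s) = 0"
proof -
  have "norm (LINT s:{a..a}|lborel. f s) \<le> (a - a) * norm (f a)"
    by (rule set_integral_norm_le_const) (auto dest: order_antisym)
  then show ?thesis by simp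
qed

lemma set_integral_point[simp]:
  fixes f :: "real \<Rightarrow> 'b::{banach,second_countable_topology}"
  shows "(LINT s:{a}|lborel. f s) = 0"
  using set_integral_Icc_point[of a f] by simp

lemma set_integral_shift:
  fixes f :: "real \<Rightarrow> 'b::{banach,second_countable_topology}"
  shows "(LINT s:{a..b}|lborel. f (c + s)) = (LINT s:{c+a..c+b}|lborel. f s)"
  unfolding set_lebesgue_integral_def
  by (subst (2) lborel_integral_real_affine[of 1 _ c]) (auto intro!: Bochner_Integration.integral_cong simp: indicator_def)

lemma set_integral_reflect:
  fixes f :: "real \<Rightarrow> 'b::{banach,second_countable_topology}"
  shows "(LINT s:{a..b}|lborel. f (c - s)) = (LINT s:{c-b..c-a}|lborel. f s)"
  unfolding set_lebesgue_integral_def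
  by (subst (2) lborel_integral_real_affine[of "-1" _ c]) (auto intro!: Bochner_Integration.integral_cong simp: indicator_def)

lemma set_integral_scale:
  fixes f :: "real \<Rightarrow> 'b::{banach,second_countable_topology}"
  assumes "0 < c"
  shows "c *\<^sub>R (LINT s:{a..b}|lborel. f (c * s)) = (LINT s:{c*a..c*b}|lborel. f s)"
  unfolding set_lebesgue_integral_def using assms
  by (subst (2) lborel_integral_real_affine[of c _ 0]) (auto intro!: Bochner_Integration.integral_cong simp: indicator_def)

lemma set_integral_split:
  fixes f :: "real \<Rightarrow> 'b::{banach,second_countable_topology}"
  assumes "set_integrable lborel {a..c} f" "a \<le> b" "b \<le> c"
  shows "(LINT s:{a..c}|lborel. f s) = (LINT s:{a..b}|lborel. f s) + (LINT s:{b..c}|lborel. f s)"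
proof -
  have i1: "set_integrable lborel {a..b} f" and i2: "set_integrable lborel {b<..c} f"
    using assms by (auto intro: set_integrable_subset)
  have "(LINT s:{a..c}|lborel. f s) = (LINT s:{a..b} \<union> {b<..c}|lborel. f s)"
    using assms by (simp add: ivl_disj_un_two(8))
  also have "\<dots> = (LINT s:{a..b}|lborel. f s) + (LINT s:{b<..c}|lborel. f s)"
    by (rule set_integral_Un) (use i1 i2 in auto)
  also have "(LINT s:{b<..c}|lborel. f s) = (LINT s:{b..c}|lborel. f s)"
    unfolding set_lebesgue_integral_def
    by (rule integral_cong_AE)
       (use assms(1) AE_lborel_singleton[of b] i2 set_integrable_subset[OF assms(1), of "{b..c}"] assms(2) in
         \<open>auto simp: indicator_def set_integrable_def elim!: eventually_mono\<close>)
  finally show ?thesis .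
qed

lemma set_integral_exp:
  assumes "0 < (a::real)" "0 \<le> t"
  shows "(LINT s:{0..t}|lborel. exp (a * s)) = (exp (a * t) - 1) / a"
    and "set_integrable lborel {0..t} (\<lambda>s. exp (a * s))"
proof -
  have "(\<integral>s. indicator {0..t} s *\<^sub>R exp (a * s) \<partial>lborel) = exp (a * t) / a - exp (a * 0) / a"
    using assms by (intro integral_FTC_atLeastAtMost)
      (auto intro!: derivative_eq_intros continuous_intros simp flip: has_real_derivative_iff_has_vector_derivative)
  then show "(LINT s:{0..t}|lborel. exp (a * s)) = (exp (a * t) - 1) / a"
    by (simp add: set_lebesgue_integral_def diff_divide_distrib)
  show "set_integrable lborel {0..t} (\<lambda>s. exp (a * s))"
    unfolding set_integrable_def by (intro borel_integrable_compact continuous_intros) auto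
qed

text \<open>The weight grows at rate \<open>2 * a\<close>, twice the coefficient in front of it, so
  integration returns the weight with the factor 1/2. This is the inequality that
  \<open>weighted_gronwall\<close> asks for in \<open>step\<close>.\<close>

lemma set_integral_exp_bound:
  fixes f :: "real \<Rightarrow> 'b::{banach,second_countable_topology}"
  assumes "0 < a" "0 \<le> w" "0 \<le> t" "\<And>s. 0 \<le> s \<Longrightarrow> s \<le> t \<Longrightarrow> norm (f s) \<le> a * (w * exp (2 * a * s)) + b"
  shows "norm (LINT s:{0..t}|lborel. f s) \<le> w * exp (2 * a * t) / 2 + b * t"
proof -
  have i: "set_integrable lborel {0..t} (\<lambda>s. exp (2 * a * s))"
    using set_integral_exp(2)[of "2 * a" t] assms by simp
  have i1: "set_integrable lborel {0..t} (\<lambda>s. (a * w) * exp (2 * a * s))" using i by simp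
  have i2: "set_integrable lborel {0..t} (\<lambda>s. b)" by (rule set_integrable_bounded_borel[of _ _ _ "\<bar>b\<bar>"]) auto
  have "norm (LINT s:{0..t}|lborel. f s) \<le> (LINT s:{0..t}|lborel. (a * w) * exp (2 * a * s) + b)"
    by (rule set_integral_norm_le) (use i1 i2 assms in \<open>auto simp: mult.assoc\<close>)
  also have "\<dots> = (a * w) * (LINT s:{0..t}|lborel. exp (2 * a * s)) + b * t"
    using i1 i2 assms by (subst set_integral_add) (auto simp: set_integral_const_Icc)
  also have "\<dots> = w * (exp (2 * a * t) - 1) / 2 + b * t"
    by (subst set_integral_exp(1)) (use assms in \<open>auto simp: field_simps\<close>)
  also have "\<dots> \<le> w * exp (2 * a * t) / 2 + b * t" using assms by (simp add: field_simps)
  finally show ?thesis .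
qed

text \<open>The weight \<open>exp (-2at)\<close> makes the Volterra operator a contraction with constant \<open>1/2\<close>.\<close>

lemma weighted_gronwall:
  fixes d :: "real \<Rightarrow> 'b::real_normed_vector"
  assumes "0 \<le> T" "0 < a" "0 \<le> b" "continuous_on {0..T} d"
    and step: "\<And>t w. 0 \<le> t \<Longrightarrow> t \<le> T \<Longrightarrow> 0 \<le> w \<Longrightarrow>
      (\<And>s. 0 \<le> s \<Longrightarrow> s \<le> t \<Longrightarrow> norm (d s) \<le> w * exp (2 * a * s)) \<Longrightarrow>
      norm (d t) \<le> w * exp (2 * a * t) / 2 + b"
    and t: "0 \<le> t" "t \<le> T"
  shows "norm (d t) \<le> 2 * b * exp (2 * a * t)"
proof -
  let ?g = "\<lambda>t. norm (d t) * exp (- (2 * a * t))"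
  have "continuous_on {0..T} ?g" by (intro continuous_intros assms)
  then obtain m where m: "m \<in> {0..T}" "\<And>s. s \<in> {0..T} \<Longrightarrow> ?g s \<le> ?g m"
    using continuous_attains_sup[of "{0..T}" ?g] assms(1) by auto
  have bd: "norm (d s) \<le> ?g m * exp (2 * a * s)" if "0 \<le> s" "s \<le> T" for s
  proof -
    have "?g s * exp (2 * a * s) \<le> ?g m * exp (2 * a * s)"
      using m(2)[of s] that by (intro mult_right_mono) auto
    then show ?thesis by (simp add: mult.assoc flip: exp_add)
  qed
  \<comment> \<open>At the maximiser of the weighted norm the step inequality reads
    \<open>norm (d m) \<le> norm (d m) / 2 + b\<close>, which bounds the maximum.\<close>
  have "norm (d m) \<le> ?g m * exp (2 * a * m) / 2 + b"
    using m by (intro step bd) auto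
  then have "norm (d m) \<le> norm (d m) / 2 + b" by (simp add: mult.assoc flip: exp_add)
  then have "norm (d m) \<le> 2 * b" by simp
  moreover have "exp (- (2 * a * m)) \<le> 1" using m assms by simp
  ultimately have "?g m \<le> 2 * b" using assms(3)
    by (metis mult.right_neutral mult_mono norm_ge_zero exp_ge_zero order_trans zero_le_mult_iff zero_le_numeral)
  then show ?thesis using bd[OF t] by (meson exp_ge_zero mult_right_mono order_trans)
qed

section \<open>Delay functionals given by a signed measure\<close>

locale dde =
  fixes r :: real and \<mu>1 \<mu>2 :: "real measure"
  assumes r: "0 < r" and fin1: "finite_measure \<mu>1" and fin2: "finite_measure \<mu>2"
    and sets1: "sets \<mu>1 = sets (restrict_space borel {-r..0})"
    and sets2: "sets \<mu>2 = sets (restrict_space borel {-r..0})"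
begin

text \<open>Polymorphic in the values: real functions enter the delay equation, complex exponentials
  its characteristic function.\<close>

definition L :: "(real \<Rightarrow> 'b::{banach,second_countable_topology}) \<Rightarrow> 'b" where
  "L f = integral\<^sup>L \<mu>1 f - integral\<^sup>L \<mu>2 f"

definition Lnorm :: real where "Lnorm = measure \<mu>1 {-r..0} + measure \<mu>2 {-r..0}"

definition bm :: "(real \<Rightarrow> 'b::{banach,second_countable_topology}) \<Rightarrow> bool" where
  "bm f \<longleftrightarrow> f \<in> borel_measurable (restrict_space borel {-r..0}) \<and> bounded (f ` {-r..0})"

lemma space12: "space \<mu>1 = {-r..0}" "space \<mu>2 = {-r..0}"
  using sets_eq_imp_space_eq[OF sets1] sets_eq_imp_space_eq[OF sets2] by (auto simp: space_restrict_space)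

lemma meas12: "borel_measurable \<mu>1 = borel_measurable (restrict_space borel {-r..0})"
  "borel_measurable \<mu>2 = borel_measurable (restrict_space borel {-r..0})"
  using measurable_cong_sets[OF sets1 refl] measurable_cong_sets[OF sets2 refl] by auto

lemma Lnorm_nonneg: "0 \<le> Lnorm" by (simp add: Lnorm_def)

lemma bmI:
  assumes "f \<in> borel_measurable borel" "\<And>\<theta>. -r \<le> \<theta> \<Longrightarrow> \<theta> \<le> 0 \<Longrightarrow> norm (f \<theta>) \<le> B"
  shows "bm f"
  using assms unfolding bm_def by (auto intro!: measurable_restrict_space1 boundedI[of _ B])

lemma bm_continuous: "continuous_on {-r..0} f \<Longrightarrow> bm f"
  unfolding bm_def
  by (auto intro!: borel_measurable_continuous_on_restrict compact_imp_bounded compact_continuous_image)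

lemma bm_integrable: assumes "bm f" shows "integrable \<mu>1 f" "integrable \<mu>2 f"
proof -
  obtain B where "\<forall>x\<in>{-r..0}. norm (f x) \<le> B" using assms unfolding bm_def bounded_iff by auto
  then show "integrable \<mu>1 f" "integrable \<mu>2 f"
    using assms unfolding bm_def
    by (auto intro!: finite_measure.integrable_const_bound[where B=B] fin1 fin2 AE_I2 simp: space12 meas12)
qed

lemma L_cong: "(\<And>\<theta>. -r \<le> \<theta> \<Longrightarrow> \<theta> \<le> 0 \<Longrightarrow> f \<theta> = g \<theta>) \<Longrightarrow> L f = L g"
  unfolding L_def by (intro arg_cong2[where f="(-)"] Bochner_Integration.integral_cong) (auto simp: space12)

lemma bm_cong: "(\<And>\<theta>. -r \<le> \<theta> \<Longrightarrow> \<theta> \<le> 0 \<Longrightarrow> f \<theta> = g \<theta>) \<Longrightarrow> bm f \<longleftrightarrow> bm g"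
  unfolding bm_def by (intro conj_cong measurable_cong arg_cong[where f=bounded] image_cong) (auto simp: space_restrict_space)

lemma L_add: "bm f \<Longrightarrow> bm g \<Longrightarrow> L (\<lambda>\<theta>. f \<theta> + g \<theta>) = L f + L g"
  by (simp add: L_def bm_integrable)

lemma L_diff: "bm f \<Longrightarrow> bm g \<Longrightarrow> L (\<lambda>\<theta>. f \<theta> - g \<theta>) = L f - L g"
  by (simp add: L_def bm_integrable)

lemma L_cmult: "L (\<lambda>\<theta>. c * f \<theta>) = c * L (f :: real \<Rightarrow> 'b::{real_normed_field,banach,second_countable_topology})"
  by (simp add: L_def right_diff_distrib)

lemma L_Re: "bm f \<Longrightarrow> L (\<lambda>\<theta>. Re (f \<theta>)) = Re (L f)"
  and L_Im: "bm f \<Longrightarrow> L (\<lambda>\<theta>. Im (f \<theta>)) = Im (L f)"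
  using bm_integrable[of f] by (auto simp: L_def)

lemma L_bound:
  assumes "bm f" "\<And>\<theta>. -r \<le> \<theta> \<Longrightarrow> \<theta> \<le> 0 \<Longrightarrow> norm (f \<theta>) \<le> B"
  shows "norm (L f) \<le> Lnorm * B"
proof -
  have *: "norm (integral\<^sup>L \<mu> f) \<le> measure \<mu> {-r..0} * B"
    if "finite_measure \<mu>" "integrable \<mu> f" "space \<mu> = {-r..0}" for \<mu>
  proof -
    interpret finite_measure \<mu> by fact
    have "norm (integral\<^sup>L \<mu> f) \<le> integral\<^sup>L \<mu> (\<lambda>_. B)"
      by (rule Bochner_Integration.integral_norm_bound_integral) (use that assms in auto)
    then show ?thesis using that by simp
  qed
  show ?thesis unfolding L_def Lnorm_def
    using *[OF fin1] *[OF fin2] bm_integrable[OF assms(1)] space12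
      norm_triangle_ineq4[of "integral\<^sup>L \<mu>1 f" "integral\<^sup>L \<mu>2 f"]
    by (simp add: distrib_right)
qed

lemma measurable_id12: "sets \<mu> = sets (restrict_space borel {-r..0}) \<Longrightarrow> (\<lambda>x. x) \<in> measurable \<mu> (borel :: real measure)"
  by (subst measurable_cong_sets[OF _ refl, of \<mu>]) (auto intro: measurable_restrict_space1)

text \<open>Fubini with the delay variable under a finite measure, so that a majorant in the other
  variable alone suffices. Joint measurability refers to the Borel sets of the line and is
  transported to the restricted \<sigma>-algebra by the identity map.\<close>

lemma L_swap_aux:
  fixes g :: "'c \<Rightarrow> real \<Rightarrow> 'b::{banach,second_countable_topology}"
  assumes g: "(\<lambda>(s, \<theta>). g s \<theta>) \<in> borel_measurable (N \<Otimes>\<^sub>M borel)" and B: "integrable N B"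
    and gB: "\<And>s \<theta>. s \<in> space N \<Longrightarrow> -r \<le> \<theta> \<Longrightarrow> \<theta> \<le> 0 \<Longrightarrow> norm (g s \<theta>) \<le> B s"
    and N: "sigma_finite_measure N" and \<mu>: "finite_measure \<mu>" "sets \<mu> = sets (restrict_space borel {-r..0})"
  shows "integrable N (\<lambda>s. integral\<^sup>L \<mu> (g s))"
    and "integral\<^sup>L \<mu> (\<lambda>\<theta>. \<integral>s. g s \<theta> \<partial>N) = (\<integral>s. integral\<^sup>L \<mu> (g s) \<partial>N)"
proof -
  interpret \<mu>: finite_measure \<mu> by fact
  interpret N: sigma_finite_measure N by fact
  interpret P: pair_sigma_finite N \<mu> ..
  have sp: "space \<mu> = {-r..0}" using sets_eq_imp_space_eq[OF \<mu>(2)] by (simp add: space_restrict_space)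
  have id: "(\<lambda>x. x) \<in> measurable \<mu> borel"
    by (rule measurable_id12[OF \<mu>(2)])
  have "(\<lambda>p. (fst p, snd p)) \<in> measurable (N \<Otimes>\<^sub>M \<mu>) (N \<Otimes>\<^sub>M borel)"
    by (intro measurable_Pair measurable_fst measurable_compose[OF measurable_snd id])
  from measurable_compose[OF this g] have gm: "(\<lambda>p. g (fst p) (snd p)) \<in> borel_measurable (N \<Otimes>\<^sub>M \<mu>)"
    by (simp add: case_prod_beta)
  then have gm': "(\<lambda>(s, \<theta>). g s \<theta>) \<in> borel_measurable (N \<Otimes>\<^sub>M \<mu>)" by (simp add: case_prod_beta)
  have gs: "integrable \<mu> (g s)" if "s \<in> space N" for s
    using measurable_compose[OF measurable_Pair1'[OF that] gm'] gB[OF that]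
    by (intro \<mu>.integrable_const_bound[where B="B s"]) (auto simp: sp)
  have bd: "norm (\<integral>\<theta>. norm (g s \<theta>) \<partial>\<mu>) \<le> norm (measure \<mu> {-r..0} * B s)" if "s \<in> space N" for s
  proof -
    have "(\<integral>\<theta>. norm (g s \<theta>) \<partial>\<mu>) \<le> (\<integral>\<theta>. B s \<partial>\<mu>)"
      using gs[OF that] gB[OF that] by (intro integral_mono) (auto simp: sp)
    then show ?thesis by (simp add: sp)
  qed
  have int: "integrable (N \<Otimes>\<^sub>M \<mu>) (\<lambda>(s, \<theta>). g s \<theta>)"
  proof (rule P.Fubini_integrable[OF gm'])
    show "integrable N (\<lambda>s. \<integral>\<theta>. norm (case (s, \<theta>) of (s, \<theta>) \<Rightarrow> g s \<theta>) \<partial>\<mu>)"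
    proof (rule Bochner_Integration.integrable_bound)
      show "integrable N (\<lambda>s. measure \<mu> {-r..0} * B s)" using B by simp
      show "(\<lambda>s. \<integral>\<theta>. norm (case (s, \<theta>) of (s, \<theta>) \<Rightarrow> g s \<theta>) \<partial>\<mu>) \<in> borel_measurable N"
        using gm' by (intro \<mu>.borel_measurable_lebesgue_integral) (auto simp: case_prod_beta)
    qed (use bd in auto)
  qed (use gs in auto)
  show "integrable N (\<lambda>s. integral\<^sup>L \<mu> (g s))"
    using P.integrable_fst'[OF int] by simp
  show "integral\<^sup>L \<mu> (\<lambda>\<theta>. \<integral>s. g s \<theta> \<partial>N) = (\<integral>s. integral\<^sup>L \<mu> (g s) \<partial>N)"
    using P.Fubini_integral[OF int] by simp
qed

lemma L_swap:
  fixes g :: "'c \<Rightarrow> real \<Rightarrow> 'b::{banach,second_countable_topology}"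
  assumes g: "(\<lambda>(s, \<theta>). g s \<theta>) \<in> borel_measurable (N \<Otimes>\<^sub>M borel)" and B: "integrable N B"
    and gB: "\<And>s \<theta>. s \<in> space N \<Longrightarrow> -r \<le> \<theta> \<Longrightarrow> \<theta> \<le> 0 \<Longrightarrow> norm (g s \<theta>) \<le> B s"
    and N: "sigma_finite_measure N"
  shows "integrable N (\<lambda>s. L (g s))"
    and "L (\<lambda>\<theta>. \<integral>s. g s \<theta> \<partial>N) = (\<integral>s. L (g s) \<partial>N)"
  using L_swap_aux[OF assms fin1 sets1] L_swap_aux[OF assms fin2 sets2] by (auto simp: L_def)

lemma L_shift_measurable:
  assumes [measurable]: "f \<in> borel_measurable borel"
  shows "(\<lambda>s. L (\<lambda>\<theta>. f (s + \<theta>))) \<in> borel_measurable (borel :: real measure)"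
proof -
  have *: "(\<lambda>s. \<integral>\<theta>. f (s + \<theta>) \<partial>\<mu>) \<in> borel_measurable (borel :: real measure)"
    if "finite_measure \<mu>" "sets \<mu> = sets (restrict_space borel {-r..0})" for \<mu>
  proof -
    interpret \<mu>: finite_measure \<mu> by fact
    have id[measurable]: "(\<lambda>x. x) \<in> measurable \<mu> borel"
      by (rule measurable_id12[OF that(2)])
    have [measurable]: "(\<lambda>p. snd p) \<in> measurable (borel \<Otimes>\<^sub>M \<mu>) (borel :: real measure)"
      by (rule measurable_compose[OF measurable_snd id])
    show ?thesis
      by (intro \<mu>.borel_measurable_lebesgue_integral) (simp add: case_prod_beta, measurable)
  qed
  show ?thesis unfolding L_def
    using *[OF fin1 sets1] *[OF fin2 sets2] by (rule borel_measurable_diff)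
qed

text \<open>Gronwall with error term 0. The delay only looks back and the weight increases, so the
  weight at s dominates the one at s + \<theta>; before time 0 the function vanishes.\<close>

lemma dde_unique:
  fixes d :: "real \<Rightarrow> real"
  assumes "0 \<le> T" "\<And>\<theta>. -r \<le> \<theta> \<Longrightarrow> \<theta> \<le> 0 \<Longrightarrow> d \<theta> = 0" and cont: "continuous_on {0..T} d"
    and eq: "\<And>t. 0 \<le> t \<Longrightarrow> t \<le> T \<Longrightarrow> d t = (LINT s:{0..t}|lborel. L (\<lambda>\<theta>. d (s + \<theta>)))"
    and t: "-r \<le> t" "t \<le> T"
  shows "d t = 0"
proof -
  have cont': "continuous_on {-r..T} d"
  proof -
    have "continuous_on ({-r..0} \<union> {0..T}) d"
    proof (intro continuous_on_closed_Un cont)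
      have "continuous_on {-r..0} (\<lambda>_. 0 :: real)" by simp
      then show "continuous_on {-r..0} d"
        by (rule continuous_on_eq) (use assms(2) in auto)
    qed auto
    then show ?thesis using assms(1) r by (simp add: ivl_disj_un_two_touch)
  qed
  have *: "norm (d t) \<le> 2 * 0 * exp (2 * (Lnorm + 1) * t)" if "0 \<le> t" "t \<le> T" for t
  proof (rule weighted_gronwall[OF assms(1) _ _ cont _ that])
    fix t w assume t: "0 \<le> t" "t \<le> T" and w: "0 \<le> w"
      and h: "\<And>s. 0 \<le> s \<Longrightarrow> s \<le> t \<Longrightarrow> norm (d s) \<le> w * exp (2 * (Lnorm + 1) * s)"
    have "norm (LINT s:{0..t}|lborel. L (\<lambda>\<theta>. d (s + \<theta>))) \<le> w * exp (2 * (Lnorm + 1) * t) / 2 + 0 * t"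
    proof (rule set_integral_exp_bound)
      fix s assume s: "0 \<le> s" "s \<le> t"
      have "norm (L (\<lambda>\<theta>. d (s + \<theta>))) \<le> Lnorm * (w * exp (2 * (Lnorm + 1) * s))"
      proof (rule L_bound)
        show "bm (\<lambda>\<theta>. d (s + \<theta>))"
          by (intro bm_continuous continuous_on_compose2[OF cont'] continuous_intros) (use s t in auto)
        fix \<theta> assume th: "-r \<le> \<theta>" "\<theta> \<le> 0"
        show "norm (d (s + \<theta>)) \<le> w * exp (2 * (Lnorm + 1) * s)"
        proof (cases "0 \<le> s + \<theta>")
          case True
          then have "norm (d (s + \<theta>)) \<le> w * exp (2 * (Lnorm + 1) * (s + \<theta>))" using h s th by auto
          also have "\<dots> \<le> w * exp (2 * (Lnorm + 1) * s)"
            using w th Lnorm_nonneg by (intro mult_left_mono) auto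
          finally show ?thesis .
        next
          case False
          then show ?thesis using assms(2)[of "s + \<theta>"] s th w by auto
        qed
      qed
      also have "\<dots> \<le> (Lnorm + 1) * (w * exp (2 * (Lnorm + 1) * s)) + 0"
        using w by (simp add: mult_right_mono)
      finally show "norm (L (\<lambda>\<theta>. d (s + \<theta>))) \<le> (Lnorm + 1) * (w * exp (2 * (Lnorm + 1) * s)) + 0" .
    qed (use Lnorm_nonneg w t in auto)
    then show "norm (d t) \<le> w * exp (2 * (Lnorm + 1) * t) / 2 + 0" using eq[OF t] by simp
  qed (use Lnorm_nonneg in auto)
  show ?thesis using *[of t] assms(2)[of t] t by (cases "0 \<le> t") auto
qed

end

section \<open>Variation of constants\<close>

text \<open>\<open>x\<close> is the solution started from the indicator of 0, hence 0 before time 0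
  with a jump to 1. A bound for all times is available because at criticality \<open>x\<close>
  settles on an oscillation.\<close>

locale fundamental = dde +
  fixes x :: "real \<Rightarrow> real" and Cx :: real
  assumes xm[measurable]: "x \<in> borel_measurable borel"
    and xneg: "\<And>t. t < 0 \<Longrightarrow> x t = 0"
    and xb: "\<And>t. \<bar>x t\<bar> \<le> Cx"
    and xeq: "\<And>t. 0 \<le> t \<Longrightarrow> x t = 1 + (LINT s:{0..t}|lborel. L (\<lambda>\<theta>. x (s + \<theta>)))"
begin

text \<open>The derivative of \<open>x\<close> almost everywhere at positive times.\<close>

definition k :: "real \<Rightarrow> real" where "k s = L (\<lambda>\<theta>. x (s + \<theta>))"

lemma km[measurable]: "k \<in> borel_measurable borel"
  unfolding k_def by (rule L_shift_measurable) simp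

lemma kneg: "s < 0 \<Longrightarrow> k s = 0"
proof -
  assume "s < 0"
  then have "k s = L (\<lambda>\<theta>. 0 :: real)" unfolding k_def by (intro L_cong) (simp add: xneg)
  then show ?thesis by (simp add: L_def)
qed

lemma Cx_nonneg: "0 \<le> Cx" using xb[of 0] by linarith

lemma kb: "\<bar>k s\<bar> \<le> Lnorm * Cx"
  unfolding k_def real_norm_def[symmetric]
  by (rule L_bound) (auto intro!: bmI[of _ Cx] simp: xb)

lemma k_integrable: "set_integrable lborel {a..b} k"
  by (rule set_integrable_bounded_borel[where B="Lnorm * Cx"]) (auto simp: kb)

lemma xeq': "0 \<le> t \<Longrightarrow> (LINT s:{0..t}|lborel. k s) = x t - 1"
  using xeq[of t] by (simp add: k_def)

text \<open>The variation of constants integral of \<open>x (t - s)\<close> against dF, integrated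
  by parts: the jump of \<open>x\<close> at 0 contributes \<open>F t\<close>, its density
  contributes \<open>k\<close>. In this form it makes sense for a forcing of unbounded
  variation.\<close>

definition voc :: "(real \<Rightarrow> real) \<Rightarrow> real \<Rightarrow> real" where
  "voc F t = F t + (LINT s:{0..t}|lborel. k (t - s) * F s)"

lemma voc_neg: "t < 0 \<Longrightarrow> F t = 0 \<Longrightarrow> voc F t = 0"
  by (simp add: voc_def set_lebesgue_integral_def)

lemma voc_measurable:
  assumes [measurable]: "F \<in> borel_measurable borel"
  shows "voc F \<in> borel_measurable borel"
proof -
  have "(\<lambda>t. \<integral>s. (if 0 \<le> s \<and> s \<le> t then k (t - s) * F s else 0) \<partial>lborel) \<in> borel_measurable borel"
    by (intro lborel.borel_measurable_lebesgue_integral) (simp add: case_prod_beta, measurable)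
  also have "(\<lambda>t. \<integral>s. (if 0 \<le> s \<and> s \<le> t then k (t - s) * F s else 0) \<partial>lborel) =
      (\<lambda>t. LINT s:{0..t}|lborel. k (t - s) * F s)"
    unfolding set_lebesgue_integral_def
    by (intro ext Bochner_Integration.integral_cong) (auto simp: indicator_def)
  finally have [measurable]: "(\<lambda>t. LINT s:{0..t}|lborel. k (t - s) * F s) \<in> borel_measurable borel" .
  show ?thesis unfolding voc_def by measurable
qed

lemma voc_bound:
  assumes "\<And>s. \<bar>F s\<bar> \<le> B" "t \<le> T" "0 \<le> T"
  shows "\<bar>voc F t\<bar> \<le> B + T * (Lnorm * Cx * B)"
proof -
  have B: "0 \<le> B" using assms(1)[of 0] by linarith
  have "norm (LINT s:{0..t}|lborel. k (t - s) * F s) \<le> T * (Lnorm * Cx * B)"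
  proof (cases "0 \<le> t")
    case True
    have "norm (LINT s:{0..t}|lborel. k (t - s) * F s) \<le> (t - 0) * (Lnorm * Cx * B)"
      by (rule set_integral_norm_le_const)
         (use True kb assms(1) Lnorm_nonneg Cx_nonneg in \<open>auto simp: abs_mult intro!: mult_mono\<close>)
    also have "\<dots> \<le> T * (Lnorm * Cx * B)"
      using assms B Lnorm_nonneg Cx_nonneg by (intro mult_right_mono) auto
    finally show ?thesis .
  next
    case False
    then show ?thesis using assms B Lnorm_nonneg Cx_nonneg by (simp add: set_lebesgue_integral_def)
  qed
  then show ?thesis unfolding voc_def using assms(1)[of t] by auto
qed

text \<open>Fubini: integrating the kernel in t first turns \<open>k\<close> into
  \<open>x - 1\<close>, and the -1 cancels the integral of \<open>F\<close>, so that the convolution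
  of \<open>F\<close> with \<open>x\<close> remains.\<close>

lemma voc_integral:
  assumes Fm[measurable]: "F \<in> borel_measurable borel" and FB: "\<And>s. \<bar>F s\<bar> \<le> B" and v: "0 \<le> v"
  shows "(LINT t:{0..v}|lborel. voc F t) = (LINT s:{0..v}|lborel. F s * x (v - s))"
proof -
  have B: "0 \<le> B" using FB[of 0] by linarith
  let ?KB = "Lnorm * Cx * B"
  have KB: "0 \<le> ?KB" using B Lnorm_nonneg Cx_nonneg by simp
  let ?g = "\<lambda>t s. if 0 \<le> s \<and> s \<le> t \<and> t \<le> v then k (t - s) * F s else 0"
  have gm[measurable]: "(\<lambda>(t, s). ?g t s) \<in> borel_measurable (lborel \<Otimes>\<^sub>M lborel)"
    by (simp add: case_prod_beta, measurable)
  have gb: "norm (?g t s) \<le> indicat_real {0..v} t * (indicat_real {0..v} s * ?KB)" for t s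
    using kb[of "t - s"] FB[of s] KB Lnorm_nonneg Cx_nonneg
    by (auto simp: indicator_def abs_mult intro!: mult_mono)
  have bi: "integrable (lborel \<Otimes>\<^sub>M lborel) (\<lambda>p. indicat_real {0..v} (fst p) * (indicat_real {0..v} (snd p) * ?KB))"
  proof (rule lborel_pair.Fubini_integrable)
    have [simp]: "integrable lborel (indicat_real {0..v})"
      using v by (intro integrable_real_indicator) auto
    show "integrable lborel (\<lambda>t. \<integral>s. norm (indicat_real {0..v} (fst (t, s)) * (indicat_real {0..v} (snd (t, s)) * ?KB)) \<partial>lborel)"
      using v KB by (simp add: abs_mult)
    show "AE t in lborel. integrable lborel (\<lambda>s. indicat_real {0..v} (fst (t, s)) * (indicat_real {0..v} (snd (t, s)) * ?KB))"
      by (intro AE_I2) simp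
  qed simp
  have gi: "integrable (lborel \<Otimes>\<^sub>M lborel) (\<lambda>(t, s). ?g t s)"
    by (rule Bochner_Integration.integrable_bound[OF bi gm])
       (use gb KB in \<open>auto simp: split_beta intro!: AE_I2\<close>)
  have 1: "(LINT t:{0..v}|lborel. voc F t) = (LINT t:{0..v}|lborel. F t) + (\<integral>t. \<integral>s. ?g t s \<partial>lborel \<partial>lborel)"
  proof -
    have [measurable]: "voc F \<in> borel_measurable borel" by (rule voc_measurable) fact
    have "set_integrable lborel {0..v} (voc F)"
      by (rule set_integrable_bounded_borel[where B="B + v * ?KB"]) (use voc_bound FB v in auto)
    moreover have "set_integrable lborel {0..v} F"
      by (rule set_integrable_bounded_borel[where B=B]) (use FB in auto)
    ultimately have "(LINT t:{0..v}|lborel. voc F t) - (LINT t:{0..v}|lborel. F t) = (LINT t:{0..v}|lborel. voc F t - F t)"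
      by (simp add: set_integral_diff)
    also have "\<dots> = (\<integral>t. \<integral>s. ?g t s \<partial>lborel \<partial>lborel)"
      unfolding set_lebesgue_integral_def[of _ "{0..v}"]
    proof (intro Bochner_Integration.integral_cong refl)
      fix t :: real
      show "indicat_real {0..v} t *\<^sub>R (voc F t - F t) = (\<integral>s. ?g t s \<partial>lborel)"
      proof (cases "t \<in> {0..v}")
        case True
        then show ?thesis unfolding voc_def set_lebesgue_integral_def
          by (auto intro!: Bochner_Integration.integral_cong simp: indicator_def)
      next
        case False
        then have "?g t s = 0" for s by auto
        then have "(\<integral>s. ?g t s \<partial>lborel) = (\<integral>s. 0 \<partial>(lborel :: real measure))" by presburger
        then show ?thesis using False by simp
      qed
    qed
    finally show ?thesis by simp
  qed
  have 2: "(\<integral>t. ?g t s \<partial>lborel) = indicator {0..v} s * (F s * (x (v - s) - 1))" for s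
  proof (cases "0 \<le> s \<and> s \<le> v")
    case True
    have "(\<integral>t. ?g t s \<partial>lborel) = (LINT t:{s..v}|lborel. k (- s + t) * F s)"
      unfolding set_lebesgue_integral_def using True
      by (intro Bochner_Integration.integral_cong) (auto simp: indicator_def)
    also have "\<dots> = (LINT t:{s..v}|lborel. k (- s + t)) * F s" by simp
    also have "\<dots> = (LINT t:{-s+s..-s+v}|lborel. k t) * F s"
      by (subst set_integral_shift) simp
    finally show ?thesis using True xeq'[of "v - s"] by simp
  next
    case False
    then have "(\<integral>t. ?g t s \<partial>lborel) = (\<integral>t. 0 \<partial>(lborel::real measure))"
      by (intro Bochner_Integration.integral_cong) auto
    then show ?thesis using False by (auto simp: indicator_def)
  qed
  have "(\<integral>t. \<integral>s. ?g t s \<partial>lborel \<partial>lborel) = (\<integral>s. \<integral>t. ?g t s \<partial>lborel \<partial>lborel)"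
    using lborel_pair.Fubini_integral[OF gi] by simp
  also have "\<dots> = (LINT s:{0..v}|lborel. F s * (x (v - s) - 1))"
    unfolding 2 set_lebesgue_integral_def by simp
  also have "\<dots> = (LINT s:{0..v}|lborel. F s * x (v - s)) - (LINT s:{0..v}|lborel. F s)"
  proof -
    have "set_integrable lborel {0..v} (\<lambda>s. F s * x (v - s))"
      by (rule set_integrable_bounded_borel[where B="B * Cx"])
         (use FB xb B in \<open>auto simp: abs_mult intro!: mult_mono\<close>)
    moreover have "set_integrable lborel {0..v} F"
      by (rule set_integrable_bounded_borel[where B=B]) (use FB in auto)
    ultimately show ?thesis by (simp add: right_diff_distrib set_integral_diff)
  qed
  finally show ?thesis using 1 by simp
qed

text \<open>The functional is moved outside the time integral, where \<open>voc_integral\<close>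
  replaces the integral of \<open>voc F\<close> by a convolution with \<open>x\<close>; moved inside
  again, it turns \<open>x\<close> into \<open>k\<close> and produces the integral in
  \<open>voc\<close>. Since \<open>F\<close> vanishes before 0, the shifted windows may start at
  0.\<close>

lemma voc_solves:
  assumes Fm[measurable]: "F \<in> borel_measurable borel" and FB: "\<And>s. \<bar>F s\<bar> \<le> B"
    and F0: "\<And>s. s < 0 \<Longrightarrow> F s = 0" and t: "0 \<le> t"
  shows "voc F t = F t + (LINT s:{0..t}|lborel. L (\<lambda>\<theta>. voc F (s + \<theta>)))"
    and "set_integrable lborel {0..t} (\<lambda>s. L (\<lambda>\<theta>. voc F (s + \<theta>)))"
proof -
  have B: "0 \<le> B" using FB[of 0] by linarith
  have KB: "0 \<le> Lnorm * Cx * B" using B Lnorm_nonneg Cx_nonneg by simp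
  have [measurable]: "voc F \<in> borel_measurable borel" by (rule voc_measurable) fact
  let ?V = "B + t * (Lnorm * Cx * B)"
  have V: "0 \<le> ?V" using B KB t by simp
  have vb: "\<bar>voc F s\<bar> \<le> ?V" if "s \<le> t" for s by (rule voc_bound[OF FB that t])
  have "integrable lborel (indicat_real {0..t})"
    using t by (intro integrable_real_indicator) auto
  then have ic: "integrable lborel (\<lambda>s. indicat_real {0..t} s * c)" for c :: real by simp
  have b1: "(\<lambda>(s, \<theta>). indicat_real {0..t} s * voc F (s + \<theta>)) \<in> borel_measurable (lborel \<Otimes>\<^sub>M borel)"
    by (simp add: case_prod_beta)
  have b2: "norm (indicat_real {0..t} s * voc F (s + \<theta>)) \<le> indicat_real {0..t} s * ?V" if "-r \<le> \<theta>" "\<theta> \<le> 0" for s \<theta>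
    using vb[of "s + \<theta>"] that by (auto simp: indicator_def)
  have A: "integrable lborel (\<lambda>s. L (\<lambda>\<theta>. indicat_real {0..t} s * voc F (s + \<theta>)))"
    "L (\<lambda>\<theta>. \<integral>s. indicat_real {0..t} s * voc F (s + \<theta>) \<partial>lborel) =
      (\<integral>s. L (\<lambda>\<theta>. indicat_real {0..t} s * voc F (s + \<theta>)) \<partial>lborel)"
    using L_swap[OF b1 ic b2 lborel.sigma_finite_measure_axioms] by auto
  show "set_integrable lborel {0..t} (\<lambda>s. L (\<lambda>\<theta>. voc F (s + \<theta>)))"
    using A(1) by (simp add: set_integrable_def L_cmult)
  have "(LINT s:{0..t}|lborel. L (\<lambda>\<theta>. voc F (s + \<theta>))) = L (\<lambda>\<theta>. LINT s:{0..t}|lborel. voc F (\<theta> + s))"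
    using A(2) by (simp add: set_lebesgue_integral_def L_cmult add.commute)
  also have "\<dots> = L (\<lambda>\<theta>. LINT s:{0..t}|lborel. F s * x (t - s + \<theta>))"
  proof (rule L_cong)
    fix \<theta> assume th: "-r \<le> \<theta>" "\<theta> \<le> 0"
    have "(LINT s:{0..t}|lborel. voc F (\<theta> + s)) = (LINT s:{\<theta>..\<theta>+t}|lborel. voc F s)"
      by (simp add: set_integral_shift)
    also have "\<dots> = (LINT s:{0..\<theta>+t}|lborel. voc F s)"
      unfolding set_lebesgue_integral_def using th
      by (intro Bochner_Integration.integral_cong) (auto simp: indicator_def voc_neg F0)
    also have "\<dots> = (LINT s:{0..\<theta>+t}|lborel. F s * x (\<theta> + t - s))"
    proof (cases "0 \<le> \<theta> + t")
      case True then show ?thesis by (intro voc_integral[OF Fm FB])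
    qed (simp add: set_lebesgue_integral_def)
    also have "\<dots> = (LINT s:{0..t}|lborel. F s * x (t - s + \<theta>))"
      unfolding set_lebesgue_integral_def using th
      by (intro Bochner_Integration.integral_cong) (auto simp: indicator_def xneg algebra_simps)
    finally show "(LINT s:{0..t}|lborel. voc F (\<theta> + s)) = (LINT s:{0..t}|lborel. F s * x (t - s + \<theta>))" .
  qed
  also have "\<dots> = (\<integral>s. L (\<lambda>\<theta>. indicator {0..t} s * (F s * x (t - s + \<theta>))) \<partial>lborel)"
    unfolding set_lebesgue_integral_def real_scaleR_def
  proof (rule L_swap(2)[OF _ ic _ lborel.sigma_finite_measure_axioms])
    show "(\<lambda>(s, \<theta>). indicat_real {0..t} s * (F s * x (t - s + \<theta>))) \<in> borel_measurable (lborel \<Otimes>\<^sub>M borel)"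
      by (simp add: case_prod_beta)
    fix s \<theta>
    show "norm (indicat_real {0..t} s * (F s * x (t - s + \<theta>))) \<le> indicat_real {0..t} s * (B * Cx)"
      using FB xb B Cx_nonneg by (auto simp: indicator_def abs_mult intro!: mult_mono)
  qed
  also have "\<dots> = (LINT s:{0..t}|lborel. k (t - s) * F s)"
    unfolding set_lebesgue_integral_def k_def
    by (intro Bochner_Integration.integral_cong) (auto simp: L_cmult mult.commute)
  finally show "voc F t = F t + (LINT s:{0..t}|lborel. L (\<lambda>\<theta>. voc F (s + \<theta>)))"
    by (simp add: voc_def)
qed

lemma voc_stopped:
  assumes Fm[measurable]: "F \<in> borel_measurable borel" and FB: "\<And>s. \<bar>F s\<bar> \<le> B"
    and st: "\<And>s. \<tau> \<le> s \<Longrightarrow> F s = F \<tau>" and t: "0 \<le> \<tau>" "\<tau> \<le> t"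
  shows "voc F t = (LINT s:{0..\<tau>}|lborel. k (t - s) * F s) + F \<tau> * x (t - \<tau>)"
proof -
  have B: "0 \<le> B" using FB[of 0] by linarith
  have "set_integrable lborel {0..t} (\<lambda>s. k (t - s) * F s)"
    by (rule set_integrable_bounded_borel[where B="Lnorm * Cx * B"])
       (use FB kb B Lnorm_nonneg Cx_nonneg in \<open>auto simp: abs_mult intro!: mult_mono\<close>)
  then have "(LINT s:{0..t}|lborel. k (t - s) * F s) =
     (LINT s:{0..\<tau>}|lborel. k (t - s) * F s) + (LINT s:{\<tau>..t}|lborel. k (t - s) * F s)"
    using t by (rule set_integral_split)
  also have "(LINT s:{\<tau>..t}|lborel. k (t - s) * F s) = (LINT s:{\<tau>..t}|lborel. k (t - s) * F \<tau>)"
    unfolding set_lebesgue_integral_def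
  proof (intro Bochner_Integration.integral_cong refl)
    fix s
    show "indicat_real {\<tau>..t} s *\<^sub>R (k (t - s) * F s) = indicat_real {\<tau>..t} s *\<^sub>R (k (t - s) * F \<tau>)"
      using st[of s] by (cases "s \<in> {\<tau>..t}") simp_all
  qed
  also have "\<dots> = (LINT s:{\<tau>..t}|lborel. k (t - s)) * F \<tau>" by simp
  also have "(LINT s:{\<tau>..t}|lborel. k (t - s)) = x (t - \<tau>) - 1"
    using t by (simp add: set_integral_reflect xeq')
  finally show ?thesis using st[OF t(2)] by (simp add: voc_def algebra_simps)
qed

end

section \<open>Integrals along vertical lines\<close>

lemma integrable_inverse_1_plus_square_lborel: "integrable lborel (\<lambda>y::real. inverse (1 + y\<^sup>2))"
  using integrable_inverse_1_plus_square by (simp add: set_integrable_def einterval_def)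

lemma line_integrable:
  fixes g :: "real \<Rightarrow> complex"
  assumes cont: "continuous_on UNIV g" and bd: "\<And>y. Y \<le> \<bar>y\<bar> \<Longrightarrow> norm (g y) \<le> A / y\<^sup>2"
  shows "integrable lborel g"
proof -
  define Y' where "Y' = max 1 Y"
  have Y': "1 \<le> Y'" "Y \<le> Y'" by (auto simp: Y'_def)
  have "compact (g ` {-Y'..Y'})"
    by (intro compact_continuous_image continuous_on_subset[OF cont]) auto
  then obtain C where "\<forall>z\<in>g ` {-Y'..Y'}. norm z \<le> C"
    using compact_imp_bounded bounded_iff by blast
  then have C: "norm (g y) \<le> C" if "\<bar>y\<bar> \<le> Y'" for y using that by (auto simp: abs_le_iff)
  have C0: "0 \<le> C" using order_trans[OF norm_ge_zero C[of 0]] Y' by simp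
  have A0: "0 \<le> A"
  proof -
    have "0 \<le> A / Y'\<^sup>2" using bd[of Y'] Y' norm_ge_zero[of "g Y'"] by linarith
    then show ?thesis using Y' by (simp add: zero_le_divide_iff)
  qed
  \<comment> \<open>The first summand serves the compact part, where \<open>C\<close> bounds g; the
    second serves y^2 \<ge> 1, where 1 + y^2 \<le> 2 y^2.\<close>
  let ?K = "C * (1 + Y'\<^sup>2) + 2 * A"
  have K: "norm (g y) \<le> ?K * inverse (1 + y\<^sup>2)" for y
  proof (cases "\<bar>y\<bar> \<le> Y'")
    case True
    then have "y\<^sup>2 \<le> Y'\<^sup>2" by (metis abs_le_square_iff abs_of_nonneg Y'(1) order_trans zero_le_one)
    have p: "0 < 1 + y\<^sup>2" by (simp add: add_pos_nonneg)
    have "norm (g y) * (1 + y\<^sup>2) \<le> C * (1 + Y'\<^sup>2)"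
      using C[OF True] C0 \<open>y\<^sup>2 \<le> Y'\<^sup>2\<close> by (intro mult_mono) auto
    also have "\<dots> \<le> ?K" using A0 by simp
    finally show ?thesis using p by (simp add: field_simps)
  next
    case False
    then have y: "1 \<le> y\<^sup>2" using Y' one_le_power[of "\<bar>y\<bar>" 2] by simp
    have p: "0 < 1 + y\<^sup>2" by (simp add: add_pos_nonneg)
    have "norm (g y) \<le> A / y\<^sup>2" using False Y' by (intro bd) auto
    also have "\<dots> \<le> 2 * A * inverse (1 + y\<^sup>2)"
    proof -
      have y0: "0 < y\<^sup>2" using y by linarith
      have "A * (1 + y\<^sup>2) \<le> 2 * A * y\<^sup>2" using mult_left_mono[OF y A0] by (simp add: algebra_simps)
      then have "A * (1 + y\<^sup>2) / (y\<^sup>2 * (1 + y\<^sup>2)) \<le> 2 * A * y\<^sup>2 / (y\<^sup>2 * (1 + y\<^sup>2))"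
        using y0 p by (intro divide_right_mono) auto
      moreover have "A * (1 + y\<^sup>2) / (y\<^sup>2 * (1 + y\<^sup>2)) = A / y\<^sup>2"
        using p by (intro mult_divide_mult_cancel_right) auto
      moreover have "2 * A * y\<^sup>2 / ((1 + y\<^sup>2) * y\<^sup>2) = 2 * A / (1 + y\<^sup>2)"
        using y0 by (intro mult_divide_mult_cancel_right) auto
      ultimately have "A / y\<^sup>2 \<le> 2 * A / (1 + y\<^sup>2)"
        by (simp only: mult.commute[of "y\<^sup>2" "1 + y\<^sup>2"])
      then show ?thesis by (simp only: divide_inverse)
    qed
    also have "\<dots> \<le> ?K * inverse (1 + y\<^sup>2)"
      using C0 p by (intro mult_right_mono) auto
    finally show ?thesis .
  qed
  have "AE y in lborel. norm (g y) \<le> norm (?K * inverse (1 + y\<^sup>2))"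
    unfolding real_norm_def by (intro AE_I2 order_trans[OF K abs_ge_self])
  moreover have "integrable lborel (\<lambda>y. ?K * inverse (1 + y\<^sup>2))"
    by (intro integrable_mult_right integrable_inverse_1_plus_square_lborel)
  moreover have "g \<in> borel_measurable lborel"
    using borel_measurable_continuous_onI[OF cont] by simp
  ultimately show ?thesis by (rule Bochner_Integration.integrable_bound[rotated 2])
qed

lemma continuous_on_line:
  assumes "continuous_on S f" "\<And>y. Complex c y \<in> S"
  shows "continuous_on UNIV (\<lambda>y. f (Complex c y))"
  by (rule continuous_on_compose2[OF assms(1)]) (use assms(2) in \<open>auto intro!: continuous_intros simp: Complex_eq\<close>)

text \<open>Contour integrals deliver gauge integrals over [-n,n]; dominated convergence passes from
  these to the Lebesgue integral over the line.\<close>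

lemma symmetric_integral_limit:
  fixes g :: "real \<Rightarrow> complex"
  assumes "integrable lborel g"
  shows "(\<lambda>n. integral {- real n..real n} g) \<longlonglongrightarrow> (\<integral>y. g y \<partial>lborel)"
proof -
  have [measurable]: "g \<in> borel_measurable borel" using assms by auto
  have si: "set_integrable lborel {- real n..real n} g" for n
    using assms unfolding set_integrable_def by (rule integrable_mult_indicator[rotated]) auto
  have "(\<lambda>n. \<integral>y. indicator {- real n..real n} y *\<^sub>R g y \<partial>lborel) \<longlonglongrightarrow> (\<integral>y. g y \<partial>lborel)"
  proof (rule integral_dominated_convergence[where w="\<lambda>y. norm (g y)"])
    show "AE y in lborel. (\<lambda>n. indicat_real {- real n..real n} y *\<^sub>R g y) \<longlonglongrightarrow> g y"
    proof (intro AE_I2 tendsto_eventually)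
      fix y :: real
      obtain N :: nat where "\<bar>y\<bar> \<le> N" using real_arch_simple by blast
      then show "\<forall>\<^sub>F n in sequentially. indicat_real {- real n..real n} y *\<^sub>R g y = g y"
        by (intro eventually_sequentiallyI[of N]) (auto simp: indicator_def)
    qed
  qed (use assms in \<open>auto simp: indicator_def\<close>)
  then show ?thesis
    using set_borel_integral_eq_integral(2)[OF si] by (simp add: set_lebesgue_integral_def)
qed

text \<open>Residue theorem on rectangles with vertical sides at a and b and height 2n: the
  horizontal sides have fixed length and the integrand is O(1/n^2) there. The i in dz = i dy cancels
  the i of 2 pi i. \<open>lo\<close> supplies an open half plane containing the closed
  strip.\<close>

lemma contour_shift:
  assumes ab: "a < b" and lo: "lo < a" and pts: "finite pts" "\<And>p. p \<in> pts \<Longrightarrow> a < Re p \<and> Re p < b"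
    and hol: "f holomorphic_on ({z. lo < Re z} - pts)"
    and bd: "\<And>z. a \<le> Re z \<Longrightarrow> Re z \<le> b \<Longrightarrow> Y \<le> \<bar>Im z\<bar> \<Longrightarrow> norm (f z) \<le> A / (Im z)\<^sup>2"
  shows "integrable lborel (\<lambda>y. f (Complex a y))" "integrable lborel (\<lambda>y. f (Complex b y))"
    and "(\<integral>y. f (Complex b y) \<partial>lborel) - (\<integral>y. f (Complex a y) \<partial>lborel) = 2 * pi * (\<Sum>p\<in>pts. residue f p)"
proof -
  let ?S = "{z. lo < Re z}"
  have opS: "open ?S" by (simp add: open_halfspace_Re_gt)
  have cvS: "connected ?S" by (simp add: convex_connected convex_halfspace_Re_gt)
  have cf: "continuous_on (?S - pts) f" by (rule holomorphic_on_imp_continuous_on[OF hol])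
  have ca: "continuous_on UNIV (\<lambda>y. f (Complex c y))" if "c = a \<or> c = b" for c
    by (rule continuous_on_line[OF cf]) (use that pts(2) ab lo in force)
  show ia: "integrable lborel (\<lambda>y. f (Complex a y))"
    by (rule line_integrable[OF ca, where Y=Y and A=A]) (use ab bd[of "Complex a y" for y] in auto)
  show ib: "integrable lborel (\<lambda>y. f (Complex b y))"
    by (rule line_integrable[OF ca, where Y=Y and A=A]) (use ab bd[of "Complex b y" for y] in auto)
  obtain I0 where I0: "\<And>p. p \<in> pts \<Longrightarrow> \<bar>Im p\<bar> \<le> I0"
    using finite_imp_bounded[of "Im ` pts"] pts(1) unfolding bounded_iff by auto
  \<comment> \<open>The defect of the claimed identity, multiplied by i, for truncated lines; it
    equals minus the integral over the two horizontal sides.\<close>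
  define D where "D n = \<i> * integral {- real n..real n} (\<lambda>y. f (Complex b y))
      - \<i> * integral {- real n..real n} (\<lambda>y. f (Complex a y)) - 2 * pi * \<i> * (\<Sum>p\<in>pts. residue f p)" for n
  have main: "norm (D n) \<le> 2 * (b - a) * (A / (real n)\<^sup>2)" if n: "I0 < real n" "Y \<le> real n" "1 \<le> real n" for n :: nat
  proof -
    let ?a1 = "Complex a (- real n)" and ?a2 = "Complex b (- real n)"
    let ?a3 = "Complex b (real n)" and ?a4 = "Complex a (real n)"
    have pin: "p \<in> box ?a1 ?a3" if "p \<in> pts" for p
      using pts(2)[OF that] I0[OF that] n by (auto simp: in_box_complex_iff)
    have pim: "path_image (rectpath ?a1 ?a3) \<subseteq> ?S - pts"
    proof -
      have "path_image (rectpath ?a1 ?a3) \<subseteq> cbox ?a1 ?a3 - box ?a1 ?a3"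
        using path_image_rectpath_cbox_minus_box[of ?a1 ?a3] ab n by auto
      then show ?thesis using pin lo by (force simp: in_cbox_complex_iff)
    qed
    have res: "contour_integral (rectpath ?a1 ?a3) f =
       2 * pi * \<i> * (\<Sum>p\<in>pts. winding_number (rectpath ?a1 ?a3) p * residue f p)"
    proof (rule Residue_theorem[OF opS cvS pts(1) hol _ _ pim])
      show "\<forall>z. z \<notin> ?S \<longrightarrow> winding_number (rectpath ?a1 ?a3) z = 0"
        by (intro allI impI winding_number_rectpath_outside) (use ab lo in \<open>auto simp: in_cbox_complex_iff\<close>)
    qed auto
    also have "(\<Sum>p\<in>pts. winding_number (rectpath ?a1 ?a3) p * residue f p) = (\<Sum>p\<in>pts. residue f p)"
      using pin by (intro sum.cong) (auto simp: winding_number_rectpath)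
    finally have 1: "contour_integral (rectpath ?a1 ?a3) f = 2 * pi * \<i> * (\<Sum>p\<in>pts. residue f p)" .
    have seg: "closed_segment u v \<subseteq> path_image (rectpath ?a1 ?a3)"
      if "(u, v) \<in> {(?a1, ?a2), (?a2, ?a3), (?a3, ?a4), (?a4, ?a1)}" for u v
      using that by (auto simp: rectpath_def Let_def path_image_join)
    have ci: "f contour_integrable_on (linepath u v)"
      if "(u, v) \<in> {(?a1, ?a2), (?a2, ?a3), (?a3, ?a4), (?a4, ?a1)}" for u v
      using seg[OF that] pim
      by (intro contour_integrable_continuous_linepath continuous_on_subset[OF cf]) auto
    have 2: "contour_integral (rectpath ?a1 ?a3) f =
       contour_integral (linepath ?a1 ?a2) f + (contour_integral (linepath ?a2 ?a3) f +
        (contour_integral (linepath ?a3 ?a4) f + contour_integral (linepath ?a4 ?a1) f))"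
      unfolding rectpath_def Let_def using ci by (simp add: contour_integrable_joinI)
    have 3: "contour_integral (linepath ?a2 ?a3) f = \<i> * integral {- real n..real n} (\<lambda>y. f (Complex b y))"
      using n by (intro contour_integral_linepath_same_Re) auto
    have "contour_integral (linepath ?a1 ?a4) f = \<i> * integral {- real n..real n} (\<lambda>y. f (Complex a y))"
      using n by (intro contour_integral_linepath_same_Re) auto
    \<comment> \<open>The left side of the rectangle is traversed downwards, whence the
      sign.\<close>
    then have 4: "contour_integral (linepath ?a4 ?a1) f = - (\<i> * integral {- real n..real n} (\<lambda>y. f (Complex a y)))"
      using contour_integral_reverse_linepath[OF continuous_on_subset[OF cf order_trans[OF seg[of ?a4 ?a1] pim]]]
      by simp
    have A0: "0 \<le> A / (real n)\<^sup>2"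
      using order_trans[OF norm_ge_zero bd[of "Complex a (real n)"]] n ab by simp
    have 5: "norm (contour_integral (linepath u v) f) \<le> A / (real n)\<^sup>2 * norm (v - u)"
      if "(u, v) \<in> {(?a1, ?a2), (?a3, ?a4)}" for u v
    proof (rule contour_integral_bound_linepath[OF ci A0])
      fix z assume "z \<in> closed_segment u v"
      then have "a \<le> Re z \<and> Re z \<le> b \<and> \<bar>Im z\<bar> = real n"
        using that ab n by (auto simp: closed_segment_same_Im closed_segment_eq_real_ivl split: if_splits)
      then show "norm (f z) \<le> A / (real n)\<^sup>2"
        using bd[of z] n power2_abs[of "Im z"] by simp
    qed (use that in auto)
    have n1: "norm (?a2 - ?a1) = b - a" "norm (?a4 - ?a3) = b - a"
      using ab by (auto simp: Complex_eq cmod_def)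
    have "D n = - contour_integral (linepath ?a1 ?a2) f - contour_integral (linepath ?a3 ?a4) f"
      using 1 2 3 4 by (simp add: D_def algebra_simps)
    then have "norm (D n) \<le> norm (contour_integral (linepath ?a1 ?a2) f) + norm (contour_integral (linepath ?a3 ?a4) f)"
      using norm_triangle_ineq4[of "- contour_integral (linepath ?a1 ?a2) f" "contour_integral (linepath ?a3 ?a4) f"]
      by simp
    also have "\<dots> \<le> A / (real n)\<^sup>2 * (b - a) + A / (real n)\<^sup>2 * (b - a)"
      using 5[of ?a1 ?a2] 5[of ?a3 ?a4] n1 by (intro add_mono) auto
    also have "\<dots> = 2 * (b - a) * (A / (real n)\<^sup>2)" by simp
    finally show ?thesis .
  qed
  have "D \<longlonglongrightarrow> 0"
  proof (rule Lim_null_comparison)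
    obtain N :: nat where N: "max (max (I0 + 1) Y) 1 \<le> N" using real_arch_simple by blast
    show "\<forall>\<^sub>F n in sequentially. norm (D n) \<le> 2 * (b - a) * (A / (real n)\<^sup>2)"
      by (intro eventually_sequentiallyI[of N] main) (use N in auto)
    have "(\<lambda>n. 2 * (b - a) * (A * (inverse (real n) * inverse (real n)))) \<longlonglongrightarrow> 2 * (b - a) * (A * (0 * 0))"
      by (intro tendsto_intros lim_inverse_n)
    then show "(\<lambda>n. 2 * (b - a) * (A / (real n)\<^sup>2)) \<longlonglongrightarrow> 0"
      by (simp add: power2_eq_square field_simps)
  qed
  moreover have "D \<longlonglongrightarrow> \<i> * (\<integral>y. f (Complex b y) \<partial>lborel) - \<i> * (\<integral>y. f (Complex a y) \<partial>lborel)
      - 2 * pi * \<i> * (\<Sum>p\<in>pts. residue f p)"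
    unfolding D_def by (intro tendsto_intros symmetric_integral_limit ia ib)
  ultimately have "\<i> * (\<integral>y. f (Complex b y) \<partial>lborel) - \<i> * (\<integral>y. f (Complex a y) \<partial>lborel)
      - 2 * pi * \<i> * (\<Sum>p\<in>pts. residue f p) = 0"
    by (rule LIMSEQ_unique[symmetric])
  then have "\<i> * ((\<integral>y. f (Complex b y) \<partial>lborel) - (\<integral>y. f (Complex a y) \<partial>lborel)) = \<i> * (2 * pi * (\<Sum>p\<in>pts. residue f p))"
    by (simp add: algebra_simps)
  then show "(\<integral>y. f (Complex b y) \<partial>lborel) - (\<integral>y. f (Complex a y) \<partial>lborel) = 2 * pi * (\<Sum>p\<in>pts. residue f p)"
    by simp
qed

text \<open>The majorant A/(1 + y^2) serves all lines at distance at least 1 from the imaginary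
  axis, and for fixed y the integrand tends to 0. The absolute value leaves the direction open: the
  lines go to the right in \<open>right_line_zero\<close> and to the left in
  \<open>inverse_laplace_ramp\<close>.\<close>

lemma line_integral_vanishes:
  fixes f :: "complex \<Rightarrow> complex" and c :: "nat \<Rightarrow> real"
  assumes c: "filterlim (\<lambda>n. \<bar>c n\<bar>) at_top sequentially" "\<And>n. 1 \<le> \<bar>c n\<bar>"
    and m: "\<And>n. (\<lambda>y. f (Complex (c n) y)) \<in> borel_measurable borel"
    and bd: "\<And>n y. norm (f (Complex (c n) y)) \<le> A / (norm (Complex (c n) y))\<^sup>2"
  shows "(\<lambda>n. \<integral>y. f (Complex (c n) y) \<partial>lborel) \<longlonglongrightarrow> 0"
proof -
  have A: "0 \<le> A"
  proof -
    have "0 \<le> A / (norm (Complex (c 0) 0))\<^sup>2" by (rule order_trans[OF norm_ge_zero bd])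
    moreover have "0 < (norm (Complex (c 0) 0))\<^sup>2" using c(2)[of 0] by (auto simp: complex_eq_iff)
    ultimately show ?thesis by (simp add: zero_le_divide_iff)
  qed
  have nrm: "(norm (Complex (c n) y))\<^sup>2 = (c n)\<^sup>2 + y\<^sup>2" for n y by (simp add: cmod_power2)
  have c1: "1 \<le> (c n)\<^sup>2" for n using one_le_power[OF c(2), of n 2] by simp
  have "(\<lambda>n. \<integral>y. f (Complex (c n) y) \<partial>lborel) \<longlonglongrightarrow> (\<integral>y. 0 \<partial>(lborel :: real measure))"
  proof (rule integral_dominated_convergence[where w="\<lambda>y. A * inverse (1 + y\<^sup>2)"])
    show "integrable lborel (\<lambda>y. A * inverse (1 + y\<^sup>2))"
      by (intro integrable_mult_right integrable_inverse_1_plus_square_lborel)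
    show "AE y in lborel. norm (f (Complex (c n) y)) \<le> A * inverse (1 + y\<^sup>2)" for n
    proof (intro AE_I2 order_trans[OF bd])
      fix y :: real
      show "A / (norm (Complex (c n) y))\<^sup>2 \<le> A * inverse (1 + y\<^sup>2)"
        unfolding nrm divide_inverse using c1[of n] A
        by (intro mult_left_mono le_imp_inverse_le) (auto simp: add_pos_nonneg)
    qed
    show "AE y in lborel. (\<lambda>n. f (Complex (c n) y)) \<longlonglongrightarrow> 0"
    proof (rule AE_I2, rule Lim_null_comparison)
      fix y :: real
      show "\<forall>\<^sub>F n in sequentially. norm (f (Complex (c n) y)) \<le> A * inverse \<bar>c n\<bar>"
      proof (intro always_eventually allI order_trans[OF bd])
        fix n
        have "\<bar>c n\<bar> \<le> \<bar>c n\<bar>\<^sup>2" using c(2)[of n] by (rule self_le_power) simp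
        then show "A / (norm (Complex (c n) y))\<^sup>2 \<le> A * inverse \<bar>c n\<bar>"
          unfolding nrm divide_inverse using c(2)[of n] A
          by (intro mult_left_mono le_imp_inverse_le) (auto simp: intro: add_increasing2)
      qed
      have "(\<lambda>n. inverse \<bar>c n\<bar>) \<longlonglongrightarrow> 0"
        using c(1) by (rule tendsto_inverse_0_at_top)
      then show "(\<lambda>n. A * inverse \<bar>c n\<bar>) \<longlonglongrightarrow> 0" by (rule tendsto_mult_right_zero)
    qed
  qed (use m in auto)
  then show ?thesis by simp
qed

lemma norm_ge_Im_bound: "Im z \<noteq> 0 \<Longrightarrow> 0 \<le> A \<Longrightarrow> A / (norm z)\<^sup>2 \<le> A / (Im z)\<^sup>2"
  by (intro divide_left_mono mult_pos_pos) (auto simp: abs_le_square_iff[symmetric] abs_Im_le_cmod zero_less_power)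

text \<open>Without poles to the right the line can be moved without changing the integral, which
  therefore equals its limit. This is the source of causality for the inverse transforms.\<close>

lemma right_line_zero:
  assumes hol: "f holomorphic_on {z. lo < Re z}" and c: "lo < c" "1 \<le> c"
    and bd: "\<And>z. c \<le> Re z \<Longrightarrow> norm (f z) \<le> A / (norm z)\<^sup>2"
  shows "(\<integral>y. f (Complex c y) \<partial>lborel) = 0"
proof -
  have A: "0 \<le> A"
  proof -
    have "0 \<le> A / (norm (Complex c 0))\<^sup>2" by (rule order_trans[OF norm_ge_zero bd]) simp
    moreover have "0 < (norm (Complex c 0))\<^sup>2" using c by (auto simp: complex_eq_iff)
    ultimately show ?thesis by (simp add: zero_le_divide_iff)
  qed
  have eq: "(\<integral>y. f (Complex (c + real n) y) \<partial>lborel) = (\<integral>y. f (Complex c y) \<partial>lborel)" for n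
  proof (cases "n = 0")
    case False
    have "(\<integral>y. f (Complex (c + real n) y) \<partial>lborel) - (\<integral>y. f (Complex c y) \<partial>lborel) = 2 * pi * (\<Sum>p\<in>{}. residue f p)"
      by (rule contour_shift(3)[where lo=lo and Y=1 and A=A])
         (use False c hol order_trans[OF bd norm_ge_Im_bound[OF _ A]] in auto)
    then show ?thesis by simp
  qed simp
  have "(\<lambda>n. \<integral>y. f (Complex (c + real n) y) \<partial>lborel) \<longlonglongrightarrow> 0"
  proof (rule line_integral_vanishes[where A=A])
    have "filterlim (\<lambda>n. c + real n) at_top sequentially"
      by (intro filterlim_tendsto_add_at_top[OF tendsto_const] filterlim_real_sequentially)
    then show "filterlim (\<lambda>n. \<bar>c + real n\<bar>) at_top sequentially"
      using c by (simp add: abs_of_nonneg)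
    show "(\<lambda>y. f (Complex (c + real n) y)) \<in> borel_measurable borel" for n
      by (intro borel_measurable_continuous_onI continuous_on_line[OF holomorphic_on_imp_continuous_on[OF hol]])
         (use c in auto)
    show "norm (f (Complex (c + real n) y)) \<le> A / (norm (Complex (c + real n) y))\<^sup>2" for n y
      by (rule bd) simp
  qed (use c in auto)
  then show ?thesis unfolding eq by (simp add: LIMSEQ_const_iff)
qed

text \<open>For nonnegative t the exponential is bounded to the left, so the line is moved to minus
  infinity; only the double pole at 0 is met, with residue t. The ramp takes the place of the step
  function, whose transform 1/z is not absolutely integrable on vertical lines.\<close>

lemma inverse_laplace_ramp:
  assumes c: "1 \<le> c" and t: "0 \<le> t"
  shows "(\<integral>y. exp (Complex c y * of_real t) / (Complex c y)\<^sup>2 \<partial>lborel) = 2 * pi * of_real t"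
proof -
  let ?f = "\<lambda>z. exp (z * of_real t) / z\<^sup>2"
  have res: "residue ?f 0 = of_real t"
  proof -
    have "((\<lambda>z. exp (z * complex_of_real t)) has_field_derivative of_real t) (at 0)"
      by (auto intro!: derivative_eq_intros)
    then have "deriv (\<lambda>z. exp (z * complex_of_real t)) 0 = of_real t" by (rule DERIV_imp_deriv)
    moreover have "residue (\<lambda>z. exp (z * complex_of_real t) / z ^ Suc 1) 0 = (deriv ^^ 1) (\<lambda>z. exp (z * complex_of_real t)) 0 / fact 1"
      by (rule residue_holomorphic_over_power'[of UNIV]) (auto intro!: holomorphic_intros)
    ultimately show ?thesis by (simp add: power2_eq_square)
  qed
  have bd: "norm (?f z) \<le> exp (c * t) / (norm z)\<^sup>2" if "Re z \<le> c" for z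
    using that t by (auto simp: norm_divide norm_power norm_exp_eq_Re intro!: divide_right_mono mult_right_mono)
  have eq: "(\<integral>y. ?f (Complex c y) \<partial>lborel) - (\<integral>y. ?f (Complex (- 1 - real n) y) \<partial>lborel) = 2 * pi * of_real t" for n
  proof -
    have "(\<integral>y. ?f (Complex c y) \<partial>lborel) - (\<integral>y. ?f (Complex (- 1 - real n) y) \<partial>lborel) = 2 * pi * (\<Sum>p\<in>{0}. residue ?f p)"
      by (rule contour_shift(3)[where lo="-2 - real n" and Y=1 and A="exp (c * t)"])
         (use c order_trans[OF bd norm_ge_Im_bound] in \<open>auto intro!: holomorphic_intros\<close>)
    then show ?thesis by (simp add: res)
  qed
  have lim: "(\<lambda>n. \<integral>y. ?f (Complex (- 1 - real n) y) \<partial>lborel) \<longlonglongrightarrow> 0"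
  proof (rule line_integral_vanishes[where A="exp (c * t)"])
    have "filterlim (\<lambda>n. 1 + real n) at_top sequentially"
      by (intro filterlim_tendsto_add_at_top[OF tendsto_const] filterlim_real_sequentially)
    then show "filterlim (\<lambda>n. \<bar>- 1 - real n\<bar>) at_top sequentially"
      by (simp add: abs_if algebra_simps)
    show "(\<lambda>y. ?f (Complex (- 1 - real n) y)) \<in> borel_measurable borel" for n
      by (intro borel_measurable_continuous_onI continuous_on_line[of "{z. Re z < 0}" ?f] continuous_intros) auto
    show "norm (?f (Complex (- 1 - real n) y)) \<le> exp (c * t) / (norm (Complex (- 1 - real n) y))\<^sup>2" for n y
      by (rule bd) (use c in auto)
  qed auto
  have "(\<lambda>n. (\<integral>y. ?f (Complex c y) \<partial>lborel) - (\<integral>y. ?f (Complex (- 1 - real n) y) \<partial>lborel)) \<longlonglongrightarrow> (\<integral>y. ?f (Complex c y) \<partial>lborel) - 0"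
    by (intro tendsto_intros lim)
  then have "(\<integral>y. ?f (Complex c y) \<partial>lborel) = 2 * pi * of_real t"
    unfolding eq by (simp add: LIMSEQ_const_iff)
  then show ?thesis .
qed

section \<open>The fundamental solution as an inverse Laplace transform\<close>

lemma Fubini_interval_line:
  fixes g :: "real \<Rightarrow> real \<Rightarrow> 'b::{banach,second_countable_topology}"
  assumes g[measurable]: "(\<lambda>(s, y). g s y) \<in> borel_measurable (lborel \<Otimes>\<^sub>M lborel)" and B: "integrable lborel B"
    and gB: "\<And>s y. a \<le> s \<Longrightarrow> s \<le> b \<Longrightarrow> norm (g s y) \<le> B y"
  shows "(LINT s:{a..b}|lborel. \<integral>y. g s y \<partial>lborel) = (\<integral>y. (LINT s:{a..b}|lborel. g s y) \<partial>lborel)"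
proof -
  have [measurable]: "B \<in> borel_measurable borel" using B by auto
  have i0: "integrable lborel (indicat_real {a..b})"
    by (cases "a \<le> b") (auto intro!: integrable_real_indicator)
  have bi: "integrable (lborel \<Otimes>\<^sub>M lborel) (\<lambda>p. indicat_real {a..b} (fst p) * B (snd p))"
    by (rule lborel_pair.Fubini_integrable) (use B i0 in \<open>auto simp: abs_mult\<close>)
  have gi: "integrable (lborel \<Otimes>\<^sub>M lborel) (\<lambda>(s, y). indicat_real {a..b} s *\<^sub>R g s y)"
  proof (rule Bochner_Integration.integrable_bound[OF bi])
    show "AE p in lborel \<Otimes>\<^sub>M lborel. norm (case p of (s, y) \<Rightarrow> indicat_real {a..b} s *\<^sub>R g s y)
        \<le> norm (indicat_real {a..b} (fst p) * B (snd p))"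
    proof (intro AE_I2)
      fix p :: "real \<times> real"
      show "norm (case p of (s, y) \<Rightarrow> indicat_real {a..b} s *\<^sub>R g s y) \<le> norm (indicat_real {a..b} (fst p) * B (snd p))"
        using gB[of "fst p" "snd p"] by (auto simp: split_beta indicator_def abs_mult intro: order_trans[OF _ abs_ge_self])
    qed
  qed measurable
  show ?thesis
    unfolding set_lebesgue_integral_def using lborel_pair.Fubini_integral[OF gi] by simp
qed

section \<open>The characteristic function and the kernels of the inversion\<close>

context dde
begin

definition Mc :: "complex \<Rightarrow> complex" where "Mc z = L (\<lambda>\<theta>. exp (z * of_real \<theta>))"

text \<open>The characteristic function, with the functional written as a measure;
  \<open>splitting_exists\<close> identifies it with \<open>char_fun\<close>.\<close>

definition Del :: "complex \<Rightarrow> complex" where "Del z = z - Mc z"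

lemma norm_exp_segment:
  assumes "-r \<le> \<theta>" "\<theta> \<le> 0"
  shows "norm (exp (z * of_real \<theta>)) \<le> exp (r * max 0 (- Re z))"
proof -
  have "Re z * \<theta> \<le> r * max 0 (- Re z)"
  proof (cases "0 \<le> Re z")
    case True
    then show ?thesis using assms by (simp add: mult_nonneg_nonpos)
  next
    case False
    have "(- \<theta>) * (- Re z) \<le> r * (- Re z)" using assms False by (intro mult_right_mono) auto
    then show ?thesis using False by (simp add: mult.commute)
  qed
  then show ?thesis by (simp add: norm_exp_eq_Re)
qed

lemma bm_exp: "bm (\<lambda>\<theta>. exp (z * complex_of_real \<theta>))"
  by (intro bm_continuous continuous_intros)

lemma Mc_bound: "norm (Mc z) \<le> Lnorm * exp (r * max 0 (- Re z))"
  unfolding Mc_def by (rule L_bound[OF bm_exp norm_exp_segment])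

text \<open>A second-order Taylor estimate of the exponential, uniform on the delay interval: the
  difference quotient misses the candidate by O(|h|), and \<open>L_bound\<close> carries this
  through the functional.\<close>

lemma Mc_deriv: "(Mc has_field_derivative L (\<lambda>\<theta>. of_real \<theta> * exp (z * of_real \<theta>))) (at z)"
proof -
  let ?D = "L (\<lambda>\<theta>. complex_of_real \<theta> * exp (z * of_real \<theta>))"
  let ?C = "Lnorm * (exp (r * max 0 (- Re z)) * (exp r * r\<^sup>2))"
  have est: "norm ((Mc (z + h) - Mc z) / h - ?D) \<le> ?C * norm h" if h: "h \<noteq> 0" "norm h < 1" for h
  proof -
    have b1: "bm (\<lambda>\<theta>. complex_of_real \<theta> * exp (z * of_real \<theta>))"
      by (intro bm_continuous continuous_intros)
    have "Mc (z + h) - Mc z - h * ?D =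
        L (\<lambda>\<theta>. exp ((z + h) * of_real \<theta>) - exp (z * of_real \<theta>) - h * (of_real \<theta> * exp (z * of_real \<theta>)))"
      unfolding Mc_def
      by (subst L_diff, (intro bm_continuous continuous_intros)+, subst L_diff[OF bm_exp bm_exp], subst L_cmult) simp
    also have "norm \<dots> \<le> Lnorm * (exp (r * max 0 (- Re z)) * (exp r * (r\<^sup>2 * (norm h)\<^sup>2)))"
    proof (rule L_bound)
      show "bm (\<lambda>\<theta>. exp ((z + h) * of_real \<theta>) - exp (z * of_real \<theta>) - h * (of_real \<theta> * exp (z * of_real \<theta>)))"
        by (intro bm_continuous continuous_intros)
      fix \<theta> assume th: "-r \<le> \<theta>" "\<theta> \<le> 0"
      have t2: "norm (exp (h * of_real \<theta>) - 1 - h * of_real \<theta>) \<le> exp r * (r\<^sup>2 * (norm h)\<^sup>2)"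
      proof -
        have "norm (exp (h * of_real \<theta>) - (\<Sum>k\<le>1. (h * of_real \<theta>) ^ k / fact k))
            \<le> exp \<bar>Re (h * of_real \<theta>)\<bar> * norm (h * of_real \<theta>) ^ Suc 1 / fact 1" by (rule Taylor_exp)
        then have "norm (exp (h * of_real \<theta>) - 1 - h * of_real \<theta>) \<le> exp \<bar>Re (h * of_real \<theta>)\<bar> * (norm (h * of_real \<theta>))\<^sup>2"
          by (simp add: numeral_2_eq_2 algebra_simps)
        also have "\<dots> \<le> exp r * (r\<^sup>2 * (norm h)\<^sup>2)"
        proof (intro mult_mono)
          have "\<bar>Re (h * of_real \<theta>)\<bar> \<le> norm h * \<bar>\<theta>\<bar>"
            using abs_Re_le_cmod[of "h * of_real \<theta>"] by (simp add: norm_mult)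
          also have "\<dots> \<le> 1 * r" using h th by (intro mult_mono) auto
          finally show "exp \<bar>Re (h * of_real \<theta>)\<bar> \<le> exp r" by simp
          have "\<theta>\<^sup>2 \<le> r\<^sup>2" using th by (simp add: abs_le_square_iff[symmetric])
          then show "(norm (h * of_real \<theta>))\<^sup>2 \<le> r\<^sup>2 * (norm h)\<^sup>2"
            by (simp add: norm_mult power_mult_distrib mult.commute mult_right_mono)
        qed auto
        finally show ?thesis .
      qed
      have "exp ((z + h) * of_real \<theta>) - exp (z * of_real \<theta>) - h * (of_real \<theta> * exp (z * of_real \<theta>))
          = exp (z * of_real \<theta>) * (exp (h * of_real \<theta>) - 1 - h * of_real \<theta>)"
        by (simp add: distrib_right exp_add algebra_simps)
      then show "norm (exp ((z + h) * of_real \<theta>) - exp (z * of_real \<theta>) - h * (of_real \<theta> * exp (z * of_real \<theta>)))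
          \<le> exp (r * max 0 (- Re z)) * (exp r * (r\<^sup>2 * (norm h)\<^sup>2))"
        using norm_exp_segment[OF th, of z] t2 by (simp only: norm_mult) (intro mult_mono, auto)
    qed
    finally have *: "norm (Mc (z + h) - Mc z - h * ?D) \<le> ?C * (norm h * norm h)"
      by (simp add: power2_eq_square mult.assoc)
    have "(Mc (z + h) - Mc z) / h - ?D = (Mc (z + h) - Mc z - h * ?D) / h" using h by (simp add: field_simps)
    then have "norm ((Mc (z + h) - Mc z) / h - ?D) = norm (Mc (z + h) - Mc z - h * ?D) / norm h"
      by (simp add: norm_divide)
    also have "\<dots> \<le> (?C * (norm h * norm h)) / norm h" by (intro divide_right_mono *) auto
    finally show ?thesis using h by simp
  qed
  have "((\<lambda>h. (Mc (z + h) - Mc z) / h - ?D) \<longlongrightarrow> 0) (at 0)"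
  proof (rule Lim_null_comparison)
    show "\<forall>\<^sub>F h in at 0. norm ((Mc (z + h) - Mc z) / h - ?D) \<le> ?C * norm h"
      unfolding eventually_at by (rule exI[of _ 1]) (use est in auto)
    show "((\<lambda>h::complex. ?C * norm h) \<longlongrightarrow> 0) (at 0)"
      by (rule tendsto_eq_intros | simp)+
  qed
  then show ?thesis unfolding DERIV_def by (rule LIM_zero_cancel)
qed

lemma Del_deriv: "(Del has_field_derivative (1 - L (\<lambda>\<theta>. of_real \<theta> * exp (z * of_real \<theta>)))) (at z)"
  using DERIV_diff[OF DERIV_ident Mc_deriv[of z]] by (simp add: Del_def[abs_def])

lemma Mc_holomorphic: "Mc holomorphic_on S"
  unfolding holomorphic_on_def field_differentiable_def
  using Mc_deriv has_field_derivative_at_within by blast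

lemma Del_holomorphic: "Del holomorphic_on S"
  unfolding holomorphic_on_def field_differentiable_def
  using Del_deriv has_field_derivative_at_within by blast

lemma Del_lower: "norm (Mc z) \<le> K \<Longrightarrow> 2 * K \<le> norm z \<Longrightarrow> norm z / 2 \<le> norm (Del z)"
  using norm_triangle_ineq2[of z "Mc z"] unfolding Del_def by simp

text \<open>Right of \<open>lo\<close> the term \<open>Mc\<close> is at most half of z in modulus,
  so there are no characteristic roots. \<open>c0\<close> is the abscissa of all inversion
  integrals, one unit inside that half plane.\<close>

definition lo :: real where "lo = 2 * Lnorm"
definition c0 :: real where "c0 = lo + 1"

lemma lo_nonneg: "0 \<le> lo" using Lnorm_nonneg by (simp add: lo_def)

lemma right_half: assumes "lo < Re z"
  shows "z \<noteq> 0" "norm (Mc z) \<le> Lnorm" "norm z / 2 \<le> norm (Del z)" "Del z \<noteq> 0"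
proof -
  show z: "z \<noteq> 0" using assms lo_nonneg by auto
  have "max 0 (- Re z) = 0" using assms lo_nonneg by simp
  then show M: "norm (Mc z) \<le> Lnorm" using Mc_bound[of z] by simp
  show D: "norm z / 2 \<le> norm (Del z)"
    using assms complex_Re_le_cmod[of z] by (intro Del_lower[OF M]) (simp add: lo_def)
  show "Del z \<noteq> 0" using z D by auto
qed

text \<open>\<open>Q\<close> is 1/Del - 1/z, the transform of \<open>x\<close> minus the step
  function; subtracting 1/z makes it O(1/z^2) and its line integrals absolutely convergent.
  \<open>P\<close> is the transform of the time integral of \<open>x\<close>.\<close>

definition Q :: "complex \<Rightarrow> complex" where "Q z = Mc z / (z * Del z)"
definition P :: "complex \<Rightarrow> complex" where "P z = 1 / (z * Del z)"

text \<open>Collects what absolute convergence on the line Re z = \<open>c0\<close> and shifts of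
  that line to the right require.\<close>

definition kernel_ok :: "(complex \<Rightarrow> complex) \<Rightarrow> bool" where
  "kernel_ok F \<longleftrightarrow> F holomorphic_on {z. lo < Re z} \<and> (\<exists>A\<ge>0. \<forall>z. c0 \<le> Re z \<longrightarrow> norm (F z) \<le> A / (norm z)\<^sup>2)"

lemma kernel_okI:
  assumes "F holomorphic_on {z. lo < Re z}" "0 \<le> A" "\<And>z. c0 \<le> Re z \<Longrightarrow> norm (F z) \<le> A / (norm z)\<^sup>2"
  shows "kernel_ok F"
  using assms unfolding kernel_ok_def by blast

lemma P_upper: assumes "z \<noteq> 0" "norm z / 2 \<le> norm (Del z)" shows "norm (P z) \<le> 2 / (norm z)\<^sup>2"
proof -
  have "norm z * (norm z / 2) \<le> norm z * norm (Del z)" using assms by (intro mult_left_mono) auto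
  moreover have "0 < norm z * (norm z / 2)" using assms(1) by simp
  ultimately have "1 / (norm z * norm (Del z)) \<le> 1 / (norm z * (norm z / 2))"
    by (intro divide_left_mono) auto
  then show ?thesis by (simp add: P_def norm_divide norm_mult power2_eq_square)
qed

lemma Q_upper: assumes "z \<noteq> 0" "norm z / 2 \<le> norm (Del z)" "norm (Mc z) \<le> K"
  shows "norm (Q z) \<le> 2 * K / (norm z)\<^sup>2"
proof -
  have "norm (Q z) = norm (Mc z) * norm (P z)" by (simp add: Q_def P_def norm_divide norm_mult)
  also have "\<dots> \<le> K * (2 / (norm z)\<^sup>2)"
    using P_upper[OF assms(1,2)] assms(3) order_trans[OF norm_ge_zero assms(3)] by (intro mult_mono) auto
  finally show ?thesis by (simp add: mult.commute)
qed

lemma kernel_P: "kernel_ok P" and kernel_Q: "kernel_ok Q"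
  and kernel_Qz: "kernel_ok (\<lambda>z. Q z / z)" and kernel_sq: "kernel_ok (\<lambda>z. 1 / z\<^sup>2)"
proof -
  have re: "lo < Re z" "1 \<le> norm z" if "c0 \<le> Re z" for z
    using that lo_nonneg complex_Re_le_cmod[of z] by (auto simp: c0_def)
  show "kernel_ok P"
    by (rule kernel_okI[of _ 2])
       (use right_half re P_upper in \<open>auto simp: P_def[abs_def] intro!: holomorphic_intros Del_holomorphic\<close>)
  have hq: "Q holomorphic_on {z. lo < Re z}"
    unfolding Q_def[abs_def] using right_half by (auto intro!: holomorphic_intros Del_holomorphic Mc_holomorphic)
  have bq: "norm (Q z) \<le> 2 * Lnorm / (norm z)\<^sup>2" if "c0 \<le> Re z" for z
    using right_half[OF re(1)[OF that]] by (intro Q_upper) auto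
  show "kernel_ok Q" by (rule kernel_okI[OF hq _ bq]) (use Lnorm_nonneg in auto)
  show "kernel_ok (\<lambda>z. Q z / z)"
  proof (rule kernel_okI[of _ "2 * Lnorm"])
    show "(\<lambda>z. Q z / z) holomorphic_on {z. lo < Re z}"
      using right_half by (auto intro!: holomorphic_intros hq)
    fix z assume z: "c0 \<le> Re z"
    have "norm (Q z / z) \<le> norm (Q z) / 1"
      unfolding norm_divide using re(2)[OF z] by (intro divide_left_mono) auto
    then show "norm (Q z / z) \<le> 2 * Lnorm / (norm z)\<^sup>2" using bq[OF z] by simp
  qed (use Lnorm_nonneg in auto)
  show "kernel_ok (\<lambda>z. 1 / z\<^sup>2)"
    by (rule kernel_okI[of _ 1]) (use right_half in \<open>auto intro!: holomorphic_intros simp: norm_divide norm_power\<close>)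
qed

section \<open>Inversion integrals along the line Re z = c0\<close>

definition ilap :: "(complex \<Rightarrow> complex) \<Rightarrow> real \<Rightarrow> complex" where
  "ilap F t = (\<integral>y. exp (Complex c0 y * of_real t) * F (Complex c0 y) \<partial>lborel)"

lemma kernel_line:
  assumes "kernel_ok F"
  shows "integrable lborel (\<lambda>y. exp (Complex c0 y * of_real t) * F (Complex c0 y))"
    and "integrable lborel (\<lambda>y. F (Complex c0 y))"
    and "(\<lambda>y. F (Complex c0 y)) \<in> borel_measurable borel"
proof -
  obtain A where h: "F holomorphic_on {z. lo < Re z}" "0 \<le> A" "\<And>z. c0 \<le> Re z \<Longrightarrow> norm (F z) \<le> A / (norm z)\<^sup>2"
    using assms unfolding kernel_ok_def by blast
  have cF: "continuous_on UNIV (\<lambda>y. F (Complex c0 y))"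
    by (rule continuous_on_line[OF holomorphic_on_imp_continuous_on[OF h(1)]]) (simp add: c0_def)
  then show m: "(\<lambda>y. F (Complex c0 y)) \<in> borel_measurable borel" by (rule borel_measurable_continuous_onI)
  show i: "integrable lborel (\<lambda>y. F (Complex c0 y))"
  proof (rule line_integrable[OF cF])
    fix y :: real assume "1 \<le> \<bar>y\<bar>"
    then show "norm (F (Complex c0 y)) \<le> A / y\<^sup>2"
      using order_trans[OF h(3)[of "Complex c0 y"] norm_ge_Im_bound[OF _ h(2), of "Complex c0 y"]] by fastforce
  qed
  show "integrable lborel (\<lambda>y. exp (Complex c0 y * of_real t) * F (Complex c0 y))"
  proof (rule Bochner_Integration.integrable_bound)
    show "integrable lborel (\<lambda>y. exp (c0 * t) * norm (F (Complex c0 y)))" using i by auto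
    show "(\<lambda>y. exp (Complex c0 y * of_real t) * F (Complex c0 y)) \<in> borel_measurable lborel"
      using m by (auto simp: Complex_eq)
  qed (auto simp: norm_mult norm_exp_eq_Re)
qed

text \<open>For t \<le> 0 the exponential is at most 1 in the right half plane, so
  \<open>right_line_zero\<close> applies. The case t = 0 is what removes the lower limit in
  \<open>ilap_integral\<close>.\<close>

lemma ilap_neg:
  assumes "kernel_ok F" "t \<le> 0" shows "ilap F t = 0"
proof -
  obtain A where h: "F holomorphic_on {z. lo < Re z}" "0 \<le> A" "\<And>z. c0 \<le> Re z \<Longrightarrow> norm (F z) \<le> A / (norm z)\<^sup>2"
    using assms unfolding kernel_ok_def by blast
  show ?thesis unfolding ilap_def
  proof (rule right_line_zero[where lo=lo and A=A and f="\<lambda>z. exp (z * of_real t) * F z"])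
    fix z assume z: "c0 \<le> Re z"
    then have "Re z * t \<le> 0" using assms(2) lo_nonneg by (simp add: mult_nonneg_nonpos c0_def)
    then have "norm (exp (z * of_real t)) \<le> 1" by (simp add: norm_exp_eq_Re)
    then show "norm (exp (z * of_real t) * F z) \<le> A / (norm z)\<^sup>2"
      unfolding norm_mult using h(3)[OF z] mult_mono[of "norm (exp (z * of_real t))" 1 "norm (F z)" "A / (norm z)\<^sup>2"]
      by simp
  qed (use lo_nonneg h(1) in \<open>auto simp: c0_def intro!: holomorphic_intros\<close>)
qed

lemma ilap_measurable: assumes "kernel_ok F" shows "ilap F \<in> borel_measurable borel"
proof -
  have [measurable]: "(\<lambda>y. F (Complex c0 y)) \<in> borel_measurable borel" by (rule kernel_line[OF assms])
  show ?thesis unfolding ilap_def[abs_def] Complex_eq[of c0]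
    using kernel_line(3)[OF assms, unfolded Complex_eq]
    by (intro lborel.borel_measurable_lebesgue_integral) (simp add: case_prod_beta, measurable)
qed

lemma ilap_bound:
  assumes "kernel_ok F"
  shows "norm (ilap F t) \<le> exp (c0 * t) * (\<integral>y. norm (F (Complex c0 y)) \<partial>lborel)"
proof -
  have "norm (ilap F t) \<le> (\<integral>y. exp (c0 * t) * norm (F (Complex c0 y)) \<partial>lborel)"
    unfolding ilap_def
    by (rule Bochner_Integration.integral_norm_bound_integral)
       (use kernel_line[OF assms] in \<open>auto simp: norm_mult norm_exp_eq_Re\<close>)
  then show ?thesis by simp
qed

text \<open>The time integral of the exponential is (exp(zv) - 1)/z; the contribution of the 1 is an
  inversion integral at time 0 and vanishes.\<close>

lemma ilap_integral:
  assumes F: "kernel_ok F" and v: "0 \<le> v" and F2: "kernel_ok (\<lambda>z. F z / z)"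
  shows "(LINT s:{0..v}|lborel. ilap F s) = ilap (\<lambda>z. F z / z) v"
proof -
  note m = kernel_line(3)[OF F, measurable]
  have "(LINT s:{0..v}|lborel. ilap F s) =
      (\<integral>y. (LINT s:{0..v}|lborel. exp (Complex c0 y * of_real s) * F (Complex c0 y)) \<partial>lborel)"
    unfolding ilap_def
  proof (rule Fubini_interval_line)
    show "(\<lambda>(s, y). exp (Complex c0 y * of_real s) * F (Complex c0 y)) \<in> borel_measurable (lborel \<Otimes>\<^sub>M lborel)"
      unfolding Complex_eq[of c0] using m[unfolded Complex_eq] by (simp add: case_prod_beta)
    show "integrable lborel (\<lambda>y. exp (c0 * v) * norm (F (Complex c0 y)))"
      using kernel_line(2)[OF F] by auto
    fix s y :: real assume "0 \<le> s" "s \<le> v"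
    then have "exp (c0 * s) \<le> exp (c0 * v)" using lo_nonneg by (simp add: c0_def mult_left_mono)
    then show "norm (exp (Complex c0 y * of_real s) * F (Complex c0 y)) \<le> exp (c0 * v) * norm (F (Complex c0 y))"
      by (auto simp: norm_mult norm_exp_eq_Re intro!: mult_right_mono)
  qed
  also have "\<dots> = (\<integral>y. exp (Complex c0 y * of_real v) * (F (Complex c0 y) / Complex c0 y) - F (Complex c0 y) / Complex c0 y \<partial>lborel)"
  proof (intro Bochner_Integration.integral_cong refl)
    fix y
    have nz: "Complex c0 y \<noteq> 0" using lo_nonneg by (auto simp: c0_def complex_eq_iff)
    have "(\<integral>s. indicator {0..v} s *\<^sub>R (exp (Complex c0 y * of_real s) * F (Complex c0 y)) \<partial>lborel) =
        exp (Complex c0 y * of_real v) / Complex c0 y * F (Complex c0 y) - exp (Complex c0 y * of_real 0) / Complex c0 y * F (Complex c0 y)"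
    proof (rule integral_FTC_atLeastAtMost[OF v])
      fix s
      show "((\<lambda>s. exp (Complex c0 y * of_real s) / Complex c0 y * F (Complex c0 y)) has_vector_derivative
          exp (Complex c0 y * of_real s) * F (Complex c0 y)) (at s within {0..v})"
      proof (rule has_vector_derivative_real_field)
        show "((\<lambda>z. exp (Complex c0 y * z) / Complex c0 y * F (Complex c0 y)) has_field_derivative
            exp (Complex c0 y * of_real s) * F (Complex c0 y)) (at (of_real s))"
          using nz by (auto intro!: derivative_eq_intros)
      qed
    qed (intro continuous_intros)
    then show "(LINT s:{0..v}|lborel. exp (Complex c0 y * of_real s) * F (Complex c0 y)) =
        exp (Complex c0 y * of_real v) * (F (Complex c0 y) / Complex c0 y) - F (Complex c0 y) / Complex c0 y"
      unfolding set_lebesgue_integral_def by (rule trans) simp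
  qed
  also have "\<dots> = ilap (\<lambda>z. F z / z) v - ilap (\<lambda>z. F z / z) 0"
    using kernel_line[OF F2] by (simp add: ilap_def)
  finally show ?thesis by (simp add: ilap_neg[OF F2])
qed

text \<open>Inverse transform of 1/Del = 1/z + Q: the part 1/z is entered as the step function, and
  only \<open>Q\<close> is inverted by a line integral. \<open>ilap\<close> omits the factor 1/(2
  pi), hence the division.\<close>

definition xc :: "real \<Rightarrow> complex" where
  "xc t = (if 0 \<le> t then 1 else 0) + ilap Q t / (2 * pi)"

lemma xc_neg: "t < 0 \<Longrightarrow> xc t = 0" by (simp add: xc_def ilap_neg[OF kernel_Q])

lemma xc_measurable[measurable]: "xc \<in> borel_measurable borel"
  using ilap_measurable[OF kernel_Q] unfolding xc_def[abs_def] by measurable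

lemma xc_local_bound: "\<exists>B\<ge>0. \<forall>s\<le>t. norm (xc s) \<le> B"
proof -
  let ?I = "\<integral>y. norm (Q (Complex c0 y)) \<partial>lborel"
  have I: "0 \<le> ?I" by simp
  have "norm (xc s) \<le> 1 + exp (c0 * t) * ?I / (2 * pi)" if "s \<le> t" for s
  proof -
    have "exp (c0 * s) \<le> exp (c0 * t)" using that lo_nonneg by (simp add: c0_def mult_left_mono)
    then have "norm (ilap Q s) \<le> exp (c0 * t) * ?I"
      using ilap_bound[OF kernel_Q, of s] I by (meson mult_right_mono order_trans)
    then have "norm (ilap Q s / (2 * pi)) \<le> exp (c0 * t) * ?I / (2 * pi)"
      by (simp add: norm_divide norm_mult divide_right_mono)
    moreover have "norm (if 0 \<le> s then 1 else 0 :: complex) \<le> 1" by simp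
    ultimately show ?thesis unfolding xc_def by (rule norm_triangle_mono[rotated])
  qed
  moreover have "0 \<le> 1 + exp (c0 * t) * ?I / (2 * pi)" using I by simp
  ultimately show ?thesis by blast
qed

text \<open>In terms of transforms this is 1/z^2 + Q/z = P, with the ramp as inverse transform of
  1/z^2.\<close>

lemma xc_integral:
  "(LINT s:{0..v}|lborel. xc s) = ilap P v / (2 * pi)"
proof (cases "0 \<le> v")
  case True
  have 1: "set_integrable lborel {0..v} (\<lambda>s. 1 :: complex)"
    by (rule set_integrable_bounded_borel[where B=1]) auto
  have "exp (c0 * s) * (\<integral>y. norm (Q (Complex c0 y)) \<partial>lborel) \<le> exp (c0 * v) * (\<integral>y. norm (Q (Complex c0 y)) \<partial>lborel)"
    if "s \<le> v" for s
    using that lo_nonneg by (intro mult_right_mono) (auto simp: c0_def mult_left_mono)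
  then have 2: "set_integrable lborel {0..v} (ilap Q)"
    by (intro set_integrable_bounded_borel[OF ilap_measurable[OF kernel_Q]] order_trans[OF ilap_bound[OF kernel_Q]])
  have 3: "set_integrable lborel {0..v} (\<lambda>s. ilap Q s / (2 * pi))" using 2 by simp
  have "(LINT s:{0..v}|lborel. xc s) = (LINT s:{0..v}|lborel. 1 + ilap Q s / (2 * pi))"
    unfolding set_lebesgue_integral_def
    by (intro Bochner_Integration.integral_cong refl) (auto simp: xc_def indicator_def)
  also have "\<dots> = (LINT s:{0..v}|lborel. 1 :: complex) + (LINT s:{0..v}|lborel. ilap Q s) / (2 * pi)"
    by (subst set_integral_add(2)[OF 1 3]) simp
  also have "(LINT s:{0..v}|lborel. 1 :: complex) = of_real v"
    using True by (simp add: set_lebesgue_integral_def of_real_def)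
  also have "of_real v = ilap (\<lambda>z. 1 / z\<^sup>2) v / (2 * pi)"
    using inverse_laplace_ramp[of c0 v] True lo_nonneg by (simp add: ilap_def c0_def)
  also have "(LINT s:{0..v}|lborel. ilap Q s) = ilap (\<lambda>z. Q z / z) v"
    by (rule ilap_integral[OF kernel_Q True kernel_Qz])
  also have "ilap (\<lambda>z. 1 / z\<^sup>2) v / (2 * pi) + ilap (\<lambda>z. Q z / z) v / (2 * pi) = ilap P v / (2 * pi)"
  proof -
    have "ilap (\<lambda>z. 1 / z\<^sup>2) v + ilap (\<lambda>z. Q z / z) v = ilap P v"
      unfolding ilap_def
    proof (subst Bochner_Integration.integral_add[symmetric, OF kernel_line(1)[OF kernel_sq] kernel_line(1)[OF kernel_Qz]],
        intro Bochner_Integration.integral_cong refl)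
      fix y
      let ?z = "Complex c0 y"
      have z: "?z \<noteq> 0" "Del ?z \<noteq> 0" using right_half[of ?z] by (auto simp: c0_def)
      have "1 / ?z\<^sup>2 + Q ?z / ?z = (Del ?z + Mc ?z) / (?z\<^sup>2 * Del ?z)"
        using z by (simp add: Q_def field_simps power2_eq_square)
      also have "\<dots> = P ?z" using z by (simp add: Del_def P_def power2_eq_square)
      finally show "exp (?z * of_real v) * (1 / ?z\<^sup>2) + exp (?z * of_real v) * (Q ?z / ?z) = exp (?z * of_real v) * P ?z"
        by (simp only: distrib_left[symmetric])
    qed
    then show ?thesis by (simp flip: add_divide_distrib)
  qed
  finally show ?thesis .
next
  case False
  then show ?thesis by (simp add: set_lebesgue_integral_def ilap_neg[OF kernel_P])
qed

text \<open>The integrated segments are inversion integrals of \<open>P\<close>; applying the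
  functional to the exponentials produces \<open>Mc\<close>, and Mc P = Q gives back
  \<open>xc t - 1\<close>.\<close>

lemma xc_solves:
  assumes t: "0 \<le> t"
  shows "xc t = 1 + (LINT s:{0..t}|lborel. L (\<lambda>\<theta>. xc (s + \<theta>)))"
    and "set_integrable lborel {0..t} (\<lambda>s. L (\<lambda>\<theta>. xc (s + \<theta>)))"
proof -
  obtain B where B: "0 \<le> B" "\<And>s. s \<le> t \<Longrightarrow> norm (xc s) \<le> B" using xc_local_bound[of t] by blast
  have "integrable lborel (indicat_real {0..t})"
    using t by (intro integrable_real_indicator) auto
  then have ic: "integrable lborel (\<lambda>s. indicat_real {0..t} s * B)" by simp
  have b1: "(\<lambda>(s, \<theta>). indicat_real {0..t} s *\<^sub>R xc (s + \<theta>)) \<in> borel_measurable (lborel \<Otimes>\<^sub>M borel)"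
    by (simp add: case_prod_beta)
  have b2: "norm (indicat_real {0..t} s *\<^sub>R xc (s + \<theta>)) \<le> indicat_real {0..t} s * B" if "-r \<le> \<theta>" "\<theta> \<le> 0" for s \<theta>
    using B that by (auto simp: indicator_def)
  note sw = L_swap[OF b1 ic b2 lborel.sigma_finite_measure_axioms]
  have Lsc: "L (\<lambda>\<theta>. indicat_real {0..t} s *\<^sub>R xc (s + \<theta>)) = indicat_real {0..t} s *\<^sub>R L (\<lambda>\<theta>. xc (s + \<theta>))" for s
    by (simp add: scaleR_conv_of_real L_cmult)
  show "set_integrable lborel {0..t} (\<lambda>s. L (\<lambda>\<theta>. xc (s + \<theta>)))"
    using sw(1) unfolding Lsc by (simp add: set_integrable_def)
  have "(LINT s:{0..t}|lborel. L (\<lambda>\<theta>. xc (s + \<theta>))) = L (\<lambda>\<theta>. LINT s:{0..t}|lborel. xc (\<theta> + s))"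
    using sw(2) unfolding Lsc by (simp add: set_lebesgue_integral_def add.commute)
  also have "\<dots> = L (\<lambda>\<theta>. \<integral>y. exp (Complex c0 y * of_real (t + \<theta>)) * P (Complex c0 y) / (2 * pi) \<partial>lborel)"
  proof (rule L_cong)
    fix \<theta> assume th: "-r \<le> \<theta>" "\<theta> \<le> 0"
    have "(LINT s:{0..t}|lborel. xc (\<theta> + s)) = (LINT s:{\<theta>..\<theta>+t}|lborel. xc s)"
      by (simp add: set_integral_shift)
    also have "\<dots> = (LINT s:{0..\<theta>+t}|lborel. xc s)"
      unfolding set_lebesgue_integral_def using th
      by (intro Bochner_Integration.integral_cong) (auto simp: indicator_def xc_neg)
    also have "\<dots> = ilap P (\<theta> + t) / (2 * pi)" by (rule xc_integral)
    finally show "(LINT s:{0..t}|lborel. xc (\<theta> + s)) =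
        (\<integral>y. exp (Complex c0 y * of_real (t + \<theta>)) * P (Complex c0 y) / (2 * pi) \<partial>lborel)"
      by (simp add: ilap_def add.commute)
  qed
  also have "\<dots> = (\<integral>y. L (\<lambda>\<theta>. exp (Complex c0 y * of_real (t + \<theta>)) * P (Complex c0 y) / (2 * pi)) \<partial>lborel)"
  proof (rule L_swap(2)[OF _ _ _ lborel.sigma_finite_measure_axioms])
    show "(\<lambda>(y, \<theta>). exp (Complex c0 y * of_real (t + \<theta>)) * P (Complex c0 y) / (2 * pi)) \<in> borel_measurable (lborel \<Otimes>\<^sub>M borel)"
      using kernel_line(3)[OF kernel_P] unfolding Complex_eq by (simp add: case_prod_beta)
    show "integrable lborel (\<lambda>y. exp (c0 * t) * norm (P (Complex c0 y)))"
      using kernel_line(2)[OF kernel_P] by auto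
    fix y \<theta> assume th: "-r \<le> \<theta>" "\<theta> \<le> 0"
    have "exp (c0 * (t + \<theta>)) \<le> exp (c0 * t)" using th lo_nonneg by (simp add: c0_def)
    then have "exp (c0 * (t + \<theta>)) * norm (P (Complex c0 y)) / (2 * pi) \<le> exp (c0 * t) * norm (P (Complex c0 y)) / 1"
      using pi_ge_two by (intro frac_le mult_right_mono) auto
    then show "norm (exp (Complex c0 y * of_real (t + \<theta>)) * P (Complex c0 y) / (2 * pi)) \<le> exp (c0 * t) * norm (P (Complex c0 y))"
      by (simp add: norm_mult norm_divide norm_exp_eq_Re)
  qed
  also have "\<dots> = (\<integral>y. exp (Complex c0 y * of_real t) * Q (Complex c0 y) / (2 * pi) \<partial>lborel)"
  proof (intro Bochner_Integration.integral_cong refl)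
    fix y
    have "L (\<lambda>\<theta>. exp (Complex c0 y * of_real (t + \<theta>)) * P (Complex c0 y) / (2 * pi)) =
        L (\<lambda>\<theta>. (exp (Complex c0 y * of_real t) * P (Complex c0 y) / (2 * pi)) * exp (Complex c0 y * of_real \<theta>))"
      by (intro L_cong) (simp add: distrib_left exp_add)
    then show "L (\<lambda>\<theta>. exp (Complex c0 y * of_real (t + \<theta>)) * P (Complex c0 y) / (2 * pi)) =
        exp (Complex c0 y * of_real t) * Q (Complex c0 y) / (2 * pi)"
      by (simp only: L_cmult Mc_def[symmetric]) (simp add: P_def Q_def)
  qed
  also have "\<dots> = xc t - 1" using t by (simp add: xc_def ilap_def)
  finally show "xc t = 1 + (LINT s:{0..t}|lborel. L (\<lambda>\<theta>. xc (s + \<theta>)))" by simp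
qed

end

section \<open>Exponential decay transversal to the critical modes\<close>

locale hopf = dde +
  fixes \<omega> :: real
  assumes \<omega>: "0 < \<omega>"
    and roots: "\<And>z. 0 \<le> Re z \<Longrightarrow> Del z = 0 \<longleftrightarrow> z = \<i> * of_real \<omega> \<or> z = - \<i> * of_real \<omega>"
    and simple: "deriv Del (\<i> * of_real \<omega>) \<noteq> 0" "deriv Del (- \<i> * of_real \<omega>) \<noteq> 0"
begin

definition K1 :: real where "K1 = Lnorm * exp r"

lemma K1_nonneg: "0 \<le> K1" by (simp add: K1_def Lnorm_nonneg)

lemma Mc_bound1: assumes "- 1 \<le> Re z" shows "norm (Mc z) \<le> K1"
proof -
  have "r * max 0 (- Re z) \<le> r * 1" using assms r by (intro mult_left_mono) auto
  then show ?thesis using Mc_bound[of z] mult_left_mono[OF _ Lnorm_nonneg, of "exp (r * max 0 (- Re z))" "exp r"]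
    unfolding K1_def by fastforce
qed

text \<open>A root satisfies z = Mc z, so the roots with real part at least -1 lie in a disc, where
  a nonconstant entire function has finitely many zeros. The largest negative real part, or -1 if
  that is larger, is taken as -2\<kappa>, which leaves room to the left of the line Re z =
  -\<kappa>.\<close>

lemma spectral_gap:
  "\<exists>\<kappa>. 0 < \<kappa> \<and> \<kappa> < 1 \<and> (\<forall>z. - 2 * \<kappa> < Re z \<longrightarrow> Del z = 0 \<longrightarrow> z = \<i> * of_real \<omega> \<or> z = - \<i> * of_real \<omega>)"
proof -
  let ?Z = "{z \<in> cball 0 (2 * K1). Del z = 0}"
  have "\<not> Del constant_on UNIV"
  proof
    assume "Del constant_on UNIV"
    then obtain w where w: "\<And>z. Del z = w" unfolding constant_on_def by blast
    have "Del (\<i> * of_real \<omega>) = 0" using roots[of "\<i> * of_real \<omega>"] by simp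
    moreover have "Del 1 \<noteq> 0" using roots[of 1] by (auto simp: complex_eq_iff)
    ultimately show False using w by metis
  qed
  then have fin: "finite ?Z"
    by (intro holomorphic_compact_finite_zeros[OF Del_holomorphic, of UNIV]) auto
  have inZ: "z \<in> ?Z" if "- 1 \<le> Re z" "Del z = 0" for z
  proof -
    have "z = Mc z" using that(2) by (simp add: Del_def)
    then have "norm z \<le> K1" using Mc_bound1[OF that(1)] by simp
    then show ?thesis using that(2) K1_nonneg by simp
  qed
  define m where "m = Max (insert (- 1) (Re ` {z \<in> ?Z. Re z < 0}))"
  have fin': "finite (insert (- 1) (Re ` {z \<in> ?Z. Re z < 0}))"
    by (intro finite.insertI finite_imageI finite_subset[OF _ fin]) auto
  have m: "m < 0" unfolding m_def by (subst Max_less_iff[OF fin']) auto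
  have m1: "- 1 \<le> m" unfolding m_def by (rule Max_ge[OF fin']) simp
  show ?thesis
  proof (intro exI[of _ "- m / 2"] conjI allI impI)
    fix z assume z: "- 2 * (- m / 2) < Re z" "Del z = 0"
    show "z = \<i> * of_real \<omega> \<or> z = - \<i> * of_real \<omega>"
    proof (cases "0 \<le> Re z")
      case True then show ?thesis using roots z by blast
    next
      case False
      have "z \<in> ?Z" using z m m1 by (intro inZ) auto
      then have "Re z \<le> m" unfolding m_def using fin' False by (intro Max_ge) auto
      then show ?thesis using z by simp
    qed
  qed (use m m1 in auto)
qed

text \<open>Moving the line from \<open>c0\<close> to -\<kappa> crosses 0 and the two critical
  roots. The residue -1 at 0 cancels the step function, the critical residues give an oscillation
  with amplitudes 1/Del', and the shifted line contributes O(exp(-\<kappa> t)).\<close>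

lemma fundamental_decay:
  "\<exists>\<kappa> C A B. 0 < \<kappa> \<and> \<kappa> < 1 \<and> 0 \<le> C \<and>
     (\<forall>t\<ge>0. \<bar>Re (xc t) - (A * cos (\<omega> * t) + B * sin (\<omega> * t))\<bar> \<le> C * exp (- \<kappa> * t))"
proof -
  obtain \<kappa> where \<kappa>: "0 < \<kappa>" "\<kappa> < 1"
    and gap: "\<And>z. - 2 * \<kappa> < Re z \<Longrightarrow> Del z = 0 \<Longrightarrow> z = \<i> * of_real \<omega> \<or> z = - \<i> * of_real \<omega>"
    using spectral_gap by blast
  let ?p = "\<i> * complex_of_real \<omega>" and ?q = "- \<i> * complex_of_real \<omega>"
  define d1 where "d1 = 1 / deriv Del ?p"
  define d2 where "d2 = 1 / deriv Del ?q"
  let ?S = "{z. - 2 * \<kappa> < Re z}"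
  have opS: "open ?S" by (simp add: open_halfspace_Re_gt)
  let ?f = "\<lambda>t z. exp (z * complex_of_real t) * Q z"
  have fin: "finite {0, ?p, ?q}" by simp
  have hol: "?f t holomorphic_on (?S - {0, ?p, ?q})" for t
    unfolding Q_def[abs_def]
  proof (intro holomorphic_intros Mc_holomorphic Del_holomorphic)
    fix z assume "z \<in> ?S - {0, ?p, ?q}"
    then show "z * Del z \<noteq> 0" using gap[of z] by auto
  qed
  have c0p: "0 < c0" using lo_nonneg by (simp add: c0_def)
  \<comment> \<open>From height 2 K1 + 1 on, |z| \<ge> 2 K1 makes \<open>Del_lower\<close>
    applicable; the extra 1 keeps z away from 0.\<close>
  have bd: "norm (?f t z) \<le> (exp (c0 * t) * (2 * K1)) / (Im z)\<^sup>2"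
    if "0 \<le> t" "- \<kappa> \<le> Re z" "Re z \<le> c0" "2 * K1 + 1 \<le> \<bar>Im z\<bar>" for t z
  proof -
    have M: "norm (Mc z) \<le> K1" using that \<kappa> by (intro Mc_bound1) auto
    have nz: "2 * K1 + 1 \<le> norm z" using that abs_Im_le_cmod[of z] by simp
    have z0: "z \<noteq> 0" using nz K1_nonneg by auto
    have "norm z / 2 \<le> norm (Del z)" using nz by (intro Del_lower[OF M]) simp
    then have "norm (Q z) \<le> 2 * K1 / (norm z)\<^sup>2" using z0 M by (intro Q_upper)
    also have "\<dots> \<le> 2 * K1 / (Im z)\<^sup>2" using that K1_nonneg by (intro norm_ge_Im_bound) auto
    finally have "norm (Q z) \<le> 2 * K1 / (Im z)\<^sup>2" .
    moreover have "norm (exp (z * of_real t)) \<le> exp (c0 * t)"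
      using that by (simp add: norm_exp_eq_Re mult_right_mono)
    ultimately have "norm (exp (z * of_real t)) * norm (Q z) \<le> exp (c0 * t) * (2 * K1 / (Im z)\<^sup>2)"
      by (intro mult_mono) auto
    then show ?thesis by (simp add: norm_mult)
  qed

  have pts: "- \<kappa> < Re p \<and> Re p < c0" if "p \<in> {0, ?p, ?q}" for p using that \<kappa> c0p by auto
  have Qi: "integrable lborel (\<lambda>y. Q (Complex (- \<kappa>) y))"
    using contour_shift(1)[OF _ _ fin pts hol[of 0] bd[of 0]] \<kappa> c0p by auto
  \<comment> \<open>The residue is Mc 0 / Del 0, and Del 0 = - Mc 0.\<close>
  have res0: "residue (?f t) 0 = - 1" for t
  proof -
    let ?T = "?S - {?p, ?q}"
    have oT: "open ?T" using opS by (intro open_Diff) auto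
    have h: "(\<lambda>z. exp (z * complex_of_real t) * Mc z / Del z) holomorphic_on ?T"
    proof (intro holomorphic_intros Mc_holomorphic Del_holomorphic)
      fix z assume "z \<in> ?T"
      then show "Del z \<noteq> 0" using gap[of z] by auto
    qed
    have "residue (\<lambda>z. (exp (z * complex_of_real t) * Mc z / Del z) / (z - 0)) 0 = exp (0 * complex_of_real t) * Mc 0 / Del 0"
      by (rule residue_simple[OF oT _ h]) (use \<kappa> \<omega> in auto)
    moreover have "(\<lambda>z. (exp (z * complex_of_real t) * Mc z / Del z) / (z - 0)) = ?f t"
      by (rule ext) (simp add: Q_def mult.commute)
    moreover have "Del 0 \<noteq> 0" using roots[of 0] \<omega> by auto
    ultimately show ?thesis by (simp add: Del_def)
  qed
  \<comment> \<open>At a root Mc z0 = z0, so the factor Mc z / z equals 1 there and the residue of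
    exp(z t)/Del remains.\<close>
  have res1: "residue (?f t) z0 = exp (z0 * of_real t) / deriv Del z0"
    if "Del z0 = 0" "z0 \<noteq> 0" "deriv Del z0 \<noteq> 0" for t z0
  proof -
    have fd: "(Del has_field_derivative deriv Del z0) (at z0)"
      using Del_deriv[of z0] DERIV_imp_deriv by metis
    have cn: "connected (- {0 :: complex})" by (rule connected_punctured_universe) simp
    have Mz: "Mc z0 = z0" using that(1) by (simp add: Del_def)
    have "residue (\<lambda>w. (exp (w * of_real t) * Mc w / w) / Del w) z0 = (exp (z0 * of_real t) * Mc z0 / z0) / deriv Del z0"
      by (rule residue_simple_pole_deriv[OF _ Del_holomorphic _ cn _ fd])
         (use that Mz in \<open>auto intro!: holomorphic_intros Mc_holomorphic\<close>)
    moreover have "(\<lambda>w. (exp (w * of_real t) * Mc w / w) / Del w) = ?f t"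
      by (rule ext) (simp add: Q_def)
    ultimately show ?thesis using that Mz by simp
  qed
  have Dp: "Del ?p = 0" "Del ?q = 0" using roots[of ?p] roots[of ?q] by auto
  have ne: "?p \<noteq> 0" "?q \<noteq> 0" "?p \<noteq> ?q" using \<omega> by (auto simp: complex_eq_iff)
  have formula: "xc t = exp (?p * of_real t) * d1 + exp (?q * of_real t) * d2
      + (\<integral>y. ?f t (Complex (- \<kappa>) y) \<partial>lborel) / (2 * pi)" if t: "0 \<le> t" for t
  proof -
    have "ilap Q t - (\<integral>y. ?f t (Complex (- \<kappa>) y) \<partial>lborel) = 2 * pi * (\<Sum>p\<in>{0, ?p, ?q}. residue (?f t) p)"
      unfolding ilap_def
      using contour_shift(3)[OF _ _ fin pts hol[of t] bd[of t]] \<kappa> c0p t by simp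
    also have "(\<Sum>p\<in>{0, ?p, ?q}. residue (?f t) p) = - 1 + (exp (?p * of_real t) * d1 + exp (?q * of_real t) * d2)"
    proof -
      have "(\<Sum>p\<in>{0, ?p, ?q}. residue (?f t) p) = residue (?f t) 0 + (residue (?f t) ?p + residue (?f t) ?q)"
        using ne by (subst sum.insert, simp, force, subst sum.insert) auto
      then show ?thesis
        unfolding res0 res1[OF Dp(1) ne(1) simple(1)] res1[OF Dp(2) ne(2) simple(2)] by (simp add: d1_def d2_def)
    qed
    finally have "ilap Q t = (\<integral>y. ?f t (Complex (- \<kappa>) y) \<partial>lborel)
        + 2 * pi * (- 1 + (exp (?p * of_real t) * d1 + exp (?q * of_real t) * d2))"
      by (simp add: algebra_simps)
    then show ?thesis using t by (simp add: xc_def add_divide_distrib)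
  qed
  define C where "C = (\<integral>y. norm (Q (Complex (- \<kappa>) y)) \<partial>lborel)"
  have C0: "0 \<le> C" by (simp add: C_def)
  have rem: "norm ((\<integral>y. ?f t (Complex (- \<kappa>) y) \<partial>lborel) / (2 * pi)) \<le> C * exp (- \<kappa> * t)" for t
  proof -
    have "norm (\<integral>y. ?f t (Complex (- \<kappa>) y) \<partial>lborel) \<le> (\<integral>y. norm (?f t (Complex (- \<kappa>) y)) \<partial>lborel)"
      by (rule integral_norm_bound)
    also have "\<dots> = exp (- \<kappa> * t) * C" by (simp add: norm_mult norm_exp_eq_Re C_def)
    finally have "norm (\<integral>y. ?f t (Complex (- \<kappa>) y) \<partial>lborel) / (2 * pi) \<le> exp (- \<kappa> * t) * C / 1"
      using pi_ge_two C0 by (intro frac_le) auto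
    then show ?thesis by (simp add: norm_divide norm_mult mult.commute)
  qed
  \<comment> \<open>The real part is taken here instead of proving that \<open>d1\<close> and
    \<open>d2\<close> are conjugate.\<close>
  have osc: "Re (exp (?p * of_real t) * d1 + exp (?q * of_real t) * d2) =
      (Re d1 + Re d2) * cos (\<omega> * t) + (Im d2 - Im d1) * sin (\<omega> * t)" for t
    by (simp add: Re_exp Im_exp algebra_simps)
  have main: "\<bar>Re (xc t) - ((Re d1 + Re d2) * cos (\<omega> * t) + (Im d2 - Im d1) * sin (\<omega> * t))\<bar> \<le> C * exp (- \<kappa> * t)"
    if t: "0 \<le> t" for t
  proof -
    have "Re (xc t) - ((Re d1 + Re d2) * cos (\<omega> * t) + (Im d2 - Im d1) * sin (\<omega> * t)) =
        Re ((\<integral>y. ?f t (Complex (- \<kappa>) y) \<partial>lborel) / (2 * pi))"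
      unfolding formula[OF t] plus_complex.sel(1)[of "_ + _" "_ / _"] osc by simp
    also have "\<bar>\<dots>\<bar> \<le> C * exp (- \<kappa> * t)" using abs_Re_le_cmod rem order_trans by blast
    finally show ?thesis .
  qed
  show ?thesis using \<kappa> C0 main by blast
qed

text \<open>The measures are real, so the real part of \<open>xc\<close> solves the same
  equation.\<close>

lemma fundamental_solution_exists:
  "\<exists>x \<kappa> C A B. 0 < \<kappa> \<and> 0 \<le> C \<and> x \<in> borel_measurable borel \<and> (\<forall>t<0. x t = 0) \<and>
     (\<forall>t\<ge>0. x t = 1 + (LINT s:{0..t}|lborel. L (\<lambda>\<theta>. x (s + \<theta>)))) \<and>
     (\<forall>t\<ge>0. \<bar>x t - (A * cos (\<omega> * t) + B * sin (\<omega> * t))\<bar> \<le> C * exp (- \<kappa> * t))"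
proof -
  obtain \<kappa> C A B where *: "0 < \<kappa>" "0 \<le> C"
    "\<And>t. 0 \<le> t \<Longrightarrow> \<bar>Re (xc t) - (A * cos (\<omega> * t) + B * sin (\<omega> * t))\<bar> \<le> C * exp (- \<kappa> * t)"
    using fundamental_decay by blast
  have eq: "Re (xc t) = 1 + (LINT s:{0..t}|lborel. L (\<lambda>\<theta>. Re (xc (s + \<theta>))))" if t: "0 \<le> t" for t
  proof -
    have bmx: "bm (\<lambda>\<theta>. xc (s + \<theta>))" for s
    proof -
      obtain B where "\<forall>u\<le>s. norm (xc u) \<le> B" using xc_local_bound by blast
      then show ?thesis by (intro bmI[of _ B]) auto
    qed
    have "Re (xc t) = 1 + Re (LINT s:{0..t}|lborel. L (\<lambda>\<theta>. xc (s + \<theta>)))"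
      using xc_solves(1)[OF t] by (metis one_complex.sel(1) plus_complex.sel(1))
    also have "Re (LINT s:{0..t}|lborel. L (\<lambda>\<theta>. xc (s + \<theta>))) = (LINT s:{0..t}|lborel. Re (L (\<lambda>\<theta>. xc (s + \<theta>))))"
      unfolding set_lebesgue_integral_def using xc_solves(2)[OF t]
      by (subst integral_Re[symmetric]) (auto simp: set_integrable_def)
    finally show ?thesis by (simp add: L_Re[OF bmx])
  qed
  show ?thesis
    by (intro exI[of _ "\<lambda>t. Re (xc t)"] exI[of _ \<kappa>] exI[of _ C] exI[of _ A] exI[of _ B])
       (use * eq xc_neg in auto)
qed

end

section \<open>Rotations and the matrix exponential\<close>

text \<open>The exponential of (a/\<omega>) B, a rotation by the angle -a. On the coordinates of
  \<open>Phi\<close> it acts as translation in time, see \<open>Phi_rot\<close>.\<close>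

definition rot :: "real \<Rightarrow> real^2 \<Rightarrow> real^2" where
  "rot a v = vector [cos a * v $ 1 + sin a * v $ 2, - sin a * v $ 1 + cos a * v $ 2]"

text \<open>The action of \<open>B_mat \<omega>\<close>, which is the time derivative in the
  coordinates of \<open>Phi\<close>.\<close>

definition Bmul :: "real \<Rightarrow> real^2 \<Rightarrow> real^2" where
  "Bmul \<omega> v = vector [\<omega> * v $ 2, - \<omega> * v $ 1]"

lemma rot_component[simp]:
  "rot a v $ 1 = cos a * v $ 1 + sin a * v $ 2" "rot a v $ 2 = - sin a * v $ 1 + cos a * v $ 2"
  by (simp_all add: rot_def)

lemma Bmul_component[simp]: "Bmul \<omega> v $ 1 = \<omega> * v $ 2" "Bmul \<omega> v $ 2 = - \<omega> * v $ 1"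
  by (simp_all add: Bmul_def)

text \<open>By induction, the entries of the n-th term of the exponential series are the n-th Taylor
  terms of cosine and sine.\<close>

lemma mat_exp_B: "mat_exp (s *\<^sub>R B_mat \<omega>) *v v = rot (\<omega> * s) v"
proof -
  define A where "A = s *\<^sub>R B_mat \<omega>"
  let ?a = "\<omega> * s"
  define T where "T n = (1 / fact n) *\<^sub>R (((**) A ^^ n) (mat 1))" for n :: nat
  define R :: "real^2^2" where "R = vector [vector [cos ?a, sin ?a], vector [- sin ?a, cos ?a]]"
  have Ac: "A $ 1 $ 1 = 0" "A $ 1 $ 2 = ?a" "A $ 2 $ 1 = - ?a" "A $ 2 $ 2 = 0"
    by (simp_all add: A_def B_mat_def)
  have TS: "T (Suc n) = (1 / real (Suc n)) *\<^sub>R (A ** T n)" for n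
    by (simp add: T_def vec_eq_iff matrix_matrix_mult_def sum_2 field_simps)
  have T: "T n $ 1 $ 1 = cos_coeff n * ?a ^ n \<and> T n $ 1 $ 2 = sin_coeff n * ?a ^ n \<and>
     T n $ 2 $ 1 = - (sin_coeff n * ?a ^ n) \<and> T n $ 2 $ 2 = cos_coeff n * ?a ^ n" for n
  proof (induction n)
    case 0
    then show ?case by (simp add: T_def mat_def)
  next
    case (Suc n)
    then show ?case
      unfolding TS by (simp add: matrix_matrix_mult_def UNIV_2 sum_2 Ac cos_coeff_Suc sin_coeff_Suc field_simps)
  qed
  have "T sums R" unfolding sums_def
  proof (intro vec_tendstoI)
    have c: "(\<lambda>n. \<Sum>i<n. cos_coeff i * ?a ^ i) \<longlonglongrightarrow> cos ?a"
      using cos_converges[of ?a] by (simp add: sums_def)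
    have s: "(\<lambda>n. \<Sum>i<n. sin_coeff i * ?a ^ i) \<longlonglongrightarrow> sin ?a"
      using sin_converges[of ?a] by (simp add: sums_def)
    fix i j :: 2
    show "(\<lambda>n. (\<Sum>m<n. T m) $ i $ j) \<longlonglongrightarrow> R $ i $ j"
      using exhaust_2[of i] exhaust_2[of j] T c s tendsto_minus[OF s]
      by (auto simp: R_def sum_negf)
  qed
  then have "mat_exp A = R" unfolding mat_exp_def T_def by (rule sums_unique[symmetric])
  then show ?thesis
    by (simp add: A_def[symmetric] vec_eq_iff forall_2 R_def matrix_vector_mult_def sum_2)
qed

lemma Phi_rot: "Phi \<omega> (rot (\<omega> * s) v) \<theta> = Phi \<omega> v (s + \<theta>)"
  by (simp add: Phi_def distrib_left cos_add sin_add algebra_simps)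

lemma rot_add: "rot a (rot b v) = rot (a + b) v"
  by (simp add: vec_eq_iff forall_2 cos_add sin_add algebra_simps)

lemma rot_0[simp]: "rot 0 v = v" by (simp add: vec_eq_iff forall_2)

lemma rot_linear: "rot a (v + w) = rot a v + rot a w" "rot a (c *\<^sub>R v) = c *\<^sub>R rot a v"
  "rot a (v - w) = rot a v - rot a w"
  by (simp_all add: vec_eq_iff forall_2 algebra_simps)

lemma norm_rot[simp]: "norm (rot a v) = norm v"
proof -
  have n2: "(norm w)\<^sup>2 = (w $ 1)\<^sup>2 + (w $ 2)\<^sup>2" for w :: "real^2"
    unfolding power2_norm_eq_inner by (simp add: inner_vec_def sum_2 power2_eq_square)
  have "(norm (rot a v))\<^sup>2 = ((sin a)\<^sup>2 + (cos a)\<^sup>2) * ((v $ 1)\<^sup>2 + (v $ 2)\<^sup>2)"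
    unfolding n2 rot_component by algebra
  then have "(norm (rot a v))\<^sup>2 = (norm v)\<^sup>2" unfolding n2 by simp
  then show ?thesis by simp
qed

lemma continuous_on_rot:
  fixes S :: "real set"
  assumes "continuous_on S f" "continuous_on S g"
  shows "continuous_on S (\<lambda>s. rot (f s) (g s))"
proof -
  have eq: "rot a v = (cos a * v $ 1 + sin a * v $ 2) *\<^sub>R axis 1 1 + (- sin a * v $ 1 + cos a * v $ 2) *\<^sub>R axis 2 1" for a v
    by (simp add: vec_eq_iff forall_2 axis_def)
  show ?thesis unfolding eq by (intro continuous_intros continuous_on_cos continuous_on_sin assms)
qed

lemma Phi_linear: "Phi \<omega> (v + w) \<theta> = Phi \<omega> v \<theta> + Phi \<omega> w \<theta>" "Phi \<omega> (v - w) \<theta> = Phi \<omega> v \<theta> - Phi \<omega> w \<theta>"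
  "Phi \<omega> (c *\<^sub>R v) \<theta> = c * Phi \<omega> v \<theta>"
  by (simp_all add: Phi_def algebra_simps)

lemma abs_Phi_le: "\<bar>Phi \<omega> v \<theta>\<bar> \<le> 2 * norm v"
proof -
  have "\<bar>v $ 1 * cos (\<omega> * \<theta>)\<bar> \<le> norm v * 1" "\<bar>v $ 2 * sin (\<omega> * \<theta>)\<bar> \<le> norm v * 1"
    unfolding abs_mult by (intro mult_mono component_le_norm_cart; simp)+
  then show ?thesis unfolding Phi_def by linarith
qed

lemma bounded_linear_Phi: "bounded_linear (\<lambda>v. Phi \<omega> v \<theta>)"
  by (rule bounded_linear_intro[of _ 2]) (use abs_Phi_le[of \<omega> _ \<theta>] in \<open>auto simp: Phi_linear mult.commute\<close>)

lemma Phi_deriv: "(Phi \<omega> v has_real_derivative Phi \<omega> (Bmul \<omega> v) t) (at t within S)"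
  unfolding Phi_def[abs_def] by (auto intro!: derivative_eq_intros simp: algebra_simps)

lemma continuous_on_Phi: "continuous_on S (Phi \<omega> v)"
  unfolding Phi_def by (intro continuous_intros)

lemma Phi_measurable[measurable]: "Phi \<omega> v \<in> borel_measurable borel"
  by (intro borel_measurable_continuous_onI continuous_on_Phi)

text \<open>A periodic function is constant along arithmetic progressions of its period, so a limit
  0 makes it vanish; the phases 0 and pi/2 isolate the two coordinates. This is the uniqueness half
  of the splitting.\<close>

lemma Phi_tendsto_zero:
  assumes "0 < \<omega>" "((\<lambda>t. Phi \<omega> v t) \<longlongrightarrow> 0) at_top" shows "v = 0"
proof -
  have top: "filterlim (\<lambda>n. (2 * pi * real n + c) / \<omega>) at_top sequentially" for c
  proof -
    have "filterlim (\<lambda>n. c / \<omega> + (2 * pi / \<omega>) * real n) at_top sequentially"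
      using assms(1) by (intro filterlim_tendsto_add_at_top[OF tendsto_const]
        filterlim_tendsto_pos_mult_at_top[OF tendsto_const] filterlim_real_sequentially) auto
    then show ?thesis by (simp add: add_divide_distrib add.commute)
  qed
  have per: "cos (2 * pi * real n + c) = cos c \<and> sin (2 * pi * real n + c) = sin c" for n c
  proof -
    have eq: "2 * pi * real n = 2 * real n * pi" by simp
    show ?thesis unfolding eq cos_add sin_add by simp
  qed
  have "Phi \<omega> v ((2 * pi * real n + c) / \<omega>) = v $ 1 * cos c + v $ 2 * sin c" for n c
    using assms(1) per[of n c] by (simp add: Phi_def)
  then have "v $ 1 * cos c + v $ 2 * sin c = 0" for c
    using filterlim_compose[OF assms(2) top[of c]] by (simp add: LIMSEQ_const_iff)
  from this[of 0] this[of "pi / 2"] show ?thesis by (simp add: vec_eq_iff forall_2)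
qed

lemma Phi_inj: assumes "0 < \<omega>" "Phi \<omega> v = Phi \<omega> w" shows "v = w"
proof -
  have "v - w = 0" by (rule Phi_tendsto_zero[OF assms(1)]) (simp add: Phi_linear assms(2))
  then show ?thesis by simp
qed

lemma P_coords_Phi: "0 < \<omega> \<Longrightarrow> P_coords \<omega> (Phi \<omega> v) = v"
  unfolding P_coords_def by (rule the_equality) (auto dest: Phi_inj)

section \<open>The spectral splitting\<close>

lemma continuous_on_set_integral:
  fixes f :: "real \<Rightarrow> 'b::euclidean_space"
  assumes "set_integrable lborel {0..T} f"
  shows "continuous_on {0..T} (\<lambda>t. LINT s:{0..t}|lborel. f s)"
proof -
  have "continuous_on {0..T} (\<lambda>t. integral {0..t} f)"
    by (intro indefinite_integral_continuous_1 set_borel_integral_eq_integral assms)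
  then show ?thesis
  proof (rule continuous_on_eq)
    fix t assume "t \<in> {0..T}"
    then have "set_integrable lborel {0..t} f" using assms by (auto intro: set_integrable_subset)
    then show "integral {0..t} f = (LINT s:{0..t}|lborel. f s)"
      by (simp add: set_borel_integral_eq_integral)
  qed
qed

lemma set_integral_measurable:
  fixes f :: "real \<Rightarrow> real"
  assumes [measurable]: "f \<in> borel_measurable borel"
  shows "(\<lambda>t. LINT s:{0..t}|lborel. f s) \<in> borel_measurable borel"
proof -
  have "(\<lambda>t. \<integral>s. (if 0 \<le> s \<and> s \<le> t then f s else 0) \<partial>lborel) \<in> borel_measurable borel"
    by (intro lborel.borel_measurable_lebesgue_integral) (simp add: case_prod_beta, measurable)
  also have "(\<lambda>t. \<integral>s. (if 0 \<le> s \<and> s \<le> t then f s else 0) \<partial>lborel) = (\<lambda>t. LINT s:{0..t}|lborel. f s)"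
    unfolding set_lebesgue_integral_def
    by (intro ext Bochner_Integration.integral_cong) (auto simp: indicator_def)
  finally show ?thesis .
qed

text \<open>\<open>Lcos\<close> and \<open>Lsin\<close> are the real and the imaginary part of the
  statement that i\<omega> is a root. \<Psi> is introduced through the asymptotics of
  \<open>x\<close>; that it is the vector of the splitting is shown in
  \<open>Psi_tilde_eq\<close>.\<close>

locale splitting = fundamental +
  fixes \<omega> \<kappa> C :: real and \<Psi> :: "real^2" and L0 :: "(real \<Rightarrow> real) \<Rightarrow> real"
  assumes \<omega>: "0 < \<omega>" and \<kappa>: "0 < \<kappa>" and C: "0 \<le> C"
    and Lcos: "L (\<lambda>\<theta>. cos (\<omega> * \<theta>)) = 0" and Lsin: "L (\<lambda>\<theta>. sin (\<omega> * \<theta>)) = \<omega>"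
    and decay: "\<And>t. 0 \<le> t \<Longrightarrow> \<bar>x t - Phi \<omega> \<Psi> t\<bar> \<le> C * exp (- \<kappa> * t)"
    and Lext: "\<And>f. L_ext r L0 f = L f"
begin

lemma bm_iff: "f \<in> delay_Chat r \<longleftrightarrow> bm f" by (simp add: delay_Chat_def bm_def)

lemma L_Phi: "L (\<lambda>\<theta>. Phi \<omega> v (s + \<theta>)) = Phi \<omega> (Bmul \<omega> v) s"
proof -
  have "L (\<lambda>\<theta>. Phi \<omega> v (s + \<theta>)) = L (\<lambda>\<theta>. rot (\<omega> * s) v $ 1 * cos (\<omega> * \<theta>) + rot (\<omega> * s) v $ 2 * sin (\<omega> * \<theta>))"
    unfolding Phi_rot[symmetric] by (simp add: Phi_def del: rot_component)
  also have "\<dots> = rot (\<omega> * s) v $ 1 * L (\<lambda>\<theta>. cos (\<omega> * \<theta>)) + rot (\<omega> * s) v $ 2 * L (\<lambda>\<theta>. sin (\<omega> * \<theta>))"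
    by (subst L_add) (auto intro!: bm_continuous continuous_intros simp: L_cmult simp del: rot_component)
  also have "\<dots> = rot (\<omega> * s) v $ 2 * \<omega>"
    by (simp only: Lcos Lsin mult_zero_right add_0_left)
  also have "\<dots> = Phi \<omega> (Bmul \<omega> v) s" by (simp add: Phi_def algebra_simps)
  finally show ?thesis .
qed

definition e :: "real \<Rightarrow> real" where "e t = x t - Phi \<omega> \<Psi> t"
definition ek :: "real \<Rightarrow> real" where "ek t = k t - Phi \<omega> (Bmul \<omega> \<Psi>) t"

text \<open>The estimate covers all real times because delayed arguments reach below 0; there
  \<open>x\<close> is 0, the oscillation is bounded and exp(-\<kappa> t) is at least 1.\<close>

lemma e_decay: "\<exists>Ce\<ge>0. \<forall>t. \<bar>e t\<bar> \<le> Ce * exp (- \<kappa> * t)"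
proof (intro exI[of _ "C + 2 * norm \<Psi>"] conjI allI)
  fix t
  show "\<bar>e t\<bar> \<le> (C + 2 * norm \<Psi>) * exp (- \<kappa> * t)"
  proof (cases "0 \<le> t")
    case True
    have "\<bar>e t\<bar> \<le> C * exp (- \<kappa> * t)" unfolding e_def by (rule decay[OF True])
    also have "\<dots> \<le> (C + 2 * norm \<Psi>) * exp (- \<kappa> * t)" by (intro mult_right_mono) auto
    finally show ?thesis .
  next
    case False
    then have "1 \<le> exp (- \<kappa> * t)" using \<kappa> by (simp add: mult_nonneg_nonpos less_imp_le)
    have "\<bar>e t\<bar> \<le> 2 * norm \<Psi> * 1" using False abs_Phi_le[of \<omega> \<Psi> t] by (simp add: e_def xneg)
    also have "\<dots> \<le> (C + 2 * norm \<Psi>) * exp (- \<kappa> * t)"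
      using \<open>1 \<le> exp (- \<kappa> * t)\<close> C by (intro mult_mono) auto
    finally show ?thesis .
  qed
qed (use C in auto)

text \<open>\<open>ek t\<close> is the functional applied to the segment of \<open>e\<close> at t,
  so the decay is inherited up to the factor exp(\<kappa> r) for the delay.\<close>

lemma ek_decay: "\<exists>Ck\<ge>0. \<forall>t. \<bar>ek t\<bar> \<le> Ck * exp (- \<kappa> * t)"
proof -
  obtain Ce where Ce: "0 \<le> Ce" "\<And>t. \<bar>e t\<bar> \<le> Ce * exp (- \<kappa> * t)" using e_decay by blast
  have "\<bar>ek t\<bar> \<le> Lnorm * (Ce * exp (\<kappa> * r)) * exp (- \<kappa> * t)" for t
  proof -
    have b1: "bm (\<lambda>\<theta>. x (t + \<theta>))" by (rule bmI[of _ Cx]) (use xb in auto)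
    have b2: "bm (\<lambda>\<theta>. Phi \<omega> \<Psi> (t + \<theta>))"
      by (intro bm_continuous continuous_on_compose2[OF continuous_on_Phi] continuous_intros) auto
    have "ek t = L (\<lambda>\<theta>. e (t + \<theta>))"
      unfolding ek_def k_def e_def L_Phi[symmetric] by (subst L_diff[OF b1 b2]) simp
    also have "\<bar>\<dots>\<bar> \<le> Lnorm * (Ce * exp (\<kappa> * r) * exp (- \<kappa> * t))"
      unfolding real_norm_def[symmetric]
    proof (rule L_bound)
      show "bm (\<lambda>\<theta>. e (t + \<theta>))"
      proof (rule bmI)
        show "(\<lambda>\<theta>. e (t + \<theta>)) \<in> borel_measurable borel" unfolding e_def by measurable
        fix \<theta> assume "-r \<le> \<theta>" "\<theta> \<le> 0"
        show "norm (e (t + \<theta>)) \<le> Cx + 2 * norm \<Psi>"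
          using xb[of "t + \<theta>"] abs_Phi_le[of \<omega> \<Psi> "t + \<theta>"] by (simp add: e_def)
      qed
      fix \<theta> assume th: "-r \<le> \<theta>" "\<theta> \<le> 0"
      have "norm (e (t + \<theta>)) \<le> Ce * exp (- \<kappa> * (t + \<theta>))" using Ce(2) by simp
      also have "\<dots> = Ce * (exp (\<kappa> * (- \<theta>)) * exp (- \<kappa> * t))" by (simp add: algebra_simps flip: exp_add)
      also have "\<dots> \<le> Ce * (exp (\<kappa> * r) * exp (- \<kappa> * t))"
      proof -
        have "\<kappa> * (- \<theta>) \<le> \<kappa> * r" using \<kappa> th by (intro mult_left_mono) auto
        then show ?thesis using Ce(1) by (intro mult_left_mono mult_right_mono) auto
      qed
      finally show "norm (e (t + \<theta>)) \<le> Ce * exp (\<kappa> * r) * exp (- \<kappa> * t)" by (simp add: mult.assoc)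
    qed
    finally show ?thesis by (simp add: mult.assoc)
  qed
  moreover have "0 \<le> Lnorm * (Ce * exp (\<kappa> * r))" using Ce Lnorm_nonneg by simp
  ultimately show ?thesis by blast
qed

lemma ek_bound: "\<bar>ek t\<bar> \<le> Lnorm * Cx + 2 * norm (Bmul \<omega> \<Psi>)"
  using kb[of t] abs_Phi_le[of \<omega> "Bmul \<omega> \<Psi>" t] by (simp add: ek_def)

lemma ek_measurable[measurable]: "ek \<in> borel_measurable borel"
  unfolding ek_def[abs_def] by measurable

text \<open>The partially integrated form of \<open>\<integral>\<^sub>0\<^sup>\<tau> exp (-s B) \<Psi> dF(s)\<close>.\<close>

definition zeta :: "(real \<Rightarrow> real) \<Rightarrow> real \<Rightarrow> real^2" where
  "zeta F \<tau> = (LINT s:{0..\<tau>}|lborel. F s *\<^sub>R rot (\<omega> * - s) (Bmul \<omega> \<Psi>)) + F \<tau> *\<^sub>R rot (\<omega> * - \<tau>) \<Psi>"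

lemma rot_measurable[measurable]: "(\<lambda>s. rot (\<omega> * - s) v) \<in> borel_measurable borel"
  by (intro borel_measurable_continuous_onI continuous_on_rot continuous_intros)

lemma Phi_zeta:
  assumes [measurable]: "F \<in> borel_measurable borel" and FB: "\<And>s. \<bar>F s\<bar> \<le> Bd"
  shows "Phi \<omega> (zeta F \<tau>) t = (LINT s:{0..\<tau>}|lborel. Phi \<omega> (Bmul \<omega> \<Psi>) (t - s) * F s) + F \<tau> * Phi \<omega> \<Psi> (t - \<tau>)"
proof -
  let ?g = "\<lambda>s. F s *\<^sub>R rot (\<omega> * - s) (Bmul \<omega> \<Psi>)"
  have "set_integrable lborel {0..\<tau>} ?g"
  proof (rule set_integrable_bounded_borel[where B="Bd * norm (Bmul \<omega> \<Psi>)"])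
    show "?g \<in> borel_measurable borel" by measurable
  qed (use FB in \<open>auto intro!: mult_right_mono\<close>)
  then have "Phi \<omega> (LINT s:{0..\<tau>}|lborel. ?g s) t = (LINT s:{0..\<tau>}|lborel. Phi \<omega> (?g s) t)"
    unfolding set_lebesgue_integral_def set_integrable_def
    by (subst integral_bounded_linear[OF bounded_linear_Phi, symmetric]) (auto simp: Phi_linear mult.assoc)
  also have "\<dots> = (LINT s:{0..\<tau>}|lborel. Phi \<omega> (Bmul \<omega> \<Psi>) (t - s) * F s)"
    by (simp only: Phi_linear Phi_rot) (simp add: mult.commute algebra_simps)
  finally show ?thesis unfolding zeta_def by (simp only: Phi_linear Phi_rot) (simp add: algebra_simps)
qed

text \<open>The difference involves only \<open>ek (t - s)\<close> with s \<le> \<tau> and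
  \<open>e (t - \<tau>)\<close>, all of which are of the order of exp(-\<kappa> (t -
  \<tau>)).\<close>

lemma voc_asymptotics:
  assumes Fm[measurable]: "F \<in> borel_measurable borel" and FB: "\<And>s. \<bar>F s\<bar> \<le> Bd"
    and st: "\<And>s. \<tau> \<le> s \<Longrightarrow> F s = F \<tau>" and \<tau>: "0 \<le> \<tau>"
  shows "((\<lambda>t. voc F t - Phi \<omega> (zeta F \<tau>) t) \<longlongrightarrow> 0) at_top"
proof -
  obtain Ce where Ce: "0 \<le> Ce" "\<And>t. \<bar>e t\<bar> \<le> Ce * exp (- \<kappa> * t)" using e_decay by blast
  obtain Ck where Ck: "0 \<le> Ck" "\<And>t. \<bar>ek t\<bar> \<le> Ck * exp (- \<kappa> * t)" using ek_decay by blast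
  have Bd: "0 \<le> Bd" using FB[of 0] by linarith
  let ?K = "\<tau> * (Ck * Bd) + Bd * Ce"
  have est: "norm (voc F t - Phi \<omega> (zeta F \<tau>) t) \<le> ?K * exp (- \<kappa> * (t - \<tau>))" if t: "\<tau> \<le> t" for t
  proof -
    have i1: "set_integrable lborel {0..\<tau>} (\<lambda>s. k (t - s) * F s)"
      by (rule set_integrable_bounded_borel[where B="Lnorm * Cx * Bd"])
         (use FB kb Bd Lnorm_nonneg Cx_nonneg in \<open>auto simp: abs_mult intro!: mult_mono\<close>)
    have i2: "set_integrable lborel {0..\<tau>} (\<lambda>s. Phi \<omega> (Bmul \<omega> \<Psi>) (t - s) * F s)"
      by (rule set_integrable_bounded_borel[where B="2 * norm (Bmul \<omega> \<Psi>) * Bd"])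
         (use FB abs_Phi_le Bd in \<open>auto simp: abs_mult intro!: mult_mono\<close>)
    have "voc F t - Phi \<omega> (zeta F \<tau>) t = (LINT s:{0..\<tau>}|lborel. k (t - s) * F s)
        - (LINT s:{0..\<tau>}|lborel. Phi \<omega> (Bmul \<omega> \<Psi>) (t - s) * F s) + F \<tau> * e (t - \<tau>)"
      using voc_stopped[OF Fm FB st \<tau> t] Phi_zeta[OF Fm FB, of \<tau> t] unfolding e_def
      by (simp add: algebra_simps)
    also have "\<dots> = (LINT s:{0..\<tau>}|lborel. ek (t - s) * F s) + F \<tau> * e (t - \<tau>)"
      by (subst set_integral_diff(2)[OF i1 i2, symmetric]) (simp add: ek_def left_diff_distrib)
    also have "norm \<dots> \<le> norm (LINT s:{0..\<tau>}|lborel. ek (t - s) * F s) + norm (F \<tau> * e (t - \<tau>))"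
      by (rule norm_triangle_ineq)
    also have "\<dots> \<le> (\<tau> - 0) * (Ck * exp (- \<kappa> * (t - \<tau>)) * Bd) + Bd * (Ce * exp (- \<kappa> * (t - \<tau>)))"
    proof (intro add_mono set_integral_norm_le_const \<tau>)
      fix s assume s: "0 \<le> s" "s \<le> \<tau>"
      have "exp (- \<kappa> * (t - s)) \<le> exp (- \<kappa> * (t - \<tau>))" using s \<kappa> by simp
      then have "\<bar>ek (t - s)\<bar> \<le> Ck * exp (- \<kappa> * (t - \<tau>))"
        using Ck by (meson mult_left_mono order_trans)
      then show "norm (ek (t - s) * F s) \<le> Ck * exp (- \<kappa> * (t - \<tau>)) * Bd"
        using FB[of s] Ck(1) by (auto simp: abs_mult intro!: mult_mono)
    next
      show "norm (F \<tau> * e (t - \<tau>)) \<le> Bd * (Ce * exp (- \<kappa> * (t - \<tau>)))"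
        using FB[of \<tau>] Ce Bd unfolding real_norm_def abs_mult by (intro mult_mono) auto
    qed
    finally show ?thesis by (simp add: algebra_simps)
  qed
  have "((\<lambda>t. ?K * exp (- \<kappa> * (t - \<tau>))) \<longlongrightarrow> 0) at_top"
    using \<kappa> by (intro tendsto_mult_right_zero) real_asymp
  then show ?thesis
    by (rule Lim_null_comparison[rotated]) (rule eventually_mono[OF eventually_ge_at_top[of \<tau>] est])
qed

section \<open>Solutions of the linear equation and the projection onto P\<close>

lemma bm_window:
  assumes "bm \<phi>" "\<And>\<theta>. -r \<le> \<theta> \<Longrightarrow> \<theta> \<le> 0 \<Longrightarrow> y \<theta> = \<phi> \<theta>" "continuous_on {0..T} y" "0 \<le> s" "s \<le> T"
  shows "bm (\<lambda>\<theta>. y (s + \<theta>) :: real)"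
proof -
  \<comment> \<open>The initial function is merely measurable and \<open>y\<close> is continuous
    only from 0 on; the glued function is Borel on the whole line and agrees with \<open>y\<close>
    wherever the window looks.\<close>
  let ?y = "\<lambda>t. indicator {-r..0} t *\<^sub>R \<phi> t + indicator {0<..T} t *\<^sub>R y t"
  have m1: "(\<lambda>t. indicator {-r..0} t *\<^sub>R \<phi> t) \<in> borel_measurable borel"
    using assms(1) unfolding bm_def by (subst (asm) borel_measurable_restrict_space_iff) (auto simp: mult.commute)
  have m2: "(\<lambda>t. indicator {0<..T} t *\<^sub>R y t) \<in> borel_measurable borel"
    by (intro borel_measurable_continuous_on_indicator continuous_on_subset[OF assms(3)]) auto
  have m: "?y \<in> borel_measurable borel" using m1 m2 by measurable
  obtain B1 where B1: "\<forall>t\<in>{-r..0}. norm (\<phi> t) \<le> B1" using assms(1) unfolding bm_def bounded_iff by auto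
  have "bounded (y ` {0..T})" by (intro compact_imp_bounded compact_continuous_image assms) auto
  then obtain B2 where B2: "\<forall>t\<in>{0..T}. norm (y t) \<le> B2" unfolding bounded_iff by auto
  have "bm (\<lambda>\<theta>. ?y (s + \<theta>))"
  proof (rule bmI)
    show "(\<lambda>\<theta>. ?y (s + \<theta>)) \<in> borel_measurable borel" using m by (rule measurable_compose[rotated]) simp
    fix \<theta> assume "-r \<le> \<theta>" "\<theta> \<le> 0"
    then show "norm (?y (s + \<theta>)) \<le> max B1 B2" using B1 B2 assms(4,5) by (auto simp: indicator_def le_max_iff_disj)
  qed
  also have "?this \<longleftrightarrow> ?thesis" by (rule bm_cong) (use assms in \<open>auto simp: indicator_def\<close>)
  finally show ?thesis .
qed

lemma lin_solution_continuous:
  assumes "lin_solution r L0 \<phi> y" shows "continuous_on {0..T} y"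
proof -
  have "continuous_on {0..T} (\<lambda>t. \<phi> 0 + (LINT s:{0..t}|lborel. L_ext r L0 (\<lambda>\<theta>. y (s + \<theta>))))"
    using assms by (cases "0 \<le> T") (auto simp: lin_solution_def intro!: continuous_intros continuous_on_set_integral)
  then show ?thesis by (rule continuous_on_eq) (use assms in \<open>auto simp: lin_solution_def\<close>)
qed

lemma lin_solution_diff:
  assumes y: "lin_solution r L0 \<phi> y" "bm \<phi>" and w: "lin_solution r L0 \<psi> w" "bm \<psi>"
  shows "lin_solution r L0 (\<lambda>\<theta>. \<phi> \<theta> - \<psi> \<theta>) (\<lambda>t. y t - w t)"
  unfolding lin_solution_def Lext
proof (intro conjI ballI allI impI)
  fix \<theta> assume "\<theta> \<in> {-r..0}"
  then show "y \<theta> - w \<theta> = \<phi> \<theta> - \<psi> \<theta>" using y w by (auto simp: lin_solution_def)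
next
  fix t :: real assume t: "0 \<le> t"
  have b: "bm (\<lambda>\<theta>. y (s + \<theta>))" "bm (\<lambda>\<theta>. w (s + \<theta>))" if "0 \<le> s" for s
    using bm_window[OF y(2) _ lin_solution_continuous[OF y(1)] that order.refl]
      bm_window[OF w(2) _ lin_solution_continuous[OF w(1)] that order.refl] y w
    by (auto simp: lin_solution_def)
  have i: "set_integrable lborel {0..t} (\<lambda>s. L (\<lambda>\<theta>. y (s + \<theta>)))" "set_integrable lborel {0..t} (\<lambda>s. L (\<lambda>\<theta>. w (s + \<theta>)))"
    using y w t by (auto simp: lin_solution_def Lext)
  have eq: "L (\<lambda>\<theta>. y (s + \<theta>) - w (s + \<theta>)) = L (\<lambda>\<theta>. y (s + \<theta>)) - L (\<lambda>\<theta>. w (s + \<theta>))" if "0 \<le> s" for s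
    by (rule L_diff[OF b[OF that]])
  show "set_integrable lborel {0..t} (\<lambda>s. L (\<lambda>\<theta>. y (s + \<theta>) - w (s + \<theta>)))"
    using set_integral_diff(1)[OF i] by (rule set_integrable_cong[THEN iffD1, rotated 3]) (auto simp: eq)
  have "(LINT s:{0..t}|lborel. L (\<lambda>\<theta>. y (s + \<theta>) - w (s + \<theta>))) =
      (LINT s:{0..t}|lborel. L (\<lambda>\<theta>. y (s + \<theta>)) - L (\<lambda>\<theta>. w (s + \<theta>)))"
    by (rule set_lebesgue_integral_cong) (auto simp: eq)
  also have "\<dots> = (LINT s:{0..t}|lborel. L (\<lambda>\<theta>. y (s + \<theta>))) - (LINT s:{0..t}|lborel. L (\<lambda>\<theta>. w (s + \<theta>)))"
    by (rule set_integral_diff(2)[OF i])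
  finally show "y t - w t = \<phi> 0 - \<psi> 0 + (LINT s:{0..t}|lborel. L (\<lambda>\<theta>. y (s + \<theta>) - w (s + \<theta>)))"
    using y w t by (simp add: lin_solution_def Lext)
qed

lemma lin_solution_unique:
  assumes "lin_solution r L0 \<phi> y" "lin_solution r L0 \<phi> w" "bm \<phi>" "-r \<le> t"
  shows "y t = w t"
proof -
  have d: "lin_solution r L0 (\<lambda>\<theta>. \<phi> \<theta> - \<phi> \<theta>) (\<lambda>t. y t - w t)"
    using lin_solution_diff assms by blast
  have "(\<lambda>t. y t - w t) t = 0"
    by (rule dde_unique[where T="max 0 t"])
       (use d lin_solution_continuous[OF d] assms(4) in \<open>auto simp: lin_solution_def Lext\<close>)
  then show ?thesis by simp
qed

lemma lin_solution_Phi: "lin_solution r L0 (Phi \<omega> v) (Phi \<omega> v)"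
  unfolding lin_solution_def Lext L_Phi
proof (intro conjI ballI allI impI)
  fix t :: real assume t: "0 \<le> t"
  show "set_integrable lborel {0..t} (\<lambda>s. Phi \<omega> (Bmul \<omega> v) s)"
    unfolding set_integrable_def by (intro borel_integrable_compact continuous_on_Phi) auto
  have "(\<integral>s. indicator {0..t} s *\<^sub>R Phi \<omega> (Bmul \<omega> v) s \<partial>lborel) = Phi \<omega> v t - Phi \<omega> v 0"
    by (intro integral_FTC_atLeastAtMost t continuous_on_Phi)
       (auto intro!: Phi_deriv simp flip: has_real_derivative_iff_has_vector_derivative)
  then show "Phi \<omega> v t = Phi \<omega> v 0 + (LINT s:{0..t}|lborel. Phi \<omega> (Bmul \<omega> v) s)"
    by (simp add: set_lebesgue_integral_def)
qed auto

lemma bm_Phi: "bm (Phi \<omega> v)" by (intro bm_continuous continuous_on_Phi)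

text \<open>\<open>That\<close> picks some solution; uniqueness makes it the given one.\<close>

lemma That_eq:
  assumes "lin_solution r L0 \<phi> y" "bm \<phi>" "0 \<le> t" "-r \<le> \<theta>"
  shows "That r L0 t \<phi> \<theta> = y (t + \<theta>)"
  unfolding That_def
  by (rule lin_solution_unique[OF someI[of "lin_solution r L0 \<phi>"] assms(1,2)]) (use assms in auto)

lemma bm_diff: "bm f \<Longrightarrow> bm g \<Longrightarrow> bm (\<lambda>\<theta>. f \<theta> - g \<theta> :: real)"
  unfolding bm_def
  by (auto intro!: borel_measurable_diff bounded_minus_comp)

text \<open>The segments have fixed length, so their sup norms tend to 0 exactly when the solution
  does. Membership in \<open>Qhat\<close> thus becomes the limit of a scalar function.\<close>

lemma Qhat_iff:
  assumes "lin_solution r L0 \<phi> y" "bm \<phi>"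
  shows "\<phi> \<in> Qhat r L0 \<longleftrightarrow> (y \<longlongrightarrow> 0) at_top"
proof -
  have bd: "bounded ((\<lambda>\<theta>. That r L0 t \<phi> \<theta>) ` {-r..0})" if t: "0 \<le> t" for t
  proof -
    have "bm (\<lambda>\<theta>. y (t + \<theta>))"
      by (rule bm_window[OF assms(2) _ lin_solution_continuous[OF assms(1)] t order.refl])
         (use assms in \<open>auto simp: lin_solution_def\<close>)
    moreover have "(\<lambda>\<theta>. That r L0 t \<phi> \<theta>) ` {-r..0} = (\<lambda>\<theta>. y (t + \<theta>)) ` {-r..0}"
      by (intro image_cong) (use That_eq[OF assms t] in auto)
    ultimately show ?thesis by (simp add: bm_def)
  qed
  have "((\<lambda>t. supnorm r (That r L0 t \<phi>)) \<longlongrightarrow> 0) at_top \<longleftrightarrow> (y \<longlongrightarrow> 0) at_top"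
  proof
    assume l: "((\<lambda>t. supnorm r (That r L0 t \<phi>)) \<longlongrightarrow> 0) at_top"
    show "(y \<longlongrightarrow> 0) at_top"
    proof (rule Lim_null_comparison[OF _ l])
      show "\<forall>\<^sub>F t in at_top. norm (y t) \<le> supnorm r (That r L0 t \<phi>)"
        using eventually_ge_at_top[of 0]
      proof eventually_elim
        case (elim t)
        show ?case using supnorm_upper[OF bd[OF elim], of 0] That_eq[OF assms elim, of 0] r by simp
      qed
    qed
  next
    assume l: "(y \<longlongrightarrow> 0) at_top"
    show "((\<lambda>t. supnorm r (That r L0 t \<phi>)) \<longlongrightarrow> 0) at_top"
    proof (rule tendstoI)
      fix \<epsilon> :: real assume e: "0 < \<epsilon>"
      have "\<forall>\<^sub>F t in at_top. dist (y t) 0 < \<epsilon> / 2" using l e by (intro tendstoD) auto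
      then obtain N where N: "\<And>t. N \<le> t \<Longrightarrow> \<bar>y t\<bar> < \<epsilon> / 2"
        unfolding eventually_at_top_linorder by auto
      show "\<forall>\<^sub>F t in at_top. dist (supnorm r (That r L0 t \<phi>)) 0 < \<epsilon>"
        using eventually_ge_at_top[of "max 0 (N + r)"]
      proof eventually_elim
        case (elim t)
        have "supnorm r (That r L0 t \<phi>) \<le> \<epsilon> / 2"
        proof (rule supnorm_le)
          fix \<theta> assume "-r \<le> \<theta>" "\<theta> \<le> 0"
          then show "\<bar>That r L0 t \<phi> \<theta>\<bar> \<le> \<epsilon> / 2"
            using That_eq[OF assms, of t \<theta>] N[of "t + \<theta>"] elim by simp
        qed (use r in auto)
        moreover have "0 \<le> supnorm r (That r L0 t \<phi>)" using r elim by (intro supnorm_nonneg bd) auto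
        ultimately show ?case using e by simp
      qed
    qed
  qed
  then show ?thesis using assms(2) by (simp add: Qhat_def bm_iff)
qed

text \<open>The projection is read off at infinity: subtracting an oscillation leaves an element of
  \<open>Qhat\<close> exactly when the solution approaches that oscillation, and by
  \<open>Phi_tendsto_zero\<close> it can approach only one.\<close>

lemma pihat_eq:
  assumes y: "lin_solution r L0 \<phi> y" "bm \<phi>" and lim: "((\<lambda>t. y t - Phi \<omega> v t) \<longlongrightarrow> 0) at_top"
  shows "pihat r L0 \<omega> \<phi> = Phi \<omega> v"
  unfolding pihat_def
proof (rule the_equality)
  have q: "(\<lambda>\<theta>. \<phi> \<theta> - Phi \<omega> w \<theta>) \<in> Qhat r L0 \<longleftrightarrow> ((\<lambda>t. y t - Phi \<omega> w t) \<longlongrightarrow> 0) at_top" for w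
    by (rule Qhat_iff[OF lin_solution_diff[OF y lin_solution_Phi bm_Phi] bm_diff[OF y(2) bm_Phi]])
  show "Phi \<omega> v \<in> P_space \<omega> \<and> (\<lambda>\<theta>. \<phi> \<theta> - Phi \<omega> v \<theta>) \<in> Qhat r L0"
    using q lim by (auto simp: P_space_def)
  fix p assume "p \<in> P_space \<omega> \<and> (\<lambda>\<theta>. \<phi> \<theta> - p \<theta>) \<in> Qhat r L0"
  then obtain w where w: "p = Phi \<omega> w" "((\<lambda>t. y t - Phi \<omega> w t) \<longlongrightarrow> 0) at_top"
    using q by (auto simp: P_space_def)
  have "((\<lambda>t. (y t - Phi \<omega> w t) - (y t - Phi \<omega> v t)) \<longlongrightarrow> 0 - 0) at_top"
    by (intro tendsto_diff w lim)
  then have "((\<lambda>t. Phi \<omega> (v - w) t) \<longlongrightarrow> 0) at_top" by (simp add: Phi_linear)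
  then have "v - w = 0" by (rule Phi_tendsto_zero[OF \<omega>])
  then show "p = Phi \<omega> v" using w by simp
qed

lemma e_tendsto: "(e \<longlongrightarrow> 0) at_top"
proof -
  obtain Ce where Ce: "\<And>t. \<bar>e t\<bar> \<le> Ce * exp (- \<kappa> * t)" using e_decay by blast
  have "((\<lambda>t. Ce * exp (- \<kappa> * t)) \<longlongrightarrow> 0) at_top"
    using \<kappa> by (intro tendsto_mult_right_zero) real_asymp
  then show ?thesis by (rule Lim_null_comparison[rotated]) (use Ce in auto)
qed

text \<open>\<open>x\<close> starts from the indicator of 0 and approaches
  \<open>Phi \<omega> \<Psi>\<close>, so \<open>pihat_eq\<close> applies to it.\<close>

lemma Psi_tilde_eq: "Psi_tilde r L0 \<omega> = \<Psi>"
proof -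
  have "lin_solution r L0 (indicat_real {0}) x"
    unfolding lin_solution_def Lext
  proof (intro conjI ballI allI impI)
    fix \<theta> assume "\<theta> \<in> {-r..0}"
    then show "x \<theta> = indicat_real {0} \<theta>"
      using xeq[of 0] xneg[of \<theta>] by (cases "\<theta> = 0") auto
  next
    fix t :: real assume "0 \<le> t"
    then show "x t = indicat_real {0} 0 + (LINT s:{0..t}|lborel. L (\<lambda>\<theta>. x (s + \<theta>)))"
      using xeq[of t] by simp
    show "set_integrable lborel {0..t} (\<lambda>s. L (\<lambda>\<theta>. x (s + \<theta>)))"
      using k_integrable unfolding k_def[abs_def] .
  qed
  moreover have "bm (indicat_real {0})" by (rule bmI[of _ 1]) auto
  ultimately have "pihat r L0 \<omega> (indicat_real {0}) = Phi \<omega> \<Psi>"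
    using e_tendsto by (intro pihat_eq) (auto simp: e_def[abs_def])
  then show ?thesis by (simp add: Psi_tilde_def P_coords_Phi[OF \<omega>])
qed

text \<open>The history on [-r,0) acts as a forcing \<open>g\<close> that stops at time r; with
  \<open>F\<close> built from its primitive, the solution is the history plus \<open>voc F\<close>.
  Since \<open>F\<close> is constant from r on, \<open>voc_asymptotics\<close> also yields the
  limiting oscillation, that is, existence of the splitting.\<close>

lemma lin_solution_exists:
  assumes \<phi>: "bm \<phi>"
  shows "\<exists>y v. lin_solution r L0 \<phi> y \<and> ((\<lambda>t. y t - Phi \<omega> v t) \<longlongrightarrow> 0) at_top"
proof -
  \<comment> \<open>The value at 0 is left out here; it enters as the jump of \<open>F\<close> at
    0.\<close>
  define \<phi>m where "\<phi>m t = indicator {-r..<0} t * \<phi> t" for t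
  have "(\<lambda>t. indicator {-r..0} t *\<^sub>R \<phi> t) \<in> borel_measurable borel"
    using \<phi> unfolding bm_def by (subst (asm) borel_measurable_restrict_space_iff) (auto simp: mult.commute)
  then have "(\<lambda>t. indicat_real {-r..<0} t * (indicator {-r..0} t *\<^sub>R \<phi> t)) \<in> borel_measurable borel"
    by measurable
  also have "(\<lambda>t. indicat_real {-r..<0} t * (indicator {-r..0} t *\<^sub>R \<phi> t)) = \<phi>m"
    by (auto simp: \<phi>m_def indicator_def)
  finally have [measurable]: "\<phi>m \<in> borel_measurable borel" .
  obtain Bp where Bp': "\<forall>t\<in>{-r..0}. norm (\<phi> t) \<le> Bp" using \<phi> unfolding bm_def bounded_iff by auto
  have Bp0: "0 \<le> Bp" using order_trans[OF norm_ge_zero Bp'[rule_format, of 0]] r by simp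
  have Bp: "\<bar>\<phi>m t\<bar> \<le> Bp" for t using Bp' Bp0 by (auto simp: \<phi>m_def indicator_def)
  have bmm: "bm (\<lambda>\<theta>. \<phi>m (s + \<theta>))" for s by (rule bmI[of _ Bp]) (use Bp in auto)
  define g where "g s = L (\<lambda>\<theta>. \<phi>m (s + \<theta>))" for s
  have gm[measurable]: "g \<in> borel_measurable borel" unfolding g_def by (rule L_shift_measurable) simp
  have gb: "\<bar>g s\<bar> \<le> Lnorm * Bp" for s
    unfolding g_def real_norm_def[symmetric] by (rule L_bound[OF bmm]) (use Bp in auto)
  have g0: "g s = 0" if "r \<le> s" for s
  proof -
    have "g s = L (\<lambda>\<theta>. 0 :: real)" unfolding g_def by (intro L_cong) (use that in \<open>auto simp: \<phi>m_def\<close>)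
    then show ?thesis by (simp add: L_def)
  qed
  have gi: "set_integrable lborel {a..b} g" for a b
    by (rule set_integrable_bounded_borel[where B="Lnorm * Bp"]) (auto simp: gb)
  define F where "F t = (if t < 0 then 0 else \<phi> 0 + (LINT s:{0..t}|lborel. g s))" for t
  have Fm[measurable]: "F \<in> borel_measurable borel"
    unfolding F_def[abs_def] using set_integral_measurable[OF gm] by measurable
  have Fst: "F s = F r" if "r \<le> s" for s
  proof -
    have "(LINT s:{0..s}|lborel. g s) = (LINT s:{0..r}|lborel. g s) + (LINT s:{r..s}|lborel. g s)"
      using r that by (intro set_integral_split gi) auto
    moreover have "(LINT s:{r..s}|lborel. g s) = (LINT s:{r..s}|lborel. 0)"
      by (rule set_lebesgue_integral_cong) (auto simp: g0)
    ultimately show ?thesis using r that by (simp add: F_def)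
  qed
  let ?FB = "Bp + r * (Lnorm * Bp)"
  have FB1: "\<bar>F t\<bar> \<le> ?FB" if "t \<le> r" for t
  proof (cases "t < 0")
    case False
    then have "norm (LINT s:{0..t}|lborel. g s) \<le> (t - 0) * (Lnorm * Bp)"
      by (intro set_integral_norm_le_const) (auto simp: gb)
    also have "\<dots> \<le> r * (Lnorm * Bp)" using that Lnorm_nonneg Bp0 by (intro mult_right_mono) auto
    finally show ?thesis using False Bp'[rule_format, of 0] r by (auto simp: F_def)
  qed (use Bp0 Lnorm_nonneg r in \<open>auto simp: F_def\<close>)
  have FB: "\<bar>F t\<bar> \<le> ?FB" for t
    using FB1[of t] FB1[of r] Fst[of t] by (cases "t \<le> r") auto
  have F0: "F s = 0" if "s < 0" for s using that by (simp add: F_def)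
  have vs: "voc F t = F t + (LINT s:{0..t}|lborel. L (\<lambda>\<theta>. voc F (s + \<theta>)))"
    "set_integrable lborel {0..t} (\<lambda>s. L (\<lambda>\<theta>. voc F (s + \<theta>)))" if "0 \<le> t" for t
    using voc_solves[OF Fm FB, of t] F0 that by auto
  define y where "y t = \<phi>m t + voc F t" for t
  have bmv: "bm (\<lambda>\<theta>. voc F (s + \<theta>))" for s
  proof -
    have "voc F \<in> borel_measurable borel" by (rule voc_measurable[OF Fm])
    then have "(\<lambda>\<theta>. voc F (s + \<theta>)) \<in> borel_measurable borel" by (rule measurable_compose[rotated]) simp
    then show ?thesis
      by (rule bmI[of _ "?FB + max 0 s * (Lnorm * Cx * ?FB)"])
         (use voc_bound[OF FB, of _ "max 0 s"] in auto)
  qed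
  have Ly: "L (\<lambda>\<theta>. y (s + \<theta>)) = g s + L (\<lambda>\<theta>. voc F (s + \<theta>))" for s
    unfolding y_def g_def by (rule L_add[OF bmm bmv])
  have "lin_solution r L0 \<phi> y"
    unfolding lin_solution_def Lext Ly
  proof (intro conjI ballI allI impI)
    fix \<theta> assume th: "\<theta> \<in> {-r..0}"
    show "y \<theta> = \<phi> \<theta>"
    proof (cases "\<theta> = 0")
      case True
      then show ?thesis by (simp add: y_def voc_def F_def \<phi>m_def)
    next
      case False
      then show ?thesis using th by (simp add: y_def voc_neg F0 \<phi>m_def)
    qed
  next
    fix t :: real assume t: "0 \<le> t"
    show "set_integrable lborel {0..t} (\<lambda>s. g s + L (\<lambda>\<theta>. voc F (s + \<theta>)))"
      by (rule set_integral_add(1)[OF gi vs(2)[OF t]])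
    have "y t = \<phi> 0 + (LINT s:{0..t}|lborel. g s) + (LINT s:{0..t}|lborel. L (\<lambda>\<theta>. voc F (s + \<theta>)))"
      using t vs(1)[OF t] by (simp add: y_def F_def \<phi>m_def)
    then show "y t = \<phi> 0 + (LINT s:{0..t}|lborel. g s + L (\<lambda>\<theta>. voc F (s + \<theta>)))"
      by (simp add: set_integral_add(2)[OF gi vs(2)[OF t]])
  qed
  moreover have "((\<lambda>t. y t - Phi \<omega> (zeta F r) t) \<longlongrightarrow> 0) at_top"
  proof (rule Lim_transform_eventually[OF voc_asymptotics[OF Fm FB Fst]])
    show "\<forall>\<^sub>F t in at_top. voc F t - Phi \<omega> (zeta F r) t = y t - Phi \<omega> (zeta F r) t"
      using eventually_ge_at_top[of 0] by eventually_elim (simp add: y_def \<phi>m_def)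
  qed (use r in auto)
  ultimately show ?thesis by blast
qed

end

section \<open>Riemann--Stieltjes integrals of continuous functions\<close>

text \<open>Tagged divisions may contain degenerate intervals, which contribute nothing.\<close>

definition incr :: "(real \<Rightarrow> real) \<Rightarrow> real set \<Rightarrow> real" where
  "incr \<nu> J = (if interior J = {} then 0 else \<nu> (Sup J) - \<nu> (Inf J))"

lemma incr_Icc: "incr \<nu> {a..b} = (if a < b then \<nu> b - \<nu> a else 0)"
  by (simp add: incr_def)

text \<open>The increment over the intersection with K is additive over adjacent intervals K, and
  \<open>operative_real\<close> sums such a function over a division.\<close>

lemma incr_inter_sum:
  assumes q: "q tagged_division_of {a..b}" and J: "{c..d} \<subseteq> {a..b}"
  shows "(\<Sum>(y, K)\<in>q. incr \<nu> ({c..d} \<inter> K)) = incr \<nu> {c..d}"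
proof -
  let ?h = "\<lambda>K. incr \<nu> ({c..d} \<inter> K)"
  interpret operative_real plus 0 ?h
    rewrites "comm_monoid_set.F (+) 0 = sum"
    by standard[1] (auto simp add: sum_def incr_Icc Int_atLeastAtMost min_def max_def)
  have "(\<Sum>(y, K)\<in>q. ?h K) = ?h {a..b}"
    using tagged_division[of q a b] q by simp
  also have "{c..d} \<inter> {a..b} = {c..d}" using J by blast
  finally show ?thesis .
qed

lemma tagged_division_real_piece:
  assumes "p tagged_division_of {a..b::real}" "(x, J) \<in> p"
  obtains c d where "J = {c..d}" "c \<le> x" "x \<le> d" "{c..d} \<subseteq> {a..b}"
  using tagged_division_ofD(2-4)[OF assms] by (metis atLeastAtMost_iff box_real(2))

definition rs_sum :: "(real \<Rightarrow> real) \<Rightarrow> (real \<Rightarrow> real) \<Rightarrow> (real \<times> real set) set \<Rightarrow> real" where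
  "rs_sum f \<nu> p = (\<Sum>(x, J)\<in>p. f x * (\<nu> (Sup J) - \<nu> (Inf J)))"

lemma rs_sum_incr:
  assumes "p tagged_division_of {a..b}"
  shows "rs_sum f \<nu> p = (\<Sum>(x, J)\<in>p. f x * incr \<nu> J)"
  unfolding rs_sum_def
proof (intro sum.cong refl, clarify)
  fix x J assume "(x, J) \<in> p"
  then obtain c d where "J = {c..d}" "c \<le> x" "x \<le> d" by (rule tagged_division_real_piece[OF assms])
  moreover from this have "c < d \<or> c = d" by linarith
  ultimately show "f x * (\<nu> (Sup J) - \<nu> (Inf J)) = f x * incr \<nu> J" by (auto simp: incr_Icc)
qed

text \<open>The nondegenerate intersections belong to the common refinement of the two divisions,
  and different pairs give different intersections because cells of one division do not overlap. The
  variation over that refinement is at most V.\<close>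

lemma incr_refinement_bound:
  assumes V: "\<And>d. d division_of {a..b} \<Longrightarrow> (\<Sum>J\<in>d. \<bar>\<nu> (Sup J) - \<nu> (Inf J)\<bar>) \<le> V"
    and p: "p tagged_division_of {a..b}" and q: "q tagged_division_of {a..b}"
  shows "(\<Sum>(x, J)\<in>p. \<Sum>(y, K)\<in>q. \<bar>incr \<nu> (J \<inter> K)\<bar>) \<le> V"
proof -
  have fin: "finite p" "finite q" using p q by auto
  let ?P = "{u \<in> p \<times> q. interior (snd (fst u) \<inter> snd (snd u)) \<noteq> {}}"
  let ?I = "\<lambda>u :: (real \<times> real set) \<times> (real \<times> real set). snd (fst u) \<inter> snd (snd u)"
  let ?D = "{k1 \<inter> k2 | k1 k2. k1 \<in> snd ` p \<and> k2 \<in> snd ` q \<and> k1 \<inter> k2 \<noteq> {}}"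
  have D: "?D division_of {a..b}"
    using division_inter[OF division_of_tagged_division[OF p] division_of_tagged_division[OF q]] by simp
  have inj: "inj_on ?I ?P"
  proof (rule inj_onI, clarsimp, goal_cases)
    case (1 x1 J1 y1 K1 x2 J2 y2 K2)
    have "interior J1 \<inter> interior K1 = interior J2 \<inter> interior K2"
      using 1(1) by (simp flip: interior_Int)
    then have "interior J1 \<inter> interior J2 \<noteq> {}" "interior K1 \<inter> interior K2 \<noteq> {}"
      using 1 by auto
    then show ?case
      using tagged_division_ofD(5)[OF p, of x1 J1 x2 J2] tagged_division_ofD(5)[OF q, of y1 K1 y2 K2] 1 by auto
  qed
  have "(\<Sum>(x, J)\<in>p. \<Sum>(y, K)\<in>q. \<bar>incr \<nu> (J \<inter> K)\<bar>) = (\<Sum>u\<in>p \<times> q. \<bar>incr \<nu> (?I u)\<bar>)"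
    by (simp add: split_beta sum.cartesian_product)
  also have "\<dots> = (\<Sum>u\<in>?P. \<bar>incr \<nu> (?I u)\<bar>)"
    using fin by (intro sum.mono_neutral_right) (auto simp: incr_def)
  also have "\<dots> = (\<Sum>J\<in>?I ` ?P. \<bar>incr \<nu> J\<bar>)" by (subst sum.reindex[OF inj]) simp
  also have "\<dots> \<le> (\<Sum>J\<in>?D. \<bar>incr \<nu> J\<bar>)"
  proof (rule sum_mono2[OF division_of_finite[OF D]])
    show "?I ` ?P \<subseteq> ?D"
    proof (rule image_subsetI)
      fix u assume u: "u \<in> ?P"
      then have "interior (?I u) \<noteq> {}" by blast
      then have "?I u \<noteq> {}" by force
      moreover have "snd (fst u) \<in> snd ` p" "snd (snd u) \<in> snd ` q" using u by auto
      ultimately show "?I u \<in> ?D" by blast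
    qed
  qed simp
  also have "\<dots> \<le> (\<Sum>J\<in>?D. \<bar>\<nu> (Sup J) - \<nu> (Inf J)\<bar>)"
    by (intro sum_mono) (auto simp: incr_def)
  also have "\<dots> \<le> V" by (rule V[OF D])
  finally show ?thesis .
qed

text \<open>Both sums are spread over pairs of overlapping cells, where only the difference of the
  tag values counts. With \<open>f = g\<close> this yields the Cauchy property, with
  \<open>p = q\<close> the Lipschitz estimate in the integrand.\<close>

lemma rs_sum_diff_le:
  assumes V: "\<And>d. d division_of {a..b} \<Longrightarrow> (\<Sum>J\<in>d. \<bar>\<nu> (Sup J) - \<nu> (Inf J)\<bar>) \<le> V"
    and p: "p tagged_division_of {a..b}" and q: "q tagged_division_of {a..b}"
    and fg: "\<And>x J y K. (x, J) \<in> p \<Longrightarrow> (y, K) \<in> q \<Longrightarrow> interior (J \<inter> K) \<noteq> {} \<Longrightarrow> \<bar>f x - g y\<bar> \<le> M" and M: "0 \<le> M"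
  shows "\<bar>rs_sum f \<nu> p - rs_sum g \<nu> q\<bar> \<le> M * V"
proof -
  have "rs_sum f \<nu> p = (\<Sum>(x, J)\<in>p. \<Sum>(y, K)\<in>q. f x * incr \<nu> (J \<inter> K))"
    unfolding rs_sum_incr[OF p]
  proof (intro sum.cong refl, clarify)
    fix x J assume "(x, J) \<in> p"
    then obtain c d where "J = {c..d}" "{c..d} \<subseteq> {a..b}" by (rule tagged_division_real_piece[OF p])
    then show "f x * incr \<nu> J = (\<Sum>(y, K)\<in>q. f x * incr \<nu> (J \<inter> K))"
      using incr_inter_sum[OF q, of c d \<nu>] by (simp add: split_beta flip: sum_distrib_left)
  qed
  moreover have "rs_sum g \<nu> q = (\<Sum>(x, J)\<in>p. \<Sum>(y, K)\<in>q. g y * incr \<nu> (J \<inter> K))"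
  proof -
    have "rs_sum g \<nu> q = (\<Sum>(y, K)\<in>q. \<Sum>(x, J)\<in>p. g y * incr \<nu> (J \<inter> K))"
      unfolding rs_sum_incr[OF q]
    proof (intro sum.cong refl, clarify)
      fix y K assume "(y, K) \<in> q"
      then obtain c d where "K = {c..d}" "{c..d} \<subseteq> {a..b}" by (rule tagged_division_real_piece[OF q])
      then show "g y * incr \<nu> K = (\<Sum>(x, J)\<in>p. g y * incr \<nu> (J \<inter> K))"
        using incr_inter_sum[OF p, of c d \<nu>] by (simp add: split_beta Int_commute flip: sum_distrib_left)
    qed
    also have "\<dots> = (\<Sum>(x, J)\<in>p. \<Sum>(y, K)\<in>q. g y * incr \<nu> (J \<inter> K))"
      unfolding split_beta by (rule sum.swap)
    finally show ?thesis .
  qed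
  ultimately have "rs_sum f \<nu> p - rs_sum g \<nu> q = (\<Sum>(x, J)\<in>p. \<Sum>(y, K)\<in>q. (f x - g y) * incr \<nu> (J \<inter> K))"
    by (simp add: split_beta left_diff_distrib sum_subtractf)
  also have "\<bar>\<dots>\<bar> \<le> (\<Sum>(x, J)\<in>p. \<Sum>(y, K)\<in>q. M * \<bar>incr \<nu> (J \<inter> K)\<bar>)"
    unfolding split_beta
  proof (intro order_trans[OF sum_abs] sum_mono)
    fix u w assume "u \<in> p" "w \<in> q"
    then show "\<bar>(f (fst u) - g (fst w)) * incr \<nu> (snd u \<inter> snd w)\<bar> \<le> M * \<bar>incr \<nu> (snd u \<inter> snd w)\<bar>"
      using fg[of "fst u" "snd u" "fst w" "snd w"] M
      by (cases "interior (snd u \<inter> snd w) = {}") (auto simp: abs_mult incr_def intro!: mult_right_mono)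
  qed
  also have "\<dots> = M * (\<Sum>(x, J)\<in>p. \<Sum>(y, K)\<in>q. \<bar>incr \<nu> (J \<inter> K)\<bar>)"
    by (simp add: split_beta sum_distrib_left)
  also have "\<dots> \<le> M * V" by (intro mult_left_mono incr_refinement_bound[OF V p q] M)
  finally show ?thesis .
qed

lemma fine_common_tag:
  assumes "(\<lambda>x. ball x d) fine p" "(\<lambda>x. ball x d) fine q" "(x, J) \<in> p" "(y, K) \<in> q" "interior (J \<inter> K) \<noteq> {}"
  shows "dist x y < 2 * (d::real)"
proof -
  obtain z where z: "z \<in> J" "z \<in> K" using assms(5) interior_subset by blast
  have "dist x z < d" "dist y z < d" using fineD[OF assms(1,3)] fineD[OF assms(2,4)] z by auto
  then show ?thesis using dist_triangle2[of x y z] by linarith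
qed

lemma fine_tagged_division_exists:
  assumes "0 < d"
  shows "\<exists>p. p tagged_division_of {a..b::real} \<and> (\<lambda>x. ball x d) fine p"
proof -
  obtain p where "p tagged_division_of {a..b}" "(\<lambda>x. ball x d) fine p"
    by (rule fine_division_exists_real[OF gauge_ball[OF assms]])
  then show ?thesis by (intro exI conjI)
qed

text \<open>Tags of overlapping cells in two fine divisions are close, so uniform continuity makes
  the sums Cauchy as the mesh shrinks.\<close>

lemma has_RS_integral_exists:
  assumes ab: "a \<le> b" and V: "\<And>d. d division_of {a..b} \<Longrightarrow> (\<Sum>J\<in>d. \<bar>\<nu> (Sup J) - \<nu> (Inf J)\<bar>) \<le> V"
    and f: "continuous_on {a..b} f"
  shows "\<exists>I. has_RS_integral f \<nu> a b I"
proof -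
  have V0: "0 \<le> V" using order_trans[OF sum_nonneg V[OF division_of_self[of a b, unfolded box_real]]] ab by auto
  have cauchy: "\<exists>d>0. \<forall>p q. p tagged_division_of {a..b} \<and> (\<lambda>x. ball x d) fine p \<and>
      q tagged_division_of {a..b} \<and> (\<lambda>x. ball x d) fine q \<longrightarrow> \<bar>rs_sum f \<nu> p - rs_sum f \<nu> q\<bar> \<le> e"
    if e: "0 < e" for e
  proof -
    have e': "0 < e / (V + 1)" using e V0 by simp
    have "uniformly_continuous_on {a..b} f" by (rule compact_uniformly_continuous[OF f]) simp
    then obtain d where d: "0 < d" "\<And>x y. x \<in> {a..b} \<Longrightarrow> y \<in> {a..b} \<Longrightarrow> dist y x < d \<Longrightarrow> dist (f y) (f x) < e / (V + 1)"
      unfolding uniformly_continuous_on_def using e' by metis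
    show ?thesis
    \<comment> \<open>Half of the modulus of continuity, because tags of overlapping cells may be
      apart by almost twice the fineness.\<close>
    proof (intro exI[of _ "d / 2"] conjI allI impI)
      fix p q assume h: "p tagged_division_of {a..b} \<and> (\<lambda>x. ball x (d / 2)) fine p \<and>
        q tagged_division_of {a..b} \<and> (\<lambda>x. ball x (d / 2)) fine q"
      have "\<bar>rs_sum f \<nu> p - rs_sum f \<nu> q\<bar> \<le> e / (V + 1) * V"
      proof (rule rs_sum_diff_le[OF V])
        fix x J y K assume xy: "(x, J) \<in> p" "(y, K) \<in> q" "interior (J \<inter> K) \<noteq> {}"
        have "dist x y < d" using fine_common_tag[of "d / 2" p q] h xy by auto
        moreover have "x \<in> {a..b}" "y \<in> {a..b}"
          using tag_in_interval[of p "{a..b}" x J] tag_in_interval[of q "{a..b}" y K] h xy by simp_all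
        ultimately show "\<bar>f x - f y\<bar> \<le> e / (V + 1)"
          using d(2)[of y x] by (simp add: dist_real_def)
      qed (use h e' in auto)
      also have "\<dots> \<le> e" using e V0 by (simp add: field_simps)
      finally show "\<bar>rs_sum f \<nu> p - rs_sum f \<nu> q\<bar> \<le> e" .
    qed (use d in auto)
  qed
  have "\<exists>p. p tagged_division_of {a..b} \<and> (\<lambda>x. ball x (1 / real (Suc n))) fine p" for n
    by (rule fine_tagged_division_exists) simp
  then obtain P where P: "\<And>n. P n tagged_division_of {a..b}" "\<And>n. (\<lambda>x. ball x (1 / real (Suc n))) fine P n"
    by metis
  have Pd: "(\<lambda>x. ball x d) fine P n" if "1 / real (Suc n) \<le> d" for n d
    using P(2)[of n] that unfolding fine_def by (force simp: subset_iff)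
  have small: "\<exists>N. \<forall>n\<ge>N. 1 / real (Suc n) \<le> d" if d0: "0 < d" for d
  proof -
    obtain N :: nat where "1 / real (Suc N) < d" by (rule nat_approx_posE[OF d0])
    then have "1 / real (Suc n) \<le> d" if "N \<le> n" for n
      using that frac_le[of 1 1 "real (Suc N)" "real (Suc n)"] by simp
    then show ?thesis by blast
  qed
  have "Cauchy (\<lambda>n. rs_sum f \<nu> (P n))"
  proof (rule metric_CauchyI)
    fix e :: real assume "0 < e"
    then obtain d where d: "0 < d" "\<And>p q. p tagged_division_of {a..b} \<and> (\<lambda>x. ball x d) fine p \<and>
      q tagged_division_of {a..b} \<and> (\<lambda>x. ball x d) fine q \<Longrightarrow> \<bar>rs_sum f \<nu> p - rs_sum f \<nu> q\<bar> \<le> e / 2"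
      using cauchy[of "e / 2"] by auto
    obtain N where N: "\<forall>n\<ge>N. 1 / real (Suc n) \<le> d" using small[OF d(1)] by blast
    show "\<exists>N. \<forall>m\<ge>N. \<forall>n\<ge>N. dist (rs_sum f \<nu> (P m)) (rs_sum f \<nu> (P n)) < e"
    proof (intro exI[of _ N] allI impI)
      fix m n assume "N \<le> m" "N \<le> n"
      then have "\<bar>rs_sum f \<nu> (P m) - rs_sum f \<nu> (P n)\<bar> \<le> e / 2"
        using N by (intro d(2) conjI P(1) Pd) simp_all
      then show "dist (rs_sum f \<nu> (P m)) (rs_sum f \<nu> (P n)) < e" using \<open>0 < e\<close> by (simp add: dist_real_def)
    qed
  qed
  then obtain I where I: "(\<lambda>n. rs_sum f \<nu> (P n)) \<longlonglongrightarrow> I" using Cauchy_convergent convergent_def by blast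
  have "has_RS_integral f \<nu> a b I"
    unfolding has_RS_integral_def
  proof (intro allI impI)
    fix e :: real assume e: "0 < e"
    then obtain d where d: "0 < d" "\<And>p q. p tagged_division_of {a..b} \<and> (\<lambda>x. ball x d) fine p \<and>
      q tagged_division_of {a..b} \<and> (\<lambda>x. ball x d) fine q \<Longrightarrow> \<bar>rs_sum f \<nu> p - rs_sum f \<nu> q\<bar> \<le> e / 2"
      using cauchy[of "e / 2"] by auto
    obtain N where N: "\<forall>n\<ge>N. 1 / real (Suc n) \<le> d" using small[OF d(1)] by blast
    show "\<exists>d>0. \<forall>p. p tagged_division_of {a..b} \<and> (\<lambda>x. ball x d) fine p \<longrightarrow>
        \<bar>(\<Sum>(x, J)\<in>p. f x * (\<nu> (Sup J) - \<nu> (Inf J))) - I\<bar> < e"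
    proof (intro exI[of _ d] conjI allI impI d(1))
      fix p assume p: "p tagged_division_of {a..b} \<and> (\<lambda>x. ball x d) fine p"
      have "(\<lambda>n. \<bar>rs_sum f \<nu> p - rs_sum f \<nu> (P n)\<bar>) \<longlonglongrightarrow> \<bar>rs_sum f \<nu> p - I\<bar>"
        by (intro tendsto_intros I)
      moreover have "\<bar>rs_sum f \<nu> p - rs_sum f \<nu> (P n)\<bar> \<le> e / 2" if "N \<le> n" for n
        using p N that by (intro d(2) conjI P(1) Pd) simp_all
      ultimately have "\<bar>rs_sum f \<nu> p - I\<bar> \<le> e / 2" by (intro LIMSEQ_le_const2) blast+
      then show "\<bar>(\<Sum>(x, J)\<in>p. f x * (\<nu> (Sup J) - \<nu> (Inf J))) - I\<bar> < e"
        using e by (simp add: rs_sum_def)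
    qed
  qed
  then show ?thesis by blast
qed

text \<open>Evaluated on one common fine division: there overlapping cells coincide, so both
  integrands are taken at the same tag. With \<open>M = 0\<close> and \<open>f = g\<close> this is
  uniqueness of the integral.\<close>

lemma has_RS_integral_diff_le:
  assumes V: "\<And>d. d division_of {a..b} \<Longrightarrow> (\<Sum>J\<in>d. \<bar>\<nu> (Sup J) - \<nu> (Inf J)\<bar>) \<le> V"
    and I: "has_RS_integral f \<nu> a b I" "has_RS_integral g \<nu> a b I'"
    and fg: "\<And>x. a \<le> x \<Longrightarrow> x \<le> b \<Longrightarrow> \<bar>f x - g x\<bar> \<le> M" and M: "0 \<le> M"
  shows "\<bar>I - I'\<bar> \<le> M * V"
proof (rule field_le_epsilon)
  fix e :: real assume "0 < e"
  then have e: "0 < e / 2" by simp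
  obtain d1 where d1: "0 < d1" "\<And>p. p tagged_division_of {a..b} \<and> (\<lambda>x. ball x d1) fine p \<Longrightarrow> \<bar>rs_sum f \<nu> p - I\<bar> < e / 2"
    using I(1) e unfolding has_RS_integral_def rs_sum_def by blast
  obtain d2 where d2: "0 < d2" "\<And>p. p tagged_division_of {a..b} \<and> (\<lambda>x. ball x d2) fine p \<Longrightarrow> \<bar>rs_sum g \<nu> p - I'\<bar> < e / 2"
    using I(2) e unfolding has_RS_integral_def rs_sum_def by blast
  obtain p where p: "p tagged_division_of {a..b}" "(\<lambda>x. ball x (min d1 d2)) fine p"
  proof -
    have "0 < min d1 d2" using d1(1) d2(1) by simp
    from fine_tagged_division_exists[OF this, of a b] show thesis by (elim exE conjE) (rule that)
  qed
  have "(\<lambda>x. ball x d1) fine p" "(\<lambda>x. ball x d2) fine p"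
    using p(2) unfolding fine_def by (force simp: subset_iff)+
  then have "\<bar>rs_sum f \<nu> p - I\<bar> < e / 2" "\<bar>rs_sum g \<nu> p - I'\<bar> < e / 2"
    using p(1) by (intro d1(2) d2(2); simp)+
  moreover have "\<bar>rs_sum f \<nu> p - rs_sum g \<nu> p\<bar> \<le> M * V"
  proof (rule rs_sum_diff_le[OF V p(1) p(1) _ M])
    fix x J y K assume xy: "(x, J) \<in> p" "(y, K) \<in> p" "interior (J \<inter> K) \<noteq> {}"
    then have "x = y" using tagged_division_ofD(5)[OF p(1) xy(1,2)] by (simp add: prod_eq_iff) metis
    then show "\<bar>f x - g y\<bar> \<le> M" using fg tag_in_interval[OF p(1) xy(1)] by auto
  qed
  ultimately show "\<bar>I - I'\<bar> \<le> M * V + e" by linarith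
qed

section \<open>Bounds for the Riemann--Stieltjes integral and for the nonlinearity\<close>

lemma has_RS_integral_RS:
  assumes ab: "a \<le> b" and V: "\<And>d. d division_of {a..b} \<Longrightarrow> (\<Sum>J\<in>d. \<bar>\<nu> (Sup J) - \<nu> (Inf J)\<bar>) \<le> V"
    and f: "continuous_on {a..b} f"
  shows "has_RS_integral f \<nu> a b (RS_integral f \<nu> a b)"
proof -
  obtain I where I: "has_RS_integral f \<nu> a b I" using has_RS_integral_exists[OF ab V f] by blast
  have "J = I" if "has_RS_integral f \<nu> a b J" for J
    using has_RS_integral_diff_le[OF V that I, of 0] by simp
  then have "RS_integral f \<nu> a b = I" unfolding RS_integral_def using I by (intro the_equality)
  then show ?thesis using I by simp
qed

lemma RS_integral_diff_le:
  assumes "a \<le> b" and V: "\<And>d. d division_of {a..b} \<Longrightarrow> (\<Sum>J\<in>d. \<bar>\<nu> (Sup J) - \<nu> (Inf J)\<bar>) \<le> V"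
    and "continuous_on {a..b} f" "continuous_on {a..b} g"
    and "\<And>x. a \<le> x \<Longrightarrow> x \<le> b \<Longrightarrow> \<bar>f x - g x\<bar> \<le> M" "0 \<le> M"
  shows "\<bar>RS_integral f \<nu> a b - RS_integral g \<nu> a b\<bar> \<le> M * V"
  by (rule has_RS_integral_diff_le[OF V has_RS_integral_RS[OF assms(1) V assms(3)]
        has_RS_integral_RS[OF assms(1) V assms(4)] assms(5,6)])

lemma RS_integral_zero: "RS_integral (\<lambda>_. 0) \<nu> a b = 0"
proof -
  have "has_RS_integral (\<lambda>_. 0) \<nu> a b 0"
    unfolding has_RS_integral_def by (auto intro!: exI[of _ 1])
  moreover have "I = 0" if "has_RS_integral (\<lambda>_. 0) \<nu> a b I" for I
  proof (rule ccontr)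
    assume "I \<noteq> 0"
    have "\<forall>e>0. \<exists>d>0. \<forall>p. p tagged_division_of {a..b} \<and> (\<lambda>x. ball x d) fine p \<longrightarrow> \<bar>0 - I\<bar> < e"
      using that unfolding has_RS_integral_def by simp
    from this[rule_format, of "\<bar>I\<bar>"] \<open>I \<noteq> 0\<close>
    obtain d where d: "0 < d" "\<forall>p. p tagged_division_of {a..b} \<and> (\<lambda>x. ball x d) fine p \<longrightarrow> \<bar>0 - I\<bar> < \<bar>I\<bar>"
      by (metis zero_less_abs_iff)
    obtain p where "p tagged_division_of {a..b}" "(\<lambda>x. ball x d) fine p"
      using fine_tagged_division_exists[OF d(1), of a b] by (elim exE conjE)
    then show False using d(2) by simp
  qed
  ultimately show ?thesis unfolding RS_integral_def by (intro the_equality)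
qed

text \<open>The cube is Lipschitz with constant 3 R^2 on the ball of radius R, and the growth bound
  follows by comparison with the zero function. One constant serves both, so that
  \<open>sdde_path\<close> can treat G abstractly.\<close>

lemma G_nl_bounds:
  assumes r: "0 < r" and "admissible_integrator r \<nu>1" "admissible_integrator r \<nu>3"
  shows "\<exists>V\<ge>0. (\<forall>f R. f \<in> delay_C r \<longrightarrow> (\<forall>\<theta>\<in>{-r..0}. \<bar>f \<theta>\<bar> \<le> R) \<longrightarrow> \<bar>G_nl r \<nu>1 \<nu>3 f\<bar> \<le> V * (R + R ^ 3)) \<and>
    (\<forall>f g R M. f \<in> delay_C r \<longrightarrow> g \<in> delay_C r \<longrightarrow> (\<forall>\<theta>\<in>{-r..0}. \<bar>f \<theta>\<bar> \<le> R) \<longrightarrow> (\<forall>\<theta>\<in>{-r..0}. \<bar>g \<theta>\<bar> \<le> R) \<longrightarrow>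
      (\<forall>\<theta>\<in>{-r..0}. \<bar>f \<theta> - g \<theta>\<bar> \<le> M) \<longrightarrow> \<bar>G_nl r \<nu>1 \<nu>3 f - G_nl r \<nu>1 \<nu>3 g\<bar> \<le> V * (1 + 3 * R\<^sup>2) * M)"
proof -
  obtain V1 where V1: "\<And>d. d division_of {-r..0} \<Longrightarrow> (\<Sum>J\<in>d. \<bar>\<nu>1 (Sup J) - \<nu>1 (Inf J)\<bar>) \<le> V1"
    using assms(2) unfolding admissible_integrator_def bounded_variation_on_def by blast
  obtain V3 where V3: "\<And>d. d division_of {-r..0} \<Longrightarrow> (\<Sum>J\<in>d. \<bar>\<nu>3 (Sup J) - \<nu>3 (Inf J)\<bar>) \<le> V3"
    using assms(3) unfolding admissible_integrator_def bounded_variation_on_def by blast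
  have V0: "0 \<le> V1" "0 \<le> V3"
    using order_trans[OF sum_nonneg V1[OF division_of_self[of "-r" 0, unfolded box_real]]]
      order_trans[OF sum_nonneg V3[OF division_of_self[of "-r" 0, unfolded box_real]]] r by auto
  have r': "-r \<le> 0" using r by simp
  let ?V = "V1 + V3"
  have lip: "\<bar>G_nl r \<nu>1 \<nu>3 f - G_nl r \<nu>1 \<nu>3 g\<bar> \<le> M * V1 + D * V3"
    if fg: "f \<in> delay_C r" "g \<in> delay_C r" and M: "\<And>\<theta>. -r \<le> \<theta> \<Longrightarrow> \<theta> \<le> 0 \<Longrightarrow> \<bar>f \<theta> - g \<theta>\<bar> \<le> M"
      and D: "\<And>\<theta>. -r \<le> \<theta> \<Longrightarrow> \<theta> \<le> 0 \<Longrightarrow> \<bar>f \<theta> ^ 3 - g \<theta> ^ 3\<bar> \<le> D" for f g M D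
  proof -
    have c: "continuous_on {-r..0} f" "continuous_on {-r..0} g" using fg by (auto simp: delay_C_def)
    have MD: "0 \<le> M" "0 \<le> D" using order_trans[OF abs_ge_zero M[OF r' order.refl]] order_trans[OF abs_ge_zero D[OF r' order.refl]] by auto
    have "\<bar>RS_integral f \<nu>1 (-r) 0 - RS_integral g \<nu>1 (-r) 0\<bar> \<le> M * V1"
      by (rule RS_integral_diff_le[OF r' V1 c M MD(1)])
    moreover have "\<bar>RS_integral (\<lambda>\<theta>. f \<theta> ^ 3) \<nu>3 (-r) 0 - RS_integral (\<lambda>\<theta>. g \<theta> ^ 3) \<nu>3 (-r) 0\<bar> \<le> D * V3"
      by (rule RS_integral_diff_le[OF r' V3]) (auto intro!: continuous_intros c D MD)
    ultimately show ?thesis unfolding G_nl_def by linarith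
  qed
  have G0: "G_nl r \<nu>1 \<nu>3 (\<lambda>_. 0) = 0" by (simp add: G_nl_def RS_integral_zero)
  show ?thesis
  proof (intro exI[of _ ?V] conjI allI impI)
    fix f R assume f: "f \<in> delay_C r" "\<forall>\<theta>\<in>{-r..0}. \<bar>f \<theta>\<bar> \<le> R"
    have R: "0 \<le> R" using order_trans[OF abs_ge_zero f(2)[rule_format, of 0]] r by simp
    have "\<bar>G_nl r \<nu>1 \<nu>3 f - G_nl r \<nu>1 \<nu>3 (\<lambda>_. 0)\<bar> \<le> R * V1 + R ^ 3 * V3"
      using f by (intro lip) (auto simp: delay_C_def power_abs intro!: power_mono)
    also have "\<dots> \<le> ?V * (R + R ^ 3)" using V0 R by (simp add: algebra_simps)
    finally show "\<bar>G_nl r \<nu>1 \<nu>3 f\<bar> \<le> ?V * (R + R ^ 3)" by (simp add: G0)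
  next
    fix f g R M
    assume fg: "f \<in> delay_C r" "g \<in> delay_C r" "\<forall>\<theta>\<in>{-r..0}. \<bar>f \<theta>\<bar> \<le> R" "\<forall>\<theta>\<in>{-r..0}. \<bar>g \<theta>\<bar> \<le> R"
      and M: "\<forall>\<theta>\<in>{-r..0}. \<bar>f \<theta> - g \<theta>\<bar> \<le> M"
    have R: "0 \<le> R" using order_trans[OF abs_ge_zero fg(3)[rule_format, of 0]] r by simp
    have M0: "0 \<le> M" using order_trans[OF abs_ge_zero M[rule_format, of 0]] r by simp
    have cube: "\<bar>f \<theta> ^ 3 - g \<theta> ^ 3\<bar> \<le> 3 * R\<^sup>2 * M" if "-r \<le> \<theta>" "\<theta> \<le> 0" for \<theta>
    proof -
      have b: "\<bar>f \<theta>\<bar> \<le> R" "\<bar>g \<theta>\<bar> \<le> R" "\<bar>f \<theta> - g \<theta>\<bar> \<le> M" using fg M that by auto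
      have "\<bar>f \<theta> * f \<theta>\<bar> \<le> R * R" "\<bar>f \<theta> * g \<theta>\<bar> \<le> R * R" "\<bar>g \<theta> * g \<theta>\<bar> \<le> R * R"
        unfolding abs_mult using b R by (intro mult_mono; simp)+
      then have s: "\<bar>f \<theta> * f \<theta> + f \<theta> * g \<theta> + g \<theta> * g \<theta>\<bar> \<le> 3 * (R * R)" by linarith
      have "f \<theta> ^ 3 - g \<theta> ^ 3 = (f \<theta> * f \<theta> + f \<theta> * g \<theta> + g \<theta> * g \<theta>) * (f \<theta> - g \<theta>)"
        by (simp add: power3_eq_cube algebra_simps)
      also have "\<bar>\<dots>\<bar> \<le> 3 * (R * R) * M" unfolding abs_mult using s b R by (intro mult_mono) auto
      finally show ?thesis by (simp add: power2_eq_square)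
    qed
    have "\<bar>G_nl r \<nu>1 \<nu>3 f - G_nl r \<nu>1 \<nu>3 g\<bar> \<le> M * V1 + 3 * R\<^sup>2 * M * V3"
      by (rule lip[OF fg(1,2) _ cube]) (use M in auto)
    also have "\<dots> \<le> ?V * (1 + 3 * R\<^sup>2) * M" using V0 R M0 by (simp add: algebra_simps)
    finally show "\<bar>G_nl r \<nu>1 \<nu>3 f - G_nl r \<nu>1 \<nu>3 g\<bar> \<le> ?V * (1 + 3 * R\<^sup>2) * M" .
  qed (use V0 in auto)
qed

section \<open>Modulus of continuity of the Wiener process\<close>

text \<open>Markov's inequality for the moment of order 2m. The exponent is left free: a large m
  buys any power of the small parameter.\<close>

lemma (in prob_space) normal_tail_bound:
  assumes X: "distributed M lborel X (normal_density 0 \<sigma>)" and \<sigma>: "0 < \<sigma>" and c: "0 < c"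
  shows "measure M {w \<in> space M. c < \<bar>X w\<bar>} \<le> fact (2 * m) / (2 ^ m * fact m) * (\<sigma> / c) ^ (2 * m)"
proof -
  let ?K = "fact (2 * m) / (2 ^ m * fact m) :: real"
  have [measurable]: "X \<in> borel_measurable M" using distributed_measurable[OF X] by simp
  have i: "integrable M (\<lambda>w. X w ^ (2 * m))"
    using distributed_integrable[OF X, of "\<lambda>x. x ^ (2 * m)"] integrable_normal_moment[OF \<sigma>, of 0 "2 * m"] by simp
  have e: "(\<integral>w. X w ^ (2 * m) \<partial>M) = ?K * \<sigma> ^ (2 * m)"
  proof -
    have "(\<integral>w. X w ^ (2 * m) \<partial>M) = (\<integral>x. normal_density 0 \<sigma> x * x ^ (2 * m) \<partial>lborel)"
      using distributed_integral[OF X, of "\<lambda>x. x ^ (2 * m)"] by simp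
    also have "\<dots> = fact (2 * m) / ((2 / \<sigma>\<^sup>2) ^ m * fact m)"
      using has_bochner_integral_integral_eq[OF normal_moment_even[OF \<sigma>, of 0 m]] by simp
    also have "\<dots> = ?K * \<sigma> ^ (2 * m)" using \<sigma> by (simp add: power_divide flip: power_mult)
    finally show ?thesis .
  qed
  have "measure M {w \<in> space M. c < \<bar>X w\<bar>} \<le> measure M {w \<in> space M. c ^ (2 * m) \<le> X w ^ (2 * m)}"
  proof (intro finite_measure_mono subsetI; clarsimp)
    fix w assume "c < \<bar>X w\<bar>"
    then have "c ^ (2 * m) \<le> \<bar>X w\<bar> ^ (2 * m)" using c by (intro power_mono) auto
    then show "c ^ (2 * m) \<le> X w ^ (2 * m)" by (simp add: power_even_abs)
  qed
  also have "\<dots> \<le> (\<integral>w. X w ^ (2 * m) \<partial>M) / c ^ (2 * m)"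
    by (rule integral_Markov_inequality_measure[OF i]) (use c in auto)
  finally show ?thesis unfolding e by (simp add: power_divide)
qed

text \<open>A dyadic point of level n + 1 is either of level n or the right neighbour of such a
  point, so each level adds at most one increment.\<close>

lemma dyadic_chain:
  fixes f :: "real \<Rightarrow> real"
  assumes h: "\<And>n i. i < 2 ^ n \<Longrightarrow> \<bar>f (u + real (Suc i) * (h / 2 ^ n)) - f (u + real i * (h / 2 ^ n))\<bar> \<le> c * (9/10) ^ n"
    and c: "0 \<le> c" and i: "i \<le> 2 ^ n"
  shows "\<bar>f (u + real i * (h / 2 ^ n)) - f u\<bar> \<le> (\<Sum>k\<le>n. c * (9/10) ^ k)"
  using i
proof (induction n arbitrary: i)
  case 0
  then have "i = 0 \<or> i = 1" by auto
  then show ?case using h[of 0 0] c by auto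
next
  case (Suc n)
  let ?j = "i div 2"
  have half: "u + real (2 * j) * (h / 2 ^ Suc n) = u + real j * (h / 2 ^ n)" for j by simp
  have j: "?j \<le> 2 ^ n" using Suc.prems by simp
  note IH = Suc.IH[OF j]
  have c': "0 \<le> c * (9/10) ^ Suc n" using c by simp
  show ?case
  proof (cases "even i")
    case True
    then have "i = 2 * ?j" by simp
    then have "u + real i * (h / 2 ^ Suc n) = u + real ?j * (h / 2 ^ n)" using half[of ?j] by simp
    then show ?thesis using IH c' by simp
  next
    case False
    then have i: "i = Suc (2 * ?j)" by simp
    then have "2 * ?j < 2 ^ Suc n" using Suc.prems by linarith
    from h[OF this] have "\<bar>f (u + real i * (h / 2 ^ Suc n)) - f (u + real ?j * (h / 2 ^ n))\<bar> \<le> c * (9/10) ^ Suc n"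
      unfolding half i[symmetric] .
    then show ?thesis using IH by (simp del: power_Suc)
  qed
qed

text \<open>Along the left dyadic approximations of s the chain is bounded by the geometric series
  (\<eta>/10)(1 + 9/10 + ...) = \<eta>, and continuity passes to s.\<close>

lemma dyadic_modulus:
  fixes f :: "real \<Rightarrow> real"
  assumes h: "\<And>n i. i < 2 ^ n \<Longrightarrow> \<bar>f (u + real (Suc i) * (h / 2 ^ n)) - f (u + real i * (h / 2 ^ n))\<bar> \<le> \<eta> / 10 * (9/10) ^ n"
    and \<eta>: "0 \<le> \<eta>" and h0: "0 < h" and cont: "continuous_on {u..u + h} f" and s: "u \<le> s" "s \<le> u + h"
  shows "\<bar>f s - f u\<bar> \<le> \<eta>"
proof -
  define i where "i n = nat \<lfloor>(s - u) / h * 2 ^ n\<rfloor>" for n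
  define d where "d n = u + real (i n) * (h / 2 ^ n)" for n
  have x: "0 \<le> (s - u) / h" "(s - u) / h \<le> 1" using s h0 by auto
  have xn: "0 \<le> (s - u) / h * 2 ^ n" for n using x(1) by (intro mult_nonneg_nonneg) auto
  have il: "real (i n) \<le> (s - u) / h * 2 ^ n" "(s - u) / h * 2 ^ n < real (i n) + 1" for n
    unfolding i_def using xn[of n] by (auto simp: of_nat_nat) 
  have ib: "i n \<le> 2 ^ n" for n
  proof -
    have "(s - u) / h * 2 ^ n \<le> 1 * 2 ^ n" using x by (intro mult_right_mono) auto
    then have "real (i n) \<le> 2 ^ n" using il(1)[of n] by linarith
    then have "real (i n) \<le> real (2 ^ n)" by simp
    then show ?thesis using of_nat_le_iff by blast
  qed
  have dl: "d n \<le> s" "s - d n \<le> h / 2 ^ n" for n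
  proof -
    have p: "0 < h / 2 ^ n" using h0 by simp
    have e: "(s - u) / h * 2 ^ n * (h / 2 ^ n) = s - u" using h0 by simp
    have "real (i n) * (h / 2 ^ n) \<le> s - u"
      using mult_right_mono[OF il(1)[of n] less_imp_le[OF p]] e by simp
    then show "d n \<le> s" by (simp add: d_def)
    have "s - u \<le> (real (i n) + 1) * (h / 2 ^ n)"
      using mult_right_mono[OF less_imp_le[OF il(2)[of n]] less_imp_le[OF p]] e by simp
    then show "s - d n \<le> h / 2 ^ n" by (simp add: d_def distrib_right add_divide_distrib)
  qed
  have ud: "u \<le> d n" for n using h0 by (simp add: d_def)
  have "(\<lambda>n. h / 2 ^ n) \<longlonglongrightarrow> 0" by (intro LIMSEQ_divide_realpow_zero) simp
  then have "(\<lambda>n. d n - s) \<longlonglongrightarrow> 0"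
  proof (rule Lim_null_comparison[rotated], intro always_eventually allI)
    fix n show "norm (d n - s) \<le> h / 2 ^ n" unfolding real_norm_def using dl[of n] by linarith
  qed
  then have ds: "d \<longlonglongrightarrow> s" by (rule LIM_zero_cancel)
  have "(\<lambda>n. f (d n)) \<longlonglongrightarrow> f s"
  proof (rule continuous_on_tendsto_compose[OF cont ds])
    show "\<forall>\<^sub>F n in sequentially. d n \<in> {u..u + h}"
      using ud dl s by (auto intro!: always_eventually intro: order_trans)
  qed (use s in auto)
  then have "(\<lambda>n. \<bar>f (d n) - f u\<bar>) \<longlonglongrightarrow> \<bar>f s - f u\<bar>" by (intro tendsto_intros)
  moreover have "\<bar>f (d n) - f u\<bar> \<le> \<eta>" for n
  proof -
    have "\<bar>f (d n) - f u\<bar> \<le> (\<Sum>k\<le>n. \<eta> / 10 * (9/10) ^ k)"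
      unfolding d_def by (rule dyadic_chain[OF h _ ib]) (use \<eta> in auto)
    also have "\<dots> = \<eta> / 10 * (\<Sum>k<Suc n. (9/10) ^ k)" by (simp only: sum_distrib_left lessThan_Suc_atMost)
    also have "\<dots> \<le> \<eta> / 10 * 10"
    proof (intro mult_left_mono)
      have "(\<Sum>k<Suc n. (9/10 :: real) ^ k) = (1 - (9/10) ^ Suc n) * 10"
        by (subst sum_gp_strict) simp
      also have "\<dots> \<le> 10" by simp
      finally show "(\<Sum>k<Suc n. (9/10 :: real) ^ k) \<le> 10" .
    qed (use \<eta> in auto)
    finally show ?thesis by simp
  qed
  ultimately show ?thesis by (intro LIMSEQ_le_const2) auto
qed

text \<open>Level n has 2^n increments of variance h/2^n and tolerance (\<eta>/10)(9/10)^n; variance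
  over squared tolerance is (100 h/\<eta>^2)(50/81)^n. For m \<ge> 2 the bounds for the levels decay
  with ratio 2(50/81)^m \<le> 4/5, whence the factor 5.\<close>

lemma wiener_block_modulus:
  assumes W: "wiener_process M W" and u: "0 \<le> u" and h: "0 < h" and \<eta>: "0 < \<eta>" and m: "2 \<le> m"
  shows "\<exists>N\<in>sets M. measure M N \<le> 5 * (fact (2 * m) / (2 ^ m * fact m)) * (100 * h / \<eta>\<^sup>2) ^ m \<and>
    (\<forall>w\<in>space M - N. \<forall>s\<in>{u..u + h}. \<bar>W s w - W u w\<bar> \<le> \<eta>)"
proof -
  interpret prob_space M using W by (simp add: wiener_process_def)
  let ?K = "fact (2 * m) / (2 ^ m * fact m) :: real"
  let ?A = "100 * h / \<eta>\<^sup>2"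
  have Wm: "W t \<in> borel_measurable M" if "0 \<le> t" for t using W that by (simp add: wiener_process_def)
  define p where "p n i = u + real i * (h / 2 ^ n)" for n i :: nat
  have p0: "0 \<le> p n i" for n i using u h by (simp add: p_def)
  define c where "c n = \<eta> / 10 * (9/10) ^ n" for n :: nat
  have c0: "0 < c n" for n using \<eta> by (simp add: c_def)
  define E where "E n i = {w \<in> space M. c n < \<bar>W (p n (Suc i)) w - W (p n i) w\<bar>}" for n i
  define F where "F n = (\<Union>i<2 ^ n. E n i)" for n :: nat
  define N where "N = (\<Union>n. F n)"
  have Es: "E n i \<in> sets M" for n i
    unfolding E_def using Wm[OF p0[of n "Suc i"]] Wm[OF p0[of n i]] by measurable
  have Fs: "F n \<in> sets M" for n unfolding F_def using Es by auto
  have Emeas: "measure M (E n i) \<le> ?K * (?A * (50/81) ^ n) ^ m" for n i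
  proof -
    have d: "distributed M lborel (\<lambda>w. W (p n (Suc i)) w - W (p n i) w) (normal_density 0 (sqrt (h / 2 ^ n)))"
    proof -
      have "p n (Suc i) - p n i = h / 2 ^ n" by (simp add: p_def algebra_simps add_divide_distrib)
      moreover have "0 < h / 2 ^ n" using h by simp
      moreover from calculation have "p n i < p n (Suc i)" by linarith
      ultimately show ?thesis using W p0[of n i] unfolding wiener_process_def by metis
    qed
    have "measure M (E n i) \<le> ?K * (sqrt (h / 2 ^ n) / c n) ^ (2 * m)"
      unfolding E_def by (rule normal_tail_bound[OF d]) (use h c0 in auto)
    also have "(sqrt (h / 2 ^ n) / c n) ^ (2 * m) = ((sqrt (h / 2 ^ n) / c n)\<^sup>2) ^ m" by (simp add: power_mult)
    also have "(sqrt (h / 2 ^ n) / c n)\<^sup>2 = ?A * (50/81) ^ n"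
    proof -
      have "(50/81 :: real) ^ n * 2 ^ n * ((9/10) ^ n)\<^sup>2 = 1"
        by (simp only: power_mult_distrib[symmetric] power_even_eq[symmetric] power_commutes flip: power_mult)
           (simp add: power_mult_distrib[symmetric] power_mult mult.commute power2_eq_square)
      then show ?thesis
        using h \<eta> by (simp add: power_divide c_def power_mult_distrib field_simps)
    qed
    finally show ?thesis .
  qed
  have K0: "0 \<le> ?K" by simp
  have A0: "0 \<le> ?A" using h by simp
  let ?q = "2 * (50/81 :: real) ^ m"
  have q: "0 \<le> ?q" "?q \<le> 4/5"
  proof -
    have "(50/81 :: real) ^ m \<le> (50/81) ^ 2" using m by (intro power_decreasing) auto
    also have "\<dots> \<le> 2/5" by (simp add: power2_eq_square)
    finally show "?q \<le> 4/5" by simp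
  qed simp
  have Fmeas: "measure M (F n) \<le> ?K * ?A ^ m * ?q ^ n" for n
  proof -
    have "measure M (F n) \<le> (\<Sum>i<2 ^ n. measure M (E n i))"
      unfolding F_def by (rule finite_measure_subadditive_finite) (use Es in auto)
    also have "\<dots> \<le> (\<Sum>i<(2::nat) ^ n. ?K * (?A * (50/81) ^ n) ^ m)" by (intro sum_mono Emeas)
    also have "\<dots> = ?K * ?A ^ m * ?q ^ n"
    proof -
      have "(?A * (50/81) ^ n) ^ m = ?A ^ m * ((50/81) ^ m) ^ n"
        by (simp only: power_mult_distrib power_mult[symmetric] mult.commute[of n m])
      then have "(\<Sum>i<(2::nat) ^ n. ?K * (?A * (50/81) ^ n) ^ m) = 2 ^ n * (?K * (?A ^ m * ((50/81) ^ m) ^ n))"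
        by simp
      also have "\<dots> = ?K * ?A ^ m * ?q ^ n" unfolding power_mult_distrib[of 2] by simp
      finally show ?thesis .
    qed
    finally show ?thesis .
  qed
  have sq: "summable (\<lambda>n. ?K * ?A ^ m * ?q ^ n)"
    using q by (intro summable_mult summable_geometric) auto
  have sF: "summable (\<lambda>n. measure M (F n))"
    by (rule summable_comparison_test'[OF sq]) (use Fmeas in auto)
  have "measure M N \<le> (\<Sum>n. measure M (F n))"
    unfolding N_def by (rule finite_measure_subadditive_countably) (use Fs sF in auto)
  also have "\<dots> \<le> (\<Sum>n. ?K * ?A ^ m * ?q ^ n)" by (rule suminf_le[OF Fmeas sF sq])
  also have "\<dots> = ?K * ?A ^ m * (1 / (1 - ?q))"
    using q by (subst suminf_mult) (auto intro!: summable_geometric simp: suminf_geometric)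
  also have "\<dots> \<le> ?K * ?A ^ m * 5"
  proof (intro mult_left_mono)
    have "1 / (1 - z) \<le> 5" if "z \<le> 4/5" for z :: real using that by (simp add: field_simps)
    from this[OF q(2)] show "1 / (1 - ?q) \<le> 5" .
  qed (use K0 A0 in auto)
  finally have mN: "measure M N \<le> 5 * ?K * ?A ^ m" by (simp add: mult_ac)
  show ?thesis
  proof (intro bexI[of _ N] conjI mN ballI)
    show "N \<in> sets M" unfolding N_def using Fs by auto
    fix w s assume w: "w \<in> space M - N" and s: "s \<in> {u..u + h}"
    show "\<bar>W s w - W u w\<bar> \<le> \<eta>"
    proof (rule dyadic_modulus[where f="\<lambda>t. W t w" and u=u and h=h])
      fix n i assume i: "i < (2::nat) ^ n"
      have "w \<notin> E n i" using w i unfolding N_def F_def by blast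
      then show "\<bar>W (u + real (Suc i) * (h / 2 ^ n)) w - W (u + real i * (h / 2 ^ n)) w\<bar> \<le> \<eta> / 10 * (9/10) ^ n"
        using w by (simp add: E_def p_def c_def)
    next
      have "continuous_on {0..} (\<lambda>t. W t w)" using W w by (simp add: wiener_process_def)
      then show "continuous_on {u..u + h} (\<lambda>t. W t w)" by (rule continuous_on_subset) (use u in auto)
    qed (use \<eta> h s in auto)
  qed
qed

text \<open>The blocks containing s and t start at most (t - s)/d + 1 blocks apart, and the two end
  pieces cost one \<eta> each.\<close>

lemma block_modulus_global:
  fixes f :: "real \<Rightarrow> real"
  assumes e: "0 < d" and \<eta>: "0 \<le> \<eta>"
    and blk: "\<And>j s. real j * d \<le> T \<Longrightarrow> real j * d \<le> s \<Longrightarrow> s \<le> real j * d + d \<Longrightarrow> \<bar>f s - f (real j * d)\<bar> \<le> \<eta>"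
    and s: "0 \<le> s" "s \<le> t" "t \<le> T"
  shows "\<bar>f t - f s\<bar> \<le> \<eta> * (3 + (t - s) / d)"
proof -
  define a where "a = nat \<lfloor>s / d\<rfloor>"
  define b where "b = nat \<lfloor>t / d\<rfloor>"
  have fl: "real (nat \<lfloor>x / d\<rfloor>) * d \<le> x \<and> x \<le> real (nat \<lfloor>x / d\<rfloor>) * d + d" if "0 \<le> x" for x
  proof -
    have "0 \<le> x / d" using that e by simp
    then have "real (nat \<lfloor>x / d\<rfloor>) \<le> x / d" "x / d < real (nat \<lfloor>x / d\<rfloor>) + 1" by (auto simp: of_nat_nat)
    then show ?thesis using e by (auto simp: field_simps)
  qed
  have A: "real a * d \<le> s" "s \<le> real a * d + d" using fl[of s] s unfolding a_def by blast+
  have B: "real b * d \<le> t" "t \<le> real b * d + d" using fl[of t] order_trans[OF s(1,2)] unfolding b_def by blast+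
  have ab: "a \<le> b" unfolding a_def b_def using s e by (intro nat_mono floor_mono divide_right_mono) auto
  have chain: "\<bar>f (real (a + n) * d) - f (real a * d)\<bar> \<le> real n * \<eta>" if "real (a + n) * d \<le> T" for n
    using that
  proof (induction n)
    case (Suc n)
    have l: "real (a + n) * d \<le> T" using Suc.prems e by (simp add: algebra_simps)
    have "\<bar>f (real (a + Suc n) * d) - f (real (a + n) * d)\<bar> \<le> \<eta>"
      by (rule blk[OF l]) (use e in \<open>auto simp: algebra_simps\<close>)
    then show ?case using Suc.IH[OF l] by (simp add: algebra_simps)
  qed simp
  have "\<bar>f (real b * d) - f (real a * d)\<bar> \<le> real (b - a) * \<eta>"
    using chain[of "b - a"] ab B s by simp
  moreover have "\<bar>f t - f (real b * d)\<bar> \<le> \<eta>" using blk[of b t] B s by simp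
  moreover have "\<bar>f s - f (real a * d)\<bar> \<le> \<eta>" using blk[of a s] A s by simp
  ultimately have "\<bar>f t - f s\<bar> \<le> \<eta> * (2 + real (b - a))" by (simp add: algebra_simps)
  also have "\<dots> \<le> \<eta> * (3 + (t - s) / d)"
  proof (intro mult_left_mono \<eta>)
    have "(real b - real a) * d \<le> (t - s) + d" using A B by (simp add: algebra_simps)
    then have "real b - real a \<le> (t - s) / d + 1" using e by (simp add: field_simps)
    then show "2 + real (b - a) \<le> 3 + (t - s) / d" using ab by (simp add: of_nat_diff)
  qed
  finally show ?thesis .
qed

text \<open>About T/\<epsilon>^2 blocks of length \<epsilon>^2, each failing with probability of the
  order of \<epsilon> to the power (2 - 2b) m; m is chosen to make this exponent at least 3, which
  leaves O(\<epsilon>) after the union bound.\<close>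

lemma wiener_modulus:
  assumes W: "wiener_process M W" and T: "0 < T" and b: "b < 1"
  shows "\<exists>K\<ge>0. \<forall>\<epsilon>. 0 < \<epsilon> \<and> \<epsilon> < 1 \<longrightarrow> (\<exists>N\<in>sets M. measure M N \<le> K * \<epsilon> \<and>
    (\<forall>w\<in>space M - N. \<forall>s t. 0 \<le> s \<and> s \<le> t \<and> t \<le> T \<longrightarrow>
      \<bar>W t w - W s w\<bar> \<le> \<epsilon> powr b * (3 + (t - s) / \<epsilon>\<^sup>2)))"
proof -
  interpret prob_space M using W by (simp add: wiener_process_def)
  obtain m0 :: nat where m0: "3 / (2 - 2 * b) \<le> real m0" using real_arch_simple by blast
  define m where "m = max 2 m0"
  have m: "2 \<le> m" "3 \<le> (2 - 2 * b) * real m"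
  proof -
    have "3 / (2 - 2 * b) \<le> real m" using m0 by (simp add: m_def)
    then show "3 \<le> (2 - 2 * b) * real m" using b by (simp add: field_simps)
  qed (simp add: m_def)
  define K0 where "K0 = 5 * (fact (2 * m) / (2 ^ m * fact m)) * (100::real) ^ m"
  have K0: "0 \<le> K0" by (simp add: K0_def)
  show ?thesis
  proof (intro exI[of _ "(T + 1) * K0"] conjI allI impI)
    fix \<epsilon> :: real assume "0 < \<epsilon> \<and> \<epsilon> < 1"
    then have e: "0 < \<epsilon>" "\<epsilon> < 1" by auto
    have e2: "0 < \<epsilon>\<^sup>2" using e by simp
    let ?\<eta> = "\<epsilon> powr b"
    have \<eta>: "0 < ?\<eta>" using e by simp
    have "\<forall>j::nat. \<exists>N\<in>sets M. measure M N \<le> 5 * (fact (2 * m) / (2 ^ m * fact m)) * (100 * \<epsilon>\<^sup>2 / ?\<eta>\<^sup>2) ^ m \<and>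
      (\<forall>w\<in>space M - N. \<forall>s\<in>{real j * \<epsilon>\<^sup>2..real j * \<epsilon>\<^sup>2 + \<epsilon>\<^sup>2}. \<bar>W s w - W (real j * \<epsilon>\<^sup>2) w\<bar> \<le> ?\<eta>)"
      using e by (intro allI wiener_block_modulus[OF W _ e2 \<eta> m(1)]) simp
    then obtain N where N: "\<And>j. N j \<in> sets M"
      "\<And>j. measure M (N j) \<le> 5 * (fact (2 * m) / (2 ^ m * fact m)) * (100 * \<epsilon>\<^sup>2 / ?\<eta>\<^sup>2) ^ m"
      "\<And>j w s. w \<in> space M - N j \<Longrightarrow> s \<in> {real j * \<epsilon>\<^sup>2..real j * \<epsilon>\<^sup>2 + \<epsilon>\<^sup>2} \<Longrightarrow> \<bar>W s w - W (real j * \<epsilon>\<^sup>2) w\<bar> \<le> ?\<eta>"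
      by metis
    have Nb: "measure M (N j) \<le> K0 * \<epsilon> ^ 3" for j
    proof -
      have a: "\<epsilon> powr 2 = \<epsilon>\<^sup>2" using e by simp
      have bq: "?\<eta>\<^sup>2 = \<epsilon> powr (2 * b)" by (simp add: power2_eq_square flip: powr_add)
      have "100 * \<epsilon>\<^sup>2 / ?\<eta>\<^sup>2 = 100 * \<epsilon> powr (2 - 2 * b)"
        unfolding powr_diff a bq by simp
      moreover have "(\<epsilon> powr (2 - 2 * b)) ^ m = \<epsilon> powr ((2 - 2 * b) * real m)"
        by (subst powr_realpow[symmetric]) (use e in \<open>auto simp: powr_powr\<close>)
      ultimately have "(100 * \<epsilon>\<^sup>2 / ?\<eta>\<^sup>2) ^ m = 100 ^ m * \<epsilon> powr ((2 - 2 * b) * real m)"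
        by (simp only: power_mult_distrib)
      also have "\<dots> \<le> 100 ^ m * \<epsilon> powr 3"
        using e m(2) by (intro mult_left_mono powr_mono') auto
      also have "\<epsilon> powr 3 = \<epsilon> ^ 3" using e by (simp add: powr_numeral)
      finally have "(100 * \<epsilon>\<^sup>2 / ?\<eta>\<^sup>2) ^ m \<le> 100 ^ m * \<epsilon> ^ 3" .
      then have "5 * (fact (2 * m) / (2 ^ m * fact m)) * (100 * \<epsilon>\<^sup>2 / ?\<eta>\<^sup>2) ^ m
          \<le> 5 * (fact (2 * m) / (2 ^ m * fact m)) * (100 ^ m * \<epsilon> ^ 3)"
        by (intro mult_left_mono) auto
      then show ?thesis using N(2)[of j] by (simp add: K0_def mult.assoc)
    qed
    define J where "J = nat \<lfloor>T / \<epsilon>\<^sup>2\<rfloor>"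
    have J: "real (Suc J) \<le> (T + 1) / \<epsilon>\<^sup>2"
    proof -
      have "0 \<le> T / \<epsilon>\<^sup>2" using T e2 by simp
      then have "real J \<le> T / \<epsilon>\<^sup>2" unfolding J_def by (auto simp: of_nat_nat)
      moreover have "1 \<le> 1 / \<epsilon>\<^sup>2" using e by (simp add: power_le_one)
      ultimately show ?thesis by (simp add: add_divide_distrib)
    qed
    have Jj: "j \<le> J" if "real j * \<epsilon>\<^sup>2 \<le> T" for j
    proof -
      have "real j \<le> T / \<epsilon>\<^sup>2" using that e2 by (simp add: field_simps)
      then show ?thesis unfolding J_def by (simp add: le_nat_floor)
    qed
    let ?N = "\<Union>j<Suc J. N j"
    show "\<exists>N\<in>sets M. measure M N \<le> (T + 1) * K0 * \<epsilon> \<and>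
      (\<forall>w\<in>space M - N. \<forall>s t. 0 \<le> s \<and> s \<le> t \<and> t \<le> T \<longrightarrow>
      \<bar>W t w - W s w\<bar> \<le> \<epsilon> powr b * (3 + (t - s) / \<epsilon>\<^sup>2))"
    proof (intro bexI[of _ ?N] conjI ballI allI impI)
      show "?N \<in> sets M" using N(1) by auto
      have "measure M ?N \<le> (\<Sum>j<Suc J. measure M (N j))"
        by (rule finite_measure_subadditive_finite) (use N(1) in auto)
      also have "\<dots> \<le> (\<Sum>j<Suc J. K0 * \<epsilon> ^ 3)" by (intro sum_mono Nb)
      also have "\<dots> = real (Suc J) * (K0 * \<epsilon> ^ 3)" by simp
      also have "\<dots> \<le> (T + 1) / \<epsilon>\<^sup>2 * (K0 * \<epsilon> ^ 3)" using K0 e by (intro mult_right_mono J) auto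
      also have "\<dots> = (T + 1) * K0 * \<epsilon>" using e by (simp add: power2_eq_square power3_eq_cube)
      finally show "measure M ?N \<le> (T + 1) * K0 * \<epsilon>" .
      fix w s t assume w: "w \<in> space M - ?N" and st: "0 \<le> s \<and> s \<le> t \<and> t \<le> T"
      show "\<bar>W t w - W s w\<bar> \<le> \<epsilon> powr b * (3 + (t - s) / \<epsilon>\<^sup>2)"
      proof (rule block_modulus_global[OF e2, where f="\<lambda>t. W t w"])
        fix j :: nat and s assume "real j * \<epsilon>\<^sup>2 \<le> T" "real j * \<epsilon>\<^sup>2 \<le> s" "s \<le> real j * \<epsilon>\<^sup>2 + \<epsilon>\<^sup>2"
        then show "\<bar>W s w - W (real j * \<epsilon>\<^sup>2) w\<bar> \<le> ?\<eta>"
          using w Jj[of j] by (intro N(3)) auto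
      qed (use st in auto)
    qed
  qed (use K0 T in auto)
qed

section \<open>Wiener integrals of smooth integrands\<close>

text \<open>On a cell [a,b] the summand differs from the increment of \<open>H\<close> by the
  integral of (g s - g b) f' s, which uniform continuity of g makes small relative to the cell
  length. The smoothness lies in f, so g may be a Wiener path.\<close>

lemma left_sums_by_parts:
  fixes f :: "real \<Rightarrow> 'b::euclidean_space" and g :: "real \<Rightarrow> real"
  assumes t: "0 \<le> t" and g: "continuous_on {0..t} g"
    and f: "\<And>s. 0 \<le> s \<Longrightarrow> s \<le> t \<Longrightarrow> (f has_vector_derivative f' s) (at s within {0..t})"
    and f': "continuous_on {0..t} f'"
  shows "(\<lambda>n. \<Sum>i<Suc n. (g (real (Suc i) * (t / real (Suc n))) - g (real i * (t / real (Suc n)))) *\<^sub>R f (real i * (t / real (Suc n))))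
    \<longlonglongrightarrow> g t *\<^sub>R f t - g 0 *\<^sub>R f 0 - (LINT s:{0..t}|lborel. g s *\<^sub>R f' s)"
proof -
  have gf: "continuous_on {0..t} (\<lambda>s. g s *\<^sub>R f' s)" by (intro continuous_intros g f')
  have int: "set_integrable lborel {a..b} h" if "0 \<le> a" "b \<le> t" "continuous_on {0..t} h" for a b and h :: "real \<Rightarrow> 'b"
    unfolding set_integrable_def
    by (intro borel_integrable_compact continuous_on_subset[OF that(3)]) (use that in auto)
  have "bounded (f' ` {0..t})" by (intro compact_imp_bounded compact_continuous_image f') auto
  then obtain B where "\<forall>s\<in>{0..t}. norm (f' s) \<le> B" unfolding bounded_iff by auto
  then have B: "\<And>s. 0 \<le> s \<Longrightarrow> s \<le> t \<Longrightarrow> norm (f' s) \<le> B" by simp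
  have B0: "0 \<le> B" using order_trans[OF norm_ge_zero B[of 0]] t by simp
  define H where "H v = g v *\<^sub>R f v - (LINT s:{0..v}|lborel. g s *\<^sub>R f' s)" for v
  have H0: "H t - H 0 = g t *\<^sub>R f t - g 0 *\<^sub>R f 0 - (LINT s:{0..t}|lborel. g s *\<^sub>R f' s)"
    by (simp add: H_def)
  have step: "norm ((g b - g a) *\<^sub>R f a - (H b - H a)) \<le> (b - a) * (e * B)"
    if ab: "0 \<le> a" "a \<le> b" "b \<le> t" and osc: "\<And>s. a \<le> s \<Longrightarrow> s \<le> b \<Longrightarrow> \<bar>g s - g b\<bar> \<le> e" for a b e
  proof -
    have i1: "(LINT s:{0..b}|lborel. g s *\<^sub>R f' s) = (LINT s:{0..a}|lborel. g s *\<^sub>R f' s) + (LINT s:{a..b}|lborel. g s *\<^sub>R f' s)"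
      using ab by (intro set_integral_split int gf) auto
    have i2: "(LINT s:{a..b}|lborel. f' s) = f b - f a"
      unfolding set_lebesgue_integral_def
    proof (rule integral_FTC_atLeastAtMost[OF ab(2)])
      fix s assume "a \<le> s" "s \<le> b"
      then show "(f has_vector_derivative f' s) (at s within {a..b})"
        using ab by (intro has_vector_derivative_within_subset[OF f]) auto
    qed (use ab continuous_on_subset[OF f'] in auto)
    have i3: "(LINT s:{a..b}|lborel. (g s - g b) *\<^sub>R f' s) = (LINT s:{a..b}|lborel. g s *\<^sub>R f' s) - g b *\<^sub>R (LINT s:{a..b}|lborel. f' s)"
      unfolding scaleR_left_diff_distrib
      using int[OF ab(1,3) gf] int[OF ab(1,3) f'] by (subst set_integral_diff(2)) auto
    have "(g b - g a) *\<^sub>R f a - (H b - H a) = (LINT s:{a..b}|lborel. (g s - g b) *\<^sub>R f' s)"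
      unfolding H_def i3 i2 i1 by (simp add: algebra_simps)
    also have "norm \<dots> \<le> (b - a) * (e * B)"
    proof (rule set_integral_norm_le_const[OF ab(2)])
      fix s assume s: "a \<le> s" "s \<le> b"
      have e0: "0 \<le> e" using order_trans[OF abs_ge_zero osc[OF s]] .
      show "norm ((g s - g b) *\<^sub>R f' s) \<le> e * B"
        using osc[OF s] B[of s] s ab e0 by (auto intro!: mult_mono)
    qed
    finally show ?thesis .
  qed
  show ?thesis
  proof (rule LIMSEQ_I)
    fix e :: real assume e: "0 < e"
    define e' where "e' = e / (t * B + 1)"
    have e': "0 < e'" unfolding e'_def using e t B0 by (simp add: add_nonneg_pos)
    have "uniformly_continuous_on {0..t} g" by (rule compact_uniformly_continuous[OF g]) simp
    then obtain d where d: "0 < d" "\<And>x y. x \<in> {0..t} \<Longrightarrow> y \<in> {0..t} \<Longrightarrow> dist y x < d \<Longrightarrow> dist (g y) (g x) < e'"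
      unfolding uniformly_continuous_on_def using e' by metis
    obtain N :: nat where N: "t / d < real N" using reals_Archimedean2 by blast
    show "\<exists>N. \<forall>n\<ge>N. norm ((\<Sum>i<Suc n. (g (real (Suc i) * (t / real (Suc n))) - g (real i * (t / real (Suc n)))) *\<^sub>R f (real i * (t / real (Suc n))))
       - (g t *\<^sub>R f t - g 0 *\<^sub>R f 0 - (LINT s:{0..t}|lborel. g s *\<^sub>R f' s))) < e"
    proof (intro exI[of _ N] allI impI)
      fix n assume n: "N \<le> n"
      define p where "p i = real i * (t / real (Suc n))" for i
      have mesh: "p (Suc i) - p i = t / real (Suc n)" for i by (simp add: p_def algebra_simps add_divide_distrib)
      have mesh0: "0 \<le> t / real (Suc n)" using t by simp
      have small: "t / real (Suc n) < d"
      proof -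
        have "t / d < real (Suc n)" using N n by simp
        then show ?thesis using d(1) by (simp add: field_simps)
      qed
      have pt: "0 \<le> p i" "p i \<le> t" if "i \<le> Suc n" for i
      proof -
        show "0 \<le> p i" using t by (simp add: p_def)
        have "real i * (t / real (Suc n)) \<le> real (Suc n) * (t / real (Suc n))"
          using that mesh0 by (intro mult_right_mono) auto
        then show "p i \<le> t" by (simp add: p_def)
      qed
      have pend: "p 0 = 0" "p (Suc n) = t" by (auto simp: p_def)
      have ple: "p i \<le> p (Suc i)" for i using mesh[of i] mesh0 by linarith
      have "(\<Sum>i<Suc n. (g (p (Suc i)) - g (p i)) *\<^sub>R f (p i)) - (H t - H 0) =
          (\<Sum>i<Suc n. (g (p (Suc i)) - g (p i)) *\<^sub>R f (p i) - (H (p (Suc i)) - H (p i)))"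
        using sum_lessThan_telescope[of "\<lambda>i. H (p i)" "Suc n"] by (simp only: sum_subtractf pend)
      also have "norm \<dots> \<le> (\<Sum>i<Suc n. t / real (Suc n) * (e' * B))"
      proof (intro sum_norm_le)
        fix i assume i: "i \<in> {..<Suc n}"
        have "norm ((g (p (Suc i)) - g (p i)) *\<^sub>R f (p i) - (H (p (Suc i)) - H (p i))) \<le> (p (Suc i) - p i) * (e' * B)"
        proof (rule step)
          fix s assume s: "p i \<le> s" "s \<le> p (Suc i)"
          have "s \<in> {0..t}" "p (Suc i) \<in> {0..t}" using s pt[of i] pt[of "Suc i"] i by auto
          moreover have "dist s (p (Suc i)) < d" using s mesh[of i] small by (simp add: dist_real_def)
          ultimately show "\<bar>g s - g (p (Suc i))\<bar> \<le> e'" using d(2)[of "p (Suc i)" s] by (simp add: dist_real_def)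
        qed (use pt[of i] pt[of "Suc i"] i ple in auto)
        then show "norm ((g (p (Suc i)) - g (p i)) *\<^sub>R f (p i) - (H (p (Suc i)) - H (p i))) \<le> t / real (Suc n) * (e' * B)"
          unfolding mesh .
      qed
      also have "\<dots> = t * (e' * B)" by simp
      also have "\<dots> = e * ((t * B) / (t * B + 1))" by (simp add: e'_def)
      also have "\<dots> < e * 1"
      proof (intro mult_strict_left_mono e)
        have "0 \<le> t * B" using t B0 by simp
        then show "t * B / (t * B + 1) < 1" by simp
      qed
      finally show "norm ((\<Sum>i<Suc n. (g (real (Suc i) * (t / real (Suc n))) - g (real i * (t / real (Suc n)))) *\<^sub>R f (real i * (t / real (Suc n))))
       - (g t *\<^sub>R f t - g 0 *\<^sub>R f 0 - (LINT s:{0..t}|lborel. g s *\<^sub>R f' s))) < e"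
        by (simp only: p_def H0 mult_1_right)
    qed
  qed
qed

text \<open>Over uniform partitions the sums converge to \<open>Y\<close> in mean square and, by
  \<open>left_sums_by_parts\<close>, pathwise to the integrated form. Fatou's lemma forces the two
  limits to agree almost surely.\<close>

lemma wiener_integral_by_parts:
  fixes f :: "real \<Rightarrow> real^2"
  assumes W: "wiener_process M W" and Y: "has_wiener_integral M W f t Y" and t: "0 \<le> t"
    and f: "\<And>s. 0 \<le> s \<Longrightarrow> s \<le> t \<Longrightarrow> (f has_vector_derivative f' s) (at s within {0..t})"
    and f': "continuous_on {0..t} f'"
  shows "AE w in M. Y w = W t w *\<^sub>R f t - W 0 w *\<^sub>R f 0 - (LINT s:{0..t}|lborel. W s w *\<^sub>R f' s)"
proof -
  have Wm: "W s \<in> borel_measurable M" if "0 \<le> s" for s using W that by (simp add: wiener_process_def)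
  have Ym[measurable]: "Y \<in> borel_measurable M" using Y by (simp add: has_wiener_integral_def)
  define p where "p n i = real i * (t / real (Suc n))" for n i :: nat
  have p0: "0 \<le> p n i" for n i using t by (simp add: p_def)
  define S where "S n w = (\<Sum>i<Suc n. (W (p n (Suc i)) w - W (p n i) w) *\<^sub>R f (p n i))" for n w
  have Sm: "S n \<in> borel_measurable M" for n
    unfolding S_def[abs_def]
    by (intro borel_measurable_sum borel_measurable_scaleR borel_measurable_diff borel_measurable_const Wm p0)
  let ?I = "\<lambda>w. W t w *\<^sub>R f t - W 0 w *\<^sub>R f 0 - (LINT s:{0..t}|lborel. W s w *\<^sub>R f' s)"
  have lim: "(\<lambda>n. S n w) \<longlonglongrightarrow> ?I w" if "w \<in> space M" for w
  proof -
    have "continuous_on {0..} (\<lambda>s. W s w)" using W that by (simp add: wiener_process_def)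
    then have "continuous_on {0..t} (\<lambda>s. W s w)" by (rule continuous_on_subset) auto
    then show ?thesis unfolding S_def p_def by (rule left_sums_by_parts[OF t _ f f'])
  qed
  let ?u = "\<lambda>n w. ennreal ((norm (Y w - S n w))\<^sup>2)"
  have um: "?u n \<in> borel_measurable M" for n using Sm[of n] by measurable
  have ui: "(\<lambda>n. \<integral>\<^sup>+ w. ?u n w \<partial>M) \<longlonglongrightarrow> 0"
  proof (rule order_tendstoI)
    fix a :: ennreal assume "0 < a"
    then obtain e where e: "0 < e" "ennreal e < a" using ennreal_rat_dense[of 0 a] ennreal_Ex_less_of_nat
      by (metis dense ennreal_0 ennreal_cases ennreal_less_iff less_ennreal.rep_eq linorder_not_less not_less_iff_gr_or_eq top.not_eq_extremum zero_less_iff_neq_zero order.strict_trans)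
    obtain d where d: "0 < d" "\<forall>n (s :: nat \<Rightarrow> real).
        s 0 = 0 \<and> s n = t \<and> (\<forall>i<n. s i \<le> s (Suc i) \<and> s (Suc i) - s i < d) \<longrightarrow>
        (\<integral>\<^sup>+ w. ennreal ((norm (Y w - (\<Sum>i<n. (W (s (Suc i)) w - W (s i) w) *\<^sub>R f (s i))))\<^sup>2) \<partial>M) < ennreal e"
      using Y e(1) unfolding has_wiener_integral_def by blast
    obtain N :: nat where N: "t / d < real N" using reals_Archimedean2 by blast
    show "\<forall>\<^sub>F n in sequentially. (\<integral>\<^sup>+ w. ?u n w \<partial>M) < a"
    proof (rule eventually_sequentiallyI[of N])
      fix n assume n: "N \<le> n"
      have mesh: "p n (Suc i) - p n i = t / real (Suc n)" for i by (simp add: p_def algebra_simps add_divide_distrib)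
      have small: "t / real (Suc n) < d"
      proof -
        have "t / d < real (Suc n)" using N n by simp
        then show ?thesis using d(1) by (simp add: field_simps)
      qed
      have le: "p n i \<le> p n (Suc i)" for i
        unfolding p_def using t by (intro mult_right_mono) auto
      have "(\<integral>\<^sup>+ w. ?u n w \<partial>M) < ennreal e"
        unfolding S_def
        by (rule d(2)[rule_format]) (use le mesh small in \<open>auto simp: p_def\<close>)
      then show "(\<integral>\<^sup>+ w. ?u n w \<partial>M) < a" using e by simp
    qed
  qed simp
  have "(\<integral>\<^sup>+ w. liminf (\<lambda>n. ?u n w) \<partial>M) \<le> liminf (\<lambda>n. \<integral>\<^sup>+ w. ?u n w \<partial>M)"
    by (rule nn_integral_liminf[OF um])
  also have "\<dots> = 0" using ui by (rule lim_imp_Liminf[rotated]) simp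
  finally have "AE w in M. liminf (\<lambda>n. ?u n w) = 0"
    using um by (subst (asm) le_zero_eq, subst (asm) nn_integral_0_iff_AE) auto
  then show ?thesis
  proof (rule AE_mp, intro AE_I2 impI)
    fix w assume w: "w \<in> space M" and z: "liminf (\<lambda>n. ?u n w) = 0"
    have "(\<lambda>n. ?u n w) \<longlonglongrightarrow> ennreal ((norm (Y w - ?I w))\<^sup>2)"
      by (intro tendsto_ennrealI tendsto_intros lim w)
    then have "liminf (\<lambda>n. ?u n w) = ennreal ((norm (Y w - ?I w))\<^sup>2)"
      by (rule lim_imp_Liminf[rotated]) simp
    then show "Y w = ?I w" using z by simp
  qed
qed

section \<open>Perturbed paths\<close>

text \<open>At the first time m with |f m| = R the path has stayed in the closed ball up to m, so
  \<open>step\<close> gives |f m| < R, a contradiction.\<close>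

lemma first_exit_bound:
  fixes f :: "real \<Rightarrow> real"
  assumes f: "continuous_on {0..T} f" and f0: "\<bar>f 0\<bar> < R"
    and step: "\<And>t. 0 \<le> t \<Longrightarrow> t \<le> T \<Longrightarrow> (\<And>s. 0 \<le> s \<Longrightarrow> s \<le> t \<Longrightarrow> \<bar>f s\<bar> \<le> R) \<Longrightarrow> \<bar>f t\<bar> < R"
    and t: "0 \<le> t" "t \<le> T"
  shows "\<bar>f t\<bar> < R"
proof (rule ccontr)
  assume "\<not> \<bar>f t\<bar> < R"
  let ?B = "{s \<in> {0..T}. \<bar>f s\<bar> = R}"
  have c: "continuous_on {0..T} (\<lambda>s. \<bar>f s\<bar>)" by (intro continuous_intros f)
  have ivt: "\<exists>s\<in>{0..u}. \<bar>f s\<bar> = R" if "0 \<le> u" "u \<le> T" "R \<le> \<bar>f u\<bar>" for u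
    using IVT'[of "\<lambda>s. \<bar>f s\<bar>" 0 R u] that f0 continuous_on_subset[OF c, of "{0..u}"] by force
  have "?B \<noteq> {}" using ivt[OF t] \<open>\<not> \<bar>f t\<bar> < R\<close> t by fastforce
  moreover have "compact ?B"
  proof -
    have "closed ?B" by (intro continuous_closed_preimage_constant c) auto
    then show ?thesis by (rule compact_Int_closed[OF compact_Icc[of 0 T], THEN back_subst[of compact]]) auto
  qed
  ultimately obtain m where m: "m \<in> ?B" "\<And>s. s \<in> ?B \<Longrightarrow> m \<le> s"
    using compact_attains_inf[of ?B] by blast
  have "\<bar>f s\<bar> \<le> R" if s: "0 \<le> s" "s \<le> m" for s
  proof (rule ccontr)
    assume a: "\<not> \<bar>f s\<bar> \<le> R"
    then have "\<exists>u\<in>{0..s}. \<bar>f u\<bar> = R" using s m(1) by (intro ivt) auto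
    then obtain u where u: "u \<in> {0..s}" "\<bar>f u\<bar> = R" by blast
    then have "u \<in> ?B" "u \<le> s" using s m(1) by auto
    with m(2)[of u] s have "u = s" by simp
    then show False using a u by simp
  qed
  then have "\<bar>f m\<bar> < R" using m(1) by (intro step) auto
  then show False using m(1) by simp
qed

context splitting
begin

text \<open>Freezing \<open>F\<close> after time \<open>\<tau>\<close> leaves the solution on \<open>[-r, \<tau>]\<close> unchanged, and from \<open>\<tau>\<close> on the
  solution follows the linear equation, so that its projection onto \<open>P\<close> can be read off from its
  asymptotics.\<close>

definition stop :: "(real \<Rightarrow> real) \<Rightarrow> real \<Rightarrow> real \<Rightarrow> real" where
  "stop F \<tau> s = (if s < 0 then 0 else F (min s \<tau>))"

lemma stop_eq: "0 \<le> s \<Longrightarrow> s \<le> \<tau> \<Longrightarrow> stop F \<tau> s = F s"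
  and stop_after: "0 \<le> \<tau> \<Longrightarrow> \<tau> \<le> s \<Longrightarrow> stop F \<tau> s = F \<tau>"
  and stop_neg: "s < 0 \<Longrightarrow> stop F \<tau> s = 0"
  by (auto simp: stop_def)

lemma stop_measurable:
  assumes "continuous_on {0..\<tau>} F" "0 \<le> \<tau>" shows "stop F \<tau> \<in> borel_measurable borel"
proof -
  have "continuous_on {0..} (\<lambda>s. F (min s \<tau>))"
    by (rule continuous_on_compose2[OF assms(1)]) (use assms(2) in \<open>auto intro!: continuous_intros\<close>)
  then have "(\<lambda>s. indicator {0..} s *\<^sub>R F (min s \<tau>)) \<in> borel_measurable borel"
    by (intro borel_measurable_continuous_on_indicator) auto
  also have "(\<lambda>s. indicator {0..} s *\<^sub>R F (min s \<tau>)) = stop F \<tau>"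
    by (auto simp: stop_def indicator_def)
  finally show ?thesis .
qed

lemma stop_bounded:
  assumes "continuous_on {0..\<tau>} F" "0 \<le> \<tau>" shows "\<exists>B. \<forall>s. \<bar>stop F \<tau> s\<bar> \<le> B"
proof -
  have "bounded (F ` {0..\<tau>})" by (intro compact_imp_bounded compact_continuous_image assms) auto
  then obtain B where "\<forall>s\<in>{0..\<tau>}. \<bar>F s\<bar> \<le> B" unfolding bounded_iff by auto
  then have "\<bar>stop F \<tau> s\<bar> \<le> max 0 B" for s using assms(2) by (auto simp: stop_def min_def le_max_iff_disj)
  then show ?thesis by blast
qed

lemma zeta_stop: "zeta (stop F \<tau>) \<tau> = zeta F \<tau>" if "0 \<le> \<tau>"
proof -
  have "(LINT s:{0..\<tau>}|lborel. stop F \<tau> s *\<^sub>R rot (\<omega> * - s) (Bmul \<omega> \<Psi>)) = (LINT s:{0..\<tau>}|lborel. F s *\<^sub>R rot (\<omega> * - s) (Bmul \<omega> \<Psi>))"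
    by (rule set_lebesgue_integral_cong) (auto simp: stop_eq)
  then show ?thesis using that by (simp add: zeta_def stop_eq)
qed

text \<open>The integrated form of U' = L U + F', since \<open>F\<close> need not be
  differentiable.\<close>

definition perturbed :: "(real \<Rightarrow> real) \<Rightarrow> (real \<Rightarrow> real) \<Rightarrow> (real \<Rightarrow> real) \<Rightarrow> real \<Rightarrow> bool" where
  "perturbed \<phi> U F T \<longleftrightarrow> 0 \<le> T \<and> continuous_on {-r..T} U \<and> continuous_on {0..T} F \<and> F 0 = 0 \<and>
     (\<forall>\<theta>\<in>{-r..0}. U \<theta> = \<phi> \<theta>) \<and>
     (\<forall>t\<in>{0..T}. U t = U 0 + (LINT s:{0..t}|lborel. L (\<lambda>\<theta>. U (s + \<theta>))) + F t)"

lemma perturbedD: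
  assumes "perturbed \<phi> U F T"
  shows "continuous_on {-r..T} U" "continuous_on {0..T} F" "F 0 = 0" "\<theta> \<in> {-r..0} \<Longrightarrow> U \<theta> = \<phi> \<theta>"
    "t \<in> {0..T} \<Longrightarrow> U t = U 0 + (LINT s:{0..t}|lborel. L (\<lambda>\<theta>. U (s + \<theta>))) + F t"
  using assms unfolding perturbed_def by blast+

lemma L_window_continuous:
  assumes "continuous_on {-r..T} U" shows "continuous_on {0..T} (\<lambda>s. L (\<lambda>\<theta>. U (s + \<theta>)) :: real)"
proof (rule continuous_on_iff[THEN iffD2], intro ballI allI impI)
  fix s e :: real assume s: "s \<in> {0..T}" and e: "0 < e"
  have e': "0 < e / (Lnorm + 1)" using e Lnorm_nonneg by simp
  have "uniformly_continuous_on {-r..T} U" by (rule compact_uniformly_continuous[OF assms]) simp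
  then obtain d where d: "0 < d" "\<And>x y. x \<in> {-r..T} \<Longrightarrow> y \<in> {-r..T} \<Longrightarrow> dist y x < d \<Longrightarrow> dist (U y) (U x) < e / (Lnorm + 1)"
    unfolding uniformly_continuous_on_def using e' by metis
  have bmU: "bm (\<lambda>\<theta>. U (s + \<theta>))" if "s \<in> {0..T}" for s
    by (intro bm_continuous continuous_on_compose2[OF assms] continuous_intros) (use that in auto)
  show "\<exists>d>0. \<forall>s'\<in>{0..T}. dist s' s < d \<longrightarrow> dist (L (\<lambda>\<theta>. U (s' + \<theta>))) (L (\<lambda>\<theta>. U (s + \<theta>))) < e"
  proof (intro exI[of _ d] conjI ballI impI d(1))
    fix s' assume s': "s' \<in> {0..T}" "dist s' s < d"
    have "norm (L (\<lambda>\<theta>. U (s' + \<theta>) - U (s + \<theta>))) \<le> Lnorm * (e / (Lnorm + 1))"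
    proof (rule L_bound[OF bm_diff[OF bmU[OF s'(1)] bmU[OF s]]])
      fix \<theta> assume "-r \<le> \<theta>" "\<theta> \<le> 0"
      then have "dist (U (s' + \<theta>)) (U (s + \<theta>)) < e / (Lnorm + 1)" using s s' by (intro d(2)) (auto simp: dist_real_def)
      then show "norm (U (s' + \<theta>) - U (s + \<theta>)) \<le> e / (Lnorm + 1)" by (simp add: dist_real_def)
    qed
    also have "\<dots> < e" using e Lnorm_nonneg by (simp add: field_simps)
    finally show "dist (L (\<lambda>\<theta>. U (s' + \<theta>))) (L (\<lambda>\<theta>. U (s + \<theta>))) < e"
      by (simp add: dist_real_def L_diff[OF bmU[OF s'(1)] bmU[OF s]])
  qed
qed

lemma Icc_integrable: "continuous_on {a..b} f \<Longrightarrow> set_integrable lborel {a..b} (f :: real \<Rightarrow> 'b::euclidean_space)"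
  unfolding set_integrable_def by (intro borel_integrable_compact) auto

lemma voc_stop_solves:
  assumes Fc: "continuous_on {0..\<tau>} F" and \<tau>: "0 \<le> \<tau>" and t: "0 \<le> t"
  shows "voc (stop F \<tau>) t = stop F \<tau> t + (LINT s:{0..t}|lborel. L (\<lambda>\<theta>. voc (stop F \<tau>) (s + \<theta>)))"
    "set_integrable lborel {0..t} (\<lambda>s. L (\<lambda>\<theta>. voc (stop F \<tau>) (s + \<theta>)))"
proof -
  obtain B where "\<And>s. \<bar>stop F \<tau> s\<bar> \<le> B" using stop_bounded[OF Fc \<tau>] by blast
  note * = voc_solves[OF stop_measurable[OF Fc \<tau>] this stop_neg t]
  show "voc (stop F \<tau>) t = stop F \<tau> t + (LINT s:{0..t}|lborel. L (\<lambda>\<theta>. voc (stop F \<tau>) (s + \<theta>)))"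
    by (rule *(1)) simp
  show "set_integrable lborel {0..t} (\<lambda>s. L (\<lambda>\<theta>. voc (stop F \<tau>) (s + \<theta>)))"
    by (rule *(2)) simp
qed

lemma bm_voc_stop:
  assumes Fc: "continuous_on {0..\<tau>} F" and \<tau>: "0 \<le> \<tau>" and s: "0 \<le> s"
  shows "bm (\<lambda>\<theta>. voc (stop F \<tau>) (s + \<theta>))"
proof -
  obtain B where B: "\<And>s. \<bar>stop F \<tau> s\<bar> \<le> B" using stop_bounded[OF Fc \<tau>] by blast
  have "voc (stop F \<tau>) \<in> borel_measurable borel" by (rule voc_measurable[OF stop_measurable[OF Fc \<tau>]])
  then have "(\<lambda>\<theta>. voc (stop F \<tau>) (s + \<theta>)) \<in> borel_measurable borel" by (rule measurable_compose[rotated]) simp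
  then show ?thesis
    by (rule bmI[of _ "B + s * (Lnorm * Cx * B)"]) (use voc_bound[OF B, of _ s] s in auto)
qed

lemma lin_solutionD:
  assumes "lin_solution r L0 \<phi> y" "0 \<le> t"
  shows "set_integrable lborel {0..t} (\<lambda>s. L (\<lambda>\<theta>. y (s + \<theta>)))"
    "y t = \<phi> 0 + (LINT s:{0..t}|lborel. L (\<lambda>\<theta>. y (s + \<theta>)))"
  using assms unfolding lin_solution_def Lext by blast+

lemma lin_solution_initial: "lin_solution r L0 \<phi> y \<Longrightarrow> -r \<le> \<theta> \<Longrightarrow> \<theta> \<le> 0 \<Longrightarrow> y \<theta> = \<phi> \<theta>"
  by (simp add: lin_solution_def)

lemma bm_lin_solution:
  assumes "bm \<phi>" "lin_solution r L0 \<phi> y" "0 \<le> s" shows "bm (\<lambda>\<theta>. y (s + \<theta>))"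
  using bm_window[OF assms(1) lin_solution_initial[OF assms(2)] lin_solution_continuous[OF assms(2)] assms(3) order.refl]
  by simp

text \<open>U - y - voc has zero initial segment and solves the homogeneous equation up to \<tau>,
  so it vanishes by \<open>dde_unique\<close>. Freezing makes the forcing bounded and measurable on
  the whole line, as \<open>voc_solves\<close> requires.\<close>

lemma perturbed_representation:
  assumes p: "perturbed \<phi> U F T" and \<phi>: "bm \<phi>" and y: "lin_solution r L0 \<phi> y" and \<tau>: "0 \<le> \<tau>" "\<tau> \<le> T"
    and t: "-r \<le> t" "t \<le> \<tau>"
  shows "U t = y t + voc (stop F \<tau>) t"
proof -
  note U = perturbedD(1-3)[OF p]
  have U4: "U \<theta> = \<phi> \<theta>" if "-r \<le> \<theta>" "\<theta> \<le> 0" for \<theta>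
    by (rule perturbedD(4)[OF p]) (use that in simp)
  have U5: "U t = U 0 + (LINT s:{0..t}|lborel. L (\<lambda>\<theta>. U (s + \<theta>))) + F t" if "0 \<le> t" "t \<le> T" for t
    by (rule perturbedD(5)[OF p]) (use that in simp)
  have Fc: "continuous_on {0..\<tau>} F" using \<tau> by (intro continuous_on_subset[OF U(2)]) auto
  let ?F = "stop F \<tau>"
  have Fm: "?F \<in> borel_measurable borel" by (rule stop_measurable[OF Fc \<tau>(1)])
  obtain B where B: "\<And>s. \<bar>?F s\<bar> \<le> B" using stop_bounded[OF Fc \<tau>(1)] by blast
  note vs = voc_stop_solves[OF Fc \<tau>(1)] and bmv = bm_voc_stop[OF Fc \<tau>(1)]
  note bmy = bm_lin_solution[OF \<phi> y]
  have bmU: "bm (\<lambda>\<theta>. U (s + \<theta>))" if "0 \<le> s" "s \<le> T" for s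
    by (intro bm_continuous continuous_on_compose2[OF U(1)] continuous_intros) (use that in auto)
  have "(\<lambda>t. (U t - y t) - voc ?F t) t = 0"
  proof (rule dde_unique[where T=\<tau> and d="\<lambda>t. (U t - y t) - voc ?F t"])
    show "(U \<theta> - y \<theta>) - voc ?F \<theta> = 0" if "-r \<le> \<theta>" "\<theta> \<le> 0" for \<theta>
    proof -
      have "voc ?F \<theta> = 0"
      proof (cases "\<theta> = 0")
        case True then show ?thesis using \<tau> U(3) by (simp add: voc_def stop_eq)
      next
        case False then show ?thesis using that by (intro voc_neg) (auto simp: stop_neg)
      qed
      then show ?thesis using U4[OF that] lin_solution_initial[OF y that] by simp
    qed
    have iL: "set_integrable lborel {0..t} (\<lambda>s. L (\<lambda>\<theta>. U (s + \<theta>)))" if "t \<le> \<tau>" for t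
      by (intro Icc_integrable continuous_on_subset[OF L_window_continuous[OF U(1)]]) (use that \<tau> in auto)
    have iy: "set_integrable lborel {0..t} (\<lambda>s. L (\<lambda>\<theta>. y (s + \<theta>)))"
      and eqy: "y t = \<phi> 0 + (LINT s:{0..t}|lborel. L (\<lambda>\<theta>. y (s + \<theta>)))" if "0 \<le> t" for t
      by (rule lin_solutionD[OF y that])+
    show "(U t - y t) - voc ?F t = (LINT s:{0..t}|lborel. L (\<lambda>\<theta>. (U (s + \<theta>) - y (s + \<theta>)) - voc ?F (s + \<theta>)))"
      if t: "0 \<le> t" "t \<le> \<tau>" for t
    proof -
      have "(LINT s:{0..t}|lborel. L (\<lambda>\<theta>. (U (s + \<theta>) - y (s + \<theta>)) - voc ?F (s + \<theta>))) =
          (LINT s:{0..t}|lborel. (L (\<lambda>\<theta>. U (s + \<theta>)) - L (\<lambda>\<theta>. y (s + \<theta>))) - L (\<lambda>\<theta>. voc ?F (s + \<theta>)))"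
      proof (rule set_lebesgue_integral_cong)
        show "\<forall>s. s \<in> {0..t} \<longrightarrow> L (\<lambda>\<theta>. (U (s + \<theta>) - y (s + \<theta>)) - voc ?F (s + \<theta>)) =
            (L (\<lambda>\<theta>. U (s + \<theta>)) - L (\<lambda>\<theta>. y (s + \<theta>))) - L (\<lambda>\<theta>. voc ?F (s + \<theta>))"
        proof (intro allI impI)
          fix s assume "s \<in> {0..t}"
          then have s: "0 \<le> s" "s \<le> T" using t \<tau> by auto
          show "L (\<lambda>\<theta>. (U (s + \<theta>) - y (s + \<theta>)) - voc ?F (s + \<theta>)) =
            (L (\<lambda>\<theta>. U (s + \<theta>)) - L (\<lambda>\<theta>. y (s + \<theta>))) - L (\<lambda>\<theta>. voc ?F (s + \<theta>))"
            using L_diff[OF bm_diff[OF bmU[OF s] bmy[OF s(1)]] bmv[OF s(1)]] L_diff[OF bmU[OF s] bmy[OF s(1)]] by simp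
        qed
      qed simp
      also have "\<dots> = (LINT s:{0..t}|lborel. L (\<lambda>\<theta>. U (s + \<theta>))) - (LINT s:{0..t}|lborel. L (\<lambda>\<theta>. y (s + \<theta>)))
          - (LINT s:{0..t}|lborel. L (\<lambda>\<theta>. voc ?F (s + \<theta>)))"
        using set_integral_diff(2)[OF set_integral_diff(1)[OF iL[OF t(2)] iy[OF t(1)]] vs(2)[OF t(1)]]
          set_integral_diff(2)[OF iL[OF t(2)] iy[OF t(1)]] by simp
      also have "\<dots> = (U t - y t) - voc ?F t"
      proof -
        have "U t = U 0 + (LINT s:{0..t}|lborel. L (\<lambda>\<theta>. U (s + \<theta>))) + F t" using t \<tau> by (intro U5) auto
        moreover have "U 0 = \<phi> 0" using r by (intro U4) auto
        ultimately show ?thesis using vs(1)[OF t(1)] eqy[OF t(1)] stop_eq[OF t, of F] by linarith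
      qed
      finally show ?thesis by simp
    qed
    show "continuous_on {0..\<tau>} (\<lambda>t. (U t - y t) - voc ?F t)"
    proof (intro continuous_on_diff)
      show "continuous_on {0..\<tau>} U" using \<tau> r by (intro continuous_on_subset[OF U(1)]) auto
      show "continuous_on {0..\<tau>} y" by (rule lin_solution_continuous[OF y])
      have "continuous_on {0..\<tau>} (\<lambda>t. F t + (LINT s:{0..t}|lborel. L (\<lambda>\<theta>. voc ?F (s + \<theta>))))"
        by (intro continuous_on_add Fc continuous_on_set_integral vs \<tau>)
      then show "continuous_on {0..\<tau>} (voc ?F)"
        by (rule continuous_on_eq) (use vs(1) stop_eq in auto)
    qed
  qed (use \<tau> t in auto)
  then show ?thesis by simp
qed

text \<open>In the original clock the continued solution approaches the oscillation with vector
  \<open>v0 + zeta F \<tau>\<close>; shifting the origin of time to \<tau> rotates this vector by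
  \<omega> \<tau>.\<close>

lemma perturbed_projection:
  assumes p: "perturbed \<phi> U F T" and \<phi>: "bm \<phi>" and y: "lin_solution r L0 \<phi> y"
    and lim: "((\<lambda>t. y t - Phi \<omega> v0 t) \<longlongrightarrow> 0) at_top" and \<tau>: "0 \<le> \<tau>" "\<tau> \<le> T"
  shows "pihat r L0 \<omega> (\<lambda>\<theta>. U (\<tau> + \<theta>)) = Phi \<omega> (rot (\<omega> * \<tau>) (v0 + zeta F \<tau>))"
proof -
  note U = perturbedD(1,2)[OF p]
  have Fc: "continuous_on {0..\<tau>} F" using \<tau> by (intro continuous_on_subset[OF U(2)]) auto
  let ?F = "stop F \<tau>"
  have Fm: "?F \<in> borel_measurable borel" by (rule stop_measurable[OF Fc \<tau>(1)])
  obtain B where B: "\<And>s. \<bar>?F s\<bar> \<le> B" using stop_bounded[OF Fc \<tau>(1)] by blast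
  note vs = voc_stop_solves[OF Fc \<tau>(1)] and bmv = bm_voc_stop[OF Fc \<tau>(1)]
  note bmy = bm_lin_solution[OF \<phi> y]
  have eqy: "y t = \<phi> 0 + (LINT s:{0..t}|lborel. L (\<lambda>\<theta>. y (s + \<theta>)))"
    and iy: "set_integrable lborel {0..t} (\<lambda>s. L (\<lambda>\<theta>. y (s + \<theta>)))" if "0 \<le> t" for t
    by (rule lin_solutionD[OF y that])+
  let ?w = "\<lambda>t. y (\<tau> + t) + voc ?F (\<tau> + t)"
  let ?l = "\<lambda>s. L (\<lambda>\<theta>. y (s + \<theta>)) + L (\<lambda>\<theta>. voc ?F (s + \<theta>))"
  have Lw: "L (\<lambda>\<theta>. ?w (s + \<theta>)) = ?l (\<tau> + s)" if "0 \<le> s" for s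
    using L_add[OF bmy bmv, of "\<tau> + s" "\<tau> + s"] \<tau> that by (simp add: add.assoc)
  have il: "set_integrable lborel {0..t} ?l" if "0 \<le> t" for t by (rule set_integral_add(1)[OF iy[OF that] vs(2)[OF that]])
  have sum: "y t + voc ?F t = \<phi> 0 + ?F t + (LINT s:{0..t}|lborel. ?l s)" if "0 \<le> t" for t
    using eqy[OF that] vs(1)[OF that] set_integral_add(2)[OF iy[OF that] vs(2)[OF that]] by linarith
  have sol: "lin_solution r L0 (\<lambda>\<theta>. U (\<tau> + \<theta>)) ?w"
    unfolding lin_solution_def Lext
  proof (intro conjI ballI allI impI)
    fix \<theta> assume "\<theta> \<in> {-r..0}"
    then show "?w \<theta> = U (\<tau> + \<theta>)"
      using perturbed_representation[OF p \<phi> y \<tau>, of "\<tau> + \<theta>"] \<tau> by simp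
  next
    fix t :: real assume t: "0 \<le> t"
    have il': "set_integrable lborel {\<tau>..\<tau> + t} ?l"
      using t \<tau> by (intro set_integrable_subset[OF il[of "\<tau> + t"]]) auto
    have "set_integrable lborel {0..t} (\<lambda>s. ?l (\<tau> + s))"
      using lborel_integrable_real_affine[OF il'[unfolded set_integrable_def], of 1 \<tau>]
      unfolding set_integrable_def by (simp add: indicator_def)
    then show "set_integrable lborel {0..t} (\<lambda>s. L (\<lambda>\<theta>. ?w (s + \<theta>)))"
      by (rule set_integrable_cong[THEN iffD1, rotated 3]) (auto simp: Lw)
    have "(LINT s:{0..t}|lborel. L (\<lambda>\<theta>. ?w (s + \<theta>))) = (LINT s:{0..t}|lborel. ?l (\<tau> + s))"
      by (rule set_lebesgue_integral_cong) (auto simp: Lw)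
    also have "\<dots> = (LINT s:{\<tau>..\<tau> + t}|lborel. ?l s)" by (subst set_integral_shift) simp
    also have "\<dots> = (LINT s:{0..\<tau> + t}|lborel. ?l s) - (LINT s:{0..\<tau>}|lborel. ?l s)"
      using set_integral_split[OF il[of "\<tau> + t"], of \<tau>] t \<tau> by simp
    also have "\<dots> = ?w t - U \<tau>"
    proof -
      have "U \<tau> = y \<tau> + voc ?F \<tau>" using \<tau> r by (intro perturbed_representation[OF p \<phi> y \<tau>]) auto
      moreover have "?F (\<tau> + t) = ?F \<tau>" using t \<tau> by (simp add: stop_def)
      moreover have "0 \<le> \<tau> + t" using t \<tau> by simp
      ultimately show ?thesis using sum[of "\<tau> + t"] sum[OF \<tau>(1)] by linarith
    qed
    finally show "?w t = U (\<tau> + 0) + (LINT s:{0..t}|lborel. L (\<lambda>\<theta>. ?w (s + \<theta>)))" by simp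
  qed
  have bmU: "bm (\<lambda>\<theta>. U (\<tau> + \<theta>))"
    by (intro bm_continuous continuous_on_compose2[OF U(1)] continuous_intros) (use \<tau> in auto)
  have st: "\<And>s. \<tau> \<le> s \<Longrightarrow> ?F s = ?F \<tau>" using stop_after[OF \<tau>(1), of _ F] \<tau> by simp
  have va: "((\<lambda>t. voc ?F t - Phi \<omega> (zeta ?F \<tau>) t) \<longlongrightarrow> 0) at_top"
    using voc_asymptotics[OF Fm B _ \<tau>(1)] st by blast
  have sh: "filterlim (\<lambda>t. \<tau> + t) at_top at_top"
    by (intro filterlim_tendsto_add_at_top[OF tendsto_const] filterlim_ident)
  have "((\<lambda>t. (y (\<tau> + t) - Phi \<omega> v0 (\<tau> + t)) + (voc ?F (\<tau> + t) - Phi \<omega> (zeta ?F \<tau>) (\<tau> + t))) \<longlongrightarrow> 0 + 0) at_top"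
    by (intro tendsto_add filterlim_compose[OF lim sh] filterlim_compose[OF va sh])
  then have "((\<lambda>t. ?w t - Phi \<omega> (rot (\<omega> * \<tau>) (v0 + zeta F \<tau>)) t) \<longlongrightarrow> 0) at_top"
    unfolding Phi_rot Phi_linear zeta_stop[OF \<tau>(1)] by (simp add: algebra_simps)
  then show ?thesis by (rule pihat_eq[OF sol bmU])
qed

section \<open>Size of the stable component\<close>

lemma linear_exp_bound: "0 \<le> v \<Longrightarrow> (3 + v) * exp (- \<kappa> * v) \<le> (3 + 2 / \<kappa>) * exp (- (\<kappa> / 2) * v)"
proof -
  assume v: "0 \<le> v"
  \<comment> \<open>Half of the decay rate is spent on the linear factor: v is at most (2/\<kappa>)
    exp(\<kappa> v/2).\<close>
  have "\<kappa> / 2 * v \<le> exp (\<kappa> / 2 * v)" using exp_ge_add_one_self[of "\<kappa> / 2 * v"] by linarith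
  then have "v \<le> 2 / \<kappa> * exp (\<kappa> / 2 * v)" using \<kappa> by (simp add: field_simps)
  moreover have "1 \<le> exp (\<kappa> / 2 * v)" using \<kappa> v by simp
  ultimately have "3 + v \<le> 3 * exp (\<kappa> / 2 * v) + 2 / \<kappa> * exp (\<kappa> / 2 * v)" by linarith
  also have "\<dots> = (3 + 2 / \<kappa>) * exp (\<kappa> / 2 * v)" by (simp only: distrib_right)
  finally have "3 + v \<le> (3 + 2 / \<kappa>) * exp (\<kappa> / 2 * v)" .
  then have "(3 + v) * exp (- \<kappa> * v) \<le> (3 + 2 / \<kappa>) * exp (\<kappa> / 2 * v) * exp (- \<kappa> * v)" by (intro mult_right_mono) auto
  also have "\<dots> = (3 + 2 / \<kappa>) * exp (- (\<kappa> / 2) * v)" by (simp add: mult.assoc flip: exp_add)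
  finally show ?thesis .
qed

text \<open>The kernel \<open>ek\<close> is integrated against F s - F \<tau> instead of F s, so
  that increments back from \<tau> enter, and their linear growth is absorbed by the decay of
  \<open>ek\<close>. The constant is therefore uniform in \<tau>, which in fast time ranges up to
  T/\<epsilon>^2.\<close>

lemma perturbation_bound:
  "\<exists>K\<ge>0. \<forall>(F :: real \<Rightarrow> real) \<tau> \<beta> \<theta>. 0 \<le> \<tau> \<and> continuous_on {0..\<tau>} F \<and> F 0 = 0 \<and> 0 \<le> \<beta> \<and> -r \<le> \<theta> \<and> \<theta> \<le> 0 \<and>
     (\<forall>s t. 0 \<le> s \<and> s \<le> t \<and> t \<le> \<tau> \<longrightarrow> \<bar>F t - F s\<bar> \<le> \<beta> * (3 + (t - s))) \<longrightarrow>
     \<bar>voc (stop F \<tau>) (\<tau> + \<theta>) - Phi \<omega> (zeta F \<tau>) (\<tau> + \<theta>)\<bar> \<le> K * \<beta>"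
proof -
  obtain Ce where Ce: "0 \<le> Ce" "\<And>t. \<bar>e t\<bar> \<le> Ce * exp (- \<kappa> * t)" using e_decay by blast
  obtain Ck where Ck: "0 \<le> Ck" "\<And>t. \<bar>ek t\<bar> \<le> Ck * exp (- \<kappa> * t)" using ek_decay by blast
  let ?D = "3 + 2 / \<kappa>"
  have D0: "0 \<le> ?D" using \<kappa> by simp
  \<comment> \<open>Summands for the increment over the window (\<open>b1\<close>), for the kernel
    integral (\<open>b3\<close>) and for the remainder with the factor \<open>e\<close>
    (\<open>b2\<close>).\<close>
  define K where "K = (3 + r) + Ck * exp (\<kappa> * r) * ?D * (2 / \<kappa>) + ?D * (Ce * exp (\<kappa> * r))"
  have K0: "0 \<le> K" unfolding K_def using r Ck Ce D0 \<kappa> by (intro add_nonneg_nonneg mult_nonneg_nonneg) auto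
  show ?thesis
  proof (intro exI[of _ K] conjI allI impI K0)
    fix F :: "real \<Rightarrow> real" and \<tau> \<beta> \<theta> :: real
    assume h: "0 \<le> \<tau> \<and> continuous_on {0..\<tau>} F \<and> F 0 = 0 \<and> 0 \<le> \<beta> \<and> -r \<le> \<theta> \<and> \<theta> \<le> 0 \<and>
     (\<forall>s t. 0 \<le> s \<and> s \<le> t \<and> t \<le> \<tau> \<longrightarrow> \<bar>F t - F s\<bar> \<le> \<beta> * (3 + (t - s)))"
    then have \<tau>: "0 \<le> \<tau>" and Fc: "continuous_on {0..\<tau>} F" and F0: "F 0 = 0" and \<beta>: "0 \<le> \<beta>"
      and th: "-r \<le> \<theta>" "\<theta> \<le> 0"
      and md: "\<And>s t. 0 \<le> s \<Longrightarrow> s \<le> t \<Longrightarrow> t \<le> \<tau> \<Longrightarrow> \<bar>F t - F s\<bar> \<le> \<beta> * (3 + (t - s))" by auto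
    let ?F = "stop F \<tau>"
    let ?s = "\<tau> + \<theta>"
    have Fm[measurable]: "?F \<in> borel_measurable borel" by (rule stop_measurable[OF Fc \<tau>])
    obtain B where B: "\<And>s. \<bar>?F s\<bar> \<le> B" using stop_bounded[OF Fc \<tau>] by blast
    have B0: "0 \<le> B" using order_trans[OF abs_ge_zero B[of 0]] .
    have i1: "set_integrable lborel {0..\<tau>} (\<lambda>s. k (?s - s) * ?F s)"
      by (rule set_integrable_bounded_borel[where B="Lnorm * Cx * B"])
         (use B kb B0 Lnorm_nonneg Cx_nonneg in \<open>auto simp: abs_mult intro!: mult_mono\<close>)
    have i2: "set_integrable lborel {0..\<tau>} (\<lambda>s. Phi \<omega> (Bmul \<omega> \<Psi>) (?s - s) * ?F s)"
      by (rule set_integrable_bounded_borel[where B="2 * norm (Bmul \<omega> \<Psi>) * B"])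
         (use B abs_Phi_le B0 in \<open>auto simp: abs_mult intro!: mult_mono\<close>)
    have i3: "set_integrable lborel {0..\<tau>} (\<lambda>s. ek (?s - s))"
      by (rule set_integrable_bounded_borel[where B="Lnorm * Cx + 2 * norm (Bmul \<omega> \<Psi>)"]) (use ek_bound in auto)
    have i4: "set_integrable lborel {0..\<tau>} (\<lambda>s. ek (?s - s) * ?F s)"
      using set_integral_diff(1)[OF i1 i2] by (simp add: ek_def left_diff_distrib)
    \<comment> \<open>The kernel vanishes at negative times, so the integral may be extended from ?s
      to \<tau>.\<close>
    have eq1: "(LINT s:{0..?s}|lborel. k (?s - s) * ?F s) = (LINT s:{0..\<tau>}|lborel. k (?s - s) * ?F s)"
      unfolding set_lebesgue_integral_def using th
      by (intro Bochner_Integration.integral_cong) (auto simp: indicator_def kneg)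
    have eq2: "voc ?F ?s - Phi \<omega> (zeta F \<tau>) ?s = ?F ?s + (LINT s:{0..\<tau>}|lborel. ek (?s - s) * ?F s) - F \<tau> * Phi \<omega> \<Psi> \<theta>"
    proof -
      have "Phi \<omega> (zeta F \<tau>) ?s = (LINT s:{0..\<tau>}|lborel. Phi \<omega> (Bmul \<omega> \<Psi>) (?s - s) * ?F s) + F \<tau> * Phi \<omega> \<Psi> \<theta>"
        using Phi_zeta[OF Fm B, of \<tau> ?s] stop_after[OF \<tau>, of \<tau> F] zeta_stop[OF \<tau>, of F] by simp
      moreover have "(LINT s:{0..\<tau>}|lborel. ek (?s - s) * ?F s) =
          (LINT s:{0..\<tau>}|lborel. k (?s - s) * ?F s) - (LINT s:{0..\<tau>}|lborel. Phi \<omega> (Bmul \<omega> \<Psi>) (?s - s) * ?F s)"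
        by (subst set_integral_diff(2)[OF i1 i2, symmetric]) (simp add: ek_def left_diff_distrib)
      ultimately show ?thesis unfolding voc_def eq1 by simp
    qed
    \<comment> \<open>The primitive of \<open>ek\<close> is \<open>e\<close> up to the jump of
      \<open>x\<close> at 0; its value is what subtracting the constant F \<tau> costs.\<close>
    have ekint: "(LINT s:{0..\<tau>}|lborel. ek (?s - s)) = e ?s - (if 0 \<le> ?s then 1 else 0) + Phi \<omega> \<Psi> \<theta>"
    proof -
      have "(LINT s:{0..\<tau>}|lborel. ek (?s - s)) = (LINT s:{\<theta>..?s}|lborel. ek s)"
        by (simp add: set_integral_reflect add.commute)
      also have "\<dots> = (LINT s:{\<theta>..?s}|lborel. k s) - (LINT s:{\<theta>..?s}|lborel. Phi \<omega> (Bmul \<omega> \<Psi>) s)"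
        unfolding ek_def by (rule set_integral_diff(2)[OF k_integrable Icc_integrable[OF continuous_on_Phi]])
      also have "(LINT s:{\<theta>..?s}|lborel. k s) = (LINT s:{0..?s}|lborel. k s)"
        unfolding set_lebesgue_integral_def using th
        by (intro Bochner_Integration.integral_cong) (auto simp: indicator_def kneg)
      also have "\<dots> = x ?s - (if 0 \<le> ?s then 1 else 0)"
        using xeq'[of ?s] xneg[of ?s] by (auto simp: set_lebesgue_integral_def)
      also have "(LINT s:{\<theta>..?s}|lborel. Phi \<omega> (Bmul \<omega> \<Psi>) s) = Phi \<omega> \<Psi> ?s - Phi \<omega> \<Psi> \<theta>"
        unfolding set_lebesgue_integral_def using \<tau>
        by (intro integral_FTC_atLeastAtMost continuous_on_Phi)
           (auto intro!: Phi_deriv simp flip: has_real_derivative_iff_has_vector_derivative)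
      finally show ?thesis by (simp add: e_def)
    qed
    have i5: "set_integrable lborel {0..\<tau>} (\<lambda>s. ek (?s - s) * F \<tau>)" using i3 by simp
    have "(LINT s:{0..\<tau>}|lborel. ek (?s - s) * (?F s - F \<tau>)) =
        (LINT s:{0..\<tau>}|lborel. ek (?s - s) * ?F s) - (LINT s:{0..\<tau>}|lborel. ek (?s - s)) * F \<tau>"
      unfolding right_diff_distrib by (subst set_integral_diff(2)[OF i4 i5]) simp
    then have main: "voc ?F ?s - Phi \<omega> (zeta F \<tau>) ?s = (?F ?s - (if 0 \<le> ?s then F \<tau> else 0))
        + (LINT s:{0..\<tau>}|lborel. ek (?s - s) * (?F s - F \<tau>)) + F \<tau> * e ?s"
      unfolding eq2 ekint by (simp add: algebra_simps)
    \<comment> \<open>If ?s is negative, the window still reaches into the initial segment, where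
      the stopped forcing is 0.\<close>
    have b1: "\<bar>?F ?s - (if 0 \<le> ?s then F \<tau> else 0)\<bar> \<le> (3 + r) * \<beta>"
    proof (cases "0 \<le> ?s")
      case True
      have "\<bar>F \<tau> - F ?s\<bar> \<le> \<beta> * (3 + (\<tau> - ?s))" using True th by (intro md) auto
      also have "\<dots> \<le> \<beta> * (3 + r)" using th \<beta> by (intro mult_left_mono) auto
      finally show ?thesis using True th stop_eq[of ?s \<tau> F] by (simp add: mult.commute abs_minus_commute)
    qed (use \<beta> r stop_neg in auto)
    \<comment> \<open>F \<tau> alone may be as large as \<beta>(3 + \<tau>), but it is multiplied by
      \<open>e\<close> at a time within r of \<tau>.\<close>
    have b2: "\<bar>F \<tau> * e ?s\<bar> \<le> ?D * (Ce * exp (\<kappa> * r)) * \<beta>"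
    proof -
      have "\<bar>F \<tau>\<bar> \<le> \<beta> * (3 + \<tau>)" using md[of 0 \<tau>] \<tau> F0 by simp
      moreover have "\<bar>e ?s\<bar> \<le> Ce * exp (\<kappa> * r) * exp (- \<kappa> * \<tau>)"
      proof -
        have "\<kappa> * (- \<theta>) \<le> \<kappa> * r" using \<kappa> th by (intro mult_left_mono) auto
        then have "exp (- \<kappa> * ?s) \<le> exp (\<kappa> * r) * exp (- \<kappa> * \<tau>)" by (simp add: algebra_simps flip: exp_add)
        then show ?thesis using Ce by (metis mult.assoc mult_left_mono order_trans)
      qed
      ultimately have "\<bar>F \<tau> * e ?s\<bar> \<le> \<beta> * (3 + \<tau>) * (Ce * exp (\<kappa> * r) * exp (- \<kappa> * \<tau>))"
        unfolding abs_mult using \<beta> \<tau> by (intro mult_mono) auto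
      also have "\<dots> = \<beta> * (Ce * exp (\<kappa> * r)) * ((3 + \<tau>) * exp (- \<kappa> * \<tau>))" by (simp add: mult_ac)
      also have "\<dots> \<le> \<beta> * (Ce * exp (\<kappa> * r)) * (?D * 1)"
      proof (intro mult_left_mono)
        have "(3 + \<tau>) * exp (- \<kappa> * \<tau>) \<le> ?D * exp (- (\<kappa> / 2) * \<tau>)" by (rule linear_exp_bound[OF \<tau>])
        also have "\<dots> \<le> ?D * 1" using D0 \<kappa> \<tau> by (intro mult_left_mono) auto
        finally show "(3 + \<tau>) * exp (- \<kappa> * \<tau>) \<le> ?D * 1" .
      qed (use \<beta> Ce in auto)
      finally show ?thesis by (simp add: mult_ac)
    qed
    have b3: "\<bar>LINT s:{0..\<tau>}|lborel. ek (?s - s) * (?F s - F \<tau>)\<bar> \<le> Ck * exp (\<kappa> * r) * ?D * (2 / \<kappa>) * \<beta>"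
    proof -
      \<comment> \<open>Everything independent of s; the factor exp(-\<kappa> \<tau>/2) is kept here
        to cancel the growth of the integral of exp(\<kappa> s/2).\<close>
      let ?c = "Ck * exp (\<kappa> * r) * \<beta> * ?D * exp (- (\<kappa> / 2) * \<tau>)"
      have k2: "0 < \<kappa> / 2" using \<kappa> by simp
      have ie: "set_integrable lborel {0..\<tau>} (\<lambda>s. ?c * exp (\<kappa> / 2 * s))" using set_integral_exp(2)[OF k2 \<tau>] by simp
      have "norm (LINT s:{0..\<tau>}|lborel. ek (?s - s) * (?F s - F \<tau>)) \<le> (LINT s:{0..\<tau>}|lborel. ?c * exp (\<kappa> / 2 * s))"
      proof (rule set_integral_norm_le[OF ie])
        fix s assume s: "0 \<le> s" "s \<le> \<tau>"
        have "\<bar>?F s - F \<tau>\<bar> \<le> \<beta> * (3 + (\<tau> - s))" using md[OF s] s by (simp add: stop_eq abs_minus_commute)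
        moreover have "\<bar>ek (?s - s)\<bar> \<le> Ck * (exp (\<kappa> * r) * exp (- \<kappa> * (\<tau> - s)))"
        proof -
          have "\<kappa> * (- \<theta>) \<le> \<kappa> * r" using \<kappa> th by (intro mult_left_mono) auto
          then have "exp (- \<kappa> * (?s - s)) \<le> exp (\<kappa> * r) * exp (- \<kappa> * (\<tau> - s))" by (simp add: algebra_simps flip: exp_add)
          then show ?thesis using Ck by (metis mult_left_mono order_trans)
        qed
        ultimately have "\<bar>ek (?s - s) * (?F s - F \<tau>)\<bar> \<le> Ck * (exp (\<kappa> * r) * exp (- \<kappa> * (\<tau> - s))) * (\<beta> * (3 + (\<tau> - s)))"
          unfolding abs_mult using Ck by (intro mult_mono) auto
        also have "\<dots> = Ck * exp (\<kappa> * r) * \<beta> * ((3 + (\<tau> - s)) * exp (- \<kappa> * (\<tau> - s)))" by (simp add: mult_ac)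
        also have "\<dots> \<le> Ck * exp (\<kappa> * r) * \<beta> * (?D * exp (- (\<kappa> / 2) * (\<tau> - s)))"
          using Ck \<beta> s by (intro mult_left_mono linear_exp_bound) auto
        also have "exp (- (\<kappa> / 2) * (\<tau> - s)) = exp (- (\<kappa> / 2) * \<tau>) * exp (\<kappa> / 2 * s)"
          unfolding exp_add[symmetric] by (rule arg_cong[where f=exp]) (simp add: field_simps)
        finally show "norm (ek (?s - s) * (?F s - F \<tau>)) \<le> ?c * exp (\<kappa> / 2 * s)" by (simp add: mult.assoc)
      qed
      also have "\<dots> = ?c * ((exp (\<kappa> / 2 * \<tau>) - 1) / (\<kappa> / 2))" using set_integral_exp(1)[OF k2 \<tau>] by simp
      also have "\<dots> = Ck * exp (\<kappa> * r) * ?D * (2 / \<kappa>) * \<beta> * (exp (- (\<kappa> / 2) * \<tau>) * (exp (\<kappa> / 2 * \<tau>) - 1))"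
      proof -
        have "c * \<beta> * d * E * ((E' - 1) / (\<kappa> / 2)) = c * d * (2 / \<kappa>) * \<beta> * (E * (E' - 1))" for c d E E' :: real
          by (simp add: mult_ac)
        then show ?thesis .
      qed
      also have "\<dots> \<le> Ck * exp (\<kappa> * r) * ?D * (2 / \<kappa>) * \<beta> * 1"
      proof (intro mult_left_mono)
        show "exp (- (\<kappa> / 2) * \<tau>) * (exp (\<kappa> / 2 * \<tau>) - 1) \<le> 1"
          by (simp add: right_diff_distrib flip: exp_add)
        show "0 \<le> Ck * exp (\<kappa> * r) * ?D * (2 / \<kappa>) * \<beta>" using Ck D0 \<kappa> \<beta> by (intro mult_nonneg_nonneg) auto
      qed
      finally show ?thesis by simp
    qed
    show "\<bar>voc ?F ?s - Phi \<omega> (zeta F \<tau>) ?s\<bar> \<le> K * \<beta>"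
    proof -
      have "K * \<beta> = (3 + r) * \<beta> + Ck * exp (\<kappa> * r) * ?D * (2 / \<kappa>) * \<beta> + ?D * (Ce * exp (\<kappa> * r)) * \<beta>"
      proof -
        have "(p + q + s) * \<beta> = p * \<beta> + q * \<beta> + s * \<beta>" for p q s by (simp only: distrib_right)
        then show ?thesis unfolding K_def .
      qed
      then show ?thesis unfolding main using b1 b2 b3 by linarith
    qed
  qed
qed

end

section \<open>A single path of the delay equation\<close>

lemma rot_expand: "rot a v = (cos a * v $ 1 + sin a * v $ 2) *\<^sub>R axis 1 1 + (- sin a * v $ 1 + cos a * v $ 2) *\<^sub>R axis 2 1"
  by (simp add: vec_eq_iff forall_2 axis_def)

lemma rot_has_vector_derivative:
  "((\<lambda>s. rot (c * s) v) has_vector_derivative rot (c * s) (Bmul c v)) (at s within S)"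
proof -
  have 1: "((\<lambda>s. cos (c * s) * v $ 1 + sin (c * s) * v $ 2) has_field_derivative
      cos (c * s) * (c * v $ 2) + sin (c * s) * (- c * v $ 1)) (at s within S)"
    by (auto intro!: derivative_eq_intros simp: algebra_simps)
  have 2: "((\<lambda>s. - sin (c * s) * v $ 1 + cos (c * s) * v $ 2) has_field_derivative
      - sin (c * s) * (c * v $ 2) + cos (c * s) * (- c * v $ 1)) (at s within S)"
    by (auto intro!: derivative_eq_intros simp: algebra_simps)
  have "((\<lambda>s. rot (c * s) v) has_vector_derivative
      (cos (c * s) * (c * v $ 2) + sin (c * s) * (- c * v $ 1)) *\<^sub>R axis 1 1 +
      (- sin (c * s) * (c * v $ 2) + cos (c * s) * (- c * v $ 1)) *\<^sub>R axis 2 1) (at s within S)"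
    unfolding rot_expand
    using has_vector_derivative_add[OF has_vector_derivative_scaleR[OF 1 has_vector_derivative_const]
        has_vector_derivative_scaleR[OF 2 has_vector_derivative_const]]
    by simp
  then show ?thesis unfolding rot_expand[of _ "Bmul c v"] Bmul_component .
qed

lemma Bmul_scale: "Bmul (a * c) v = a *\<^sub>R Bmul c v"
  by (simp add: vec_eq_iff forall_2)

lemma rot_reverse_has_vector_derivative:
  "((\<lambda>s. rot (c * - (s / d)) v) has_vector_derivative - (1 / d) *\<^sub>R rot (c * - (s / d)) (Bmul c v)) (at s within S)"
proof -
  let ?c = "- (1 / d) * c"
  have "((\<lambda>s. rot (?c * s) v) has_vector_derivative rot (?c * s) (Bmul ?c v)) (at s within S)"
    by (rule rot_has_vector_derivative)
  moreover have "?c * s = c * - (s / d)" for s by simp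
  moreover have "rot (?c * s) (Bmul ?c v) = - (1 / d) *\<^sub>R rot (?c * s) (Bmul c v)"
    unfolding Bmul_scale rot_linear ..
  ultimately show ?thesis by simp
qed

lemma has_vector_derivative_set_integral:
  fixes g :: "real \<Rightarrow> real"
  assumes g: "continuous_on {0..T} g" and s: "s \<in> {0..T}"
  shows "((\<lambda>t. LINT u:{0..t}|lborel. g u) has_vector_derivative g s) (at s within {0..T})"
proof -
  have eq: "integral {0..t} g = (LINT u:{0..t}|lborel. g u)" if "t \<in> {0..T}" for t
  proof -
    have "set_integrable lborel {0..t} g"
      unfolding set_integrable_def
      by (intro borel_integrable_compact continuous_on_subset[OF g]) (use that in auto)
    then show ?thesis by (simp add: set_borel_integral_eq_integral)
  qed
  have "((\<lambda>t. integral {0..t} g) has_vector_derivative g s) (at s within {0..T})"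
    by (rule integral_has_vector_derivative[OF g s])
  then show ?thesis
    by (rule has_vector_derivative_transform[OF s, rotated]) (simp add: eq)
qed

section \<open>Bounds that depend on the linear equation alone\<close>

context splitting
begin

lemma lin_solution_cong:
  assumes "\<And>\<theta>. -r \<le> \<theta> \<Longrightarrow> \<theta> \<le> 0 \<Longrightarrow> \<phi> \<theta> = \<psi> \<theta>"
  shows "lin_solution r L0 \<phi> y \<longleftrightarrow> lin_solution r L0 \<psi> y"
  unfolding lin_solution_def using assms r by auto

lemma lin_solution_continuous_segment:
  assumes xi: "xi \<in> delay_C r" and ysol: "lin_solution r L0 xi y"
  shows "continuous_on {-r..S} y"
proof (cases "0 \<le> S")
  case True
  have "continuous_on ({-r..0} \<union> {0..S}) y"
  proof (intro continuous_on_closed_Un lin_solution_continuous[OF ysol])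
    have "continuous_on {-r..0} xi" using xi by (simp add: delay_C_def)
    then show "continuous_on {-r..0} y"
      by (rule continuous_on_eq) (use lin_solution_initial[OF ysol] in auto)
  qed auto
  then show ?thesis using True r by (simp add: ivl_disj_un_two_touch)
next
  case False
  have "continuous_on {-r..S} xi" using xi False by (auto simp: delay_C_def intro: continuous_on_subset)
  then show ?thesis
    by (rule continuous_on_eq) (use lin_solution_initial[OF ysol] False in auto)
qed

text \<open>For late times the solution is within 1 of its oscillation, and before that it is
  continuous on a compact interval. The bound is in fast time, hence the same for all
  \<epsilon>.\<close>

lemma lin_solution_bounded:
  assumes xi: "xi \<in> delay_C r" and ysol: "lin_solution r L0 xi y" and lim: "((\<lambda>t. y t - Phi \<omega> v t) \<longlongrightarrow> 0) at_top"
  shows "\<exists>B. \<forall>t\<ge>-r. \<bar>y t - Phi \<omega> v t\<bar> \<le> B"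
proof -
  have "\<forall>\<^sub>F t in at_top. \<bar>y t - Phi \<omega> v t\<bar> < 1"
    using tendstoD[OF lim, of 1] by (simp add: dist_real_def)
  then obtain S where S: "\<And>t. S \<le> t \<Longrightarrow> \<bar>y t - Phi \<omega> v t\<bar> < 1" unfolding eventually_at_top_linorder by blast
  have "continuous_on {-r..S} (\<lambda>t. y t - Phi \<omega> v t)"
    by (intro continuous_intros lin_solution_continuous_segment[OF xi ysol] continuous_on_Phi)
  then have "bounded ((\<lambda>t. y t - Phi \<omega> v t) ` {-r..S})"
    by (intro compact_imp_bounded compact_continuous_image) auto
  then obtain B where B: "\<forall>t\<in>{-r..S}. norm (y t - Phi \<omega> v t) \<le> B" unfolding bounded_iff by auto
  show ?thesis
  proof (intro exI[of _ "max 1 B"] allI impI)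
    fix t assume "-r \<le> t"
    then show "\<bar>y t - Phi \<omega> v t\<bar> \<le> max 1 B"
      using S[of t] B by (cases "S \<le> t") (fastforce simp: le_max_iff_disj)+
  qed
qed

text \<open>A fixed choice of the constant of \<open>perturbation_bound\<close>, so that it can
  occur in \<open>gam\<close> and in statements about paths.\<close>

definition Kp :: real where
  "Kp = (SOME K. 0 \<le> K \<and> (\<forall>(F :: real \<Rightarrow> real) \<tau> \<beta> \<theta>. 0 \<le> \<tau> \<and> continuous_on {0..\<tau>} F \<and> F 0 = 0 \<and> 0 \<le> \<beta> \<and> -r \<le> \<theta> \<and> \<theta> \<le> 0 \<and>
     (\<forall>s t. 0 \<le> s \<and> s \<le> t \<and> t \<le> \<tau> \<longrightarrow> \<bar>F t - F s\<bar> \<le> \<beta> * (3 + (t - s))) \<longrightarrow>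
     \<bar>voc (stop F \<tau>) (\<tau> + \<theta>) - Phi \<omega> (zeta F \<tau>) (\<tau> + \<theta>)\<bar> \<le> K * \<beta>))"

lemma Kp: "0 \<le> Kp"
  "0 \<le> \<tau> \<Longrightarrow> continuous_on {0..\<tau>} F \<Longrightarrow> F 0 = 0 \<Longrightarrow> 0 \<le> \<beta> \<Longrightarrow> -r \<le> \<theta> \<Longrightarrow> \<theta> \<le> 0 \<Longrightarrow>
     (\<And>s t. 0 \<le> s \<Longrightarrow> s \<le> t \<Longrightarrow> t \<le> \<tau> \<Longrightarrow> \<bar>F t - F s\<bar> \<le> \<beta> * (3 + (t - s))) \<Longrightarrow>
     \<bar>voc (stop F \<tau>) (\<tau> + \<theta>) - Phi \<omega> (zeta F \<tau>) (\<tau> + \<theta>)\<bar> \<le> Kp * \<beta>"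
proof -
  have "\<exists>K. 0 \<le> K \<and> (\<forall>(F :: real \<Rightarrow> real) \<tau> \<beta> \<theta>. 0 \<le> \<tau> \<and> continuous_on {0..\<tau>} F \<and> F 0 = 0 \<and> 0 \<le> \<beta> \<and> -r \<le> \<theta> \<and> \<theta> \<le> 0 \<and>
     (\<forall>s t. 0 \<le> s \<and> s \<le> t \<and> t \<le> \<tau> \<longrightarrow> \<bar>F t - F s\<bar> \<le> \<beta> * (3 + (t - s))) \<longrightarrow>
     \<bar>voc (stop F \<tau>) (\<tau> + \<theta>) - Phi \<omega> (zeta F \<tau>) (\<tau> + \<theta>)\<bar> \<le> K * \<beta>)"
    using perturbation_bound by blast
  from someI_ex[OF this, folded Kp_def]
  show "0 \<le> Kp" "0 \<le> \<tau> \<Longrightarrow> continuous_on {0..\<tau>} F \<Longrightarrow> F 0 = 0 \<Longrightarrow> 0 \<le> \<beta> \<Longrightarrow> -r \<le> \<theta> \<Longrightarrow> \<theta> \<le> 0 \<Longrightarrow>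
     (\<And>s t. 0 \<le> s \<Longrightarrow> s \<le> t \<Longrightarrow> t \<le> \<tau> \<Longrightarrow> \<bar>F t - F s\<bar> \<le> \<beta> * (3 + (t - s))) \<Longrightarrow>
     \<bar>voc (stop F \<tau>) (\<tau> + \<theta>) - Phi \<omega> (zeta F \<tau>) (\<tau> + \<theta>)\<bar> \<le> Kp * \<beta>"
    by blast+
qed

lemma bm_delay_C: "f \<in> delay_C r \<Longrightarrow> bm f" by (simp add: delay_C_def bm_continuous)

end

text \<open>The nonlinearity is represented by a growth bound and a Lipschitz bound on balls, both
  supplied by \<open>G_nl_bounds\<close>.\<close>

locale sdde_path = splitting +
  fixes G :: "(real \<Rightarrow> real) \<Rightarrow> real" and V :: real
  assumes V0: "0 \<le> V"
    and Gb: "\<And>f R. f \<in> delay_C r \<Longrightarrow> (\<And>\<theta>. -r \<le> \<theta> \<Longrightarrow> \<theta> \<le> 0 \<Longrightarrow> \<bar>f \<theta>\<bar> \<le> R) \<Longrightarrow> \<bar>G f\<bar> \<le> V * (R + R ^ 3)"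
    and Gl: "\<And>f g R M. f \<in> delay_C r \<Longrightarrow> g \<in> delay_C r \<Longrightarrow> (\<And>\<theta>. -r \<le> \<theta> \<Longrightarrow> \<theta> \<le> 0 \<Longrightarrow> \<bar>f \<theta>\<bar> \<le> R) \<Longrightarrow>
      (\<And>\<theta>. -r \<le> \<theta> \<Longrightarrow> \<theta> \<le> 0 \<Longrightarrow> \<bar>g \<theta>\<bar> \<le> R) \<Longrightarrow> (\<And>\<theta>. -r \<le> \<theta> \<Longrightarrow> \<theta> \<le> 0 \<Longrightarrow> \<bar>f \<theta> - g \<theta>\<bar> \<le> M) \<Longrightarrow>
      \<bar>G f - G g\<bar> \<le> V * (1 + 3 * R\<^sup>2) * M"
    and L0C: "\<And>\<eta>. \<eta> \<in> delay_C r \<Longrightarrow> L0 \<eta> = L \<eta>"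
begin

text \<open>The bound of \<open>weighted_gronwall\<close> at time T per unit size of the forcing:
  rate 2 Lip |\<Psi>| + 1 and error Lip Kp |\<Psi>| T, where Lip = V(1 + 3 R^2). The 2 in the rate
  comes from \<open>abs_Phi_le\<close>, and the 1 keeps the rate positive.\<close>

definition gam :: "real \<Rightarrow> real \<Rightarrow> real" where
  "gam T R = 2 * (V * (1 + 3 * R\<^sup>2) * Kp * norm \<Psi> * T) * exp (2 * (2 * (V * (1 + 3 * R\<^sup>2)) * norm \<Psi> + 1) * T)"

lemma delay_C_cong: "(\<And>\<theta>. -r \<le> \<theta> \<Longrightarrow> \<theta> \<le> 0 \<Longrightarrow> f \<theta> = g \<theta>) \<Longrightarrow> f \<in> delay_C r \<longleftrightarrow> g \<in> delay_C r"
  unfolding delay_C_def mem_Collect_eq by (rule continuous_on_cong) auto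

lemma G_cong:
  assumes f: "f \<in> delay_C r" and eq: "\<And>\<theta>. -r \<le> \<theta> \<Longrightarrow> \<theta> \<le> 0 \<Longrightarrow> f \<theta> = g \<theta>"
  shows "G f = G g"
proof -
  have g: "g \<in> delay_C r" using delay_C_cong[OF eq] f by simp
  have "\<bar>f \<theta>\<bar> \<le> supnorm r f" if "-r \<le> \<theta>" "\<theta> \<le> 0" for \<theta>
    by (rule supnorm_upper[OF bounded_image_delay_C[OF f] that])
  then have "\<bar>G f - G g\<bar> \<le> V * (1 + 3 * (supnorm r f)\<^sup>2) * 0"
    using eq by (intro Gl f g) auto
  then show ?thesis by simp
qed

text \<open>Uniform continuity on the compact product makes segments at nearby times uniformly
  close, and the Lipschitz bound of G does the rest.\<close>

lemma G_continuous:
  fixes a b :: real and h :: "real \<Rightarrow> real \<Rightarrow> real"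
  assumes h: "continuous_on ({a..b} \<times> {-r..0}) (\<lambda>p. h (fst p) (snd p))"
  shows "continuous_on {a..b} (\<lambda>s. G (h s))"
  unfolding continuous_on_iff
proof (intro ballI allI impI)
  fix s e :: real assume s: "s \<in> {a..b}" and e: "0 < e"
  let ?S = "{a..b} \<times> {-r..0}"
  have cS: "compact ?S" by (intro compact_Times) auto
  have "bounded ((\<lambda>p. h (fst p) (snd p)) ` ?S)" by (intro compact_imp_bounded compact_continuous_image h cS)
  then obtain R where R: "\<forall>p\<in>?S. norm (h (fst p) (snd p)) \<le> R" unfolding bounded_iff by auto
  have Rb: "\<bar>h u \<theta>\<bar> \<le> R" if "u \<in> {a..b}" "-r \<le> \<theta>" "\<theta> \<le> 0" for u \<theta> using R that by auto
  let ?K = "V * (1 + 3 * R\<^sup>2)"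
  have K0: "0 \<le> ?K" using V0 by simp
  have e': "0 < e / (?K + 1)" using e K0 by simp
  have "uniformly_continuous_on ?S (\<lambda>p. h (fst p) (snd p))" by (rule compact_uniformly_continuous[OF h cS])
  then obtain d where d: "0 < d" "\<And>p q. p \<in> ?S \<Longrightarrow> q \<in> ?S \<Longrightarrow> dist q p < d \<Longrightarrow> dist (h (fst q) (snd q)) (h (fst p) (snd p)) < e / (?K + 1)"
    unfolding uniformly_continuous_on_def using e' by metis
  have hC: "h u \<in> delay_C r" if "u \<in> {a..b}" for u
  proof -
    have "continuous_on {-r..0} (\<lambda>\<theta>. h (fst (u, \<theta>)) (snd (u, \<theta>)))"
      by (rule continuous_on_compose2[OF h]) (use that in \<open>auto intro!: continuous_intros\<close>)
    then show ?thesis by (simp add: delay_C_def)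
  qed
  show "\<exists>d>0. \<forall>s'\<in>{a..b}. dist s' s < d \<longrightarrow> dist (G (h s')) (G (h s)) < e"
  proof (intro exI[of _ d] conjI ballI impI d(1))
    fix s' assume s': "s' \<in> {a..b}" "dist s' s < d"
    have "\<bar>G (h s') - G (h s)\<bar> \<le> ?K * (e / (?K + 1))"
    proof (rule Gl[OF hC[OF s'(1)] hC[OF s] Rb[OF s'(1)] Rb[OF s]])
      fix \<theta> assume "-r \<le> \<theta>" "\<theta> \<le> 0"
      then have "dist (h (fst (s', \<theta>)) (snd (s', \<theta>))) (h (fst (s, \<theta>)) (snd (s, \<theta>))) < e / (?K + 1)"
        using s s' by (intro d(2)) (auto simp: dist_Pair_Pair)
      then show "\<bar>h s' \<theta> - h s \<theta>\<bar> \<le> e / (?K + 1)" by (simp add: dist_real_def)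
    qed
    also have "\<dots> < e" using e K0 by (simp add: field_simps)
    finally show "dist (G (h s')) (G (h s)) < e" by (simp add: dist_real_def)
  qed
qed

end

text \<open>One sample path, so everything here is deterministic. \<open>y\<close> is the linear
  evolution of the initial segment and \<open>v0\<close> its critical vector; \<open>Z\<close> is
  only continuous for now, its equation being added in \<open>sample_path\<close>.\<close>

locale delay_path = sdde_path +
  fixes \<epsilon> T \<sigma> :: real and xi y :: "real \<Rightarrow> real" and v0 :: "real^2" and X Wp :: "real \<Rightarrow> real" and Z :: "real \<Rightarrow> real^2"
  assumes eps: "0 < \<epsilon>" and T: "0 < T" and xi: "xi \<in> delay_C r" and ysol: "lin_solution r L0 xi y"
    and ylim: "((\<lambda>t. y t - Phi \<omega> v0 t) \<longlongrightarrow> 0) at_top"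
    and Xcont: "continuous_on {- (\<epsilon>\<^sup>2 * r)..T} X" and Xinit: "\<And>t. - (\<epsilon>\<^sup>2 * r) \<le> t \<Longrightarrow> t \<le> 0 \<Longrightarrow> X t = xi (t / \<epsilon>\<^sup>2)"
    and Wcont: "continuous_on {0..T} Wp" and W0: "Wp 0 = 0"
    and Xeq: "\<And>t. 0 \<le> t \<Longrightarrow> t \<le> T \<Longrightarrow> X t = X 0
      + (LINT s:{0..t}|lborel. (1 / \<epsilon>\<^sup>2) * L0 (segment \<epsilon> X s) + G (segment \<epsilon> X s)) + \<sigma> * Wp t"
    and Zcont: "continuous_on {0..T} Z"
begin

definition psi :: "real \<Rightarrow> real^2" where "psi s = rot (\<omega> * - (s / \<epsilon>\<^sup>2)) \<Psi>"
definition psi' :: "real \<Rightarrow> real^2" where "psi' s = - (1 / \<epsilon>\<^sup>2) *\<^sub>R rot (\<omega> * - (s / \<epsilon>\<^sup>2)) (Bmul \<omega> \<Psi>)"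
definition g :: "real \<Rightarrow> real" where "g s = G (segment \<epsilon> X s)"
definition gZ :: "real \<Rightarrow> real" where
  "gZ s = G (\<lambda>\<theta>. Phi \<omega> (rot (\<omega> * (s / \<epsilon>\<^sup>2)) (Z s)) \<theta> + Yfrak r L0 \<omega> \<epsilon> X s \<theta>)"
text \<open>The forcing in slow time, followed by forcing and solution in the fast time \<tau> =
  t/\<epsilon>^2. The drift integral stays in slow time, so it is of order \<epsilon>^2 per unit of
  fast time.\<close>

definition Fr :: "real \<Rightarrow> real" where "Fr t = (LINT s:{0..t}|lborel. g s) + \<sigma> * Wp t"
definition F :: "real \<Rightarrow> real" where "F \<tau> = Fr (\<epsilon>\<^sup>2 * \<tau>)"
definition U :: "real \<Rightarrow> real" where "U \<tau> = X (\<epsilon>\<^sup>2 * \<tau>)"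

section \<open>One path of the delay equation in fast time\<close>

lemma e2: "0 < \<epsilon>\<^sup>2" using eps by simp

lemma psi_deriv: "(psi has_vector_derivative psi' s) (at s within S)"
  unfolding psi_def[abs_def] psi'_def by (rule rot_reverse_has_vector_derivative)

lemma psi_continuous: "continuous_on S psi"
  unfolding psi_def by (intro continuous_on_rot continuous_intros) (use e2 in auto)

lemma psi'_continuous: "continuous_on S psi'"
  unfolding psi'_def by (intro continuous_intros continuous_on_rot) (use e2 in auto)

lemma norm_psi: "norm (psi s) = norm \<Psi>" by (simp add: psi_def)

lemma segment_U: "segment \<epsilon> X t = (\<lambda>\<theta>. U (t / \<epsilon>\<^sup>2 + \<theta>))"
  using e2 by (auto simp: segment_def U_def distrib_left)

lemma segment_delay_C: assumes "0 \<le> t" "t \<le> T" shows "segment \<epsilon> X t \<in> delay_C r"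
  unfolding delay_C_def segment_def
proof (clarify, rule continuous_on_compose2[OF Xcont])
  show "(\<lambda>\<theta>. t + \<epsilon>\<^sup>2 * \<theta>) ` {-r..0} \<subseteq> {- (\<epsilon>\<^sup>2 * r)..T}"
  proof clarsimp
    fix \<theta> assume th: "-r \<le> \<theta>" "\<theta> \<le> 0"
    have "\<epsilon>\<^sup>2 * (- r) \<le> \<epsilon>\<^sup>2 * \<theta>" using th by (intro mult_left_mono) auto
    moreover have "\<epsilon>\<^sup>2 * \<theta> \<le> 0" using th by (simp add: mult_nonneg_nonpos)
    ultimately show "- (\<epsilon>\<^sup>2 * r) \<le> t + \<epsilon>\<^sup>2 * \<theta> \<and> t + \<epsilon>\<^sup>2 * \<theta> \<le> T" using assms by simp
  qed
qed (intro continuous_intros)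

lemma g_continuous: "continuous_on {0..T} g"
  unfolding g_def
proof (rule G_continuous)
  show "continuous_on ({0..T} \<times> {-r..0}) (\<lambda>p. segment \<epsilon> X (fst p) (snd p))"
    unfolding segment_def
  proof (rule continuous_on_compose2[OF Xcont])
    show "(\<lambda>p. fst p + \<epsilon>\<^sup>2 * snd p) ` ({0..T} \<times> {-r..0}) \<subseteq> {- (\<epsilon>\<^sup>2 * r)..T}"
    proof clarsimp
      fix t \<theta> assume th: "0 \<le> t" "t \<le> T" "-r \<le> \<theta>" "\<theta> \<le> 0"
      have "\<epsilon>\<^sup>2 * (- r) \<le> \<epsilon>\<^sup>2 * \<theta>" using th by (intro mult_left_mono) auto
      moreover have "\<epsilon>\<^sup>2 * \<theta> \<le> 0" using th by (simp add: mult_nonneg_nonpos)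
      ultimately show "- (\<epsilon>\<^sup>2 * r) \<le> t + \<epsilon>\<^sup>2 * \<theta> \<and> t + \<epsilon>\<^sup>2 * \<theta> \<le> T" using th by simp
    qed
  qed (intro continuous_intros)
qed

lemma U_continuous: "continuous_on {-r..T / \<epsilon>\<^sup>2} U"
  unfolding U_def
proof (rule continuous_on_compose2[OF Xcont])
  show "(\<lambda>\<tau>. \<epsilon>\<^sup>2 * \<tau>) ` {-r..T / \<epsilon>\<^sup>2} \<subseteq> {- (\<epsilon>\<^sup>2 * r)..T}"
  proof (intro image_subsetI)
    fix \<tau> assume "\<tau> \<in> {-r..T / \<epsilon>\<^sup>2}"
    then have "\<epsilon>\<^sup>2 * (- r) \<le> \<epsilon>\<^sup>2 * \<tau>" "\<epsilon>\<^sup>2 * \<tau> \<le> \<epsilon>\<^sup>2 * (T / \<epsilon>\<^sup>2)"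
      using e2 by (intro mult_left_mono; simp)+
    moreover have "\<epsilon>\<^sup>2 * (T / \<epsilon>\<^sup>2) = T" using e2 by simp
    ultimately show "\<epsilon>\<^sup>2 * \<tau> \<in> {- (\<epsilon>\<^sup>2 * r)..T}" by simp
  qed
qed (intro continuous_intros)

lemma Fr_continuous: "continuous_on {0..T} Fr"
  unfolding Fr_def by (intro continuous_intros continuous_on_set_integral Icc_integrable g_continuous Wcont)

lemma scaled_le: "0 \<le> \<tau> \<Longrightarrow> \<tau> \<le> T / \<epsilon>\<^sup>2 \<Longrightarrow> 0 \<le> \<epsilon>\<^sup>2 * \<tau> \<and> \<epsilon>\<^sup>2 * \<tau> \<le> T"
  using e2 by (simp add: field_simps)

lemma F_continuous: "continuous_on {0..T / \<epsilon>\<^sup>2} F"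
  unfolding F_def
  by (rule continuous_on_compose2[OF Fr_continuous]) (use scaled_le in \<open>auto intro!: continuous_intros\<close>)

text \<open>The substitution s = \<epsilon>^2 \<tau> removes the factor 1/\<epsilon>^2 in front of
  the functional, which leaves a linear part with delay r that is free of \<epsilon>.\<close>

lemma perturbed_U: "perturbed xi U F (T / \<epsilon>\<^sup>2)"
  unfolding perturbed_def
proof (intro conjI ballI U_continuous F_continuous)
  show "0 \<le> T / \<epsilon>\<^sup>2" using T by simp
  show "F 0 = 0" by (simp add: F_def Fr_def W0)
  fix \<theta> assume th: "\<theta> \<in> {-r..0}"
  have "\<epsilon>\<^sup>2 * (- r) \<le> \<epsilon>\<^sup>2 * \<theta>" using th by (intro mult_left_mono) auto
  moreover have "\<epsilon>\<^sup>2 * \<theta> \<le> 0" using th by (simp add: mult_nonneg_nonpos)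
  ultimately show "U \<theta> = xi \<theta>" using Xinit[of "\<epsilon>\<^sup>2 * \<theta>"] e2 by (simp add: U_def)
next
  fix \<tau> assume \<tau>: "\<tau> \<in> {0..T / \<epsilon>\<^sup>2}"
  let ?t = "\<epsilon>\<^sup>2 * \<tau>"
  have t: "0 \<le> ?t" "?t \<le> T" using scaled_le \<tau> by auto
  have Lc: "continuous_on {0..T} (\<lambda>s. L (segment \<epsilon> X s))"
    unfolding segment_U
    by (rule continuous_on_compose2[OF L_window_continuous[OF U_continuous], of _ "\<lambda>s. s / \<epsilon>\<^sup>2"])
       (use e2 in \<open>auto intro!: continuous_intros divide_right_mono\<close>)
  have i1: "set_integrable lborel {0..?t} (\<lambda>s. (1 / \<epsilon>\<^sup>2) * L (segment \<epsilon> X s))"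
    by (intro Icc_integrable continuous_intros continuous_on_subset[OF Lc]) (use t in auto)
  have i2: "set_integrable lborel {0..?t} g"
    by (intro Icc_integrable continuous_on_subset[OF g_continuous]) (use t in auto)
  have "(LINT s:{0..?t}|lborel. (1 / \<epsilon>\<^sup>2) * L0 (segment \<epsilon> X s) + G (segment \<epsilon> X s)) =
      (LINT s:{0..?t}|lborel. (1 / \<epsilon>\<^sup>2) * L (segment \<epsilon> X s) + g s)"
    by (rule set_lebesgue_integral_cong) (use t L0C segment_delay_C in \<open>auto simp: g_def\<close>)
  also have "\<dots> = (LINT s:{0..?t}|lborel. (1 / \<epsilon>\<^sup>2) * L (segment \<epsilon> X s)) + (LINT s:{0..?t}|lborel. g s)"
    by (rule set_integral_add(2)[OF i1 i2])
  also have "(LINT s:{0..?t}|lborel. (1 / \<epsilon>\<^sup>2) * L (segment \<epsilon> X s)) = (LINT s:{0..\<tau>}|lborel. L (\<lambda>\<theta>. U (s + \<theta>)))"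
    using set_integral_scale[OF e2, of 0 \<tau> "\<lambda>s. (1 / \<epsilon>\<^sup>2) * L (segment \<epsilon> X s)"] e2 unfolding segment_U by simp
  finally show "U \<tau> = U 0 + (LINT s:{0..\<tau>}|lborel. L (\<lambda>\<theta>. U (s + \<theta>))) + F \<tau>"
    using Xeq[OF t] by (simp add: U_def[of \<tau>] U_def[of 0] F_def Fr_def)
qed

lemma div_le: "0 \<le> t \<Longrightarrow> t \<le> T \<Longrightarrow> 0 \<le> t / \<epsilon>\<^sup>2 \<and> t / \<epsilon>\<^sup>2 \<le> T / \<epsilon>\<^sup>2"
  using e2 by (auto intro!: divide_right_mono)

lemma pihat_segment:
  assumes "0 \<le> t" "t \<le> T"
  shows "pihat r L0 \<omega> (segment \<epsilon> X t) = Phi \<omega> (rot (\<omega> * (t / \<epsilon>\<^sup>2)) (v0 + zeta F (t / \<epsilon>\<^sup>2)))"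
  unfolding segment_U
  using perturbed_projection[OF perturbed_U bm_delay_C[OF xi] ysol ylim] div_le[OF assms] by blast

lemma z_path_eq:
  assumes "0 \<le> t" "t \<le> T"
  shows "z_path r L0 \<omega> \<epsilon> X t = rot (\<omega> * (t / \<epsilon>\<^sup>2)) (v0 + zeta F (t / \<epsilon>\<^sup>2))"
  unfolding z_path_def pihat_segment[OF assms] by (rule P_coords_Phi[OF \<omega>])

lemma zeta_0: "zeta F 0 = 0"
  using perturbedD(3)[OF perturbed_U] by (simp add: zeta_def)

lemma z_path_0: "z_path r L0 \<omega> \<epsilon> X 0 = v0"
  using z_path_eq[of 0] T by (simp add: zeta_0)

lemma zfrak_eq:
  assumes "0 \<le> t" "t \<le> T"
  shows "zfrak r L0 \<omega> \<epsilon> X t = v0 + zeta F (t / \<epsilon>\<^sup>2)"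
  unfolding zfrak_def mat_exp_B z_path_eq[OF assms] rot_add by (simp flip: distrib_left)

lemma y_bm0: "bm (y_path r L0 \<omega> \<epsilon> X 0)"
  and y_sol0: "lin_solution r L0 (y_path r L0 \<omega> \<epsilon> X 0) (\<lambda>t. y t - Phi \<omega> v0 t)"
proof -
  have eq: "y_path r L0 \<omega> \<epsilon> X 0 \<theta> = xi \<theta> - Phi \<omega> v0 \<theta>" if "-r \<le> \<theta>" "\<theta> \<le> 0" for \<theta>
    using pihat_segment[of 0] T perturbedD(4)[OF perturbed_U, of \<theta>] that
    by (simp add: y_path_def zeta_0 segment_U)
  show "bm (y_path r L0 \<omega> \<epsilon> X 0)"
    using bm_cong[OF eq] bm_diff[OF bm_delay_C[OF xi] bm_Phi[of v0]] by simp
  show "lin_solution r L0 (y_path r L0 \<omega> \<epsilon> X 0) (\<lambda>t. y t - Phi \<omega> v0 t)"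
    using lin_solution_cong[OF eq] lin_solution_diff[OF ysol bm_delay_C[OF xi] lin_solution_Phi bm_Phi] by simp
qed

lemma Yfrak_eq:
  assumes "0 \<le> t" "-r \<le> \<theta>"
  shows "Yfrak r L0 \<omega> \<epsilon> X t \<theta> = y (t / \<epsilon>\<^sup>2 + \<theta>) - Phi \<omega> v0 (t / \<epsilon>\<^sup>2 + \<theta>)"
  unfolding Yfrak_def by (rule That_eq[OF y_sol0 y_bm0]) (use assms e2 in auto)

text \<open>The free evolution \<open>y\<close> cancels between the stable part and its linear flow;
  the forced response that remains is the quantity bounded in
  \<open>perturbation_bound\<close>.\<close>

lemma Ycal_eq:
  assumes t: "0 \<le> t" "t \<le> T" and th: "-r \<le> \<theta>" "\<theta> \<le> 0"
  shows "Ycal r L0 \<omega> \<epsilon> X t \<theta> = voc (stop F (t / \<epsilon>\<^sup>2)) (t / \<epsilon>\<^sup>2 + \<theta>) - Phi \<omega> (zeta F (t / \<epsilon>\<^sup>2)) (t / \<epsilon>\<^sup>2 + \<theta>)"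
proof -
  have "U (t / \<epsilon>\<^sup>2 + \<theta>) = y (t / \<epsilon>\<^sup>2 + \<theta>) + voc (stop F (t / \<epsilon>\<^sup>2)) (t / \<epsilon>\<^sup>2 + \<theta>)"
    by (rule perturbed_representation[OF perturbed_U bm_delay_C[OF xi] ysol]) (use div_le[OF t] th in auto)
  then show ?thesis
    unfolding Ycal_def y_path_def pihat_segment[OF t] Yfrak_eq[OF t(1) th(1)] Phi_rot Phi_linear by (simp add: segment_U)
qed

lemma segment_decomposition:
  assumes t: "0 \<le> t" "t \<le> T" and th: "-r \<le> \<theta>" "\<theta> \<le> 0"
  shows "segment \<epsilon> X t \<theta> = Phi \<omega> (rot (\<omega> * (t / \<epsilon>\<^sup>2)) (zfrak r L0 \<omega> \<epsilon> X t)) \<theta> + Yfrak r L0 \<omega> \<epsilon> X t \<theta> + Ycal r L0 \<omega> \<epsilon> X t \<theta>"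
  unfolding Ycal_def y_path_def pihat_segment[OF t] zfrak_eq[OF t] by simp

text \<open>Back in slow time, the drift is reassembled into the plain integral of g psi, whereas
  the noise keeps its partially integrated form. \<open>zhat_rhs\<close> has the same shape, so the
  noise terms of the two equations coincide literally.\<close>

lemma zfrak_by_parts:
  assumes t: "0 \<le> t" "t \<le> T"
  shows "zfrak r L0 \<omega> \<epsilon> X t = v0 + (LINT s:{0..t}|lborel. g s *\<^sub>R psi s)
      + (Wp t *\<^sub>R (\<sigma> *\<^sub>R psi t) - (LINT s:{0..t}|lborel. Wp s *\<^sub>R (\<sigma> *\<^sub>R psi' s)))"
proof -
  let ?Gi = "\<lambda>u. LINT s:{0..u}|lborel. g s"
  have sub: "{0..t} \<subseteq> {0..T}" using t by auto
  have gt: "continuous_on {0..t} g" by (rule continuous_on_subset[OF g_continuous sub])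
  have Wt: "continuous_on {0..t} Wp" by (rule continuous_on_subset[OF Wcont sub])
  have Gt: "continuous_on {0..t} ?Gi" by (intro continuous_on_set_integral Icc_integrable gt)
  have "\<epsilon>\<^sup>2 *\<^sub>R (LINT s:{0..t / \<epsilon>\<^sup>2}|lborel. F s *\<^sub>R rot (\<omega> * - s) (Bmul \<omega> \<Psi>)) =
      (LINT u:{0..t}|lborel. Fr u *\<^sub>R rot (\<omega> * - (u / \<epsilon>\<^sup>2)) (Bmul \<omega> \<Psi>))"
    using set_integral_scale[OF e2, of 0 "t / \<epsilon>\<^sup>2" "\<lambda>u. Fr u *\<^sub>R rot (\<omega> * - (u / \<epsilon>\<^sup>2)) (Bmul \<omega> \<Psi>)"] e2
    by (simp add: F_def)
  then have sc: "(LINT s:{0..t / \<epsilon>\<^sup>2}|lborel. F s *\<^sub>R rot (\<omega> * - s) (Bmul \<omega> \<Psi>)) =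
      (1 / \<epsilon>\<^sup>2) *\<^sub>R (LINT u:{0..t}|lborel. Fr u *\<^sub>R rot (\<omega> * - (u / \<epsilon>\<^sup>2)) (Bmul \<omega> \<Psi>))"
  proof -
    have inv: "p = (1 / \<epsilon>\<^sup>2) *\<^sub>R q" if "\<epsilon>\<^sup>2 *\<^sub>R p = q" for p q :: "real^2"
      unfolding that[symmetric] using eps by simp
    assume "\<epsilon>\<^sup>2 *\<^sub>R (LINT s:{0..t / \<epsilon>\<^sup>2}|lborel. F s *\<^sub>R rot (\<omega> * - s) (Bmul \<omega> \<Psi>)) =
      (LINT u:{0..t}|lborel. Fr u *\<^sub>R rot (\<omega> * - (u / \<epsilon>\<^sup>2)) (Bmul \<omega> \<Psi>))"
    then show ?thesis by (rule inv)
  qed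
  \<comment> \<open>The factor 1/\<epsilon>^2 of the time change is, up to sign, the one contained
    in \<open>psi'\<close>.\<close>
  have "(LINT u:{0..t}|lborel. Fr u *\<^sub>R psi' u) =
      - ((1 / \<epsilon>\<^sup>2) *\<^sub>R (LINT u:{0..t}|lborel. Fr u *\<^sub>R rot (\<omega> * - (u / \<epsilon>\<^sup>2)) (Bmul \<omega> \<Psi>)))"
    unfolding psi'_def set_lebesgue_integral_def
    by (subst integral_scaleR_right[symmetric], subst Bochner_Integration.integral_minus[symmetric])
       (intro Bochner_Integration.integral_cong refl, simp add: mult.commute)
  with sc have z1: "zeta F (t / \<epsilon>\<^sup>2) = Fr t *\<^sub>R psi t - (LINT u:{0..t}|lborel. Fr u *\<^sub>R psi' u)"
    using e2 by (simp add: zeta_def psi_def F_def)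
  have ii1: "set_integrable lborel {0..t} (\<lambda>u. ?Gi u *\<^sub>R psi' u)"
    by (intro Icc_integrable continuous_intros Gt psi'_continuous)
  have ii2: "set_integrable lborel {0..t} (\<lambda>u. Wp u *\<^sub>R (\<sigma> *\<^sub>R psi' u))"
    by (intro Icc_integrable continuous_intros Wt psi'_continuous)
  have ii3: "set_integrable lborel {0..t} (\<lambda>u. g u *\<^sub>R psi u)"
    by (intro Icc_integrable continuous_intros gt psi_continuous)
  have z2: "(LINT u:{0..t}|lborel. Fr u *\<^sub>R psi' u) = (LINT u:{0..t}|lborel. ?Gi u *\<^sub>R psi' u) + (LINT u:{0..t}|lborel. Wp u *\<^sub>R (\<sigma> *\<^sub>R psi' u))"
    by (subst set_integral_add(2)[OF ii1 ii2, symmetric]) (simp add: Fr_def scaleR_left_distrib mult.commute)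
  have "(LINT u:{0..t}|lborel. g u *\<^sub>R psi u + ?Gi u *\<^sub>R psi' u) = ?Gi t *\<^sub>R psi t - ?Gi 0 *\<^sub>R psi 0"
    unfolding set_lebesgue_integral_def[of lborel "{0..t}" "\<lambda>u. g u *\<^sub>R psi u + ?Gi u *\<^sub>R psi' u"]
  proof (rule integral_FTC_atLeastAtMost[OF t(1)])
    fix u assume u: "0 \<le> u" "u \<le> t"
    have "(?Gi has_vector_derivative g u) (at u within {0..t})"
      by (rule has_vector_derivative_set_integral[OF gt]) (use u in auto)
    then have "(?Gi has_field_derivative g u) (at u within {0..t})"
      by (simp add: has_real_derivative_iff_has_vector_derivative)
    from has_vector_derivative_scaleR[OF this psi_deriv]
    show "((\<lambda>u. ?Gi u *\<^sub>R psi u) has_vector_derivative g u *\<^sub>R psi u + ?Gi u *\<^sub>R psi' u) (at u within {0..t})"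
      by (simp add: add.commute)
  qed (intro continuous_intros gt psi_continuous Gt psi'_continuous)
  then have z3: "(LINT u:{0..t}|lborel. g u *\<^sub>R psi u) + (LINT u:{0..t}|lborel. ?Gi u *\<^sub>R psi' u) = ?Gi t *\<^sub>R psi t"
    by (simp add: set_integral_add(2)[OF ii3 ii1])
  show ?thesis
    unfolding zfrak_eq[OF t] z1 z2 Fr_def[of t] scaleR_left_distrib z3[symmetric] by (simp add: mult.commute)
qed

section \<open>The reduced equation along a path\<close>

lemma Zarg_delay_C:
  assumes "0 \<le> s"
  shows "(\<lambda>\<theta>. Phi \<omega> (rot (\<omega> * (s / \<epsilon>\<^sup>2)) (Z s)) \<theta> + Yfrak r L0 \<omega> \<epsilon> X s \<theta>) \<in> delay_C r"
proof -
  have "continuous_on {-r..0} (\<lambda>\<theta>. Phi \<omega> (rot (\<omega> * (s / \<epsilon>\<^sup>2)) (Z s)) \<theta> + (y (s / \<epsilon>\<^sup>2 + \<theta>) - Phi \<omega> v0 (s / \<epsilon>\<^sup>2 + \<theta>)))"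
    by (intro continuous_intros continuous_on_Phi continuous_on_compose2[OF lin_solution_continuous_segment[OF xi ysol, of "s / \<epsilon>\<^sup>2"]]
        continuous_on_compose2[OF continuous_on_Phi[of UNIV]]) (use assms e2 in auto)
  then show ?thesis
    unfolding delay_C_def mem_Collect_eq
    by (rule continuous_on_eq) (simp only: Yfrak_eq[OF assms] atLeastAtMost_iff)
qed

lemma gZ_continuous: "continuous_on {0..T} gZ"
proof -
  let ?h = "\<lambda>s \<theta>. Phi \<omega> (Z s) (s / \<epsilon>\<^sup>2 + \<theta>) + (y (s / \<epsilon>\<^sup>2 + \<theta>) - Phi \<omega> v0 (s / \<epsilon>\<^sup>2 + \<theta>))"
  have "continuous_on {0..T} (\<lambda>s. G (?h s))"
  proof (rule G_continuous)
    have Zc: "continuous_on ({0..T} \<times> {-r..0}) (\<lambda>p. Z (fst p))"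
      by (rule continuous_on_compose2[OF Zcont]) (auto intro!: continuous_intros)
    have yc: "continuous_on ({0..T} \<times> {-r..0}) (\<lambda>p. y (fst p / \<epsilon>\<^sup>2 + snd p))"
    proof (rule continuous_on_compose2[OF lin_solution_continuous_segment[OF xi ysol, of "T / \<epsilon>\<^sup>2"]])
      show "(\<lambda>p. fst p / \<epsilon>\<^sup>2 + snd p) ` ({0..T} \<times> {-r..0}) \<subseteq> {-r..T / \<epsilon>\<^sup>2}"
      proof (intro image_subsetI)
        fix p :: "real \<times> real" assume "p \<in> {0..T} \<times> {-r..0}"
        then show "fst p / \<epsilon>\<^sup>2 + snd p \<in> {-r..T / \<epsilon>\<^sup>2}"
          using div_le[of "fst p"] by (cases p) (auto intro: order_trans[OF _ le_add_same_cancel2[THEN iffD2]])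
      qed
    qed (use e2 in \<open>auto intro!: continuous_intros\<close>)
    show "continuous_on ({0..T} \<times> {-r..0}) (\<lambda>p. ?h (fst p) (snd p))"
      unfolding Phi_def using e2
      by (intro continuous_intros yc Zc continuous_on_cos continuous_on_sin continuous_on_component) auto
  qed
  then show ?thesis
  proof (rule continuous_on_eq)
    fix s assume s: "s \<in> {0..T}"
    show "G (?h s) = gZ s"
      unfolding gZ_def
    proof (rule G_cong[symmetric, OF Zarg_delay_C])
      show "0 \<le> s" using s by simp
      then show "Phi \<omega> (rot (\<omega> * (s / \<epsilon>\<^sup>2)) (Z s)) \<theta> + Yfrak r L0 \<omega> \<epsilon> X s \<theta> = ?h s \<theta>" if "-r \<le> \<theta>" for \<theta>
        by (simp only: Phi_rot Yfrak_eq that)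
    qed
  qed
qed

text \<open>The Wiener integral in the equation for \<open>Z\<close> is written in the form obtained by partial
  integration, which makes sense for every path.\<close>

definition zhat_rhs :: "real \<Rightarrow> real^2" where
  "zhat_rhs t = z_path r L0 \<omega> \<epsilon> X 0 + (LINT s:{0..t}|lborel. gZ s *\<^sub>R psi s)
      + (Wp t *\<^sub>R (\<sigma> *\<^sub>R psi t) - (LINT s:{0..t}|lborel. Wp s *\<^sub>R (\<sigma> *\<^sub>R psi' s)))"

lemma zhat_rhs_continuous: "continuous_on {0..T} zhat_rhs"
  unfolding zhat_rhs_def
  by (intro continuous_intros continuous_on_set_integral Icc_integrable gZ_continuous psi_continuous psi'_continuous Wcont)

text \<open>The partially integrated form of the Wiener integral is obtained almost surely for
  countably many times at once; both sides are continuous and the rationals are dense.\<close>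

lemma zhat_rhs_dense:
  assumes eq: "\<And>t. t \<in> {0<..<T} \<inter> \<rat> \<Longrightarrow> Z t = zhat_rhs t" and t: "0 \<le> t" "t \<le> T"
  shows "Z t = zhat_rhs t"
proof -
  have cl: "closure ({0<..<T} \<inter> \<rat>) = {0..T}"
    using closure_open_Int_superset[of "{0<..<T}" "\<rat> :: real set"] Rats_closure_real T by simp
  have "Z t - zhat_rhs t = 0"
    by (rule continuous_constant_on_closure[of "{0<..<T} \<inter> \<rat>" "\<lambda>t. Z t - zhat_rhs t"])
       (use eq t in \<open>auto simp: cl intro!: continuous_intros Zcont zhat_rhs_continuous\<close>)
  then show ?thesis by simp
qed

end

locale sample_path = delay_path +
  assumes Zeq: "\<And>t. 0 \<le> t \<Longrightarrow> t \<le> T \<Longrightarrow> Z t = zhat_rhs t"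
begin

lemma difference_eq:
  assumes t: "0 \<le> t" "t \<le> T"
  shows "zfrak r L0 \<omega> \<epsilon> X t - Z t = (LINT s:{0..t}|lborel. (g s - gZ s) *\<^sub>R psi s)"
proof -
  have sub: "{0..t} \<subseteq> {0..T}" using t by auto
  have i1: "set_integrable lborel {0..t} (\<lambda>s. g s *\<^sub>R psi s)"
    by (intro Icc_integrable continuous_intros continuous_on_subset[OF g_continuous sub] psi_continuous)
  have i2: "set_integrable lborel {0..t} (\<lambda>s. gZ s *\<^sub>R psi s)"
    by (intro Icc_integrable continuous_intros continuous_on_subset[OF gZ_continuous sub] psi_continuous)

  have "Z t = v0 + (LINT s:{0..t}|lborel. gZ s *\<^sub>R psi s)
      + (Wp t *\<^sub>R (\<sigma> *\<^sub>R psi t) - (LINT s:{0..t}|lborel. Wp s *\<^sub>R (\<sigma> *\<^sub>R psi' s)))"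
    using Zeq[OF t] unfolding zhat_rhs_def z_path_0 .
  then have "zfrak r L0 \<omega> \<epsilon> X t - Z t = (LINT s:{0..t}|lborel. g s *\<^sub>R psi s) - (LINT s:{0..t}|lborel. gZ s *\<^sub>R psi s)"
    using zfrak_by_parts[OF t] by (metis (no_types) add_diff_cancel_left add_diff_cancel_right)
  also have "\<dots> = (LINT s:{0..t}|lborel. g s *\<^sub>R psi s - gZ s *\<^sub>R psi s)"
    by (rule set_integral_diff(2)[OF i1 i2, symmetric])
  finally show ?thesis by (simp add: scaleR_left_diff_distrib)
qed

text \<open>As long as |X| \<le> R the drift is bounded, so the forcing has the modulus
  \<open>b * (3 + (v - u))\<close> in fast time; this bounds the stable part, then by Gronwall the
  difference of the critical parts, and finally |X| by a number below R, so that
  \<open>first_exit_bound\<close> closes the argument. The surplus 2 in \<open>R\<close> exceeds the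
  total error 1 allowed by \<open>small\<close>.\<close>

lemma path_estimate:
  assumes RZ: "\<And>t \<theta>. 0 \<le> t \<Longrightarrow> t \<le> T \<Longrightarrow> -r \<le> \<theta> \<Longrightarrow> \<theta> \<le> 0 \<Longrightarrow> \<bar>Phi \<omega> (rot (\<omega> * (t / \<epsilon>\<^sup>2)) (Z t)) \<theta>\<bar> \<le> Ce"
    and Yb: "\<And>t. -r \<le> t \<Longrightarrow> \<bar>y t - Phi \<omega> v0 t\<bar> \<le> Y0"
    and Xb: "\<And>\<theta>. -r \<le> \<theta> \<Longrightarrow> \<theta> \<le> 0 \<Longrightarrow> \<bar>xi \<theta>\<bar> \<le> X0"
    and md: "\<And>s t. 0 \<le> s \<Longrightarrow> s \<le> t \<Longrightarrow> t \<le> T \<Longrightarrow> \<bar>Wp t - Wp s\<bar> \<le> \<eta> * (3 + (t - s) / \<epsilon>\<^sup>2)"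
    and R: "R = Ce + Y0 + X0 + 2" and b: "b = \<epsilon>\<^sup>2 * (V * (R + R ^ 3)) + \<bar>\<sigma>\<bar> * \<eta>" and \<eta>: "0 \<le> \<eta>"
    and small: "Kp * b \<le> 1 / 2" "2 * (gam T R * b) \<le> 1 / 2"
    and t: "0 \<le> t" "t \<le> T"
  shows "\<forall>\<theta>\<in>{-r..0}. \<bar>Ycal r L0 \<omega> \<epsilon> X t \<theta>\<bar> \<le> Kp * b" and "norm (zfrak r L0 \<omega> \<epsilon> X t - Z t) \<le> gam T R * b"
proof -
  let ?D = "\<lambda>t. zfrak r L0 \<omega> \<epsilon> X t - Z t"
  have Ce0: "0 \<le> Ce" using order_trans[OF abs_ge_zero RZ[of 0 0]] T r by simp
  have Y00: "0 \<le> Y0" using order_trans[OF abs_ge_zero Yb[of 0]] r by simp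
  have X00: "0 \<le> X0" using order_trans[OF abs_ge_zero Xb[of 0]] r by simp
  have R0: "0 \<le> R" using Ce0 Y00 X00 R by simp
  let ?Lg = "V * (1 + 3 * R\<^sup>2)"
  let ?Cg = "V * (R + R ^ 3)"
  have Lg0: "0 \<le> ?Lg" and Cg0: "0 \<le> ?Cg" using V0 R0 by auto
  have b0: "0 \<le> b" unfolding b by (intro add_nonneg_nonneg mult_nonneg_nonneg[OF _ Cg0] mult_nonneg_nonneg[OF _ \<eta>]) auto
  have Kb0: "0 \<le> Kp * b" using Kp(1) b0 by simp
  \<comment> \<open>Arguments before time 0 fall into the initial segment, which \<open>X0\<close>
    covers.\<close>
  have seg: "\<bar>segment \<epsilon> X s \<theta>\<bar> \<le> R"
    if s: "0 \<le> s" "s \<le> t" "t \<le> T" and h: "\<And>s. 0 \<le> s \<Longrightarrow> s \<le> t \<Longrightarrow> \<bar>X s\<bar> \<le> R" and th: "-r \<le> \<theta>" "\<theta> \<le> 0" for s \<theta> t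
  proof (cases "0 \<le> s + \<epsilon>\<^sup>2 * \<theta>")
    case True
    have "\<epsilon>\<^sup>2 * \<theta> \<le> 0" using th by (simp add: mult_nonneg_nonpos)
    then show ?thesis using h[of "s + \<epsilon>\<^sup>2 * \<theta>"] True s by (simp add: segment_def)
  next
    case False
    have "\<epsilon>\<^sup>2 * (- r) \<le> \<epsilon>\<^sup>2 * \<theta>" using th by (intro mult_left_mono) auto
    then have lo: "- (\<epsilon>\<^sup>2 * r) \<le> s + \<epsilon>\<^sup>2 * \<theta>" using s by simp
    have "- r \<le> (s + \<epsilon>\<^sup>2 * \<theta>) / \<epsilon>\<^sup>2" "(s + \<epsilon>\<^sup>2 * \<theta>) / \<epsilon>\<^sup>2 \<le> 0"
      using lo False e2 by (auto simp: field_simps)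
    then have "\<bar>xi ((s + \<epsilon>\<^sup>2 * \<theta>) / \<epsilon>\<^sup>2)\<bar> \<le> X0" by (rule Xb)
    then show ?thesis using Xinit[of "s + \<epsilon>\<^sup>2 * \<theta>"] lo False R Ce0 Y00 by (simp add: segment_def)
  qed
  have Ybound: "\<bar>Ycal r L0 \<omega> \<epsilon> X s \<theta>\<bar> \<le> Kp * b"
    if s: "0 \<le> s" "s \<le> t" "t \<le> T" and h: "\<And>s. 0 \<le> s \<Longrightarrow> s \<le> t \<Longrightarrow> \<bar>X s\<bar> \<le> R" and th: "-r \<le> \<theta>" "\<theta> \<le> 0" for s \<theta> t
  proof -
    have sT: "s \<le> T" using s by simp
    show ?thesis unfolding Ycal_eq[OF s(1) sT th]
    proof (rule Kp(2))
      show "continuous_on {0..s / \<epsilon>\<^sup>2} F" by (rule continuous_on_subset[OF F_continuous]) (use div_le[OF s(1) sT] in auto)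
      show "F 0 = 0" by (rule perturbedD(3)[OF perturbed_U])
      fix u v :: real assume uv: "0 \<le> u" "u \<le> v" "v \<le> s / \<epsilon>\<^sup>2"
      let ?u = "\<epsilon>\<^sup>2 * u" and ?v = "\<epsilon>\<^sup>2 * v"
      have uv': "0 \<le> ?u" "?u \<le> ?v" "?v \<le> s" using uv e2 by (auto simp: field_simps)
      have gi: "set_integrable lborel {0..?v} g"
        by (intro Icc_integrable continuous_on_subset[OF g_continuous]) (use uv' sT in auto)
      have "(LINT s:{0..?v}|lborel. g s) - (LINT s:{0..?u}|lborel. g s) = (LINT s:{?u..?v}|lborel. g s)"
        using set_integral_split[OF gi uv'(1,2)] by simp
      moreover have "norm (LINT s:{?u..?v}|lborel. g s) \<le> (?v - ?u) * ?Cg"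
      proof (rule set_integral_norm_le_const[OF uv'(2)])
        fix q assume q: "?u \<le> q" "q \<le> ?v"
        have q': "0 \<le> q" "q \<le> t" using q uv' s by auto
        show "norm (g q) \<le> ?Cg" unfolding g_def real_norm_def
          by (rule Gb[OF segment_delay_C seg[OF q' s(3) h]]) (use q' s in auto)
      qed
      moreover have "\<bar>Wp ?v - Wp ?u\<bar> \<le> \<eta> * (3 + (v - u))"
      proof -
        have "(?v - ?u) / \<epsilon>\<^sup>2 = v - u" using e2 by (simp flip: right_diff_distrib)
        then show ?thesis using md[of ?u ?v] uv' sT by simp
      qed
      then have "\<bar>\<sigma> * Wp ?v - \<sigma> * Wp ?u\<bar> \<le> \<bar>\<sigma>\<bar> * (\<eta> * (3 + (v - u)))"
        by (simp add: abs_mult mult_left_mono flip: right_diff_distrib)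
      ultimately have "\<bar>F v - F u\<bar> \<le> (?v - ?u) * ?Cg + \<bar>\<sigma>\<bar> * (\<eta> * (3 + (v - u)))"
        unfolding F_def Fr_def real_norm_def by linarith
      \<comment> \<open>Over a fast time v - u the drift moves the forcing by at most \<epsilon>^2
        V(R + R^3)(v - u), which accounts for the first summand of \<open>b\<close>.\<close>
      also have "\<dots> \<le> b * (3 + (v - u))"
      proof -
        have "(?v - ?u) * ?Cg = \<epsilon>\<^sup>2 * ?Cg * (v - u)" by (simp add: algebra_simps)
        also have "\<dots> \<le> \<epsilon>\<^sup>2 * ?Cg * (3 + (v - u))" using Cg0 by (intro mult_left_mono) auto
        finally show ?thesis unfolding b by (simp add: distrib_right mult.assoc)
      qed
      finally show "\<bar>F v - F u\<bar> \<le> b * (3 + (v - u))" .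
    qed (use div_le[OF s(1) sT] b0 th in auto)
  qed
  have Yf: "\<bar>Yfrak r L0 \<omega> \<epsilon> X s \<theta>\<bar> \<le> Y0" if "0 \<le> s" "-r \<le> \<theta>" for s \<theta>
  proof -
    have "- r \<le> s / \<epsilon>\<^sup>2 + \<theta>" using that e2 by (intro order_trans[OF that(2)]) auto
    then show ?thesis unfolding Yfrak_eq[OF that] by (rule Yb)
  qed
  \<comment> \<open>The arguments of G in \<open>g\<close> and \<open>gZ\<close> differ by the
    difference of the critical parts, doubled by \<open>abs_Phi_le\<close>, and by the forced stable
    part: the former feeds Gronwall, the latter is its error term.\<close>
  have Dbound: "norm (?D s) \<le> gam T R * b"
    if tT: "0 \<le> t" "t \<le> T" and h: "\<And>s. 0 \<le> s \<Longrightarrow> s \<le> t \<Longrightarrow> \<bar>X s\<bar> \<le> R" and s: "0 \<le> s" "s \<le> t" for s t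
  proof -
    let ?a = "2 * ?Lg * norm \<Psi> + 1"
    let ?c = "?Lg * (Kp * b) * norm \<Psi>"
    have a0: "0 < ?a" using Lg0 by (simp add: add_nonneg_pos)
    have c0': "0 \<le> ?c" using Lg0 Kb0 by simp
    have "continuous_on {0..t} (\<lambda>t. LINT s:{0..t}|lborel. (g s - gZ s) *\<^sub>R psi s)"
      by (intro continuous_on_set_integral Icc_integrable continuous_intros psi_continuous
          continuous_on_subset[OF g_continuous] continuous_on_subset[OF gZ_continuous]) (use tT in auto)
    then have Dc: "continuous_on {0..t} ?D"
      by (rule continuous_on_eq) (use difference_eq tT in auto)
    have "norm (?D s) \<le> 2 * (?c * T) * exp (2 * ?a * s)"
    proof (rule weighted_gronwall[OF tT(1) a0 _ Dc _ s])
      fix u w assume u: "0 \<le> u" "u \<le> t" and w: "0 \<le> w"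
        and hw: "\<And>s. 0 \<le> s \<Longrightarrow> s \<le> u \<Longrightarrow> norm (?D s) \<le> w * exp (2 * ?a * s)"
      have uT: "u \<le> T" using u tT by simp
      have "norm (LINT s:{0..u}|lborel. (g s - gZ s) *\<^sub>R psi s) \<le> w * exp (2 * ?a * u) / 2 + ?c * u"
      proof (rule set_integral_exp_bound[OF a0 w u(1)])
        fix q assume q: "0 \<le> q" "q \<le> u"
        have qT: "q \<le> t" "q \<le> T" using q u tT by auto
        have "\<bar>g q - gZ q\<bar> \<le> ?Lg * (2 * norm (?D q) + Kp * b)"
          unfolding g_def gZ_def
        proof (rule Gl[OF segment_delay_C[OF q(1) qT(2)] Zarg_delay_C[OF q(1)] seg[OF q(1) qT(1) tT(2) h]])
          fix \<theta> assume th: "-r \<le> \<theta>" "\<theta> \<le> 0"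
          show "\<bar>Phi \<omega> (rot (\<omega> * (q / \<epsilon>\<^sup>2)) (Z q)) \<theta> + Yfrak r L0 \<omega> \<epsilon> X q \<theta>\<bar> \<le> R"
            using RZ[OF q(1) qT(2) th] Yf[OF q(1) th(1)] R X00 by linarith
          have "segment \<epsilon> X q \<theta> - (Phi \<omega> (rot (\<omega> * (q / \<epsilon>\<^sup>2)) (Z q)) \<theta> + Yfrak r L0 \<omega> \<epsilon> X q \<theta>) =
              Phi \<omega> (rot (\<omega> * (q / \<epsilon>\<^sup>2)) (?D q)) \<theta> + Ycal r L0 \<omega> \<epsilon> X q \<theta>"
            unfolding segment_decomposition[OF q(1) qT(2) th] rot_linear Phi_linear by simp
          also have "\<bar>\<dots>\<bar> \<le> 2 * norm (?D q) + Kp * b"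
            using abs_Phi_le[of \<omega> "rot (\<omega> * (q / \<epsilon>\<^sup>2)) (?D q)" \<theta>] Ybound[OF q(1) qT(1) tT(2) h th]
            unfolding norm_rot by linarith
          finally show "\<bar>segment \<epsilon> X q \<theta> - (Phi \<omega> (rot (\<omega> * (q / \<epsilon>\<^sup>2)) (Z q)) \<theta> + Yfrak r L0 \<omega> \<epsilon> X q \<theta>)\<bar>
              \<le> 2 * norm (?D q) + Kp * b" .
        qed
        then have "\<bar>g q - gZ q\<bar> * norm \<Psi> \<le> ?Lg * (2 * norm (?D q) + Kp * b) * norm \<Psi>" by (rule mult_right_mono) simp
        also have "\<dots> = 2 * ?Lg * norm \<Psi> * norm (?D q) + ?c" by (simp add: algebra_simps)
        also have "\<dots> \<le> ?a * norm (?D q) + ?c" by (simp add: distrib_right)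
        also have "\<dots> \<le> ?a * (w * exp (2 * ?a * q)) + ?c"
          using hw[OF q] a0 by (intro add_right_mono mult_left_mono) auto
        finally show "norm ((g q - gZ q) *\<^sub>R psi q) \<le> ?a * (w * exp (2 * ?a * q)) + ?c" by (simp add: norm_psi)
      qed
      also have "\<dots> \<le> w * exp (2 * ?a * u) / 2 + ?c * T" using c0' uT by (intro add_left_mono mult_left_mono) auto
      finally show "norm (?D u) \<le> w * exp (2 * ?a * u) / 2 + ?c * T" unfolding difference_eq[OF u(1) uT] .
    qed (use c0' T in auto)
    also have "\<dots> \<le> 2 * (?c * T) * exp (2 * ?a * T)"
      using c0' T s tT a0 by (intro mult_left_mono) auto
    also have "\<dots> = gam T R * b" by (simp add: gam_def mult_ac)
    finally show ?thesis .
  qed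
  have Xlt: "\<bar>X t\<bar> < R" if tT: "0 \<le> t" "t \<le> T" for t
  proof (rule first_exit_bound[OF _ _ _ tT])
    show "continuous_on {0..T} X" using r eps by (intro continuous_on_subset[OF Xcont]) auto
    show "\<bar>X 0\<bar> < R" using Xinit[of 0] Xb[of 0] r R Ce0 Y00 by simp
    fix u assume u: "0 \<le> u" "u \<le> T" and h: "\<And>s. 0 \<le> s \<Longrightarrow> s \<le> u \<Longrightarrow> \<bar>X s\<bar> \<le> R"
    have th: "-r \<le> 0" "(0::real) \<le> 0" using r by auto
    \<comment> \<open>The present value is the segment at 0, split into reduced critical part, its
      error, free stable part and forced stable part.\<close>
    have "X u = segment \<epsilon> X u 0" by (simp add: segment_def)
    also have "\<dots> = Phi \<omega> (rot (\<omega> * (u / \<epsilon>\<^sup>2)) (Z u)) 0 + Phi \<omega> (rot (\<omega> * (u / \<epsilon>\<^sup>2)) (?D u)) 0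
        + Yfrak r L0 \<omega> \<epsilon> X u 0 + Ycal r L0 \<omega> \<epsilon> X u 0"
      unfolding segment_decomposition[OF u th] rot_linear Phi_linear by simp
    finally have "\<bar>X u\<bar> \<le> Ce + 2 * norm (?D u) + Y0 + Kp * b"
      using RZ[OF u th] abs_Phi_le[of \<omega> "rot (\<omega> * (u / \<epsilon>\<^sup>2)) (?D u)" 0] Yf[OF u(1) th(1)] Ybound[OF u(1) order.refl u(2) h th]
      unfolding norm_rot by linarith
    also have "\<dots> \<le> Ce + 1 / 2 + Y0 + 1 / 2"
      using Dbound[OF u h u(1) order.refl] small by linarith
    also have "\<dots> < R" using R X00 by simp
    finally show "\<bar>X u\<bar> < R" .
  qed
  have h: "\<bar>X s\<bar> \<le> R" if "0 \<le> s" "s \<le> t" for s using Xlt[of s] that t by simp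
  show "\<forall>\<theta>\<in>{-r..0}. \<bar>Ycal r L0 \<omega> \<epsilon> X t \<theta>\<bar> \<le> Kp * b"
    using Ybound[OF t(1) order.refl t(2) h] by auto
  show "norm (?D t) \<le> gam T R * b" by (rule Dbound[OF t h t(1) order.refl])
qed

end

section \<open>The splitting at the critical eigenvalues\<close>

text \<open>Near a zero of order 1 the function is g(u)(u - z) with g z nonzero, and g z is the
  derivative at z. The point w excludes the zero function.\<close>

lemma zorder_1_deriv:
  assumes f: "f holomorphic_on UNIV" and z: "f z = 0" and w: "f w \<noteq> 0" and o: "zorder f z = 1"
  shows "deriv f z \<noteq> 0"
proof -
  obtain g e where e: "0 < e" and g: "g holomorphic_on cball z e"
    and eq: "\<And>u. u \<in> cball z e \<Longrightarrow> f u = g u * (u - z) \<and> g u \<noteq> 0"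
  proof -
    have "\<exists>e>0. zor_poly f z holomorphic_on cball z e \<and> (\<forall>u\<in>cball z e. f u = zor_poly f z u * (u - z) \<and> zor_poly f z u \<noteq> 0)"
      using zorder_exist_zero[OF f open_UNIV connected_UNIV UNIV_I, of z] w o z by auto
    then show ?thesis using that by blast
  qed
  have gd: "(g has_field_derivative deriv g z) (at z)"
    using g e holomorphic_on_imp_differentiable_at[of g "ball z e" z] holomorphic_on_subset[of g "cball z e" "ball z e"]
    by (auto simp: DERIV_deriv_iff_field_differentiable)
  have "((\<lambda>u. g u * (u - z)) has_field_derivative g z) (at z)"
    by (auto intro!: derivative_eq_intros gd)
  then have "(f has_field_derivative g z) (at z)"
    by (rule has_field_derivative_transform_within_open[of _ _ _ "ball z e"]) (use e eq in auto)
  then show ?thesis using eq[of z] e by (simp add: DERIV_imp_deriv)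
qed

text \<open>The assumptions on \<open>L0\<close> become data of the locale: the measures are those
  chosen in \<open>riesz_measures\<close>, so that \<open>L_ext\<close> is integration against them,
  and the simple roots yield \<open>x\<close>, its decay and \<Psi> = (A, B).\<close>

lemma splitting_exists:
  assumes r: "0 < r" and L0: "bounded_linear_functional r L0" and crit: "critical_spectrum L0 \<omega>"
  shows "\<exists>\<mu>1 \<mu>2 x Cx \<kappa> C \<Psi>. splitting r \<mu>1 \<mu>2 x Cx \<omega> \<kappa> C \<Psi> L0 \<and> (\<forall>\<eta>\<in>delay_C r. L0 \<eta> = dde.L \<mu>1 \<mu>2 \<eta>)"
proof -
  define \<mu>1 \<mu>2 where "\<mu>1 = fst (riesz_measures r L0)" and "\<mu>2 = snd (riesz_measures r L0)"
  obtain m1 m2 where "riesz_represents r L0 m1 m2" using riesz_representation[OF r L0] by blast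
  then have rr: "riesz_represents r L0 \<mu>1 \<mu>2"
    unfolding \<mu>1_def \<mu>2_def riesz_measures_def
    by (intro someI[of "\<lambda>\<mu>. riesz_represents r L0 (fst \<mu>) (snd \<mu>)" "(m1, m2)"]) simp
  interpret dde r \<mu>1 \<mu>2
    by (rule dde.intro) (use r rr in \<open>simp_all only: riesz_represents_def\<close>)
  have L0C: "L0 \<eta> = L \<eta>" if "\<eta> \<in> delay_C r" for \<eta>
    using rr that unfolding riesz_represents_def L_def by blast
  have cf: "char_fun L0 = Del"
  proof
    fix z
    have "L0 (\<lambda>\<theta>. Re (exp (z * of_real \<theta>))) = Re (Mc z)" "L0 (\<lambda>\<theta>. Im (exp (z * of_real \<theta>))) = Im (Mc z)"
      unfolding Mc_def L_Re[OF bm_exp, symmetric] L_Im[OF bm_exp, symmetric]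
      by (rule L0C; unfold delay_C_def mem_Collect_eq; intro continuous_intros)+
    then show "char_fun L0 z = Del z"
      unfolding char_fun_def Del_def by simp
  qed
  have \<omega>: "0 < \<omega>" and imag: "{z. Del z = 0 \<and> Re z = 0} = {\<i> * of_real \<omega>, - \<i> * of_real \<omega>}"
    and ord: "zorder Del (\<i> * of_real \<omega>) = 1" "zorder Del (- \<i> * of_real \<omega>) = 1"
    and left: "\<And>z. Del z = 0 \<Longrightarrow> Re z \<noteq> 0 \<Longrightarrow> Re z < 0"
    using crit unfolding critical_spectrum_def cf by auto
  have root: "Del (\<i> * of_real \<omega>) = 0" "Del (- \<i> * of_real \<omega>) = 0" using imag by blast+
  \<comment> \<open>All roots off the imaginary axis lie to its left, so 1 is a point where
    \<open>Del\<close> is nonzero, as \<open>zorder_1_deriv\<close> requires.\<close>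
  have D1: "Del 1 \<noteq> 0" using left[of 1] by auto
  interpret hopf r \<mu>1 \<mu>2 \<omega>
  proof
    show "deriv Del (\<i> * of_real \<omega>) \<noteq> 0" "deriv Del (- \<i> * of_real \<omega>) \<noteq> 0"
      using zorder_1_deriv[OF Del_holomorphic _ D1] root ord by auto
    show "Del z = 0 \<longleftrightarrow> z = \<i> * of_real \<omega> \<or> z = - \<i> * of_real \<omega>" if "0 \<le> Re z" for z
      using left[of z] that root imag by fastforce
  qed (rule \<omega>)
  obtain x \<kappa> C A B where \<kappa>: "0 < \<kappa>" and C: "0 \<le> C" and xm: "x \<in> borel_measurable borel" and xneg: "\<And>t. t < 0 \<Longrightarrow> x t = 0"
    and xeq: "\<And>t. 0 \<le> t \<Longrightarrow> x t = 1 + (LINT s:{0..t}|lborel. L (\<lambda>\<theta>. x (s + \<theta>)))"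
    and dec: "\<And>t. 0 \<le> t \<Longrightarrow> \<bar>x t - (A * cos (\<omega> * t) + B * sin (\<omega> * t))\<bar> \<le> C * exp (- \<kappa> * t)"
    using fundamental_solution_exists by blast
  define \<Psi> :: "real^2" where "\<Psi> = vector [A, B]"
  have Phi: "Phi \<omega> \<Psi> t = A * cos (\<omega> * t) + B * sin (\<omega> * t)" for t by (simp add: Phi_def \<Psi>_def)
  have xb: "\<bar>x t\<bar> \<le> C + 2 * norm \<Psi>" for t
  proof (cases "0 \<le> t")
    case True
    have "C * exp (- \<kappa> * t) \<le> C * 1" using \<kappa> True C by (intro mult_left_mono) auto
    then show ?thesis using dec[OF True] abs_Phi_le[of \<omega> \<Psi> t] unfolding Phi by linarith
  qed (use xneg C in auto)
  have Mi: "Mc (\<i> * of_real \<omega>) = \<i> * of_real \<omega>" using root(1) by (simp add: Del_def)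
  have re: "L (\<lambda>\<theta>. Re (exp (\<i> * of_real \<omega> * of_real \<theta>))) = 0" and im: "L (\<lambda>\<theta>. Im (exp (\<i> * of_real \<omega> * of_real \<theta>))) = \<omega>"
    unfolding L_Re[OF bm_exp] L_Im[OF bm_exp] Mc_def[symmetric] Mi by auto
  have "splitting r \<mu>1 \<mu>2 x (C + 2 * norm \<Psi>) \<omega> \<kappa> C \<Psi> L0"
  proof unfold_locales
    show "L (\<lambda>\<theta>. cos (\<omega> * \<theta>)) = 0" using re by (simp add: Re_exp)
    show "L (\<lambda>\<theta>. sin (\<omega> * \<theta>)) = \<omega>" using im by (simp add: Im_exp)
    show "L_ext r L0 f = L f" for f by (subst L_def) (simp only: L_ext_def \<mu>1_def \<mu>2_def)
    show "\<bar>x t - Phi \<omega> \<Psi> t\<bar> \<le> C * exp (- \<kappa> * t)" if "0 \<le> t" for t unfolding Phi by (rule dec[OF that])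
    show "x t = 1 + (LINT s:{0..t}|lborel. L (\<lambda>\<theta>. x (s + \<theta>)))" if "0 \<le> t" for t by (rule xeq[OF that])
  qed (fact \<omega> \<kappa> C xm xneg xb)+
  then show ?thesis using L0C by blast
qed

section \<open>Small parameters\<close>

text \<open>With \<delta> = 2(a + c) the factor \<epsilon>^(a + c) leaves the square root and
  absorbs \<epsilon>^(-a); what remains is \<epsilon>^c times the root of a logarithm.\<close>

lemma p_eps_tendsto:
  assumes "0 < r" "0 < T" "2 * a < \<delta>" "0 \<le> a"
  shows "(p_eps 1 r T a \<delta> \<longlongrightarrow> 1) (at_right 0)"
proof -
  define c where "c = \<delta> / 2 - a"
  have c: "0 < c" "\<delta> = 2 * (a + c)" using assms by (auto simp: c_def)
  have ac: "0 < a + c" using c assms by simp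
  have *: "((\<lambda>\<epsilon>. \<epsilon> powr c * sqrt (r * ln (T / (r * (\<epsilon> powr (a + c))\<^sup>2)))) \<longlongrightarrow> 0) (at_right 0)"
    using assms c(1) ac by real_asymp
  have "((\<lambda>\<epsilon>. 1 - \<epsilon> powr c * sqrt (r * ln (T / (r * (\<epsilon> powr (a + c))\<^sup>2)))) \<longlongrightarrow> 1 - 0) (at_right 0)"
    by (intro tendsto_diff tendsto_const *)
  then have "((\<lambda>\<epsilon>. 1 - \<epsilon> powr c * sqrt (r * ln (T / (r * (\<epsilon> powr (a + c))\<^sup>2)))) \<longlongrightarrow> 1) (at_right 0)" by simp
  then show ?thesis
  proof (rule Lim_transform_eventually)
    show "\<forall>\<^sub>F \<epsilon> in at_right 0. 1 - \<epsilon> powr c * sqrt (r * ln (T / (r * (\<epsilon> powr (a + c))\<^sup>2))) = p_eps 1 r T a \<delta> \<epsilon>"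
      using eventually_at_right_less
    proof eventually_elim
      case (elim \<epsilon>)
      have d: "\<epsilon> powr \<delta> = (\<epsilon> powr (a + c))\<^sup>2"
        using elim by (simp add: c(2) power2_eq_square flip: powr_add)
      have "sqrt (r * (\<epsilon> powr (a + c))\<^sup>2 * l) = \<epsilon> powr (a + c) * sqrt (r * l)" for l
      proof -
        have "sqrt (r * (\<epsilon> powr (a + c))\<^sup>2 * l) = sqrt ((\<epsilon> powr (a + c))\<^sup>2 * (r * l))" by (simp add: mult_ac)
        then show ?thesis by (simp add: real_sqrt_mult)
      qed
      moreover have "\<epsilon> powr (- a) * (\<epsilon> powr (a + c) * q) = \<epsilon> powr c * q" for q
        using elim by (simp flip: powr_add mult.assoc)
      ultimately show ?case unfolding p_eps_def d by (simp only: mult_1_left)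
    qed
  qed
qed

text \<open>Once the logarithm is at least 1, 1 - p is at least sqrt(r) \<epsilon>^(\<delta>/2 - a),
  and an exponent below 1 beats any multiple of \<epsilon>.\<close>

lemma p_eps_lower:
  assumes "0 < r" "0 < T" "2 * a < \<delta>" "\<delta> < 2" "0 \<le> a"
  shows "\<forall>\<^sub>F \<epsilon> in at_right 0. K * \<epsilon> < 2 * (1 - p_eps 1 r T a \<delta> \<epsilon>)"
proof -
  have d: "0 < \<delta>" using assms by simp
  have ev: "\<forall>\<^sub>F \<epsilon> in at_right 0. 1 \<le> ln (T / (r * \<epsilon> powr \<delta>))"
    using assms(1,2) d by real_asymp
  have c: "0 < 1 - \<delta> / 2 + a" using assms by simp
  have "((\<lambda>\<epsilon>. K * \<epsilon> powr (1 - \<delta> / 2 + a)) \<longlongrightarrow> 0) (at_right 0)" using c by real_asymp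
  then have ev2: "\<forall>\<^sub>F \<epsilon> in at_right 0. K * \<epsilon> powr (1 - \<delta> / 2 + a) < 2 * sqrt r"
    by (rule order_tendstoD) (use assms in simp)
  show ?thesis using ev ev2 eventually_at_right_less
  proof eventually_elim
    case (elim \<epsilon>)
    have d2: "\<epsilon> powr \<delta> = (\<epsilon> powr (\<delta> / 2))\<^sup>2" using elim by (simp add: power2_eq_square flip: powr_add)
    have "sqrt r * \<epsilon> powr (\<delta> / 2) = sqrt (r * \<epsilon> powr \<delta>)" unfolding d2 by (simp add: real_sqrt_mult)
    also have "\<dots> \<le> sqrt (r * \<epsilon> powr \<delta> * ln (T / (r * \<epsilon> powr \<delta>)))"
      using elim assms mult_left_mono[of 1 "ln (T / (r * \<epsilon> powr \<delta>))" "r * \<epsilon> powr \<delta>"] by simp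
    finally have "\<epsilon> powr (- a) * (sqrt r * \<epsilon> powr (\<delta> / 2)) \<le> 1 - p_eps 1 r T a \<delta> \<epsilon>"
      by (simp add: p_eps_def mult_left_mono)
    moreover have "K * \<epsilon> < 2 * (\<epsilon> powr (- a) * (sqrt r * \<epsilon> powr (\<delta> / 2)))"
    proof -
      have "K * \<epsilon> powr (1 - \<delta> / 2 + a) * \<epsilon> powr (\<delta> / 2 - a) < 2 * sqrt r * \<epsilon> powr (\<delta> / 2 - a)"
        using elim by (intro mult_strict_right_mono) auto
      moreover have "K * \<epsilon> powr (1 - \<delta> / 2 + a) * \<epsilon> powr (\<delta> / 2 - a) = K * \<epsilon>"
        using elim by (simp add: mult.assoc flip: powr_add)
      moreover have "2 * sqrt r * \<epsilon> powr (\<delta> / 2 - a) = 2 * (\<epsilon> powr (- a) * (sqrt r * \<epsilon> powr (\<delta> / 2)))"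
        by (simp add: mult.left_commute flip: powr_add)
      ultimately show ?thesis by simp
    qed
    ultimately show ?case by (meson less_le_trans mult_left_mono zero_le_numeral)
  qed
qed

text \<open>b lies halfway between a and 1, and \<epsilon>^2 \<le> \<epsilon>^b, so the forcing is
  at most (c + s) \<epsilon>^b. Then b > a serves the threshold 8 \<epsilon>^a, and 2b > a/2 serves
  the threshold \<epsilon>^(a/2) for the squared norm.\<close>

lemma small_parameter:
  fixes a b K \<gamma> c s :: real
  assumes a: "0 \<le> a" "a < 1" and b: "b = (1 + a) / 2" and nn: "0 \<le> K" "0 \<le> \<gamma>" "0 \<le> c" "0 \<le> s"
  shows "\<forall>\<^sub>F \<epsilon> in at_right 0. K * (\<epsilon>\<^sup>2 * c + s * \<epsilon> powr b) \<le> 1 / 2 \<and> 2 * (\<gamma> * (\<epsilon>\<^sup>2 * c + s * \<epsilon> powr b)) \<le> 1 / 2 \<and>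
    K * (\<epsilon>\<^sup>2 * c + s * \<epsilon> powr b) < 8 * \<epsilon> powr a \<and> 1 / 2 * (\<gamma> * (\<epsilon>\<^sup>2 * c + s * \<epsilon> powr b))\<^sup>2 < \<epsilon> powr (a / 2)"
proof -
  have bb: "0 < b" "b < 2" "a < b" "a < 2 * b" "a / 2 < b" using a by (auto simp: b)
  have ev: "\<forall>\<^sub>F \<epsilon> in at_right 0. K * (c + s) * \<epsilon> powr (b - a) < 8"
    "\<forall>\<^sub>F \<epsilon>::real in at_right 0. K * (c + s) * \<epsilon> powr b < 1 / 2"
    "\<forall>\<^sub>F \<epsilon> in at_right 0. 2 * \<gamma> * (c + s) * \<epsilon> powr b < 1 / 2"
    "\<forall>\<^sub>F \<epsilon> in at_right 0. (\<gamma> * (c + s))\<^sup>2 / 2 * \<epsilon> powr (2 * b - a / 2) < 1"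
  proof -
    have t: "((\<lambda>\<epsilon>::real. D * \<epsilon> powr p) \<longlongrightarrow> 0) (at_right 0)" if "0 < p" for D p :: real using that by real_asymp
    show "\<forall>\<^sub>F \<epsilon> in at_right 0. K * (c + s) * \<epsilon> powr (b - a) < 8"
      "\<forall>\<^sub>F \<epsilon> in at_right 0. K * (c + s) * \<epsilon> powr b < 1 / 2"
      "\<forall>\<^sub>F \<epsilon> in at_right 0. 2 * \<gamma> * (c + s) * \<epsilon> powr b < 1 / 2"
      "\<forall>\<^sub>F \<epsilon> in at_right 0. (\<gamma> * (c + s))\<^sup>2 / 2 * \<epsilon> powr (2 * b - a / 2) < 1"
      by (rule order_tendstoD(2)[OF t]; use bb in simp)+
  qed
  have ev1: "\<forall>\<^sub>F \<epsilon>::real in at_right 0. \<epsilon> < 1" by real_asymp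
  show ?thesis using ev ev1 eventually_at_right_less
  proof eventually_elim
    case (elim \<epsilon>)
    let ?\<beta> = "\<epsilon>\<^sup>2 * c + s * \<epsilon> powr b"
    have e: "0 < \<epsilon>" "\<epsilon> < 1" using elim by auto
    have "\<epsilon>\<^sup>2 = \<epsilon> powr 2" using e by simp
    also have "\<dots> \<le> \<epsilon> powr b" using e bb by (intro powr_mono') auto
    finally have be: "?\<beta> \<le> (c + s) * \<epsilon> powr b"
      using mult_right_mono[of "\<epsilon>\<^sup>2" "\<epsilon> powr b" c] nn by (simp add: distrib_right mult.commute)
    have b0: "0 \<le> ?\<beta>" using nn by simp
    have k: "K * ?\<beta> \<le> K * (c + s) * \<epsilon> powr b" using mult_left_mono[OF be nn(1)] by (simp add: mult.assoc)
    have g: "\<gamma> * ?\<beta> \<le> \<gamma> * (c + s) * \<epsilon> powr b" using mult_left_mono[OF be nn(2)] by (simp add: mult.assoc)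
    have "K * (c + s) * \<epsilon> powr (b - a) * \<epsilon> powr a < 8 * \<epsilon> powr a" using elim by (intro mult_strict_right_mono) auto
    then have k8: "K * (c + s) * \<epsilon> powr b < 8 * \<epsilon> powr a" using e by (simp add: mult.assoc flip: powr_add)
    have "(\<gamma> * (c + s))\<^sup>2 / 2 * \<epsilon> powr (2 * b - a / 2) * \<epsilon> powr (a / 2) < 1 * \<epsilon> powr (a / 2)"
      using elim by (intro mult_strict_right_mono) auto
    then have g8: "(\<gamma> * (c + s))\<^sup>2 / 2 * \<epsilon> powr (2 * b) < \<epsilon> powr (a / 2)" by (simp add: mult.assoc flip: powr_add)
    have "(\<gamma> * ?\<beta>)\<^sup>2 \<le> (\<gamma> * (c + s) * \<epsilon> powr b)\<^sup>2" using g b0 nn by (intro power_mono) auto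
    also have "\<dots> = (\<gamma> * (c + s))\<^sup>2 * \<epsilon> powr (2 * b)"
      by (simp add: power_mult_distrib power2_eq_square flip: powr_add)
    finally have g2: "(\<gamma> * ?\<beta>)\<^sup>2 \<le> (\<gamma> * (c + s))\<^sup>2 * \<epsilon> powr (2 * b)" .
    show ?case
    proof (intro conjI)
      show "K * ?\<beta> \<le> 1 / 2" using k elim by linarith
      have "2 * (\<gamma> * ?\<beta>) \<le> 2 * (\<gamma> * (c + s) * \<epsilon> powr b)" using g by (rule mult_left_mono) simp
      then show "2 * (\<gamma> * ?\<beta>) \<le> 1 / 2" using elim(3) unfolding mult.assoc by linarith
      show "K * ?\<beta> < 8 * \<epsilon> powr a" using k k8 by linarith
      show "1 / 2 * (\<gamma> * ?\<beta>)\<^sup>2 < \<epsilon> powr (a / 2)" using g2 g8 by linarith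
    qed
  qed
qed

section \<open>Probability estimates\<close>

text \<open>Each rational time has its own null set from \<open>wiener_integral_by_parts\<close>;
  their countable union is null, and \<open>zhat_rhs_dense\<close> reaches the remaining times. That
  W starts at 0 removes the boundary term.\<close>

lemma AE_sample_path:
  assumes sp: "sdde_path r \<mu>1 \<mu>2 x Cx \<omega> \<kappa> C \<Psi> L0 (G_nl r \<nu>1 \<nu>3) V" and W: "wiener_process M W"
    and \<epsilon>: "0 < \<epsilon>" and T: "0 < T" and \<xi>: "\<xi> \<in> delay_C r" and y: "lin_solution r L0 \<xi> y"
    and ylim: "((\<lambda>t. y t - Phi \<omega> v0 t) \<longlongrightarrow> 0) at_top"
    and X: "sdde_solution M W r T \<sigma> L0 \<nu>1 \<nu>3 \<xi> \<epsilon> X" and Z: "zhat_solution M W r T \<sigma> L0 \<omega> \<nu>1 \<nu>3 \<epsilon> X Z"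
  shows "AE w in M. sample_path r \<mu>1 \<mu>2 x Cx \<omega> \<kappa> C \<Psi> L0 (G_nl r \<nu>1 \<nu>3) V \<epsilon> T \<sigma> \<xi> y v0
    (\<lambda>t. X t w) (\<lambda>t. W t w) (\<lambda>t. Z t w)"
proof -
  interpret sdde_path r \<mu>1 \<mu>2 x Cx \<omega> \<kappa> C \<Psi> L0 "G_nl r \<nu>1 \<nu>3" V by (rule sp)
  let ?D = "{0<..<T} \<inter> \<rat>"
  let ?psi = "\<lambda>s. rot (\<omega> * - (s / \<epsilon>\<^sup>2)) \<Psi>"
  let ?psi' = "\<lambda>s. - (1 / \<epsilon>\<^sup>2) *\<^sub>R rot (\<omega> * - (s / \<epsilon>\<^sup>2)) (Bmul \<omega> \<Psi>)"
  let ?I = "\<lambda>t w. LINT s:{0..t}|lborel. G_nl r \<nu>1 \<nu>3 (\<lambda>\<theta>. Phi \<omega> (rot (\<omega> * (s / \<epsilon>\<^sup>2)) (Z s w)) \<theta>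
      + Yfrak r L0 \<omega> \<epsilon> (\<lambda>u. X u w) s \<theta>) *\<^sub>R ?psi s"
  have "AE w in M. \<forall>t\<in>?D. Z t w - z_path r L0 \<omega> \<epsilon> (\<lambda>u. X u w) 0 - ?I t w =
      W t w *\<^sub>R (\<sigma> *\<^sub>R ?psi t) - W 0 w *\<^sub>R (\<sigma> *\<^sub>R ?psi 0) - (LINT s:{0..t}|lborel. W s w *\<^sub>R (\<sigma> *\<^sub>R ?psi' s))"
  proof (subst AE_ball_countable)
    show "countable ?D" using countable_rat by (rule countable_subset[rotated]) auto
    show "\<forall>t\<in>?D. AE w in M. Z t w - z_path r L0 \<omega> \<epsilon> (\<lambda>u. X u w) 0 - ?I t w =
      W t w *\<^sub>R (\<sigma> *\<^sub>R ?psi t) - W 0 w *\<^sub>R (\<sigma> *\<^sub>R ?psi 0) - (LINT s:{0..t}|lborel. W s w *\<^sub>R (\<sigma> *\<^sub>R ?psi' s))"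
    proof
      fix t assume t: "t \<in> ?D"
      have Y: "has_wiener_integral M W (\<lambda>s. \<sigma> *\<^sub>R ?psi s) t (\<lambda>w. Z t w - z_path r L0 \<omega> \<epsilon> (\<lambda>u. X u w) 0 - ?I t w)"
        using Z t unfolding zhat_solution_def mat_exp_B Psi_tilde_eq by auto
      show "AE w in M. Z t w - z_path r L0 \<omega> \<epsilon> (\<lambda>u. X u w) 0 - ?I t w =
        W t w *\<^sub>R (\<sigma> *\<^sub>R ?psi t) - W 0 w *\<^sub>R (\<sigma> *\<^sub>R ?psi 0) - (LINT s:{0..t}|lborel. W s w *\<^sub>R (\<sigma> *\<^sub>R ?psi' s))"
      proof (rule wiener_integral_by_parts[OF W Y])
        show "((\<lambda>s. \<sigma> *\<^sub>R ?psi s) has_vector_derivative \<sigma> *\<^sub>R ?psi' s) (at s within {0..t})" for s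
          by (rule bounded_linear.has_vector_derivative[OF bounded_linear_scaleR_right rot_reverse_has_vector_derivative])
        show "continuous_on {0..t} (\<lambda>s. \<sigma> *\<^sub>R ?psi' s)"
          by (intro continuous_intros continuous_on_rot) (use \<epsilon> in auto)
      qed (use t in auto)
    qed
  qed
  moreover have "AE w in M. W 0 w = 0" using W by (simp add: wiener_process_def)
  moreover have "AE w in M. \<forall>t\<in>{0..T}. X t w = X 0 w
      + (LINT s:{0..t}|lborel. (1 / \<epsilon>\<^sup>2) * L0 (segment \<epsilon> (\<lambda>u. X u w) s) + G_nl r \<nu>1 \<nu>3 (segment \<epsilon> (\<lambda>u. X u w) s))
      + \<sigma> * W t w"
    using X unfolding sdde_solution_def by blast
  ultimately show ?thesis
    using AE_space
  proof eventually_elim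
    case (elim w)
    interpret dp: delay_path r \<mu>1 \<mu>2 x Cx \<omega> \<kappa> C \<Psi> L0 "G_nl r \<nu>1 \<nu>3" V \<epsilon> T \<sigma> \<xi> y v0 "\<lambda>t. X t w" "\<lambda>t. W t w" "\<lambda>t. Z t w"
    proof
      show "continuous_on {- (\<epsilon>\<^sup>2 * r)..T} (\<lambda>t. X t w)" "\<And>t. - (\<epsilon>\<^sup>2 * r) \<le> t \<Longrightarrow> t \<le> 0 \<Longrightarrow> X t w = \<xi> (t / \<epsilon>\<^sup>2)"
        using X elim(4) unfolding sdde_solution_def by auto
      show "continuous_on {0..T} (\<lambda>t. W t w)"
        using W elim(4) unfolding wiener_process_def by (auto intro: continuous_on_subset[of "{0..}"])
      show "continuous_on {0..T} (\<lambda>t. Z t w)" using Z elim(4) unfolding zhat_solution_def by auto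
      show "X t w = X 0 w
        + (LINT s:{0..t}|lborel. (1 / \<epsilon>\<^sup>2) * L0 (segment \<epsilon> (\<lambda>u. X u w) s) + G_nl r \<nu>1 \<nu>3 (segment \<epsilon> (\<lambda>u. X u w) s))
        + \<sigma> * W t w" if "0 \<le> t" "t \<le> T" for t by (rule elim(3)[rule_format]) (use that in simp)
    qed (fact \<epsilon> T \<xi> y ylim elim(2))+
    show ?case
    proof unfold_locales
      fix t :: real assume t: "0 \<le> t" "t \<le> T"
      show "Z t w = dp.zhat_rhs t"
      proof (rule dp.zhat_rhs_dense[OF _ t])
        fix t assume "t \<in> ?D"
        from elim(1)[rule_format, OF this, unfolded elim(2)]
        show "Z t w = dp.zhat_rhs t"
          unfolding dp.zhat_rhs_def dp.gZ_def dp.psi_def dp.psi'_def by (simp only: scaleR_zero_left diff_zero diff_eq_eq add.assoc) (simp only: add_ac)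
      qed
    qed
  qed
qed

text \<open>Off one bad set, \<open>path_estimate\<close> keeps both quantities below their
  thresholds. The bad set costs q for the reduced system, K \<epsilon> for the modulus of the noise,
  and nothing for the null set where the path equations fail.\<close>

lemma events_small:
  assumes sp: "sdde_path r \<mu>1 \<mu>2 x Cx \<omega> \<kappa> C \<Psi> L0 (G_nl r \<nu>1 \<nu>3) V" and W: "wiener_process M W"
    and T: "0 < T" and \<xi>: "\<xi> \<in> delay_C r"
    and X: "\<And>\<epsilon>. 0 < \<epsilon> \<Longrightarrow> sdde_solution M W r T \<sigma> L0 \<nu>1 \<nu>3 \<xi> \<epsilon> (X \<epsilon>)"
    and Z: "\<And>\<epsilon>. 0 < \<epsilon> \<Longrightarrow> zhat_solution M W r T \<sigma> L0 \<omega> \<nu>1 \<nu>3 \<epsilon> (X \<epsilon>) (Z \<epsilon>)"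
    and a: "0 \<le> a" "a < 1" and q: "0 < q" and P: "property_P M r \<omega> Z T q"
  shows "\<exists>K. \<forall>\<^sub>F \<epsilon> in at_right 0. measure M (H_event M r T L0 \<omega> X Z a \<epsilon>) \<le> q + K * \<epsilon> \<and>
    measure M (S_event M r T L0 \<omega> X a \<epsilon>) \<le> q + K * \<epsilon>"
proof -
  interpret prob_space M using W by (simp add: wiener_process_def)
  interpret sdde_path r \<mu>1 \<mu>2 x Cx \<omega> \<kappa> C \<Psi> L0 "G_nl r \<nu>1 \<nu>3" V by (rule sp)
  show ?thesis
  \<comment> \<open>Below, positivity of 1 - q certifies that the event of the property is
    measurable; for q \<ge> 1 the claim is trivial.\<close>
  proof (cases "1 \<le> q")
    case True
    then show ?thesis
      by (intro exI[of _ 0] always_eventually allI) (auto intro: order_trans[OF prob_le_1])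
  next
    case False
    obtain C' \<epsilon>' where C': "0 < C'" and \<epsilon>': "0 < \<epsilon>'" and PP: "\<And>\<epsilon>. 0 < \<epsilon> \<Longrightarrow> \<epsilon> < \<epsilon>' \<Longrightarrow> measure M {w \<in> space M.
          (SUP t\<in>{0..T}. supnorm r (Phi \<omega> (rot (\<omega> * (t / \<epsilon>\<^sup>2)) (Z \<epsilon> t w)))) < 0.99 * C'} \<ge> 1 - q"
      using P unfolding property_P_def mat_exp_B by blast
    obtain y v0 where y: "lin_solution r L0 \<xi> y" and ylim: "((\<lambda>t. y t - Phi \<omega> v0 t) \<longlongrightarrow> 0) at_top"
      using lin_solution_exists[OF bm_delay_C[OF \<xi>]] by blast
    obtain Y0 where Y0: "\<And>t. -r \<le> t \<Longrightarrow> \<bar>y t - Phi \<omega> v0 t\<bar> \<le> Y0" using lin_solution_bounded[OF \<xi> y ylim] by blast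
    define X0 where "X0 = supnorm r \<xi>"
    have X0: "\<bar>\<xi> \<theta>\<bar> \<le> X0" if "-r \<le> \<theta>" "\<theta> \<le> 0" for \<theta>
      unfolding X0_def by (rule supnorm_upper[OF bounded_image_delay_C[OF \<xi>] that])
    define R where "R = 0.99 * C' + Y0 + X0 + 2"
    have R0: "0 \<le> R" using C' order_trans[OF abs_ge_zero Y0[of 0]] order_trans[OF abs_ge_zero X0[of 0]] r by (simp add: R_def)
    define b where "b = (1 + a) / 2"
    have b1: "b < 1" using a by (simp add: b_def)
    obtain K where N: "\<And>\<epsilon>. 0 < \<epsilon> \<Longrightarrow> \<epsilon> < 1 \<Longrightarrow> \<exists>N\<in>sets M. measure M N \<le> K * \<epsilon> \<and>
      (\<forall>w\<in>space M - N. \<forall>s t. 0 \<le> s \<and> s \<le> t \<and> t \<le> T \<longrightarrow> \<bar>W t w - W s w\<bar> \<le> \<epsilon> powr b * (3 + (t - s) / \<epsilon>\<^sup>2))"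
      using wiener_modulus[OF W T b1] by blast
    have g0: "0 \<le> gam T R" unfolding gam_def using V0 Kp(1) T by (intro mult_nonneg_nonneg) auto
    have c0: "0 \<le> V * (R + R ^ 3)" using V0 R0 by simp
    show ?thesis
    proof (intro exI[of _ K])
      have "\<forall>\<^sub>F \<epsilon>::real in at_right 0. \<epsilon> < min 1 \<epsilon>'"
        using \<epsilon>' by (intro order_tendstoD(2)[OF tendsto_ident_at]) auto
      with small_parameter[OF a b_def Kp(1) g0 c0 abs_ge_zero[of \<sigma>]] eventually_at_right_less
      show "\<forall>\<^sub>F \<epsilon> in at_right 0. measure M (H_event M r T L0 \<omega> X Z a \<epsilon>) \<le> q + K * \<epsilon> \<and>
        measure M (S_event M r T L0 \<omega> X a \<epsilon>) \<le> q + K * \<epsilon>"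
      proof eventually_elim
        case (elim \<epsilon>)
        define \<beta> where "\<beta> = \<epsilon>\<^sup>2 * (V * (R + R ^ 3)) + \<bar>\<sigma>\<bar> * \<epsilon> powr b"
        have small: "Kp * \<beta> \<le> 1 / 2" "2 * (gam T R * \<beta>) \<le> 1 / 2" "Kp * \<beta> < 8 * \<epsilon> powr a" "1 / 2 * (gam T R * \<beta>)\<^sup>2 < \<epsilon> powr (a / 2)"
          using elim(1) unfolding \<beta>_def by auto
        have e: "0 < \<epsilon>" "\<epsilon> < 1" "\<epsilon> < \<epsilon>'" using elim by auto
        obtain N where N: "N \<in> sets M" "measure M N \<le> K * \<epsilon>" and
          md: "\<And>w s t. w \<in> space M - N \<Longrightarrow> 0 \<le> s \<Longrightarrow> s \<le> t \<Longrightarrow> t \<le> T \<Longrightarrow> \<bar>W t w - W s w\<bar> \<le> \<epsilon> powr b * (3 + (t - s) / \<epsilon>\<^sup>2)"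
          using N[OF e(1,2)] by blast
        define B where "B = {w \<in> space M. (SUP t\<in>{0..T}. supnorm r (Phi \<omega> (rot (\<omega> * (t / \<epsilon>\<^sup>2)) (Z \<epsilon> t w)))) < 0.99 * C'}"
        have B1: "1 - q \<le> measure M B" unfolding B_def by (rule PP[OF e(1,3)])
        \<comment> \<open>A non-measurable set has measure 0 by convention, so positive measure
          implies measurability.\<close>
        have Bs: "B \<in> sets M" using B1 False measure_notin_sets[of B M] by force
        obtain E where E: "{w \<in> space M. \<not> sample_path r \<mu>1 \<mu>2 x Cx \<omega> \<kappa> C \<Psi> L0 (G_nl r \<nu>1 \<nu>3) V \<epsilon> T \<sigma> \<xi> y v0
            (\<lambda>t. X \<epsilon> t w) (\<lambda>t. W t w) (\<lambda>t. Z \<epsilon> t w)} \<subseteq> E" "emeasure M E = 0" "E \<in> sets M"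
          using AE_E[OF AE_sample_path[OF sp W e(1) T \<xi> y ylim X[OF e(1)] Z[OF e(1)]]] by blast
        define Bad where "Bad = (space M - B) \<union> N \<union> E"
        have Bads: "Bad \<in> sets M" using Bs N E by (auto simp: Bad_def)
        have "measure M Bad \<le> measure M (space M - B) + measure M N + measure M E"
          unfolding Bad_def using Bs N E by (intro order_trans[OF measure_Un_le] add_mono measure_Un_le) auto
        also have "measure M (space M - B) = 1 - measure M B" by (rule prob_compl[OF Bs])
        also have "measure M E = 0" using E by (simp add: measure_def)
        finally have Bad: "measure M Bad \<le> q + K * \<epsilon>" using B1 N(2) by linarith
        have good: "(\<forall>\<theta>\<in>{-r..0}. \<bar>Ycal r L0 \<omega> \<epsilon> (\<lambda>u. X \<epsilon> u w) t \<theta>\<bar> \<le> Kp * \<beta>) \<and>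
            norm (zfrak r L0 \<omega> \<epsilon> (\<lambda>u. X \<epsilon> u w) t - Z \<epsilon> t w) \<le> gam T R * \<beta>"
          if w: "w \<in> space M" "w \<notin> Bad" and t: "0 \<le> t" "t \<le> T" for w t
        proof -
          interpret sample_path r \<mu>1 \<mu>2 x Cx \<omega> \<kappa> C \<Psi> L0 "G_nl r \<nu>1 \<nu>3" V \<epsilon> T \<sigma> \<xi> y v0 "\<lambda>t. X \<epsilon> t w" "\<lambda>t. W t w" "\<lambda>t. Z \<epsilon> t w"
            using w E unfolding Bad_def by blast
          have wB: "w \<in> B" and wN: "w \<in> space M - N" using w by (auto simp: Bad_def)
          have RZ: "\<bar>Phi \<omega> (rot (\<omega> * (t / \<epsilon>\<^sup>2)) (Z \<epsilon> t w)) \<theta>\<bar> \<le> 0.99 * C'"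
            if t: "0 \<le> t" "t \<le> T" and th: "-r \<le> \<theta>" "\<theta> \<le> 0" for t \<theta>
          proof -
            have "bounded ((\<lambda>t. Z \<epsilon> t w) ` {0..T})" by (intro compact_imp_bounded compact_continuous_image Zcont) auto
            then obtain z where z: "\<forall>t\<in>{0..T}. norm (Z \<epsilon> t w) \<le> z" unfolding bounded_iff by auto
            \<comment> \<open>A real supremum dominates its values only if the set is bounded above;
              continuity of the path of Z on a compact interval provides this.\<close>
            have bd: "bdd_above ((\<lambda>t. supnorm r (Phi \<omega> (rot (\<omega> * (t / \<epsilon>\<^sup>2)) (Z \<epsilon> t w)))) ` {0..T})"
            proof (intro bdd_aboveI2[of _ _ "2 * z"] supnorm_le)
              fix t \<theta> assume "t \<in> {0..T}"
              then show "\<bar>Phi \<omega> (rot (\<omega> * (t / \<epsilon>\<^sup>2)) (Z \<epsilon> t w)) \<theta>\<bar> \<le> 2 * z"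
                using abs_Phi_le[of \<omega> "rot (\<omega> * (t / \<epsilon>\<^sup>2)) (Z \<epsilon> t w)" \<theta>] z[rule_format, of t] unfolding norm_rot by linarith
            qed (use r in simp)
            have "\<bar>Phi \<omega> (rot (\<omega> * (t / \<epsilon>\<^sup>2)) (Z \<epsilon> t w)) \<theta>\<bar> \<le> supnorm r (Phi \<omega> (rot (\<omega> * (t / \<epsilon>\<^sup>2)) (Z \<epsilon> t w)))"
              by (rule supnorm_upper[OF bounded_image_delay_C th]) (simp add: delay_C_def continuous_on_Phi)
            also have "\<dots> \<le> (SUP t\<in>{0..T}. supnorm r (Phi \<omega> (rot (\<omega> * (t / \<epsilon>\<^sup>2)) (Z \<epsilon> t w))))"
              by (rule cSUP_upper[OF _ bd]) (use t in simp)
            also have "\<dots> \<le> 0.99 * C'" using wB unfolding B_def by simp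
            finally show ?thesis .
          qed
          show ?thesis
            using path_estimate[OF RZ Y0 X0 md[OF wN] R_def \<beta>_def powr_ge_zero small(1,2) t] by blast
        qed
        \<comment> \<open>Inclusion is enough: monotonicity asks for measurability of the larger set
          alone.\<close>
        have "H_event M r T L0 \<omega> X Z a \<epsilon> \<subseteq> Bad"
        proof
          fix w assume w: "w \<in> H_event M r T L0 \<omega> X Z a \<epsilon>"
          show "w \<in> Bad"
          proof (rule ccontr)
            assume nb: "w \<notin> Bad"
            have ws: "w \<in> space M" using w by (simp add: H_event_def)
            have "(SUP t\<in>{0..T}. alpha_proc r L0 \<omega> X Z \<epsilon> t w) \<le> 1 / 2 * (gam T R * \<beta>)\<^sup>2"
            proof (rule cSUP_least)
              fix t assume "t \<in> {0..T}"
              then show "alpha_proc r L0 \<omega> X Z \<epsilon> t w \<le> 1 / 2 * (gam T R * \<beta>)\<^sup>2"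
                using good[OF ws nb, of t] unfolding alpha_proc_def by (intro mult_left_mono power_mono) auto
            qed (use T in auto)
            then show False using w small(4) unfolding H_event_def by simp
          qed
        qed
        moreover have "S_event M r T L0 \<omega> X a \<epsilon> \<subseteq> Bad"
        proof
          fix w assume w: "w \<in> S_event M r T L0 \<omega> X a \<epsilon>"
          show "w \<in> Bad"
          proof (rule ccontr)
            assume nb: "w \<notin> Bad"
            have ws: "w \<in> space M" using w by (simp add: S_event_def)
            have "(SUP t\<in>{0..T}. supnorm r (Ycal r L0 \<omega> \<epsilon> (\<lambda>u. X \<epsilon> u w) t)) \<le> Kp * \<beta>"
              using good[OF ws nb] T r by (intro cSUP_least supnorm_le) auto
            then show False using w small(3) unfolding S_event_def by simp
          qed
        qed
        ultimately show ?case using finite_measure_mono[OF _ Bads] Bad by (meson order_trans)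
      qed
    qed
  qed
qed

theorem theorem3p6:
  fixes r T \<sigma> \<omega>c :: real and L0 :: "(real \<Rightarrow> real) \<Rightarrow> real"
  assumes "0 < r" and "0 < T"
    and "bounded_linear_functional r L0"
    and "critical_spectrum L0 \<omega>c"
  shows "\<exists>C>0.
    \<forall>(M :: 'a measure) W \<nu>1 \<nu>3 \<xi> X Z.
      wiener_process M W \<and>
      admissible_integrator r \<nu>1 \<and> admissible_integrator r \<nu>3 \<and>
      \<xi> \<in> delay_C r \<and>
      (\<forall>\<epsilon>>0. sdde_solution M W r T \<sigma> L0 \<nu>1 \<nu>3 \<xi> \<epsilon> (X \<epsilon>)) \<and>
      (\<forall>\<epsilon>>0. zhat_solution M W r T \<sigma> L0 \<omega>c \<nu>1 \<nu>3 \<epsilon> (X \<epsilon>) (Z \<epsilon>)) \<longrightarrow>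
      (\<forall>a \<delta>. 0 \<le> a \<and> a < 1 \<and> 2 * a < \<delta> \<and> \<delta> < 2 \<longrightarrow>
         (p_eps C r T a \<delta> \<longlongrightarrow> 1) (at_right 0) \<and>
         (\<forall>q>0. property_P M r \<omega>c Z T q \<longrightarrow>
            (\<exists>\<epsilon>q>0. \<forall>\<epsilon>. 0 < \<epsilon> \<and> \<epsilon> < \<epsilon>q \<longrightarrow>
               measure M (H_event M r T L0 \<omega>c X Z a \<epsilon>) < q + 2 * (1 - p_eps C r T a \<delta> \<epsilon>) \<and>
               measure M (S_event M r T L0 \<omega>c X a \<epsilon>) < q + 2 * (1 - p_eps C r T a \<delta> \<epsilon>))))"
proof -
  obtain \<mu>1 \<mu>2 x Cx \<kappa> C \<Psi> where spl: "splitting r \<mu>1 \<mu>2 x Cx \<omega>c \<kappa> C \<Psi> L0" and L0C: "\<And>\<eta>. \<eta> \<in> delay_C r \<Longrightarrow> L0 \<eta> = dde.L \<mu>1 \<mu>2 \<eta>"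
    using splitting_exists[OF assms(1,3,4)] by blast
  show ?thesis
  proof (rule exI[of _ 1], intro conjI allI impI)
    show "0 < (1::real)" by simp
  next
    fix M :: "'a measure" and W \<nu>1 \<nu>3 \<xi> X Z and a \<delta> :: real
    assume "0 \<le> a \<and> a < 1 \<and> 2 * a < \<delta> \<and> \<delta> < 2"
    then show "(p_eps 1 r T a \<delta> \<longlongrightarrow> 1) (at_right 0)" using assms by (intro p_eps_tendsto) auto
  next
    fix M :: "'a measure" and W \<nu>1 \<nu>3 \<xi> X Z and a \<delta> q :: real
    assume h: "wiener_process M W \<and> admissible_integrator r \<nu>1 \<and> admissible_integrator r \<nu>3 \<and> \<xi> \<in> delay_C r \<and>
      (\<forall>\<epsilon>>0. sdde_solution M W r T \<sigma> L0 \<nu>1 \<nu>3 \<xi> \<epsilon> (X \<epsilon>)) \<and>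
      (\<forall>\<epsilon>>0. zhat_solution M W r T \<sigma> L0 \<omega>c \<nu>1 \<nu>3 \<epsilon> (X \<epsilon>) (Z \<epsilon>))"
      and a: "0 \<le> a \<and> a < 1 \<and> 2 * a < \<delta> \<and> \<delta> < 2" and q: "0 < q" "property_P M r \<omega>c Z T q"
    from h have W: "wiener_process M W" and \<nu>: "admissible_integrator r \<nu>1" "admissible_integrator r \<nu>3" and \<xi>: "\<xi> \<in> delay_C r"
      and X: "\<And>\<epsilon>. 0 < \<epsilon> \<Longrightarrow> sdde_solution M W r T \<sigma> L0 \<nu>1 \<nu>3 \<xi> \<epsilon> (X \<epsilon>)"
      and Z: "\<And>\<epsilon>. 0 < \<epsilon> \<Longrightarrow> zhat_solution M W r T \<sigma> L0 \<omega>c \<nu>1 \<nu>3 \<epsilon> (X \<epsilon>) (Z \<epsilon>)" by auto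
    obtain V where V: "0 \<le> V"
      "\<And>f R. f \<in> delay_C r \<Longrightarrow> \<forall>\<theta>\<in>{-r..0}. \<bar>f \<theta>\<bar> \<le> R \<Longrightarrow> \<bar>G_nl r \<nu>1 \<nu>3 f\<bar> \<le> V * (R + R ^ 3)"
      "\<And>f g R M. f \<in> delay_C r \<Longrightarrow> g \<in> delay_C r \<Longrightarrow> \<forall>\<theta>\<in>{-r..0}. \<bar>f \<theta>\<bar> \<le> R \<Longrightarrow> \<forall>\<theta>\<in>{-r..0}. \<bar>g \<theta>\<bar> \<le> R \<Longrightarrow>
        \<forall>\<theta>\<in>{-r..0}. \<bar>f \<theta> - g \<theta>\<bar> \<le> M \<Longrightarrow> \<bar>G_nl r \<nu>1 \<nu>3 f - G_nl r \<nu>1 \<nu>3 g\<bar> \<le> V * (1 + 3 * R\<^sup>2) * M"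
      using G_nl_bounds[OF assms(1) \<nu>] by metis
    have sp: "sdde_path r \<mu>1 \<mu>2 x Cx \<omega>c \<kappa> C \<Psi> L0 (G_nl r \<nu>1 \<nu>3) V"
      by (intro sdde_path.intro[OF spl] sdde_path_axioms.intro V L0C) auto
    \<comment> \<open>\<open>K\<close> may depend on everything fixed so far, since
      \<open>p_eps_lower\<close> holds for every multiple of \<epsilon>; this is why the constant
      can be 1.\<close>
    obtain K where "\<forall>\<^sub>F \<epsilon> in at_right 0. measure M (H_event M r T L0 \<omega>c X Z a \<epsilon>) \<le> q + K * \<epsilon> \<and>
        measure M (S_event M r T L0 \<omega>c X a \<epsilon>) \<le> q + K * \<epsilon>"
      using events_small[OF sp W assms(2) \<xi> X Z _ _ q] a by blast
    moreover have "\<forall>\<^sub>F \<epsilon> in at_right 0. K * \<epsilon> < 2 * (1 - p_eps 1 r T a \<delta> \<epsilon>)"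
      using assms a by (intro p_eps_lower) auto
    ultimately have "\<forall>\<^sub>F \<epsilon> in at_right 0. measure M (H_event M r T L0 \<omega>c X Z a \<epsilon>) < q + 2 * (1 - p_eps 1 r T a \<delta> \<epsilon>) \<and>
        measure M (S_event M r T L0 \<omega>c X a \<epsilon>) < q + 2 * (1 - p_eps 1 r T a \<delta> \<epsilon>)"
      by eventually_elim linarith
    then show "\<exists>\<epsilon>q>0. \<forall>\<epsilon>. 0 < \<epsilon> \<and> \<epsilon> < \<epsilon>q \<longrightarrow>
        measure M (H_event M r T L0 \<omega>c X Z a \<epsilon>) < q + 2 * (1 - p_eps 1 r T a \<delta> \<epsilon>) \<and>
        measure M (S_event M r T L0 \<omega>c X a \<epsilon>) < q + 2 * (1 - p_eps 1 r T a \<delta> \<epsilon>)"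
      unfolding eventually_at_right_field by auto
  qed
qed

end
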